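(* Let $D\subset\mathbb R^d$ be a bounded domain with $\partial D\in C^1$, let $k\ge1$ and $n\ge m\ge0$ be integers, $\gamma\in(0,1]$ and $\frac{2d}{\gamma}<p<\infty$. Then there exists a constant $C_{tr}>0$ such that for every $\varphi=\varphi(x,y_1,\dots,y_k)\in\mathcal C^{n,\gamma,mix}(\overline D^{\times k};W^{m,p}(D))$ (the $W^{m,p}(D)$-values being functions of $x$) the following holds. For all $j=2,\dots,k+1$ and all $(y_j,\dots,y_k)\in D^{\times(k-j+1)}$, $(\mathrm{Tr}_{|1:j}\varphi)(\cdot\,;y_j,\dots,y_k)\in W^{m,p}(D)$, and $$\|(\mathrm{Tr}_{|1:j}\varphi)(\cdot\,;y_j,\dots,y_k)\|_{W^{m,p}(D)}\le C_{tr}^{\,j-1}\,\|\varphi(\cdot,\cdot,\dots,\cdot\,;y_j,\dots,y_k)\|_{\mathcal C^{n,\gamma,mix}_{y_1,\dots,y_{j-1}}(\overline D^{\times(j-1)};W^{m,p}(D))},$$ where on the right the norm is taken with respect to $(y_1,\dots,y_{j-1})$ with $(y_j,\dots,y_k)$ fixed. Moreover, $\mathrm{Tr}_{|1:j}\varphi\in\mathcal C^{n,\gamma,mix}_{y_j,\dots,y_k}(\overline D^{\times(k-j+1)};W^{m,p}(D))$ and $$\|\mathrm{Tr}_{|1:j}\varphi\|_{\mathcal C^{n,\gamma,mix}_{y_j,\dots,y_k}(\overline D^{\times(k-j+1)};W^{m,p}(D))}\le C_{tr}^{\,j-1}\,\|\varphi\|_{\mathcal C^{n,\gamma,mix}_{y_1,\dots,y_k}(\overline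 D^{\times k};W^{m,p}(D))}$$ for all $j=2,\dots,k+1$.
   Context: Diagonal trace. For a function $v$ of $N$ variables and $1\le a\le b\le N$, $(\mathrm{Tr}_{|a:b}v)(x_1,\dots,x_a,x_{b+1},\dots,x_N):=v(x_1,\dots,x_{a-1},x_a,\dots,x_a,x_{b+1},\dots,x_N)$, with $x_a$ repeated $b-a+1$ times. A map $\varphi:\overline D^{\times k}\to W^{m,p}(D)$ is regarded as a function of the $k+1$ variables $(x,y_1,\dots,y_k)$, so $(\mathrm{Tr}_{|1:j}\varphi)(x;y_j,\dots,y_k)=\varphi(x,x,\dots,x,y_j,\dots,y_k)$; the diagonal is taken on the representative of $\varphi$ that is continuous in $(y_1,\dots,y_k)$ for a.e. $x$. Mixed Hölder spaces. $d\in\{2,3\}$. Let $V$ be a Banach space, $0<\gamma\le1$, $n\ge0$, $k\ge1$ integers. For $\mathbf h=(h_1,\dots,h_k)\in\mathbb R^{kd}$, $h_j\in\mathbb R^d$, let $\mathbf i(\mathbf h)$ be the set of indices $j$ with $h_j\ne0$ and $\|\mathbf h\|_0:=\#\mathbf i(\mathbf h)$. For $h_j\ne0$ set $D^\gamma_{j,h_j}\varphi(\mathbf y):=\|h_j\|^{-\gamma}(\varphi(y_1,\dots,y_j+h_j,\dots,y_k)-\varphi(\mathbf y))$ ($\|\cdot\|$ Euclidean) and $D^{\gamma,mix}_{\mathbf i,\mathbf h}:=\prod_{j\in\mathbf i(\mathbf h)}D^\gamma_{j,h_j}$ (composition). $\mathcal C^{n,mix}(\overline D^{\times k};V)$ is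 the space of $\varphi$ such that $\partial^{\boldsymbol\alpha}\varphi=\partial^{\alpha_1}_{y_1}\cdots\partial^{\alpha_k}_{y_k}\varphi$ is continuous on $\overline D^{\times k}$ with values in $V$ for all $\boldsymbol\alpha=(\alpha_1,\dots,\alpha_k)$, $\alpha_\ell\in\mathbb N^d$, $0\le|\alpha_\ell|\le n$ for every $\ell$, with norm the maximum over such $\boldsymbol\alpha$ of $\sup_{\mathbf y}\|\partial^{\boldsymbol\alpha}\varphi(\mathbf y)\|_V$. $\mathcal C^{n,\gamma,mix}(\overline D^{\times k};V)$, also written $\mathcal C^{n,\gamma,mix}_{y_1,\dots,y_k}(\overline D^{\times k};V)$, is the subspace where the seminorm $$|\varphi|:=\max_{j=1,\dots,k}\ \sup_{\mathbf y,\mathbf y+\mathbf h\in\overline D^{\times k},\,\|\mathbf h\|_0=j}\ \max_{\boldsymbol\alpha:\ 0\le|\alpha_\ell|\le n\ \forall\ell,\ |\alpha_\ell|=n\ \forall\ell\in\mathbf i(\mathbf h)}\|D^{\gamma,mix}_{\mathbf i,\mathbf h}\partial^{\boldsymbol\alpha}\varphi(\mathbf y)\|_V$$ is finite, normed by the maximum of the $\mathcal C^{n,mix}$ norm and $|\varphi|$. For $k=0$ the space is $V$ itself. *)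

theory Defs
  imports "HOL-Analysis.Analysis"
begin

section \<open>Domains\<close>

text \<open>
  \<open>\<partial>D\<close> is \<open>C\<^sup>1\<close> if, near each boundary point and in suitable Cartesian coordinates, \<open>D\<close> is the
  strict epigraph of a \<open>C\<^sup>1\<close> function of the other \<open>d - 1\<close> coordinates.  Here \<open>\<nu>\<close> is the last
  coordinate direction, and a function on the hyperplane orthogonal to \<open>\<nu>\<close> is encoded as a function
  \<open>g\<close> on the whole space that is invariant under translations along \<open>\<nu>\<close>.
\<close>

definition C1_boundary :: "(real^'d) set \<Rightarrow> bool" where
  "C1_boundary D \<longleftrightarrow>
     (\<forall>z\<in>frontier D. \<exists>r>0. \<exists>\<nu> g G.
        norm \<nu> = 1 \<and> (\<forall>x t. g (x + t *\<^sub>R \<nu>) = g x) \<and>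
        (\<forall>x. (g has_derivative (\<lambda>h. G x \<bullet> h)) (at x)) \<and> continuous_on UNIV G \<and>
        D \<inter> ball z r = {x \<in> ball z r. g x < x \<bullet> \<nu>})"

definition bounded_C1_domain :: "(real^'d) set \<Rightarrow> bool" where
  "bounded_C1_domain D \<longleftrightarrow> D \<noteq> {} \<and> open D \<and> connected D \<and> bounded D \<and> C1_boundary D"


section \<open>Sobolev spaces\<close>

text \<open>
  Elements of \<open>L\<^sup>p(D)\<close> and \<open>W\<^sup>m\<^sup>,\<^sup>p(D)\<close> are represented by functions on the whole space, of which only
  the values on \<open>D\<close> matter; two functions represent the same element iff they agree a.e. on \<open>D\<close>,
  i.e. iff their difference has norm \<open>0\<close>.
\<close>

definition mi_order :: "('d::finite \<Rightarrow> nat) \<Rightarrow> nat" where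
  "mi_order \<alpha> = (\<Sum>i\<in>UNIV. \<alpha> i)"

definition Lp :: "(real^'d) set \<Rightarrow> real \<Rightarrow> (real^'d \<Rightarrow> real) set" where
  "Lp D p = {u \<in> borel_measurable (lebesgue_on D).
               integrable (lebesgue_on D) (\<lambda>x. \<bar>u x\<bar> powr p)}"

text \<open>
  \<open>Z\<close> is the family of all partial derivatives \<open>Z \<alpha> = \<partial>\<^sup>\<alpha> (Z 0)\<close> of the \<open>C\<^sup>\<infinity>\<close> function \<open>Z 0\<close>,
  where \<open>0\<close> is the multi-index \<open>\<lambda>_. 0\<close>.
\<close>

definition smooth_derivs :: "(('d::finite \<Rightarrow> nat) \<Rightarrow> real^'d \<Rightarrow> real) \<Rightarrow> bool" where
  "smooth_derivs Z \<longleftrightarrow>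
     (\<forall>\<alpha>. continuous_on UNIV (Z \<alpha>)) \<and>
     (\<forall>\<alpha> i x. ((\<lambda>t. Z \<alpha> (x + t *\<^sub>R axis i 1)) has_real_derivative Z (\<alpha>(i := Suc (\<alpha> i))) x) (at 0))"

definition test_derivs :: "(real^'d) set \<Rightarrow> (('d \<Rightarrow> nat) \<Rightarrow> real^'d \<Rightarrow> real) \<Rightarrow> bool" where
  "test_derivs D Z \<longleftrightarrow>
     smooth_derivs Z \<and>
     compact (closure {x. Z (\<lambda>_. 0) x \<noteq> 0}) \<and> closure {x. Z (\<lambda>_. 0) x \<noteq> 0} \<subseteq> D"

definition has_weak_deriv ::
    "(real^'d) set \<Rightarrow> ('d \<Rightarrow> nat) \<Rightarrow> (real^'d \<Rightarrow> real) \<Rightarrow> (real^'d \<Rightarrow> real) \<Rightarrow> bool" where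
  "has_weak_deriv D \<alpha> u v \<longleftrightarrow>
     (\<forall>Z. test_derivs D Z \<longrightarrow>
        (\<integral>x. u x * Z \<alpha> x \<partial>lebesgue_on D) =
        (-1) ^ mi_order \<alpha> * (\<integral>x. v x * Z (\<lambda>_. 0) x \<partial>lebesgue_on D))"

definition sobolev :: "(real^'d) set \<Rightarrow> nat \<Rightarrow> real \<Rightarrow> (real^'d \<Rightarrow> real) set" where
  "sobolev D m p =
     {u \<in> Lp D p. \<forall>\<alpha>. mi_order \<alpha> \<le> m \<longrightarrow> (\<exists>v\<in>Lp D p. has_weak_deriv D \<alpha> u v)}"

definition weak_deriv ::
    "(real^'d) set \<Rightarrow> real \<Rightarrow> ('d \<Rightarrow> nat) \<Rightarrow> (real^'d \<Rightarrow> real) \<Rightarrow> real^'d \<Rightarrow> real" where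
  "weak_deriv D p \<alpha> u = (SOME v. v \<in> Lp D p \<and> has_weak_deriv D \<alpha> u v)"

definition sobolev_norm :: "(real^'d) set \<Rightarrow> nat \<Rightarrow> real \<Rightarrow> (real^'d \<Rightarrow> real) \<Rightarrow> real" where
  "sobolev_norm D m p u =
     (\<Sum>\<alpha>\<in>{\<alpha>. mi_order \<alpha> \<le> m}. \<integral>x. \<bar>weak_deriv D p \<alpha> u x\<bar> powr p \<partial>lebesgue_on D) powr (1 / p)"


section \<open>Mixed Hoelder spaces\<close>

text \<open>
  The variables \<open>y\<^sub>l\<close> are indexed by a finite set \<open>I\<close> of natural numbers (\<open>{1..k}\<close> for \<open>k\<close> variables);
  a point of the product of copies of the closure of \<open>D\<close> is an element of
  \<open>I \<rightarrow>\<^sub>E closure D\<close>, and continuity in it refers to the product topology.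
  The Banach space of values is given by a set \<open>V\<close> of real functions with a seminorm \<open>N\<close>, elements at
  \<open>N\<close>-distance \<open>0\<close> being identified; a limit in \<open>V\<close> means convergence of the \<open>N\<close>-distance to \<open>0\<close>.
  All suprema are taken in \<open>ennreal\<close>, where the supremum of the empty set is \<open>0\<close>.
\<close>

definition mix_indices :: "nat set \<Rightarrow> nat \<Rightarrow> (nat \<Rightarrow> 'd::finite \<Rightarrow> nat) set" where
  "mix_indices I n =
     {\<alpha>. (\<forall>l\<in>I. mi_order (\<alpha> l) \<le> n) \<and> (\<forall>l. l \<notin> I \<longrightarrow> \<alpha> l = (\<lambda>_. 0))}"

text \<open>
  \<open>g \<alpha> = \<partial>\<^sup>\<alpha> \<phi>\<close> for all \<open>\<alpha>\<close> with \<open>\<bar>\<alpha>\<^sub>l\<bar> \<le> n\<close>: the derivatives are \<open>V\<close>-valued partial derivatives in the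
  open set \<open>D\<close> in each variable, and extend continuously to the closure.  Such a family is unique up
  to \<open>N\<close>-distance \<open>0\<close>.
\<close>

definition mix_derivs ::
    "(real^'d) set \<Rightarrow> nat set \<Rightarrow> nat \<Rightarrow> ('x \<Rightarrow> real) set \<Rightarrow> (('x \<Rightarrow> real) \<Rightarrow> real) \<Rightarrow>
     ((nat \<Rightarrow> real^'d) \<Rightarrow> 'x \<Rightarrow> real) \<Rightarrow>
     ((nat \<Rightarrow> 'd \<Rightarrow> nat) \<Rightarrow> (nat \<Rightarrow> real^'d) \<Rightarrow> 'x \<Rightarrow> real) \<Rightarrow> bool" where
  "mix_derivs D I n V N \<phi> g \<longleftrightarrow>
     (\<forall>y\<in>I \<rightarrow>\<^sub>E closure D. g (\<lambda>_ _. 0) y = \<phi> y) \<and>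
     (\<forall>\<alpha>\<in>mix_indices I n. \<forall>y\<in>I \<rightarrow>\<^sub>E closure D.
        g \<alpha> y \<in> V \<and>
        ((\<lambda>z. N (\<lambda>x. g \<alpha> z x - g \<alpha> y x)) \<longlongrightarrow> 0) (at y within (I \<rightarrow>\<^sub>E closure D))) \<and>
     (\<forall>\<alpha> l i. l \<in> I \<longrightarrow> \<alpha>(l := (\<alpha> l)(i := Suc (\<alpha> l i))) \<in> mix_indices I n \<longrightarrow>
        (\<forall>y\<in>I \<rightarrow>\<^sub>E D.
           ((\<lambda>t. N (\<lambda>x. (g \<alpha> (y(l := y l + t *\<^sub>R axis i 1)) x - g \<alpha> y x) / t
                        - g (\<alpha>(l := (\<alpha> l)(i := Suc (\<alpha> l i)))) y x)) \<longlongrightarrow> 0) (at 0)))"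

definition mix_partial ::
    "(real^'d) set \<Rightarrow> nat set \<Rightarrow> nat \<Rightarrow> ('x \<Rightarrow> real) set \<Rightarrow> (('x \<Rightarrow> real) \<Rightarrow> real) \<Rightarrow>
     (nat \<Rightarrow> 'd \<Rightarrow> nat) \<Rightarrow> ((nat \<Rightarrow> real^'d) \<Rightarrow> 'x \<Rightarrow> real) \<Rightarrow> (nat \<Rightarrow> real^'d) \<Rightarrow> 'x \<Rightarrow> real" where
  "mix_partial D I n V N \<alpha> \<phi> = (SOME g. mix_derivs D I n V N \<phi> g) \<alpha>"

definition C_mix ::
    "(real^'d) set \<Rightarrow> nat set \<Rightarrow> nat \<Rightarrow> ('x \<Rightarrow> real) set \<Rightarrow> (('x \<Rightarrow> real) \<Rightarrow> real) \<Rightarrow>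
     ((nat \<Rightarrow> real^'d) \<Rightarrow> 'x \<Rightarrow> real) set" where
  "C_mix D I n V N = {\<phi>. \<exists>g. mix_derivs D I n V N \<phi> g}"

definition C_mix_norm ::
    "(real^'d) set \<Rightarrow> nat set \<Rightarrow> nat \<Rightarrow> ('x \<Rightarrow> real) set \<Rightarrow> (('x \<Rightarrow> real) \<Rightarrow> real) \<Rightarrow>
     ((nat \<Rightarrow> real^'d) \<Rightarrow> 'x \<Rightarrow> real) \<Rightarrow> ennreal" where
  "C_mix_norm D I n V N \<phi> =
     (SUP \<alpha>\<in>mix_indices I n. SUP y\<in>I \<rightarrow>\<^sub>E closure D. ennreal (N (mix_partial D I n V N \<alpha> \<phi> y)))"

definition diff_quot ::
    "real \<Rightarrow> nat \<Rightarrow> (real^'d) \<Rightarrow> ((nat \<Rightarrow> real^'d) \<Rightarrow> 'x \<Rightarrow> real) \<Rightarrow> (nat \<Rightarrow> real^'d) \<Rightarrow> 'x \<Rightarrow> real" where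
  "diff_quot \<gamma> l h f = (\<lambda>y x. norm h powr (- \<gamma>) * (f (y(l := y l + h)) x - f y x))"

definition active :: "nat set \<Rightarrow> (nat \<Rightarrow> real^'d) \<Rightarrow> nat set" where
  "active I h = {l\<in>I. h l \<noteq> 0}"

text \<open>The operators \<open>diff_quot \<gamma> l (h l)\<close> commute, so the order of composition is immaterial.\<close>

definition mix_diff_quot ::
    "real \<Rightarrow> nat set \<Rightarrow> (nat \<Rightarrow> real^'d) \<Rightarrow> ((nat \<Rightarrow> real^'d) \<Rightarrow> 'x \<Rightarrow> real) \<Rightarrow>
     (nat \<Rightarrow> real^'d) \<Rightarrow> 'x \<Rightarrow> real" where
  "mix_diff_quot \<gamma> I h f = foldr (\<lambda>l. diff_quot \<gamma> l (h l)) (sorted_list_of_set (active I h)) f"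

definition holder_mix_seminorm ::
    "(real^'d) set \<Rightarrow> nat set \<Rightarrow> nat \<Rightarrow> real \<Rightarrow> ('x \<Rightarrow> real) set \<Rightarrow> (('x \<Rightarrow> real) \<Rightarrow> real) \<Rightarrow>
     ((nat \<Rightarrow> real^'d) \<Rightarrow> 'x \<Rightarrow> real) \<Rightarrow> ennreal" where
  "holder_mix_seminorm D I n \<gamma> V N \<phi> =
     (SUP j\<in>{1..card I}.
      SUP (y, h)\<in>{(y, h). y \<in> I \<rightarrow>\<^sub>E closure D \<and> (\<forall>l\<in>I. y l + h l \<in> closure D) \<and>
                           card (active I h) = j}.
      SUP \<alpha>\<in>{\<alpha> \<in> mix_indices I n. \<forall>l\<in>active I h. mi_order (\<alpha> l) = n}.
        ennreal (N (mix_diff_quot \<gamma> I h (mix_partial D I n V N \<alpha> \<phi>) y)))"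

definition holder_mix ::
    "(real^'d) set \<Rightarrow> nat set \<Rightarrow> nat \<Rightarrow> real \<Rightarrow> ('x \<Rightarrow> real) set \<Rightarrow> (('x \<Rightarrow> real) \<Rightarrow> real) \<Rightarrow>
     ((nat \<Rightarrow> real^'d) \<Rightarrow> 'x \<Rightarrow> real) set" where
  "holder_mix D I n \<gamma> V N = {\<phi> \<in> C_mix D I n V N. holder_mix_seminorm D I n \<gamma> V N \<phi> < \<infinity>}"

definition holder_mix_norm ::
    "(real^'d) set \<Rightarrow> nat set \<Rightarrow> nat \<Rightarrow> real \<Rightarrow> ('x \<Rightarrow> real) set \<Rightarrow> (('x \<Rightarrow> real) \<Rightarrow> real) \<Rightarrow>
     ((nat \<Rightarrow> real^'d) \<Rightarrow> 'x \<Rightarrow> real) \<Rightarrow> ennreal" where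
  "holder_mix_norm D I n \<gamma> V N \<phi> = max (C_mix_norm D I n V N \<phi>) (holder_mix_seminorm D I n \<gamma> V N \<phi>)"

text \<open>Without variables the space is \<open>V\<close> itself.\<close>

lemma mix_indices_empty: "mix_indices {} n = {\<lambda>_ _. 0}"
  by (auto simp: mix_indices_def)

lemma mix_derivs_empty:
  assumes "\<phi> (\<lambda>_. undefined) \<in> V" and "N (\<lambda>_. 0) = 0"
  shows "mix_derivs D {} n V N \<phi> (\<lambda>_. \<phi>)"
  using assms by (auto simp: mix_derivs_def at_within_def)

lemma holder_mix_empty:
  assumes "N (\<lambda>_. 0) = 0"
  shows "\<phi> \<in> holder_mix D {} n \<gamma> V N \<longleftrightarrow> \<phi> (\<lambda>_. undefined) \<in> V"
proof
  assume "\<phi> \<in> holder_mix D {} n \<gamma> V N"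
  then show "\<phi> (\<lambda>_. undefined) \<in> V"
    by (auto simp: holder_mix_def C_mix_def mix_derivs_def mix_indices_empty)
next
  assume "\<phi> (\<lambda>_. undefined) \<in> V"
  then have "mix_derivs D {} n V N \<phi> (\<lambda>_. \<phi>)"
    using assms by (rule mix_derivs_empty)
  then show "\<phi> \<in> holder_mix D {} n \<gamma> V N"
    by (auto simp: holder_mix_def C_mix_def holder_mix_seminorm_def bot_ennreal)
qed

lemma holder_mix_norm_empty:
  assumes "\<phi> (\<lambda>_. undefined) \<in> V" and "N (\<lambda>_. 0) = 0"
  shows "holder_mix_norm D {} n \<gamma> V N \<phi> = ennreal (N (\<phi> (\<lambda>_. undefined)))"
proof -
  have "mix_derivs D {} n V N \<phi> (\<lambda>_. \<phi>)"
    using assms by (rule mix_derivs_empty)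
  then have "mix_derivs D {} n V N \<phi> (SOME g. mix_derivs D {} n V N \<phi> g)"
    by (rule someI[where P = "mix_derivs D {} n V N \<phi>"])
  then have "mix_partial D {} n V N (\<lambda>_ _. 0) \<phi> (\<lambda>_. undefined) = \<phi> (\<lambda>_. undefined)"
    by (simp add: mix_derivs_def mix_partial_def)
  then show ?thesis
    by (simp add: holder_mix_norm_def C_mix_norm_def holder_mix_seminorm_def mix_indices_empty)
qed


section \<open>Diagonal traces\<close>

text \<open>
  A map \<open>\<phi>\<close> with values in a space of functions of \<open>x\<close> is written \<open>\<phi> y x\<close>.  A continuous
  representative is determined up to a null set of points \<open>x\<close> that does not depend on \<open>y\<close>; hence its
  restriction to the diagonal is determined almost everywhere.
\<close>

definition continuous_representative ::
    "(real^'d) set \<Rightarrow> nat \<Rightarrow> ((nat \<Rightarrow> real^'d) \<Rightarrow> real^'d \<Rightarrow> real) \<Rightarrow>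
     ((nat \<Rightarrow> real^'d) \<Rightarrow> real^'d \<Rightarrow> real) \<Rightarrow> bool" where
  "continuous_representative D k \<phi> \<psi> \<longleftrightarrow>
     (\<forall>y\<in>{1..k} \<rightarrow>\<^sub>E closure D. AE x in lebesgue_on D. \<psi> y x = \<phi> y x) \<and>
     (AE x in lebesgue_on D. continuous_on ({1..k} \<rightarrow>\<^sub>E closure D) (\<lambda>y. \<psi> y x))"

text \<open>
  In the list of variables \<open>(x, y\<^sub>1, \<dots>, y\<^sub>k)\<close>, the positions \<open>1, \<dots>, j\<close> are those of
  \<open>x, y\<^sub>1, \<dots>, y\<^sub>j\<^sub>-\<^sub>1\<close>.
\<close>

definition diag_trace ::
    "nat \<Rightarrow> nat \<Rightarrow> ((nat \<Rightarrow> 'a) \<Rightarrow> 'a \<Rightarrow> real) \<Rightarrow> (nat \<Rightarrow> 'a) \<Rightarrow> 'a \<Rightarrow> real" where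
  "diag_trace k j \<psi> = (\<lambda>y x. \<psi> (merge {1..<j} {j..k} ((\<lambda>_. x), y)) x)"

end

theory Submission
 imports Defs
begin

text \<open>
 A map on the closure of \<open>D\<close> that is \<open>\<gamma>\<close>-Hoelder with values in \<open>L\<^sup>p\<close>, \<open>p > 2 d / \<gamma>\<close>, has a
 representative that is continuous in \<open>y\<close> and whose supremum over \<open>y\<close> is bounded in \<open>L\<^sup>p\<close> by the Hoelder
 constant: interpolate on nets of mesh \<open>2\<^sup>-\<^sup>i\<close> by partitions of unity and sum the increments between
 consecutive nets (Kolmogorov chaining).  Iterating over the variables with mixed differences treats
 \<open>k\<close> variables, and the supremum dominates the trace on the diagonal.  Mollifying the diagonal shows
 that the weak derivatives of the trace obey the chain rule, which bounds its \<open>W\<^sup>m\<^sup>,\<^sup>p\<close> norm.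
 Applied to finite differences and difference quotients in the remaining variables, the same estimate
 makes the trace differentiable and Hoelder in them.  The \<open>C\<^sup>1\<close> boundary enters only through chains of
 three segments in \<open>D\<close> of comparable length: with them, bounded derivatives give Hoelder bounds for the
 derivatives of order below \<open>n\<close>, for which the seminorm has no differences.
\<close>

text \<open>The diagonal is a null set of the product, so the trace of a family of a.e. classes
  makes sense only if the exceptional null set does not depend on y. Chaining, carried out pointwise
  in x, provides this together with an integrable majorant of the supremum. The threshold 2 d /
  \<gamma> comes from counting pairs: consecutive nets of level i have about 2^(2 d i) pairs, each
  contributes 2^(-\<gamma> p i), and the series converges for \<gamma> p > 2 d. All of y_1, ...,
  y_(j-1) are set equal to x in one step, so each j has a constant of its own; any C >= 1 above all
  of them satisfies C <= C^(j-1), as j >= 2. Each property of the trace in the remaining variables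
  (size, continuity, derivatives, Hoelder quotients) is a bound for a finite linear combination of
  traces, and one estimate for such combinations serves them all. It rests on mixed differences: a
  difference in the remaining variables is still Hoelder in the traced ones. Derivatives are
  selected by a choice operator, so uniqueness is what carries bounds from a constructed family to
  the selected one.\<close>

definition Lp_norm :: "(real^'d) set => real => (real^'d => real) => real" where
 "Lp_norm D p u = (\<integral>x. \<bar>u x\<bar> powr p \<partial>lebesgue_on D) powr (1 / p)"

text \<open>The multi-index of one more derivative in the coordinate i of the variable y_l.\<close>

abbreviation mi_inc :: "(nat => 'd => nat) => nat => 'd => nat => 'd => nat" where
 "mi_inc \<alpha> l i \<equiv> \<alpha>(l := (\<alpha> l)(i := Suc (\<alpha> l i)))"

text \<open>On the open half-line this is convexity of t^p. At the endpoint 0 it reduces to c^p <= c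
  for c in [0, 1], which holds since p >= 1.\<close>

lemma powr_convex_combination:
 fixes a b l p :: real
 assumes "0 <= a" "0 <= b" "0 <= l" "l <= 1" "1 <= p"
 shows "(l * a + (1 - l) * b) powr p <= l * a powr p + (1 - l) * b powr p"
proof (cases "a = 0 \<or> b = 0")
 case False
 then have "a \<in> {0<..}" "b \<in> {0<..}" using assms by auto
 then have "((1 - (1-l)) *\<^sub>R a + (1-l) *\<^sub>R b) powr p <= (1 - (1-l)) * a powr p + (1-l) * b powr p"
  using assms powr_convex[OF \<open>1 <= p\<close>] by (intro convex_onD[where A="{0<..}"]) auto
 then show ?thesis by simp
next
 case True
 have k: "(c * z) powr p <= c * z powr p" if "0 <= c" "c <= 1" "0 <= z" for c z
 proof -
  have "c powr p <= c powr 1"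
  proof (cases "c = 0")
   case False
   then show ?thesis using that assms by (intro powr_mono') auto
  qed (use assms in auto)
  then have "c powr p <= c" using that by simp
  then show ?thesis using that by (simp add: powr_mult mult_right_mono)
 qed
 from True show ?thesis using k[of l a] k[of "1-l" b] assms by auto
qed

section \<open>The seminormed space L^p(D) on a set of finite measure\<close>

locale Lp_space =
 fixes D :: "(real^'d) set" and p :: real
 assumes lmeas: "D \<in> lmeasurable" and p1: "1 <= p"
begin

abbreviation "nrm \<equiv> Lp_norm D p"
abbreviation "LP \<equiv> Lp D p"

lemma p_pos: "0 < p" using p1 by simp

lemma finite_measure_L: "finite_measure (lebesgue_on D)"
 using lmeas by (metis finite_measure_lebesgue_on)

lemma D_sets: "D \<in> sets lebesgue"
 using lmeas by (simp add: fmeasurableD)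

lemma Lp_measurable[measurable_dest]: "u \<in> LP ==> u \<in> borel_measurable (lebesgue_on D)"
 by (simp add: Lp_def)

lemma Lp_norm_nonneg [simp]: "0 <= nrm u"
 by (simp add: Lp_norm_def)

lemma Lp_norm_powr: "nrm u powr p = (\<integral>x. \<bar>u x\<bar> powr p \<partial>lebesgue_on D)"
 unfolding Lp_norm_def using p_pos by (simp add: powr_powr integral_nonneg)

lemma Lp_zero [simp]: "(%x. 0) \<in> LP" by (simp add: Lp_def)

lemma Lp_norm_zero [simp]: "nrm (%x. 0) = 0"
 by (simp add: Lp_norm_def)

lemma Lp_scale: "u \<in> LP ==> (%x. c * u x) \<in> LP"
 by (auto simp: Lp_def abs_mult powr_mult)

lemma Lp_norm_scale: "nrm (%x. c * u x) = \<bar>c\<bar> * nrm u"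
 using p_pos by (simp add: Lp_norm_def abs_mult powr_mult powr_powr integral_nonneg)

lemma Lp_add:
 assumes u: "u \<in> LP" and v: "v \<in> LP"
 shows "(%x. u x + v x) \<in> LP"
proof -
 have [measurable]: "u \<in> borel_measurable (lebesgue_on D)" "v \<in> borel_measurable (lebesgue_on D)"
  using u v by (auto simp: Lp_def)
 have b: "\<bar>u x + v x\<bar> powr p <= 2 powr p * (\<bar>u x\<bar> powr p + \<bar>v x\<bar> powr p)" for x
 proof -
  have "\<bar>u x + v x\<bar> powr p <= (2 * max \<bar>u x\<bar> \<bar>v x\<bar>) powr p"
   using p_pos by (intro powr_mono2) auto
  also have "\<dots> = 2 powr p * (max \<bar>u x\<bar> \<bar>v x\<bar>) powr p" by (simp add: powr_mult)
  also have "\<dots> <= 2 powr p * (\<bar>u x\<bar> powr p + \<bar>v x\<bar> powr p)"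
   by (intro mult_left_mono) (auto simp: max_def)
  finally show ?thesis .
 qed
 have "integrable (lebesgue_on D) (%x. \<bar>u x + v x\<bar> powr p)"
  by (rule Bochner_Integration.integrable_bound[where f="%x. 2 powr p * (\<bar>u x\<bar> powr p + \<bar>v x\<bar> powr p)"])
    (use u v b in \<open>auto simp: Lp_def\<close>)
 then show ?thesis by (simp add: Lp_def)
qed

lemma Lp_minus: "u \<in> LP ==> (%x. - u x) \<in> LP"
 by (auto simp: Lp_def)

lemma Lp_norm_minus: "nrm (%x. - u x) = nrm u"
 by (simp add: Lp_norm_def)

lemma Lp_norm_minus_commute: "nrm (%x. u x - v x) = nrm (%x. v x - u x)"
 by (simp add: Lp_norm_def abs_minus_commute)

lemma Lp_diff:
 assumes "u \<in> LP" "v \<in> LP"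
 shows "(%x. u x - v x) \<in> LP"
 using Lp_add[OF assms(1) Lp_minus[OF assms(2)]] by simp

lemma Lp_sum:
 assumes "!!i. i \<in> S ==> u i \<in> LP"
 shows "(%x. \<Sum>i\<in>S. u i x) \<in> LP"
 using assms by (induction S rule: infinite_finite_induct) (auto intro!: Lp_add)

lemma Lp_norm_cong_AE:
 assumes "AE x in lebesgue_on D. u x = v x"
  and "u \<in> borel_measurable (lebesgue_on D)" "v \<in> borel_measurable (lebesgue_on D)"
 shows "nrm u = nrm v"
 unfolding Lp_norm_def
 by (subst integral_cong_AE[where g = "%x. \<bar>v x\<bar> powr p"]) (use assms in auto)

lemma Lp_norm_eq_0_iff:
 assumes "u \<in> LP"
 shows "nrm u = 0 \<longleftrightarrow> (AE x in lebesgue_on D. u x = 0)"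
proof -
 have "nrm u = 0 \<longleftrightarrow> (\<integral>x. \<bar>u x\<bar> powr p \<partial>lebesgue_on D) = 0"
  unfolding Lp_norm_def using p_pos by simp
 also have "\<dots> \<longleftrightarrow> (AE x in lebesgue_on D. \<bar>u x\<bar> powr p = 0)"
  using assms by (intro integral_nonneg_eq_0_iff_AE) (auto simp: Lp_def)
 finally show ?thesis by simp
qed

lemma Lp_cong_AE:
 assumes "u \<in> LP" "AE x in lebesgue_on D. v x = u x" 
 shows "v \<in> LP"
proof -
 have "v \<in> borel_measurable (lebesgue_on D)"
 proof -
  have "(%x. if x \<in> D then u x else 0) \<in> borel_measurable lebesgue"
   using assms(1) D_sets borel_measurable_if Lp_measurable by blast
  moreover have "AE x in lebesgue. (if x \<in> D then u x else 0) = (if x \<in> D then v x else 0)"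
   using assms(2) D_sets by (auto simp: AE_restrict_space_iff)
  ultimately have "(%x. if x \<in> D then v x else 0) \<in> borel_measurable lebesgue"
   by (rule borel_measurable_AE)
  then show ?thesis using D_sets borel_measurable_if by blast
 qed
 moreover have "integrable (lebesgue_on D) (%x. \<bar>v x\<bar> powr p)"
  using assms calculation 
  by (subst integrable_cong_AE[where g="%x. \<bar>u x\<bar> powr p"]) (auto simp: Lp_def)
 ultimately show ?thesis by (simp add: Lp_def)
qed

text \<open>Minkowski from convexity alone: with a, b the two norms and l = a / (a + b), |u + v| <=
  (a + b) (l |u| / a + (1 - l) |v| / b). The p-th power of the bracket is at most the same
  combination of p-th powers, and its integral is at most l + (1 - l) = 1. If a norm vanishes, that
  function is 0 a.e.\<close>

lemma Lp_norm_triangle: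
 assumes u: "u \<in> LP" and v: "v \<in> LP"
 shows "nrm (%x. u x + v x) <= nrm u + nrm v"
proof -
 define a b where "a = nrm u" and "b = nrm v"
 have [measurable]: "u \<in> borel_measurable (lebesgue_on D)" "v \<in> borel_measurable (lebesgue_on D)"
  using u v by (auto simp: Lp_def)
 show ?thesis
 proof (cases "a = 0 \<or> b = 0")
  case True
  then show ?thesis
  proof
   assume "a = 0"
   then have "AE x in lebesgue_on D. u x + v x = v x"
    using Lp_norm_eq_0_iff[OF u] a_def by auto
   from Lp_norm_cong_AE[OF this] show ?thesis using \<open>a = 0\<close> a_def by simp
  next
   assume "b = 0"
   then have "AE x in lebesgue_on D. u x + v x = u x"
    using Lp_norm_eq_0_iff[OF v] b_def by auto
   from Lp_norm_cong_AE[OF this] show ?thesis using \<open>b = 0\<close> b_def by simp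
  qed
 next
  case False
  then have ab: "a > 0" "b > 0" using Lp_norm_nonneg a_def b_def by (auto simp: less_le)
  define l where "l = a / (a + b)"
  have l: "0 <= l" "l <= 1" "1 - l = b / (a+b)" using ab by (auto simp: l_def field_simps)
  have pt: "\<bar>u x + v x\<bar> powr p <= (a+b) powr p * (l * (\<bar>u x\<bar> powr p / a powr p) + (1-l) * (\<bar>v x\<bar> powr p / b powr p))" for x
  proof -
   have "\<bar>u x + v x\<bar> <= (a+b) * (l * (\<bar>u x\<bar>/a) + (1-l) * (\<bar>v x\<bar>/b))"
   proof -
    have "(a+b) * (l * (\<bar>u x\<bar>/a)) = \<bar>u x\<bar>" using ab by (simp add: l_def)
    moreover have "(a+b) * ((1-l) * (\<bar>v x\<bar>/b)) = \<bar>v x\<bar>" using ab by (simp add: l(3))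
    ultimately show ?thesis by (simp add: distrib_left)
   qed
   then have "\<bar>u x + v x\<bar> powr p <= ((a+b) * (l * (\<bar>u x\<bar>/a) + (1-l) * (\<bar>v x\<bar>/b))) powr p"
    using p_pos by (intro powr_mono2) auto
   also have "\<dots> = (a+b) powr p * (l * (\<bar>u x\<bar>/a) + (1-l) * (\<bar>v x\<bar>/b)) powr p"
    using ab l by (simp add: powr_mult)
   also have "\<dots> <= (a+b) powr p * (l * (\<bar>u x\<bar>/a) powr p + (1-l) * (\<bar>v x\<bar>/b) powr p)"
    using ab l p1 by (intro mult_left_mono powr_convex_combination) auto
   finally show ?thesis using ab by (simp add: powr_divide)
  qed
  have ap: "(\<integral>x. \<bar>u x\<bar> powr p \<partial>lebesgue_on D) = a powr p" "(\<integral>x. \<bar>v x\<bar> powr p \<partial>lebesgue_on D) = b powr p"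
   using Lp_norm_powr a_def b_def by auto
  have "(\<integral>x. \<bar>u x + v x\<bar> powr p \<partial>lebesgue_on D) \<le>
    (\<integral>x. (a+b) powr p * (l * (\<bar>u x\<bar> powr p / a powr p) + (1-l) * (\<bar>v x\<bar> powr p / b powr p)) \<partial>lebesgue_on D)"
   using Lp_add[OF u v] u v pt by (intro integral_mono) (auto simp: Lp_def)
  also have "\<dots> = (a+b) powr p * (l * (a powr p / a powr p) + (1-l) * (b powr p / b powr p))"
   using u v by (simp add: Lp_def ap[symmetric])
  also have "\<dots> = (a+b) powr p" using ab by simp
  finally have "(\<integral>x. \<bar>u x + v x\<bar> powr p \<partial>lebesgue_on D) powr (1/p) <= ((a+b) powr p) powr (1/p)"
   using p_pos by (intro powr_mono2) (auto simp: integral_nonneg)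
  also have "\<dots> = a + b" using ab p_pos by (simp add: powr_powr)
  finally show ?thesis by (simp add: Lp_norm_def[of D p "%x. u x + v x"] a_def b_def)
 qed
qed

lemma Lp_norm_triangle_diff:
 assumes "u \<in> LP" "v \<in> LP"
 shows "nrm (%x. u x - v x) <= nrm u + nrm v"
 using Lp_norm_triangle[OF assms(1) Lp_minus[OF assms(2)]] by (simp add: Lp_norm_minus)

lemma Lp_norm_dist_triangle:
 assumes "u \<in> LP" "v \<in> LP" "w \<in> LP"
 shows "nrm (%x. u x - w x) <= nrm (%x. u x - v x) + nrm (%x. v x - w x)"
 using Lp_norm_triangle[OF Lp_diff[OF assms(1,2)] Lp_diff[OF assms(2,3)]] by simp

lemma Lp_norm_le_add_diff:
 assumes "u \<in> LP" "v \<in> LP"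
 shows "nrm u <= nrm v + nrm (%x. u x - v x)"
 using Lp_norm_triangle[OF assms(2) Lp_diff[OF assms]] by simp

lemma Lp_norm_reverse_triangle:
 assumes "u \<in> LP" "v \<in> LP"
 shows "\<bar>nrm u - nrm v\<bar> <= nrm (%x. u x - v x)"
 using Lp_norm_le_add_diff[OF assms] Lp_norm_le_add_diff[OF assms(2,1)] Lp_norm_minus_commute[of v u]
 by simp

lemma Lp_norm_sum:
 assumes "!!i. i \<in> S ==> u i \<in> LP"
 shows "nrm (%x. \<Sum>i\<in>S. u i x) <= (\<Sum>i\<in>S. nrm (u i))"
 using assms
proof (induction S rule: infinite_finite_induct)
 case (insert i S)
 then show ?case
  using Lp_norm_triangle[of "u i" "%x. \<Sum>i\<in>S. u i x"] Lp_sum[of S u] by force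
qed auto

lemma Lp_integrable:
 assumes u: "u \<in> LP"
 shows "integrable (lebesgue_on D) u"
proof -
 have [measurable]: "u \<in> borel_measurable (lebesgue_on D)" using u by (rule Lp_measurable)
 interpret finite_measure "lebesgue_on D" by (rule finite_measure_L)
 have b: "\<bar>u x\<bar> <= 1 + \<bar>u x\<bar> powr p" for x
 proof (cases "\<bar>u x\<bar> <= 1")
  case False
  then have "\<bar>u x\<bar> powr 1 <= \<bar>u x\<bar> powr p" using p1 by (intro powr_mono) auto
  then show ?thesis by auto
 qed (use powr_ge_zero[of "\<bar>u x\<bar>" p] in linarith)
 show ?thesis
  by (rule Bochner_Integration.integrable_bound[where f="%x. 1 + \<bar>u x\<bar> powr p"])
    (use u b in \<open>auto simp: Lp_def\<close>)
qed

text \<open>Instead of Hoelder's inequality, t <= a (1 + (t / a)^p) for t >= 0 with a =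
  \<open>nrm u\<close>. Integration turns the bracket into the measure of D plus 1, which explains
  the constant.\<close>

lemma Lp_L1_bound:
 assumes u: "u \<in> LP"
 shows "(\<integral>x. \<bar>u x\<bar> \<partial>lebesgue_on D) <= (measure lebesgue D + 1) * nrm u"
proof (cases "nrm u = 0")
 case True
 then have "AE x in lebesgue_on D. \<bar>u x\<bar> = 0" using Lp_norm_eq_0_iff[OF u] by simp
 then have "(\<integral>x. \<bar>u x\<bar> \<partial>lebesgue_on D) = 0" by (rule integral_eq_zero_AE)
 then show ?thesis using True by simp
next
 case False
 define a where "a = nrm u"
 have a: "a > 0" using False Lp_norm_nonneg[of u] unfolding a_def by linarith
 interpret finite_measure "lebesgue_on D" by (rule finite_measure_L)
 have b: "\<bar>u x\<bar> <= a * (1 + \<bar>u x\<bar> powr p / a powr p)" for x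
 proof (cases "\<bar>u x\<bar> <= a")
  case False
  then have "(\<bar>u x\<bar>/a) powr 1 <= (\<bar>u x\<bar>/a) powr p" using p1 a by (intro powr_mono) auto
  then have "\<bar>u x\<bar>/a <= \<bar>u x\<bar> powr p / a powr p" using a by (simp add: powr_divide)
  then have "\<bar>u x\<bar> <= a * (\<bar>u x\<bar> powr p / a powr p)" using a by (simp add: field_simps)
  then show ?thesis using a by (simp add: distrib_left)
 next
  case True
  have "a * 1 <= a * (1 + \<bar>u x\<bar> powr p / a powr p)" using a by (intro mult_left_mono) auto
  then show ?thesis using True by simp
 qed
 have "(\<integral>x. \<bar>u x\<bar> \<partial>lebesgue_on D) <= (\<integral>x. a * (1 + \<bar>u x\<bar> powr p / a powr p) \<partial>lebesgue_on D)"
  using Lp_integrable[OF u] u b by (intro integral_mono) (auto simp: Lp_def)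
 also have "\<dots> = a * (measure lebesgue D + a powr p / a powr p)"
  using u Lp_norm_powr[of u] D_sets
  by (simp add: Lp_def a_def measure_restrict_space)
 finally show ?thesis using a by (simp add: a_def mult.commute)
qed

lemma Lp_mult_bounded:
 assumes u: "u \<in> LP" and z: "z \<in> borel_measurable (lebesgue_on D)" and c: "!!x. x \<in> D ==> \<bar>z x\<bar> <= C"
 shows "(%x. u x * z x) \<in> LP"
proof -
 have [measurable]: "u \<in> borel_measurable (lebesgue_on D)" using u by (rule Lp_measurable)
 note z[measurable]
 have "integrable (lebesgue_on D) (%x. \<bar>u x * z x\<bar> powr p)"
 proof (rule Bochner_Integration.integrable_bound[where f="%x. \<bar>C\<bar> powr p * \<bar>u x\<bar> powr p"])
  show "AE x in lebesgue_on D. norm (\<bar>u x * z x\<bar> powr p) <= norm (\<bar>C\<bar> powr p * \<bar>u x\<bar> powr p)"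
  proof (rule AE_I2)
   fix x assume "x \<in> space (lebesgue_on D)"
   then have "\<bar>z x\<bar> <= \<bar>C\<bar>" using c[of x] by (auto simp: )
   then show "norm (\<bar>u x * z x\<bar> powr p) <= norm (\<bar>C\<bar> powr p * \<bar>u x\<bar> powr p)"
    using p_pos by (simp add: abs_mult powr_mult mult.commute[of "\<bar>C\<bar> powr p"] mult_left_mono powr_mono2)
  qed
 qed (use u in \<open>auto simp: Lp_def\<close>)
 then show ?thesis by (simp add: Lp_def)
qed

lemma Lp_integral_mult_bound:
 assumes u: "u \<in> LP" and z: "z \<in> borel_measurable (lebesgue_on D)" and c: "!!x. x \<in> D ==> \<bar>z x\<bar> <= C"
 shows "\<bar>\<integral>x. u x * z x \<partial>lebesgue_on D\<bar> <= C * ((measure lebesgue D + 1) * nrm u)"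
proof (cases "D = {}")
 case True
 then have "(\<integral>x. f x \<partial>lebesgue_on D) = 0" for f :: "real^'d => real"
  by (intro integral_eq_zero_AE) (simp add: AE_restrict_space_iff)
 then show ?thesis by (simp add: Lp_norm_def)
next
 case False
 then have "C \<ge> 0" using c by force
 have "\<bar>\<integral>x. u x * z x \<partial>lebesgue_on D\<bar> <= (\<integral>x. \<bar>u x * z x\<bar> \<partial>lebesgue_on D)"
  by (rule integral_abs_bound)
 also have "\<dots> <= (\<integral>x. C * \<bar>u x\<bar> \<partial>lebesgue_on D)"
 proof (rule integral_mono)
  show "integrable (lebesgue_on D) (%x. \<bar>u x * z x\<bar>)"
   by (intro integrable_abs Lp_integrable Lp_mult_bounded[OF u z c])
  show "integrable (lebesgue_on D) (%x. C * \<bar>u x\<bar>)"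
   using Lp_integrable[OF u] by simp
  show "\<bar>u x * z x\<bar> <= C * \<bar>u x\<bar>" if "x \<in> space (lebesgue_on D)" for x
   using c[of x] that mult_left_mono[of "\<bar>z x\<bar>" C "\<bar>u x\<bar>"] by (simp add: abs_mult mult.commute)
 qed
 also have "\<dots> <= C * ((measure lebesgue D + 1) * nrm u)"
  using Lp_L1_bound[OF u] \<open>C \<ge> 0\<close> by (simp add: mult_left_mono)
 finally show ?thesis .
qed

lemma nn_integral_Lp:
 assumes "u \<in> LP"
 shows "(\<integral>\<^sup>+x. ennreal (\<bar>u x\<bar> powr p) \<partial>lebesgue_on D) = ennreal (nrm u powr p)"
 using assms unfolding Lp_norm_powr by (intro nn_integral_eq_integral) (auto simp: Lp_def)

text \<open>The Bochner integral of a non-integrable function is 0, so a bound on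
  \<open>nrm u\<close> alone says nothing about u. The nonnegative integral gives membership and
  bound together.\<close>

lemma Lp_normI:
 assumes [measurable]: "u \<in> borel_measurable (lebesgue_on D)" and "0 <= c"
  and le: "(\<integral>\<^sup>+x. ennreal (\<bar>u x\<bar> powr p) \<partial>lebesgue_on D) <= ennreal (c powr p)"
 shows "u \<in> LP" "nrm u <= c"
proof -
 show u: "u \<in> LP"
  unfolding Lp_def using le
  by (auto intro!: integrableI_nonneg order.strict_trans1[OF le])
 have "nrm u powr p <= c powr p"
  using le nn_integral_Lp[OF u] by simp
 then show "nrm u <= c"
  using p_pos \<open>0 <= c\<close> powr_less_mono2[of p c "nrm u"] by force
qed

text \<open>Fatou's lemma for |u_n - v|^p: the integrals tend to 0 while the integrand tends to |w -
  v|^p a.e., so the latter vanishes a.e. No passage to a subsequence is made.\<close>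

lemma AE_lim_eq_Lp_lim:
 assumes u: "!!n. u n \<in> LP" and v: "v \<in> LP"
  and ae: "AE x in lebesgue_on D. (%n. u n x) \<longlonglongrightarrow> w x"
  and lim: "(%n. nrm (%x. u n x - v x)) \<longlonglongrightarrow> 0"
 shows "AE x in lebesgue_on D. w x = v x"
proof -
 have [measurable]: "!!n. u n \<in> borel_measurable (lebesgue_on D)" "v \<in> borel_measurable (lebesgue_on D)"
  using u v Lp_measurable by auto
 have "(\<integral>\<^sup>+x. liminf (%n. ennreal (\<bar>u n x - v x\<bar> powr p)) \<partial>lebesgue_on D)
   <= liminf (%n. \<integral>\<^sup>+x. ennreal (\<bar>u n x - v x\<bar> powr p) \<partial>lebesgue_on D)"
  by (intro nn_integral_liminf) auto
 also have "\<dots> = liminf (%n. ennreal (nrm (%x. u n x - v x) powr p))"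
  using nn_integral_Lp[OF Lp_diff[OF u v]] by simp
 also have "\<dots> = 0"
 proof -
  have "(%n. ennreal (nrm (%x. u n x - v x) powr p)) \<longlonglongrightarrow> ennreal (0 powr p)"
   using p_pos by (intro tendsto_ennrealI tendsto_powr'[OF lim]) auto
  then show ?thesis by (simp add: lim_imp_Liminf)
 qed
 finally have "(\<integral>\<^sup>+x. liminf (%n. ennreal (\<bar>u n x - v x\<bar> powr p)) \<partial>lebesgue_on D) = 0" by simp
 then have "AE x in lebesgue_on D. liminf (%n. ennreal (\<bar>u n x - v x\<bar> powr p)) = 0"
  by (subst (asm) nn_integral_0_iff_AE) auto
 with ae show ?thesis
 proof eventually_elim
  case (elim x)
  have "(%n. ennreal (\<bar>u n x - v x\<bar> powr p)) \<longlonglongrightarrow> ennreal (\<bar>w x - v x\<bar> powr p)"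
   using p_pos by (intro tendsto_ennrealI tendsto_powr' tendsto_intros elim(1)) auto
  then have "liminf (%n. ennreal (\<bar>u n x - v x\<bar> powr p)) = ennreal (\<bar>w x - v x\<bar> powr p)"
   by (rule lim_imp_Liminf[rotated]) simp
  with elim(2) show ?case by simp
 qed
qed

end

subsection \<open>Smooth functions with compact support\<close>

text \<open>Smooth functions of one variable come with all their derivatives, in the style of
  \<open>smooth_derivs\<close>: the entry \<open>c n\<close> is the n-th derivative of
  \<open>c 0\<close>.\<close>

definition deriv_seq :: "(nat => real => real) => bool" where
 "deriv_seq c \<longleftrightarrow> (\<forall>n t. (c n has_real_derivative c (Suc n) t) (at t))"

text \<open>The polynomials P_n for which the n-th derivative of exp(-1/t) is P_n(1/t) exp(-1/t), t
  > 0. With s = 1/t one has ds/dt = -s^2, whence P_(n+1)(s) = s^2 (P_n(s) - P_n'(s)).\<close>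

primrec flat_poly :: "nat => real poly" where
 "flat_poly 0 = 1"
| "flat_poly (Suc n) = [:0, 0, 1:] * (flat_poly n - pderiv (flat_poly n))"

definition flat :: "nat => real => real" where
 "flat n t = (if 0 < t then poly (flat_poly n) (1 / t) * exp (- (1 / t)) else 0)"

lemma poly_mult_exp_minus_tendsto_0:
 fixes Q :: "real poly"
 shows "((%s. poly Q s * exp (- s)) \<longlongrightarrow> 0) at_top"
proof -
 have "((%s. \<Sum>i\<le>degree Q. coeff Q i * (s ^ i / exp s)) \<longlongrightarrow> (\<Sum>i\<le>degree Q. coeff Q i * 0)) at_top"
  by (intro tendsto_sum tendsto_mult tendsto_const tendsto_power_div_exp_0)
 then show ?thesis
  by (simp add: poly_altdef sum_divide_distrib exp_minus field_simps)
qed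

text \<open>For t > 0 this is the chain rule. At 0 the right difference quotient of
  \<open>flat n\<close> is s P_n(s) exp(-s) with s = 1/h, and the exponential beats every
  polynomial; the left one is 0.\<close>

lemma deriv_seq_flat: "deriv_seq flat"
 unfolding deriv_seq_def
proof (intro allI)
 fix n :: nat and t :: real
 consider "t > 0" | "t < 0" | "t = 0" by linarith
 then show "(flat n has_real_derivative flat (Suc n) t) (at t)"
 proof cases
  case 1
  have "((%t. poly (flat_poly n) (1 / t) * exp (- (1 / t))) has_real_derivative flat (Suc n) t) (at t)"
  proof -
   have "((%t. 1 / t) has_real_derivative - (1 / t\<^sup>2)) (at t)"
    using 1 by (auto intro!: derivative_eq_intros simp: power2_eq_square)
   note d = this
   have e: "((%t. exp (- (1 / t))) has_real_derivative exp (- (1 / t)) * (1 / t\<^sup>2)) (at t)"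
    using DERIV_fun_exp[OF DERIV_minus[OF d]] by simp
   have "((%t. poly (flat_poly n) (1 / t)) has_real_derivative poly (pderiv (flat_poly n)) (1 / t) * (- (1 / t\<^sup>2))) (at t)"
    by (rule DERIV_chain2[OF poly_DERIV d])
   from DERIV_mult[OF this e] show ?thesis
    by (rule DERIV_cong) (use 1 in \<open>simp add: flat_def power2_eq_square algebra_simps\<close>)
  qed
  then show ?thesis
   by (rule has_field_derivative_transform_within_open[where S="{0<..}"]) (use 1 in \<open>auto simp: flat_def\<close>)
 next
  case 2
  have "((%t. 0) has_real_derivative 0) (at t)" by simp
  then have "(flat n has_real_derivative 0) (at t)"
   by (rule has_field_derivative_transform_within_open[where S="{..<0}"]) (use 2 in \<open>auto simp: flat_def\<close>)
  then show ?thesis using 2 by (simp add: flat_def)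
 next
  case 3
  have "((%h. flat n h / h) \<longlongrightarrow> 0) (at_left 0)"
   by (rule tendsto_eventually) (auto simp: eventually_at_filter flat_def)
  moreover have "((%h. flat n h / h) \<longlongrightarrow> 0) (at_right 0)"
  proof -
   have "((%h. poly ([:0,1:] * flat_poly n) (inverse h) * exp (- (inverse h))) \<longlongrightarrow> 0) (at_right 0)"
    by (rule filterlim_compose[OF poly_mult_exp_minus_tendsto_0 filterlim_inverse_at_top_right])
   moreover have "\<forall>\<^sub>F h in at_right 0. poly ([:0,1:] * flat_poly n) (inverse h) * exp (- (inverse h)) = flat n h / h"
    by (auto simp: eventually_at_filter flat_def field_simps)
   ultimately show ?thesis by (rule Lim_transform_eventually)
  qed
  ultimately have "((%h. flat n h / h) \<longlongrightarrow> 0) (at 0)"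
   by (rule filterlim_split_at)
  then show ?thesis using 3 by (simp add: has_field_derivative_iff flat_def)
 qed
qed

lemma flat_0_props: "0 <= flat 0 t" "flat 0 t <= 1" "flat 0 t > 0 \<longleftrightarrow> t > 0" "t <= 0 ==> flat 0 t = 0"
 by (auto simp: flat_def)

lemma deriv_seq_continuous: "deriv_seq c ==> continuous_on A (c n)"
 by (rule continuous_at_imp_continuous_on) (auto simp: deriv_seq_def intro: DERIV_isCont)

lemma deriv_seq_compose_affine:
 assumes "deriv_seq c"
 shows "deriv_seq (%n t. k ^ n * c n (k * t + b))"
 unfolding deriv_seq_def
proof (intro allI)
 fix n t
 have "(c n has_real_derivative c (Suc n) (k * t + b)) (at (k * t + b))"
  using assms by (simp add: deriv_seq_def)
 then have "((%t. c n (k * t + b)) has_real_derivative c (Suc n) (k * t + b) * k) (at t)"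
  by (rule DERIV_chain2) (auto intro!: derivative_eq_intros)
 then show "((%t. k ^ n * c n (k * t + b)) has_real_derivative k ^ Suc n * c (Suc n) (k * t + b)) (at t)"
  by (auto intro!: derivative_eq_intros)
qed

text \<open>Pascal's rule in the form in which it occurs when the N-th Leibniz sum is differentiated
  once more.\<close>

lemma binomial_sum_Suc:
 fixes a b :: "nat => real"
 shows "(\<Sum>r\<le>N. real (N choose r) * (a (Suc r) * b (N - r) + a r * b (Suc (N - r))))
    = (\<Sum>r\<le>Suc N. real (Suc N choose r) * (a r * b (Suc N - r)))"
proof -
 have "(\<Sum>r\<le>Suc N. real (Suc N choose r) * (a r * b (Suc N - r)))
   = a 0 * b (Suc N) + (\<Sum>r\<le>N. real (N choose r) * (a (Suc r) * b (N - r))) 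
     + (\<Sum>r\<le>N. real (N choose Suc r) * (a (Suc r) * b (N - r)))"
  by (subst sum.atMost_Suc_shift) (simp add: distrib_right sum.distrib)
 moreover have "a 0 * b (Suc N) + (\<Sum>r\<le>N. real (N choose Suc r) * (a (Suc r) * b (N - r)))
   = (\<Sum>r\<le>Suc N. real (N choose r) * (a r * b (Suc N - r)))"
  by (subst sum.atMost_Suc_shift) simp
 moreover have "\<dots> = (\<Sum>r\<le>N. real (N choose r) * (a r * b (Suc (N - r))))"
  by (simp add: Suc_diff_le)
 ultimately show ?thesis
  by (simp add: distrib_left sum.distrib)
qed

text \<open>The witness is the Leibniz formula in the single coordinate j. Multiplying by a function
  of one coordinate keeps the formula one-dimensional; products over all coordinates are then built
  one factor at a time.\<close>

lemma smooth_derivs_mult_coord: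
 fixes Z :: "('d::finite => nat) => real^'d => real"
 assumes Z: "smooth_derivs Z" and c: "deriv_seq c"
 shows "\<exists>Z'. smooth_derivs Z' & (\<forall>x. Z' (%_. 0) x = c 0 (x $ j) * Z (%_. 0) x)"
proof (intro exI conjI allI)
 define Z' where "Z' \<alpha> x = (\<Sum>r\<le>\<alpha> j. real (\<alpha> j choose r) * (c r (x $ j) * Z (\<alpha>(j := \<alpha> j - r)) x))" for \<alpha> x
 have cc: "continuous_on UNIV (c r)" for r
  using c by (rule deriv_seq_continuous)
 have Zc: "continuous_on UNIV (Z \<alpha>)" for \<alpha> using Z by (simp add: smooth_derivs_def)
 have Zd: "((%t. Z \<alpha> (x + t *\<^sub>R axis i 1)) has_real_derivative Z (\<alpha>(i := Suc (\<alpha> i))) x) (at 0)" for \<alpha> i x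
  using Z by (simp add: smooth_derivs_def)
 show "smooth_derivs Z'"
  unfolding smooth_derivs_def
 proof (intro conjI allI)
  show "continuous_on UNIV (Z' \<alpha>)" for \<alpha>
   unfolding Z'_def
   by (intro continuous_intros continuous_on_compose2[OF cc] Zc) auto
  fix \<alpha> i x
  show "((%t. Z' \<alpha> (x + t *\<^sub>R axis i 1)) has_real_derivative Z' (\<alpha>(i := Suc (\<alpha> i))) x) (at 0)"
  proof (cases "i = j")
   case False
   have "((%t. \<Sum>r\<le>\<alpha> j. real (\<alpha> j choose r) * (c r (x $ j) * Z (\<alpha>(j := \<alpha> j - r)) (x + t *\<^sub>R axis i 1)))
     has_real_derivative
     (\<Sum>r\<le>\<alpha> j. real (\<alpha> j choose r) * (c r (x $ j) * Z ((\<alpha>(j := \<alpha> j - r))(i := Suc ((\<alpha>(j := \<alpha> j - r)) i))) x))) (at 0)"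
    by (intro DERIV_sum DERIV_cmult Zd)
   then show ?thesis
    using False by (simp add: Z'_def axis_def fun_upd_twist)
  next
   case True
   have cd: "((%t. c r ((x + t *\<^sub>R axis j 1) $ j)) has_real_derivative c (Suc r) (x $ j)) (at 0)" for r
   proof -
    have "(c r has_real_derivative c (Suc r) (x $ j)) (at (x $ j + 0))"
     using c by (simp add: deriv_seq_def)
    from DERIV_at_within_shift[THEN iffD1, of "c r" _ "x $ j" 0 UNIV] this
    show ?thesis by (simp add: axis_def add.commute)
   qed
   have "((%t. \<Sum>r\<le>\<alpha> j. real (\<alpha> j choose r) * (c r ((x + t *\<^sub>R axis j 1) $ j) * Z (\<alpha>(j := \<alpha> j - r)) (x + t *\<^sub>R axis j 1)))
     has_real_derivative
     (\<Sum>r\<le>\<alpha> j. real (\<alpha> j choose r) * (c (Suc r) (x $ j) * Z (\<alpha>(j := \<alpha> j - r)) (x + 0 *\<^sub>R axis j 1) 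
      + Z ((\<alpha>(j := \<alpha> j - r))(j := Suc ((\<alpha>(j := \<alpha> j - r)) j))) x * c r ((x + 0 *\<^sub>R axis j 1) $ j)))) (at 0)"
    by (intro DERIV_sum DERIV_cmult DERIV_mult Zd cd)
   also have "(\<Sum>r\<le>\<alpha> j. real (\<alpha> j choose r) * (c (Suc r) (x $ j) * Z (\<alpha>(j := \<alpha> j - r)) (x + 0 *\<^sub>R axis j 1) 
      + Z ((\<alpha>(j := \<alpha> j - r))(j := Suc ((\<alpha>(j := \<alpha> j - r)) j))) x * c r ((x + 0 *\<^sub>R axis j 1) $ j)))
     = (\<Sum>r\<le>\<alpha> j. real (\<alpha> j choose r) * (c (Suc r) (x $ j) * Z (\<alpha>(j := \<alpha> j - r)) x + c r (x $ j) * Z (\<alpha>(j := Suc (\<alpha> j - r))) x))"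
    by (simp add: mult.commute)
   also have "\<dots> = Z' (\<alpha>(j := Suc (\<alpha> j))) x"
    unfolding Z'_def by (subst binomial_sum_Suc[of "\<alpha> j" "%r. c r (x $ j)" "%r. Z (\<alpha>(j := r)) x"]) simp
   finally show ?thesis using True by (simp add: Z'_def fun_upd_def)
  qed
 qed
 show "Z' (%_. 0) x = c 0 (x $ j) * Z (%_. 0) x" for x
  by (simp add: Z'_def fun_upd_idem)
qed

text \<open>For k > 0, a smooth function positive exactly on the box. Since \<open>flat 0\<close>
  tends to 1 at infinity, increasing the steepness k makes it converge to the indicator of the box
  while it stays below 1.\<close>

definition box_bump :: "real => real^'d => real^'d => real^'d => real" where
 "box_bump k a b x = (\<Prod>i\<in>UNIV. flat 0 (k * (x $ i - a $ i)) * flat 0 (k * (b $ i - x $ i)))"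

lemma smooth_derivs_box_bump:
 fixes Z :: "('d::finite => nat) => real^'d => real"
 assumes Z: "smooth_derivs Z"
 shows "\<exists>Z'. smooth_derivs Z' & (\<forall>x. Z' (%_. 0) x = Z (%_. 0) x * box_bump k a b x)"
proof -
 have "\<exists>Z'. smooth_derivs Z' & (\<forall>x. Z' (%_. 0) x = Z (%_. 0) x * (\<Prod>i\<in>S. flat 0 (k * (x $ i - a $ i)) * flat 0 (k * (b $ i - x $ i))))"
  if "finite S" for S :: "'d set"
  using that
 proof induction
  case (insert j S)
  then obtain Z1 where Z1: "smooth_derivs Z1" "!!x. Z1 (%_. 0) x = Z (%_. 0) x * (\<Prod>i\<in>S. flat 0 (k * (x $ i - a $ i)) * flat 0 (k * (b $ i - x $ i)))"
   by blast
  obtain Z2 where Z2: "smooth_derivs Z2" "!!x. Z2 (%_. 0) x = (k ^ 0 * flat 0 (k * (x $ j) + - (k * a $ j))) * Z1 (%_. 0) x"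
   using smooth_derivs_mult_coord[OF Z1(1) deriv_seq_compose_affine[OF deriv_seq_flat, of k "- (k * a $ j)"], of j] by blast
  obtain Z3 where Z3: "smooth_derivs Z3" "!!x. Z3 (%_. 0) x = ((- k) ^ 0 * flat 0 ((- k) * (x $ j) + (k * b $ j))) * Z2 (%_. 0) x"
   using smooth_derivs_mult_coord[OF Z2(1) deriv_seq_compose_affine[OF deriv_seq_flat, of "- k" "(k * b $ j)"], of j] by blast
  have "Z3 (%_. 0) x = Z (%_. 0) x * (\<Prod>i\<in>insert j S. flat 0 (k * (x $ i - a $ i)) * flat 0 (k * (b $ i - x $ i)))" for x
   using insert.hyps by (simp add: Z1 Z2 Z3 right_diff_distrib mult_ac)
  with Z3 show ?case by blast
 qed (use Z in auto)
 from this[of UNIV] show ?thesis by (simp add: box_bump_def)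
qed

lemma smooth_derivs_one: "smooth_derivs (%\<alpha> x. if \<alpha> = (%_. 0) then 1 else 0)"
 by (auto simp: smooth_derivs_def fun_eq_iff)

lemma box_bump_bounds: "0 <= box_bump k a b x" "box_bump k a b x <= 1"
 unfolding box_bump_def
 by (intro prod_nonneg ballI mult_nonneg_nonneg flat_0_props)
  (intro prod_le_1 conjI mult_nonneg_nonneg mult_le_one flat_0_props)

lemma box_bump_pos_iff:
 assumes "k > 0"
 shows "box_bump k a b x > 0 \<longleftrightarrow> x \<in> box a b"
proof -
 have f: "flat 0 t = 0 \<longleftrightarrow> \<not> 0 < t" for t by (simp add: flat_def)
 have "box_bump k a b x ~= 0 \<longleftrightarrow> (\<forall>i. a $ i < x $ i & x $ i < b $ i)"
  using assms by (simp add: box_bump_def f zero_less_mult_iff)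
 then have "box_bump k a b x ~= 0 \<longleftrightarrow> x \<in> box a b" by (simp add: mem_box_cart)
 then show ?thesis using box_bump_bounds(1)[of k a b x] by linarith
qed

lemma continuous_on_box_bump: "continuous_on A (box_bump k a b)"
proof -
 have c: "continuous_on UNIV (flat 0)" by (rule deriv_seq_continuous[OF deriv_seq_flat])
 have "continuous_on A (%x. flat 0 (k * (x $ i - a $ i)) * flat 0 (k * (b $ i - x $ i)))" for i
  by (intro continuous_on_mult continuous_on_compose2[OF c]) (auto intro!: continuous_intros)
 then show ?thesis
  unfolding box_bump_def by (intro continuous_on_prod)
qed

lemma box_bump_tendsto:
 "(%n. box_bump (real (Suc n)) a b x) \<longlonglongrightarrow> indicator (box a b) x"
proof (cases "x \<in> box a b")
 case False
 then have "box_bump (real (Suc n)) a b x = 0" for n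
  using box_bump_pos_iff[of "real (Suc n)" a b x] box_bump_bounds(1)[of "real (Suc n)" a b x]
  by force
 then show ?thesis using False by simp
next
 case True
 have f: "(%n. flat 0 (real (Suc n) * s)) \<longlonglongrightarrow> 1" if "s > 0" for s
 proof -
  have "(%n. exp (- (1 / s * inverse (real (Suc n))))) \<longlonglongrightarrow> exp (- (1 / s * 0))"
   by (intro tendsto_intros LIMSEQ_inverse_real_of_nat)
  moreover have "flat 0 (real (Suc n) * s) = exp (- (1 / s * inverse (real (Suc n))))" for n
  proof -
   have "0 < real (Suc n) * s" using that by simp
   then show ?thesis by (simp add: flat_def divide_inverse mult.commute)
  qed
  ultimately show ?thesis by simp
 qed
 have "(%n. box_bump (real (Suc n)) a b x) \<longlonglongrightarrow> (\<Prod>i\<in>(UNIV::'a set). 1 * 1)"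
  unfolding box_bump_def
  by (intro tendsto_prod tendsto_mult f) (use True in \<open>auto simp: mem_box_cart\<close>)
 then show ?thesis using True by simp
qed

subsection \<open>Test functions\<close>

lemma mi_order_eq_0_iff: "mi_order \<alpha> = 0 \<longleftrightarrow> \<alpha> = (%_. 0)"
 by (auto simp: mi_order_def fun_eq_iff)

lemma mi_order_Suc [simp]: "mi_order (\<alpha>(i := Suc (\<alpha> i))) = Suc (mi_order \<alpha>)"
proof -
 have "sum (\<alpha>(i := Suc (\<alpha> i))) UNIV = Suc (\<alpha> i) + sum \<alpha> (UNIV - {i})"
  by (subst sum.remove[of UNIV i]) (auto intro!: sum.cong)
 also have "\<dots> = Suc (sum \<alpha> UNIV)" by (subst sum.remove[of UNIV i \<alpha>]) auto
 finally show ?thesis by (simp add: mi_order_def)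
qed

lemma mi_order_SucE:
 assumes "mi_order \<alpha> = Suc n"
 obtains i \<alpha>' where "\<alpha> = \<alpha>'(i := Suc (\<alpha>' i))" "mi_order \<alpha>' = n"
proof -
 have "\<alpha> ~= (%_. 0)" using assms mi_order_eq_0_iff[of \<alpha>] by auto
 then obtain i where i: "\<alpha> i ~= 0" by auto
 define \<alpha>' where "\<alpha>' = \<alpha>(i := \<alpha> i - 1)"
 have "\<alpha> = \<alpha>'(i := Suc (\<alpha>' i))" using i by (auto simp: \<alpha>'_def fun_eq_iff)
 then show ?thesis using that mi_order_Suc[of \<alpha>' i] assms by simp
qed

lemma mi_order_component_le: "\<alpha> i <= mi_order \<alpha>"
 unfolding mi_order_def by (rule member_le_sum) auto

lemma finite_mi_order_le: "finite {\<alpha> :: 'd::finite => nat. mi_order \<alpha> <= m}"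
proof (rule finite_subset)
 show "{\<alpha> :: 'd => nat. mi_order \<alpha> <= m} \<subseteq> PiE UNIV (%_. {..m})"
  using mi_order_component_le order_trans by fastforce
qed (auto intro: finite_PiE)

lemma mi_order_add: "mi_order (%i. \<alpha> i + \<beta> i) = mi_order \<alpha> + mi_order \<beta>"
 by (simp add: mi_order_def sum.distrib)

abbreviation mi_support :: "(('d => nat) => real^'d => real) => (real^'d) set" where
 "mi_support Z \<equiv> closure {x. Z (%_. 0) x ~= 0}"

text \<open>Off the closed support a lower derivative vanishes on a whole ball, so the next one is a
  derivative of a function that is 0 near the point.\<close>

lemma smooth_derivs_zero_outside:
 assumes Z: "smooth_derivs Z" and x: "x \<notin> mi_support Z"
 shows "Z \<alpha> x = 0"
 using x
proof (induction "mi_order \<alpha>" arbitrary: \<alpha> x)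
 case 0
 then have "\<alpha> = (%_. 0)" by (metis mi_order_eq_0_iff)
 then show ?case using 0(2) closure_subset[of "{x. Z (%_. 0) x ~= 0}"] by auto
next
 case (Suc n)
 obtain i \<alpha>' where a: "\<alpha> = \<alpha>'(i := Suc (\<alpha>' i))" "mi_order \<alpha>' = n"
  using mi_order_SucE[of \<alpha> n] Suc(2) by metis
 have "open (- mi_support Z)" by (intro open_Compl closed_closure)
 then obtain e where e: "e > 0" "ball x e \<subseteq> - mi_support Z"
  using Suc(3) by (meson ComplI openE)
 have "((%t. Z \<alpha>' (x + t *\<^sub>R axis i 1)) has_real_derivative Z \<alpha> x) (at 0)"
  using Z a(1) by (simp add: smooth_derivs_def)
 moreover have "((%t. Z \<alpha>' (x + t *\<^sub>R axis i 1)) has_real_derivative 0) (at 0)"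
 proof (rule has_field_derivative_transform_within_open[where f="%_. 0" and S="ball 0 e"])
  fix t :: real assume "t \<in> ball 0 e"
  then have "x + t *\<^sub>R axis i 1 \<in> ball x e" by (simp add: dist_norm)
  then show "0 = Z \<alpha>' (x + t *\<^sub>R axis i 1)" using Suc(1)[of \<alpha>'] a(2) e(2) by (metis ComplD subsetD)
 qed (use e in auto)
 ultimately show ?case by (rule DERIV_unique)
qed

text \<open>Derivatives of test functions are test functions; in the encoding by families this is a
  shift of the index. It is what allows weak derivatives to be composed and factored.\<close>

lemma test_derivs_shift:
 assumes Z: "test_derivs D Z"
 shows "test_derivs D (%\<beta>. Z (%i. \<beta> i + \<alpha> i))"
proof -
 have s: "smooth_derivs Z" using Z by (simp add: test_derivs_def)
 have e: "(%i'. (\<beta>(i := Suc (\<beta> i))) i' + \<alpha> i') = (%i'. \<beta> i' + \<alpha> i')(i := Suc ((%i'. \<beta> i' + \<alpha> i') i))" for \<beta> i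
  by auto
 have "smooth_derivs (%\<beta>. Z (%i. \<beta> i + \<alpha> i))"
  unfolding smooth_derivs_def e
 proof (intro conjI allI)
  show "continuous_on UNIV (Z (%i. \<beta> i + \<alpha> i))" for \<beta>
   using s by (simp add: smooth_derivs_def)
  show "((%t. Z (%i. \<beta> i + \<alpha> i) (x + t *\<^sub>R axis i 1)) has_real_derivative
    Z ((%i'. \<beta> i' + \<alpha> i')(i := Suc ((%i'. \<beta> i' + \<alpha> i') i))) x) (at 0)" for \<beta> i x
  proof -
   have "\<forall>\<alpha> i x. ((%t. Z \<alpha> (x + t *\<^sub>R axis i 1)) has_real_derivative Z (\<alpha>(i := Suc (\<alpha> i))) x) (at 0)"
    using s unfolding smooth_derivs_def by (rule conjunct2)
   from spec[OF spec[OF spec[OF this, of "%i. \<beta> i + \<alpha> i"], of i], of x] show ?thesis .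
  qed
 qed
 moreover have sub: "closure {x. Z (%i. 0 + \<alpha> i) x ~= 0} \<subseteq> mi_support Z"
 proof (rule closure_minimal)
  show "{x. Z (%i. 0 + \<alpha> i) x ~= 0} \<subseteq> mi_support Z"
  proof
   fix x assume "x \<in> {x. Z (%i. 0 + \<alpha> i) x ~= 0}"
   then show "x \<in> mi_support Z"
    using smooth_derivs_zero_outside[OF s, of x "%i. 0 + \<alpha> i"] by (simp only: mem_Collect_eq) metis
  qed
 qed simp
 moreover have "compact (closure {x. Z (%i. 0 + \<alpha> i) x ~= 0})"
 proof -
  have "bounded (mi_support Z)" using Z by (intro compact_imp_bounded) (simp only: test_derivs_def)
  then show ?thesis using sub by (metis bounded_subset closed_closure compact_eq_bounded_closed)
 qed
 ultimately show ?thesis using Z unfolding test_derivs_def by (intro conjI) auto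
qed

lemma test_derivs_continuous: "test_derivs D Z ==> continuous_on A (Z \<alpha>)"
 using continuous_on_subset[of UNIV "Z \<alpha>" A] by (simp add: test_derivs_def smooth_derivs_def)

lemma test_derivs_measurable:
 assumes "test_derivs D Z"
 shows "Z \<alpha> \<in> borel_measurable (lebesgue_on A)"
proof -
 have "Z \<alpha> \<in> borel_measurable borel"
  using test_derivs_continuous[OF assms] by (intro borel_measurable_continuous_onI)
 then have "Z \<alpha> \<in> borel_measurable lebesgue" by (simp add: measurable_completion)
 then show ?thesis by (rule measurable_restrict_space1)
qed

lemma test_derivs_bounded:
 assumes "test_derivs D Z"
 obtains C where "C \<ge> 0" "!!x. \<bar>Z \<alpha> x\<bar> <= C"
proof -
 have "compact (Z \<alpha> ` mi_support Z)"
  using assms by (intro compact_continuous_image test_derivs_continuous[OF assms]) (auto simp: test_derivs_def)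
 then obtain C where C: "!!y. y \<in> Z \<alpha> ` mi_support Z ==> norm y <= C"
  using compact_imp_bounded bounded_iff by metis
 have "\<bar>Z \<alpha> x\<bar> <= max C 0" for x
 proof (cases "x \<in> mi_support Z")
  case False
  then show ?thesis using smooth_derivs_zero_outside[of Z x \<alpha>] assms by (simp add: test_derivs_def)
 qed (use C in force)
 then show ?thesis using that[of "max C 0"] by auto
qed

lemma box_bump_test_derivs:
 assumes "cbox a b \<subseteq> D" "k > 0"
 shows "\<exists>Z. test_derivs D Z & Z (%_. 0) = box_bump k a b"
proof -
 obtain Z where Z: "smooth_derivs Z" "!!x. Z (%_. 0) x = box_bump k a b x"
  using smooth_derivs_box_bump[OF smooth_derivs_one, of k a b] by auto
 have "{x. Z (%_. 0) x ~= 0} \<subseteq> cbox a b"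
  using box_bump_pos_iff[OF \<open>k>0\<close>, of a b] box_bump_bounds(1)[of k a b] box_subset_cbox[of a b]
  by (force simp: Z less_le)
 then have s: "mi_support Z \<subseteq> cbox a b" by (intro closure_minimal) auto
 then have "compact (mi_support Z)" by (metis closed_closure compact_Int_closed compact_cbox inf.absorb_iff2)
 then show ?thesis using Z s assms by (intro exI[of _ Z]) (auto simp: test_derivs_def)
qed

subsection \<open>Weak derivatives\<close>

locale Sobolev_domain = Lp_space D p for D :: "(real^'d) set" and p :: real +
 assumes open_D: "open D" and bounded_D: "bounded D"
begin

abbreviation L where "L \<equiv> lebesgue_on D"

lemma test_mult_Lp: "u \<in> LP ==> test_derivs D Z ==> (%x. u x * Z \<alpha> x) \<in> LP"
 by (metis Lp_mult_bounded test_derivs_measurable test_derivs_bounded)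

lemma test_mult_integrable: "u \<in> LP ==> test_derivs D Z ==> integrable L (%x. u x * Z \<alpha> x)"
 by (intro Lp_integrable test_mult_Lp)

lemma continuous_measurable_lebesgue_on:
 fixes f :: "real^'d => real"
 assumes "continuous_on UNIV f"
 shows "f \<in> borel_measurable L"
proof -
 have "f \<in> borel_measurable borel" using assms by (rule borel_measurable_continuous_onI)
 then have "f \<in> borel_measurable lebesgue" by (simp add: measurable_completion)
 then show ?thesis by (rule measurable_restrict_space1)
qed

text \<open>Smooth bumps converge to indicators of boxes, so z has integral 0 over every box whose
  closed box lies in D. Boxes form an intersection-stable generator, so Dynkin's argument extends
  this to Borel subsets of B and completion to Lebesgue sets; a density with all integrals 0
  vanishes a.e.\<close>

lemma Lp_eq_0_on_boxI:
 assumes z: "z \<in> LP" and Z: "!!Z. test_derivs D Z ==> (\<integral>x. z x * Z (%_. 0) x \<partial>L) = 0"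
  and ab: "cbox a b \<subseteq> D"
 shows "AE x in lebesgue. x \<in> box a b --> z x = 0"
proof -
 have [measurable]: "z \<in> borel_measurable L" using z by (rule Lp_measurable)
 have box0: "(\<integral>x. z x * indicator (box c d) x \<partial>L) = 0" if "cbox c d \<subseteq> D" for c d
 proof -
  have "(%n. \<integral>x. z x * box_bump (real (Suc n)) c d x \<partial>L) \<longlonglongrightarrow> (\<integral>x. z x * indicator (box c d) x \<partial>L)"
  proof (rule integral_dominated_convergence[where w="%x. \<bar>z x\<bar>"])
   show "AE x in L. (%n. z x * box_bump (real (Suc n)) c d x) \<longlonglongrightarrow> z x * indicator (box c d) x"
    by (intro AE_I2 tendsto_mult tendsto_const box_bump_tendsto)
   show "AE x in L. norm (z x * box_bump (real (Suc n)) c d x) <= \<bar>z x\<bar>" for n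
    using box_bump_bounds[of "real (Suc n)" c d]
    by (intro AE_I2) (simp add: abs_mult mult_left_le)
   show "(%x. z x * box_bump (real (Suc n)) c d x) \<in> borel_measurable L" for n
    by (intro borel_measurable_times \<open>z \<in> borel_measurable L\<close> continuous_measurable_lebesgue_on continuous_on_box_bump)
   show "(%x. z x * indicator (box c d) x) \<in> borel_measurable L"
    by (intro borel_measurable_times \<open>z \<in> borel_measurable L\<close> measurable_restrict_space1
      borel_measurable_indicator) (simp add: sets_completionI_sets)
  qed (use Lp_integrable[OF z] in auto)
  moreover have "(\<integral>x. z x * box_bump (real (Suc n)) c d x \<partial>L) = 0" for n
   using box_bump_test_derivs[OF that, of "real (Suc n)"] Z by force
  ultimately show ?thesis by (simp add: LIMSEQ_const_iff)
 qed
 define B where "B = box a b"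
 have BD: "B \<subseteq> D" using ab box_subset_cbox by (auto simp: B_def)
 have zi: "set_integrable lebesgue B z"
 proof -
  have "integrable L z" by (rule Lp_integrable[OF z])
  then have "set_integrable lebesgue D z"
   using D_sets by (simp add: integrable_restrict_space set_integrable_def)
  then show ?thesis by (rule set_integrable_subset) (use BD in \<open>auto simp: B_def\<close>)
 qed
 have si: "set_integrable lebesgue A z" if "A \<in> sets lebesgue" "A \<subseteq> B" for A
  using set_integrable_subset[OF zi that] .
 \<comment> \<open>Cutting with B keeps every box inside \<open>cbox a b\<close>, hence compactly
   inside D, where the bumps are test functions. For this reason all set integrals below are taken
   over subsets of B.\<close>
 have boxi: "(LINT x:box c d \<inter> B|lebesgue. z x) = 0" for c d
 proof -
  have "\<exists>c' d'. box c d \<inter> B = box c' d'" unfolding B_def box_Int_box by (intro exI) (rule refl)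
  then obtain c' d' where cd: "box c d \<inter> B = box c' d'" by (elim exE)
  show ?thesis
  proof (cases "box c' d' = {}")
   case False
   then have "cbox c' d' = closure (box c' d')" by (simp add: closure_box)
   also have "\<dots> \<subseteq> closure (box a b)" using cd B_def by (metis closure_mono inf_le2)
   also have "\<dots> \<subseteq> cbox a b" by (intro closure_minimal box_subset_cbox closed_cbox)
   finally have "cbox c' d' \<subseteq> D" using ab by blast
   from box0[OF this] have "(\<integral>x. indicator D x *\<^sub>R (z x * indicator (box c' d') x) \<partial>lebesgue) = 0"
    using D_sets by (simp add: integral_restrict_space)
   moreover have "indicator D x *\<^sub>R (z x * indicator (box c' d') x) = indicator (box c' d') x *\<^sub>R z x" for x
    using BD cd by (auto simp: indicator_def)
   ultimately show ?thesis unfolding cd set_lebesgue_integral_def by (simp only:)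
  qed (simp add: cd set_lebesgue_integral_def)
 qed
 have B0: "(LINT x:B|lebesgue. z x) = 0" using boxi[of a b] by (simp add: B_def)
 have borel0: "(LINT x:A \<inter> B|lebesgue. z x) = 0" if "A \<in> sets borel" for A
 proof -
  have st: "Int_stable (range (%(a, b). box a b :: (real^'d) set))"
   by (auto simp: Int_stable_def box_Int_box)
  have gen: "range (%(a, b). box a b :: (real^'d) set) \<subseteq> Pow UNIV" by auto
  have "A \<in> sigma_sets UNIV (range (%(a, b). box a b :: (real^'d) set))"
   using that by (simp add: borel_eq_box)
  with st gen show ?thesis
  proof (induction rule: sigma_sets_induct_disjoint)
   case (basic A) then show ?case using boxi by auto
  next
   case empty then show ?case by (simp add: set_lebesgue_integral_def)
  next
   case (compl A)
   have A: "A \<in> sets borel" using compl(1) by (simp add: borel_eq_box)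
   have "(LINT x:(A \<inter> B) \<union> ((UNIV - A) \<inter> B)|lebesgue. z x) = (LINT x:A \<inter> B|lebesgue. z x) + (LINT x:(UNIV - A) \<inter> B|lebesgue. z x)"
    using A by (intro set_integral_Un si) (auto simp: B_def)
   moreover have "(A \<inter> B) \<union> ((UNIV - A) \<inter> B) = B" by auto
   ultimately show ?case using compl B0 by simp
  next
   case (union A)
   have A: "A i \<in> sets borel" for i using union(2) by (auto simp: borel_eq_box)
   have "(LINT x:(\<Union>i. A i \<inter> B)|lebesgue. z x) = (\<Sum>i. (LINT x:A i \<inter> B|lebesgue. z x))"
    using union(1) A by (intro lebesgue_integral_countable_add si) (auto simp: disjoint_family_on_def B_def)
   then show ?case using union by (simp add: Int_UN_distrib2)
  qed
 qed
 have leb0: "(LINT x:A|lebesgue. indicator B x * z x) = 0" if A: "A \<in> sets lebesgue" for A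
 proof -
  obtain S N N' where S: "A = S \<union> N" "N \<subseteq> N'" "N' \<in> null_sets lborel" "S \<in> sets lborel"
   using A by (rule sets_completionE)
  have N': "N' \<in> null_sets lebesgue" using S(3) unfolding null_sets_completion_iff2 by blast 
  have "(LINT x:A|lebesgue. indicator B x * z x) = (LINT x:S \<inter> B|lebesgue. z x)"
   unfolding set_lebesgue_integral_def
  proof (rule integral_cong_AE)
   have "set_integrable lebesgue (A \<inter> B) z" "set_integrable lebesgue (S \<inter> B) z"
    using A S(4) by (auto intro!: si simp: B_def)
   moreover have "(%x. indicator A x *\<^sub>R (indicator B x * z x)) = (%x. indicator (A \<inter> B) x *\<^sub>R z x)"
    by (auto simp: indicator_def fun_eq_iff)
   ultimately show "(%x. indicator A x *\<^sub>R (indicator B x * z x)) \<in> borel_measurable lebesgue"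
    "(%x. indicator (S \<inter> B) x *\<^sub>R z x) \<in> borel_measurable lebesgue"
    unfolding set_integrable_def by (simp_all only: borel_measurable_integrable)
   show "AE x in lebesgue. indicator A x *\<^sub>R (indicator B x * z x) = indicator (S \<inter> B) x *\<^sub>R z x"
    by (rule AE_I'[OF N']) (use S in \<open>auto simp: indicator_def\<close>)
  qed
  then show ?thesis using borel0[of S] S(4) by simp
 qed
 have "AE x in lebesgue. indicator B x * z x = 0"
  using zi leb0 by (intro density_unique_real) (auto simp: set_integrable_def set_lebesgue_integral_def)
 then show ?thesis by eventually_elim (auto simp: B_def)
qed

text \<open>Every point of D lies in a box whose closed box is contained in D. By Lindelof countably
  many of these boxes cover D, and countably many null sets are collected.\<close>

lemma fundamental_lemma:
 assumes z: "z \<in> LP" and Z: "!!Z. test_derivs D Z ==> (\<integral>x. z x * Z (%_. 0) x \<partial>L) = 0"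
 shows "AE x in L. z x = 0"
proof -
 have "\<exists>a b. x \<in> box a b & cbox a b \<subseteq> D" if "x \<in> D" for x
  using open_D that by (meson open_contains_cbox)
 then have "\<forall>x\<in>D. \<exists>ab. x \<in> box (fst ab) (snd ab) & cbox (fst ab) (snd ab) \<subseteq> D" by auto
 then obtain ab where ab: "!!x. x \<in> D ==> x \<in> box (fst (ab x)) (snd (ab x)) & cbox (fst (ab x)) (snd (ab x)) \<subseteq> D"
  by metis
 obtain F where F: "F \<subseteq> (%x. box (fst (ab x)) (snd (ab x))) ` D" "countable F" "\<Union>F = \<Union>((%x. box (fst (ab x)) (snd (ab x))) ` D)"
  using Lindelof[of "(%x. box (fst (ab x)) (snd (ab x))) ` D"] by auto
 have "AE x in lebesgue. \<forall>B\<in>F. x \<in> B --> z x = 0"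
 proof (subst AE_ball_countable[OF F(2)], rule ballI)
  fix B assume "B \<in> F"
  then obtain y where "y \<in> D" "B = box (fst (ab y)) (snd (ab y))" using F(1) by auto
  then show "AE x in lebesgue. x \<in> B --> z x = 0" using Lp_eq_0_on_boxI[OF z, of "fst (ab y)" "snd (ab y)"] Z ab by simp
 qed
 then have "AE x in lebesgue. x \<in> D --> z x = 0"
  by eventually_elim (use F(3) ab in blast)
 then show ?thesis using D_sets by (simp add: AE_restrict_space_iff)
qed

lemma has_weak_deriv_unique:
 assumes "v \<in> LP" "w \<in> LP" "has_weak_deriv D \<alpha> u v" "has_weak_deriv D \<alpha> u w"
 shows "AE x in L. v x = w x"
proof -
 have "(\<integral>x. (v x - w x) * Z (%_. 0) x \<partial>L) = 0" if Z: "test_derivs D Z" for Z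
 proof -
  have "(\<integral>x. v x * Z (%_. 0) x \<partial>L) = (\<integral>x. w x * Z (%_. 0) x \<partial>L)"
   using assms(3,4) Z by (simp add: has_weak_deriv_def)
  then show ?thesis
   using test_mult_integrable[OF assms(1) Z] test_mult_integrable[OF assms(2) Z] by (simp add: left_diff_distrib)
 qed
 then have "AE x in L. v x - w x = 0" by (intro fundamental_lemma Lp_diff assms)
 then show ?thesis by simp
qed

lemma has_weak_deriv_cong_AE:
 assumes u: "u \<in> LP" and ae: "AE x in L. u' x = u x"
 shows "has_weak_deriv D \<alpha> u' v \<longleftrightarrow> has_weak_deriv D \<alpha> u v"
proof -
 have "(\<integral>x. u' x * Z \<alpha> x \<partial>L) = (\<integral>x. u x * Z \<alpha> x \<partial>L)" if Z: "test_derivs D Z" for Z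
  using ae test_mult_Lp[OF u Z] test_mult_Lp[OF Lp_cong_AE[OF u ae] Z]
  by (intro integral_cong_AE Lp_measurable) auto
 then show ?thesis by (simp add: has_weak_deriv_def)
qed

lemma has_weak_deriv_scale: "has_weak_deriv D \<alpha> u v ==> has_weak_deriv D \<alpha> (%x. c * u x) (%x. c * v x)"
 by (simp add: has_weak_deriv_def mult.assoc)

lemma has_weak_deriv_add:
 assumes "u \<in> LP" "v \<in> LP" "has_weak_deriv D \<alpha> u v"
  and "u' \<in> LP" "v' \<in> LP" "has_weak_deriv D \<alpha> u' v'"
 shows "has_weak_deriv D \<alpha> (%x. u x + u' x) (%x. v x + v' x)"
 using assms test_mult_integrable by (simp add: has_weak_deriv_def distrib_right distrib_left)

lemma has_weak_deriv_sum:
 assumes "!!i. i \<in> S ==> u i \<in> LP" "!!i. i \<in> S ==> v i \<in> LP" "!!i. i \<in> S ==> has_weak_deriv D \<alpha> (u i) (v i)"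
 shows "has_weak_deriv D \<alpha> (%x. \<Sum>i\<in>S. u i x) (%x. \<Sum>i\<in>S. v i x)"
 using assms
proof (induction S rule: infinite_finite_induct)
 case (insert j S)
 have "has_weak_deriv D \<alpha> (%x. u j x + (\<Sum>i\<in>S. u i x)) (%x. v j x + (\<Sum>i\<in>S. v i x))"
  using insert.prems insert.IH by (intro has_weak_deriv_add Lp_sum) auto
 then show ?case using insert.hyps by simp
qed (simp_all add: has_weak_deriv_def)

lemma has_weak_deriv_0: "has_weak_deriv D (%_. 0) u u"
 by (simp add: has_weak_deriv_def mi_order_def)

text \<open>Inserting the test function \<partial>^\<beta> Z into the relation between u and v
  expresses the integral of v against \<partial>^\<beta> Z through u, and the second relation
  expresses it through w. The sign (-1)^|\<alpha>| cancels.\<close>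

lemma has_weak_deriv_factor:
 assumes "has_weak_deriv D \<alpha> u v" "has_weak_deriv D (%i. \<beta> i + \<alpha> i) u w"
 shows "has_weak_deriv D \<beta> v w"
 unfolding has_weak_deriv_def
proof (intro allI impI)
 fix Z assume Z: "test_derivs D Z"
 show "(\<integral>x. v x * Z \<beta> x \<partial>L) = (- 1) ^ mi_order \<beta> * (\<integral>x. w x * Z (%_. 0) x \<partial>L)"
 proof -
  have "(\<integral>x. u x * Z (%i. \<alpha> i + \<beta> i) x \<partial>L) = (- 1) ^ mi_order \<alpha> * (\<integral>x. v x * Z (%i. 0 + \<beta> i) x \<partial>L)"
   using assms(1) test_derivs_shift[OF Z, of \<beta>] unfolding has_weak_deriv_def by blast
  moreover have "(\<integral>x. u x * Z (%i. \<beta> i + \<alpha> i) x \<partial>L) = (- 1) ^ mi_order (%i. \<beta> i + \<alpha> i) * (\<integral>x. w x * Z (%i. 0) x \<partial>L)"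
   using assms(2) Z unfolding has_weak_deriv_def by blast
  ultimately have "(- 1) ^ mi_order \<alpha> * (\<integral>x. v x * Z \<beta> x \<partial>L) = (- 1) ^ mi_order \<alpha> * ((- 1) ^ mi_order \<beta> * (\<integral>x. w x * Z (%i. 0) x \<partial>L))"
   by (simp add: mi_order_add power_add add.commute mult_ac)
  then show ?thesis by simp
 qed
qed

lemma has_weak_deriv_compose:
 assumes "has_weak_deriv D \<alpha> u v" "has_weak_deriv D \<beta> v w"
 shows "has_weak_deriv D (%i. \<beta> i + \<alpha> i) u w"
 unfolding has_weak_deriv_def
proof (intro allI impI)
 fix Z assume Z: "test_derivs D Z"
 have "(\<integral>x. u x * Z (%i. \<alpha> i + \<beta> i) x \<partial>L) = (- 1) ^ mi_order \<alpha> * (\<integral>x. v x * Z (%i. 0 + \<beta> i) x \<partial>L)"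
  using assms(1) test_derivs_shift[OF Z, of \<beta>] unfolding has_weak_deriv_def by blast
 moreover have "(\<integral>x. v x * Z \<beta> x \<partial>L) = (- 1) ^ mi_order \<beta> * (\<integral>x. w x * Z (%i. 0) x \<partial>L)"
  using assms(2) Z unfolding has_weak_deriv_def by blast
 ultimately show "(\<integral>x. u x * Z (%i. \<beta> i + \<alpha> i) x \<partial>L) = (- 1) ^ mi_order (%i. \<beta> i + \<alpha> i) * (\<integral>x. w x * Z (%_. 0) x \<partial>L)"
  by (simp add: mi_order_add power_add add.commute)
qed

subsection \<open>Sobolev spaces\<close>

lemma weak_deriv_props:
 assumes "u \<in> sobolev D m p" "mi_order \<alpha> <= m"
 shows "weak_deriv D p \<alpha> u \<in> LP" "has_weak_deriv D \<alpha> u (weak_deriv D p \<alpha> u)"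
proof -
 have "\<exists>v. v \<in> LP & has_weak_deriv D \<alpha> u v" using assms by (auto simp: sobolev_def)
 from someI_ex[OF this] show "weak_deriv D p \<alpha> u \<in> LP" "has_weak_deriv D \<alpha> u (weak_deriv D p \<alpha> u)"
  by (simp_all add: weak_deriv_def)
qed

lemma weak_deriv_AE_eq:
 assumes "v \<in> LP" "has_weak_deriv D \<alpha> u v"
 shows "AE x in L. weak_deriv D p \<alpha> u x = v x"
proof -
 have "\<exists>v. v \<in> LP & has_weak_deriv D \<alpha> u v" using assms by auto
 from someI_ex[OF this] show ?thesis
  using assms by (intro has_weak_deriv_unique) (auto simp: weak_deriv_def)
qed

lemma sobolev_Lp: "u \<in> sobolev D m p ==> u \<in> LP"
 by (simp add: sobolev_def)

text \<open>The predicate from which \<open>weak_deriv\<close> chooses is the same for a.e. equal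
  functions, so the chosen derivatives are equal as functions and not merely a.e.\<close>

lemma sobolev_cong_AE:
 assumes u: "u \<in> LP" and ae: "AE x in L. u' x = u x"
 shows "u' \<in> sobolev D m p \<longleftrightarrow> u \<in> sobolev D m p" "weak_deriv D p \<alpha> u' = weak_deriv D p \<alpha> u"
  "sobolev_norm D m p u' = sobolev_norm D m p u"
proof -
 show "weak_deriv D p \<alpha> u' = weak_deriv D p \<alpha> u" for \<alpha>
  unfolding weak_deriv_def using has_weak_deriv_cong_AE[OF assms] by simp
 then show "sobolev_norm D m p u' = sobolev_norm D m p u" by (simp add: sobolev_norm_def)
 show "u' \<in> sobolev D m p \<longleftrightarrow> u \<in> sobolev D m p"
  unfolding sobolev_def using has_weak_deriv_cong_AE[OF assms] u Lp_cong_AE[OF assms] by simp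
qed

lemma weak_deriv_0:
 assumes "u \<in> LP"
 shows "AE x in L. weak_deriv D p (%_. 0) u x = u x"
 using weak_deriv_AE_eq[OF assms has_weak_deriv_0] .

lemma weak_deriv_Suc:
 assumes u: "u \<in> sobolev D m p" and a: "Suc (mi_order \<alpha>) <= m"
 shows "has_weak_deriv D ((%_. 0)(i := 1)) (weak_deriv D p \<alpha> u) (weak_deriv D p (\<alpha>(i := Suc (\<alpha> i))) u)"
proof -
 have e: "(%j. ((%_. 0)(i := 1)) j + \<alpha> j) = \<alpha>(i := Suc (\<alpha> i))" by auto
 have 1: "has_weak_deriv D \<alpha> u (weak_deriv D p \<alpha> u)" using weak_deriv_props(2)[OF u, of \<alpha>] a by simp
 have 2: "has_weak_deriv D (\<alpha>(i := Suc (\<alpha> i))) u (weak_deriv D p (\<alpha>(i := Suc (\<alpha> i))) u)"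
  using a by (intro weak_deriv_props(2)[OF u]) (simp only: mi_order_Suc)
 show ?thesis by (rule has_weak_deriv_factor[OF 1]) (subst e, rule 2)
qed

text \<open>Chosen derivatives are linear only up to null sets, so identities between them hold a.e.
  and reach the norms through \<open>Lp_norm_cong_AE\<close>.\<close>

lemma sobolev_linear_combination:
 assumes u: "!!i. i \<in> S ==> u i \<in> sobolev D m p"
 shows "(%x. \<Sum>i\<in>S. c i * u i x) \<in> sobolev D m p"
  and "mi_order \<alpha> <= m ==>
   AE x in L. weak_deriv D p \<alpha> (%x. \<Sum>i\<in>S. c i * u i x) x = (\<Sum>i\<in>S. c i * weak_deriv D p \<alpha> (u i) x)"
proof -
 have h: "(%x. \<Sum>i\<in>S. c i * weak_deriv D p \<alpha> (u i) x) \<in> LP \<and>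
   has_weak_deriv D \<alpha> (%x. \<Sum>i\<in>S. c i * u i x) (%x. \<Sum>i\<in>S. c i * weak_deriv D p \<alpha> (u i) x)"
  if "mi_order \<alpha> <= m" for \<alpha>
  using weak_deriv_props[OF u that] sobolev_Lp[OF u]
  by (intro conjI Lp_sum Lp_scale has_weak_deriv_sum has_weak_deriv_scale)
 show "(%x. \<Sum>i\<in>S. c i * u i x) \<in> sobolev D m p"
  unfolding sobolev_def using h sobolev_Lp[OF u] by (auto intro!: Lp_sum Lp_scale)
 show "AE x in L. weak_deriv D p \<alpha> (%x. \<Sum>i\<in>S. c i * u i x) x = (\<Sum>i\<in>S. c i * weak_deriv D p \<alpha> (u i) x)"
  if "mi_order \<alpha> <= m"
  using h[OF that] by (intro weak_deriv_AE_eq) auto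
qed

lemma sobolev_norm_eq: "sobolev_norm D m p u = (\<Sum>\<alpha>\<in>{\<alpha>. mi_order \<alpha> <= m}. nrm (weak_deriv D p \<alpha> u) powr p) powr (1 / p)"
 by (simp add: sobolev_norm_def Lp_norm_powr)

lemma sobolev_norm_nonneg [simp]: "0 <= sobolev_norm D m p u"
 by (simp add: sobolev_norm_def)

lemma Lp_norm_weak_deriv_le:
 assumes "mi_order \<alpha> <= m"
 shows "nrm (weak_deriv D p \<alpha> u) <= sobolev_norm D m p u"
proof -
 have "nrm (weak_deriv D p \<alpha> u) powr p <= (\<Sum>\<alpha>\<in>{\<alpha>. mi_order \<alpha> <= m}. nrm (weak_deriv D p \<alpha> u) powr p)"
  using assms finite_mi_order_le by (intro member_le_sum) auto
 then have "(nrm (weak_deriv D p \<alpha> u) powr p) powr (1/p) <= sobolev_norm D m p u"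
  unfolding sobolev_norm_eq using p_pos by (intro powr_mono2) auto
 then show ?thesis using p_pos by (simp add: powr_powr)
qed

text \<open>With N multi-indices the l^p sum of terms of size b is at most N^(1/p) b, and N >= 1
  together with p >= 1 bounds the power by N itself.\<close>

lemma sobolev_norm_le:
 assumes "!!\<alpha>. mi_order \<alpha> <= m ==> nrm (weak_deriv D p \<alpha> u) <= b" and "0 <= b"
 shows "sobolev_norm D m p u <= real (card {\<alpha> :: 'd => nat. mi_order \<alpha> <= m}) * b"
proof -
 let ?A = "{\<alpha> :: 'd => nat. mi_order \<alpha> <= m}"
 have c: "1 <= real (card ?A)"
 proof -
  have "(%_. 0) \<in> ?A" by (simp add: mi_order_def)
  then have "card ?A > 0" using finite_mi_order_le card_gt_0_iff by blast
  then show ?thesis by simp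
 qed
 have "(\<Sum>\<alpha>\<in>?A. nrm (weak_deriv D p \<alpha> u) powr p) <= (\<Sum>\<alpha>\<in>?A. b powr p)"
  using assms p_pos by (intro sum_mono powr_mono2) auto
 then have "sobolev_norm D m p u <= (real (card ?A) * b powr p) powr (1/p)"
  unfolding sobolev_norm_eq using p_pos by (intro powr_mono2) (auto intro: sum_nonneg)
 also have "\<dots> = real (card ?A) powr (1/p) * b" using p_pos assms by (simp add: powr_mult powr_powr)
 also have "\<dots> <= real (card ?A) powr 1 * b"
  using c p1 assms by (intro mult_right_mono powr_mono) auto
 finally show ?thesis using c by simp
qed

end

subsection \<open>Mixed differences\<close>

text \<open>The product of the unnormalised differences with steps h_l, l in A, expanded into an
  alternating sum over the vertices of a parallelepiped. In this form it is visibly symmetric in the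
  variables and linear in f.\<close>

definition mdiff :: "nat set => (nat => 'a::ab_group_add) => ((nat => 'a) => 'x => real) => (nat => 'a) => 'x => real" where
 "mdiff A h f y x = (\<Sum>S\<in>Pow A. (-1) ^ card (A - S) * f (%l. if l \<in> S then y l + h l else y l) x)"

lemma mdiff_empty [simp]: "mdiff {} h f y x = f y x"
 by (simp add: mdiff_def)

text \<open>Split the subsets of \<open>insert l A\<close> by whether they contain l; the sign
  changes when they do not. The difference in direction l can thus be taken outermost.\<close>

lemma mdiff_insert:
 assumes A: "finite A" "l \<notin> A"
 shows "mdiff (insert l A) h f y x = mdiff A h f (y(l := y l + h l)) x - mdiff A h f y x"
proof -
 have inj: "inj_on (insert l) (Pow A)" using A by (auto simp: inj_on_def)
 have 1: "(-1) ^ card (insert l A - S) * f (%i. if i \<in> S then y i + h i else y i) x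
   = - ((-1) ^ card (A - S) * f (%i. if i \<in> S then y i + h i else y i) x)" if "S \<in> Pow A" for S
 proof -
  have "insert l A - S = insert l (A - S)" using that A by auto
  then show ?thesis using A by (simp add: card_insert_if)
 qed
 have 2: "(-1) ^ card (insert l A - insert l S) * f (%i. if i \<in> insert l S then y i + h i else y i) x
   = (-1) ^ card (A - S) * f (%i. if i \<in> S then (y(l := y l + h l)) i + h i else (y(l := y l + h l)) i) x"
  if "S \<in> Pow A" for S
 proof -
  have "insert l A - insert l S = A - S" using A that by auto
  moreover have "(%i. if i \<in> insert l S then y i + h i else y i)
    = (%i. if i \<in> S then (y(l := y l + h l)) i + h i else (y(l := y l + h l)) i)"
   using A that by (auto simp: fun_eq_iff)
  ultimately show ?thesis by (simp only:)
 qed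
 have "mdiff (insert l A) h f y x =
   (\<Sum>S\<in>Pow A. (-1) ^ card (insert l A - S) * f (%i. if i \<in> S then y i + h i else y i) x)
  + (\<Sum>S\<in>Pow A. (-1) ^ card (insert l A - insert l S) * f (%i. if i \<in> insert l S then y i + h i else y i) x)"
  unfolding mdiff_def Pow_insert
  by (subst sum.union_disjoint) (use A in \<open>auto simp: sum.reindex[OF inj] simp del: insert_iff\<close>)
 also have "\<dots> = (\<Sum>S\<in>Pow A. - ((-1) ^ card (A - S) * f (%i. if i \<in> S then y i + h i else y i) x))
  + (\<Sum>S\<in>Pow A. (-1) ^ card (A - S) * f (%i. if i \<in> S then (y(l := y l + h l)) i + h i else (y(l := y l + h l)) i) x)"
  using 1 2 by (intro arg_cong2[where f="(+)"] sum.cong refl)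
 finally show ?thesis by (simp add: mdiff_def sum_negf)
qed

lemma mdiff_cong:
 assumes "!!l. l \<in> A ==> h l = h' l"
 shows "mdiff A h f y x = mdiff A h' f y x"
 unfolding mdiff_def
proof (rule sum.cong[OF refl])
 fix S assume "S \<in> Pow A"
 then have "(%l. if l \<in> S then y l + h l else y l) = (%l. if l \<in> S then y l + h' l else y l)"
  using assms by (auto simp: fun_eq_iff)
 then show "(-1) ^ card (A - S) * f (%l. if l \<in> S then y l + h l else y l) x
   = (-1) ^ card (A - S) * f (%l. if l \<in> S then y l + h' l else y l) x" by simp
qed

lemma mdiff_fun_upd:
 assumes "l \<notin> A"
 shows "mdiff A h (%y. f (y(l := q))) y x = mdiff A h f (y(l := q)) x"
 unfolding mdiff_def
proof (rule sum.cong[OF refl])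
 fix S assume "S \<in> Pow A"
 then have "(%i. if i \<in> S then y i + h i else y i)(l := q) = (%i. if i \<in> S then (y(l := q)) i + h i else (y(l := q)) i)"
  using assms by (auto simp: fun_eq_iff)
 then show "(-1) ^ card (A - S) * f ((%l. if l \<in> S then y l + h l else y l)(l := q)) x
   = (-1) ^ card (A - S) * f (%i. if i \<in> S then (y(l := q)) i + h i else (y(l := q)) i) x" by simp
qed

lemma mdiff_sub: "mdiff A h (%y x. f y x - g y x) y x = mdiff A h f y x - mdiff A h g y x"
 by (simp add: mdiff_def right_diff_distrib sum_subtractf)

lemma mdiff_point_mem:
 assumes "y \<in> I \<rightarrow>\<^sub>E C" "!!l. l \<in> A ==> y l + h l \<in> C" "A \<subseteq> I" "S \<subseteq> A"
 shows "(%l. if l \<in> S then y l + h l else y l) \<in> I \<rightarrow>\<^sub>E C"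
 using assms by (auto simp: PiE_iff extensional_def)

text \<open>Passes from the ordered composition of normalised quotients to the symmetric sum, after
  which the order of the variables is gone.\<close>

lemma mix_diff_quot_eq_mdiff:
 assumes "finite I"
 shows "mix_diff_quot \<gamma> I h f y x = (\<Prod>l\<in>active I h. norm (h l) powr (- \<gamma>)) * mdiff (active I h) h f y x"
proof -
 have "foldr (%l. diff_quot \<gamma> l (h l)) ls f y x = (\<Prod>l\<in>set ls. norm (h l) powr (- \<gamma>)) * mdiff (set ls) h f y x"
  if "distinct ls" for ls y
  using that
 proof (induction ls arbitrary: y)
  case (Cons l ls)
  then show ?case
   by (simp add: diff_quot_def mdiff_insert right_diff_distrib mult.assoc)
 qed simp
 moreover have "finite (active I h)" using assms by (simp add: active_def)
 ultimately show ?thesis by (simp add: mix_diff_quot_def)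
qed

subsection \<open>Nets and partitions of unity\<close>

lemma tendsto_fun_iff:
 fixes f :: "'b => 'i => 'a::topological_space"
 shows "(f \<longlongrightarrow> l) F \<longleftrightarrow> (\<forall>i. ((%x. f x i) \<longlongrightarrow> l i) F)"
proof -
 have "limitin euclidean f l F \<longleftrightarrow> (\<forall>i. limitin euclidean (%x. f x i) (l i) F)"
  unfolding euclidean_product_topology[symmetric] by (subst limitin_componentwise) auto
 then show ?thesis by (simp add: limitin_canonical_iff)
qed

text \<open>One point of D is picked from each grid cell that meets D. The nets therefore lie in D
  itself, and their size is at most the number of cells of a bounding cube.\<close>

lemma finite_nets:
 fixes D :: "(real^'d) set"
 assumes "bounded D"
 obtains G :: "nat => (real^'d) set" and C :: real where "!!i. finite (G i)" "!!i. G i \<subseteq> D" "0 <= C"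
  "!!i. real (card (G i)) <= C * 2 ^ (i * CARD('d))"
  "!!i y. y \<in> closure D ==> \<exists>q\<in>G i. dist y q < 1 / 2 ^ i"
proof -
 obtain R0 where R0: "!!x. x \<in> D ==> norm x <= R0" using assms by (auto simp: bounded_iff)
 define R where "R = nat \<lceil>R0\<rceil>"
 have R: "\<bar>x $ j\<bar> <= real R" if "x \<in> D" for x j
  using R0[OF that] component_le_norm_cart[of x j] unfolding R_def by linarith
 \<comment> \<open>Cells of side 1 / (2 d 2^i) have l^1 diameter at most 1 / (2 * 2^i). The other
   half of the mesh 1 / 2^i is spent on moving a point of the closure into D.\<close>
 define K where "K = 2 * CARD('d)"
 define s where "s i = real (K * 2 ^ i)" for i :: nat
 have s: "s i > 0" for i by (simp add: s_def K_def)
 define cell where "cell i y = (%j. \<lfloor>(y $ j) * s i\<rfloor>)" for i and y :: "real^'d"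
 define B where "B i = int (R * K * 2 ^ i)" for i :: nat
 have cell: "cell i y \<in> PiE UNIV (%_. {- B i..B i})" if "y \<in> D" for i y
 proof -
  have "\<bar>y $ j * s i\<bar> <= real R * s i" for j
   using R[OF that, of j] s[of i] by (simp add: abs_mult mult_right_mono)
  moreover have "real R * s i = of_int (B i)" by (simp add: s_def B_def mult_ac)
  ultimately have "\<bar>y $ j * s i\<bar> <= of_int (B i)" for j by simp
  then have "- B i <= \<lfloor>y $ j * s i\<rfloor>" "\<lfloor>y $ j * s i\<rfloor> <= B i" for j
   by (simp_all add: abs_le_iff le_floor_iff floor_le_iff) (smt (verit))+
  then show ?thesis by (auto simp: cell_def)
 qed
 define pick where "pick i c = (SOME y. y \<in> D & cell i y = c)" for i c
 define G where "G i = pick i ` cell i ` D" for i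
 have fin: "finite (cell i ` D)" for i
  by (rule finite_subset[of _ "PiE UNIV (%_. {- B i..B i})"]) (use cell in \<open>auto intro: finite_PiE\<close>)
 have pick: "pick i (cell i y) \<in> D" "cell i (pick i (cell i y)) = cell i y" if "y \<in> D" for i y
  using someI[of "%z. z \<in> D & cell i z = cell i y" y] that by (auto simp: pick_def)
 have near: "dist y (pick i (cell i y)) <= 1 / (2 * 2 ^ i)" if "y \<in> D" for i y
 proof -
  define q where "q = pick i (cell i y)"
  have "\<bar>(y - q) $ j\<bar> <= 1 / s i" for j
  proof -
   have "\<lfloor>y $ j * s i\<rfloor> = \<lfloor>q $ j * s i\<rfloor>" using pick(2)[OF that, of i] by (auto simp: cell_def q_def fun_eq_iff)
   then have "\<bar>y $ j * s i - q $ j * s i\<bar> <= 1" by linarith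
   then have "\<bar>(y - q) $ j\<bar> * s i <= 1" using s[of i] by (simp add: left_diff_distrib[symmetric] abs_mult)
   then show ?thesis using s[of i] by (simp add: field_simps)
  qed
  then have "norm (y - q) <= (\<Sum>j\<in>(UNIV :: 'd set). 1 / s i)"
   by (intro order.trans[OF norm_le_l1_cart] sum_mono)
  also have "\<dots> = 1 / (2 * 2 ^ i)" by (simp add: s_def K_def)
  finally show ?thesis by (simp add: dist_norm q_def)
 qed
 show ?thesis
 proof (rule that[of G "(2 * real R * real K + 1) ^ CARD('d)"])
  show "finite (G i)" for i using fin by (simp add: G_def)
  show "G i \<subseteq> D" for i using pick by (auto simp: G_def)
  show "0 <= (2 * real R * real K + 1) ^ CARD('d)" by simp
  show "real (card (G i)) <= (2 * real R * real K + 1) ^ CARD('d) * 2 ^ (i * CARD('d))" for i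
  proof -
   have "card (G i) <= card (cell i ` D)" unfolding G_def using fin by (rule card_image_le)
   also have "\<dots> <= card (PiE (UNIV :: 'd set) (%_. {- B i..B i}))"
    by (rule card_mono) (use cell in \<open>auto intro: finite_PiE\<close>)
   also have "\<dots> = nat (2 * B i + 1) ^ CARD('d)" by (simp add: card_PiE)
   finally have "real (card (G i)) <= real (nat (2 * B i + 1) ^ CARD('d))" by (simp only: of_nat_le_iff)
   also have "\<dots> = (2 * real R * real K * 2 ^ i + 1) ^ CARD('d)" by (simp add: B_def mult_ac)
   also have "\<dots> <= ((2 * real R * real K + 1) * 2 ^ i) ^ CARD('d)"
    by (intro power_mono) (auto simp: distrib_right)
   also have "\<dots> = (2 * real R * real K + 1) ^ CARD('d) * 2 ^ (i * CARD('d))"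
    by (simp add: power_mult_distrib power_mult)
   finally show ?thesis .
  qed
  show "\<exists>q\<in>G i. dist y q < 1 / 2 ^ i" if "y \<in> closure D" for i y
  proof -
   obtain y' where y': "y' \<in> D" "dist y' y < 1 / (2 * 2 ^ i)"
    using closure_approachableD[of y D "1 / (2 * 2 ^ i)"] \<open>y \<in> closure D\<close> by (auto simp: dist_commute)
   then have "dist y (pick i (cell i y')) < 1 / (2 * 2 ^ i) + 1 / (2 * 2 ^ i)"
    using near[OF y'(1), of i] dist_triangle[of y "pick i (cell i y')" y'] by (simp add: dist_commute)
   then show ?thesis using y'(1) by (auto simp: G_def intro!: bexI)
  qed
 qed
qed

text \<open>Tents of radius 2 r around the net points, divided by their sum. The net property with
  radius r keeps this sum positive on S.\<close>

lemma partition_of_unity_net: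
 fixes G :: "'a::metric_space set"
 assumes G: "finite G" and net: "!!y. y \<in> S ==> \<exists>q\<in>G. dist y q < r"
 obtains \<omega> :: "'a => 'a => real" where "!!q. continuous_on S (\<omega> q)" "!!q y. 0 <= \<omega> q y"
  "!!y. y \<in> S ==> (\<Sum>q\<in>G. \<omega> q y) = 1" "!!q y. \<omega> q y ~= 0 ==> dist y q < 2 * r"
proof -
 define \<theta> where "\<theta> q y = max 0 (2 * r - dist y q)" for q y :: 'a
 have pos: "(\<Sum>q\<in>G. \<theta> q y) > 0" if y: "y \<in> S" for y
 proof -
  obtain q where q: "q \<in> G" "dist y q < r" using net[OF y] by blast
  have r: "r > 0" using q(2) zero_le_dist[of y q] by linarith
  then show ?thesis using G q by (intro sum_pos2[of G q]) (auto simp: \<theta>_def)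
 qed
 show ?thesis
 proof (rule that[of "%q y. \<theta> q y / (\<Sum>q\<in>G. \<theta> q y)"])
  show "continuous_on S (%y. \<theta> q y / (\<Sum>q\<in>G. \<theta> q y))" for q
  proof (intro continuous_on_divide)
   show "continuous_on S (\<theta> q)" for q unfolding \<theta>_def by (intro continuous_intros)
   then show "continuous_on S (%y. \<Sum>q\<in>G. \<theta> q y)" by (intro continuous_on_sum)
   show "\<forall>y\<in>S. (\<Sum>q\<in>G. \<theta> q y) ~= 0" using pos by force
  qed
  show "0 <= \<theta> q y / (\<Sum>q\<in>G. \<theta> q y)" for q y
   by (intro divide_nonneg_nonneg sum_nonneg) (auto simp: \<theta>_def)
  show "(\<Sum>q\<in>G. \<theta> q y / (\<Sum>q\<in>G. \<theta> q y)) = 1" if "y \<in> S" for y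
   using pos[OF that] by (simp add: sum_divide_distrib[symmetric])
  show "dist y q < 2 * r" if "\<theta> q y / (\<Sum>q\<in>G. \<theta> q y) ~= 0" for q y
   using that by (auto simp: \<theta>_def max_def split: if_splits)
 qed
qed

text \<open>The deterministic half of the chaining, used for one fixed x: increments dominated by a
  geometric series make the sequence converge uniformly by the Weierstrass test, which gives
  continuity and the bound of the limit.\<close>

lemma geometric_chain_limit:
 fixes P :: "nat => 'y::topological_space => real"
 assumes cont: "!!n. continuous_on S (P n)"
  and step: "!!n y. y \<in> S ==> \<bar>P (Suc n) y - P n y\<bar> <= c * \<sigma> ^ n"
  and init: "!!y. y \<in> S ==> \<bar>P 0 y\<bar> <= t" and \<sigma>: "0 <= \<sigma>" "\<sigma> < 1"
 shows "continuous_on S (%y. lim (%n. P n y))"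
  and "!!y. y \<in> S ==> (%n. P n y) \<longlonglongrightarrow> lim (%n. P n y)"
  and "!!y. y \<in> S ==> \<bar>lim (%n. P n y)\<bar> <= t + c / (1 - \<sigma>)"
proof -
 have geo: "(%n. c * \<sigma> ^ n) sums (c * (1 / (1 - \<sigma>)))"
  using geometric_sums[of \<sigma>] \<sigma> by (intro sums_mult) auto
 have gs: "summable (%n. c * \<sigma> ^ n)" using geo by (rule sums_summable)
 have P: "P 0 y + (\<Sum>i<n. (P (Suc i) y - P i y)) = P n y" for n y
  by (induction n) auto
 have "uniform_limit S (%n y. \<Sum>i<n. (P (Suc i) y - P i y)) (%y. \<Sum>i. (P (Suc i) y - P i y)) sequentially"
  by (rule Weierstrass_m_test[OF _ gs]) (simp add: step)
 then have "uniform_limit S (%n y. P 0 y + (\<Sum>i<n. (P (Suc i) y - P i y))) (%y. P 0 y + (\<Sum>i. (P (Suc i) y - P i y))) sequentially"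
  by (intro uniform_limit_add uniform_limit_const)
 then have u: "uniform_limit S P (%y. P 0 y + (\<Sum>i. (P (Suc i) y - P i y))) sequentially"
  by (simp add: P)
 have l: "(%n. P n y) \<longlonglongrightarrow> P 0 y + (\<Sum>i. (P (Suc i) y - P i y))" if "y \<in> S" for y
  by (rule tendsto_uniform_limitI[OF u that])
 then have le: "lim (%n. P n y) = P 0 y + (\<Sum>i. (P (Suc i) y - P i y))" if "y \<in> S" for y
  using that by (intro limI) auto
 show "(%n. P n y) \<longlonglongrightarrow> lim (%n. P n y)" if "y \<in> S" for y
  using l[OF that] le[OF that] by simp
 have "continuous_on S (%y. P 0 y + (\<Sum>i. (P (Suc i) y - P i y)))"
  by (rule uniform_limit_theorem[OF always_eventually u]) (simp_all add: cont)
 then show "continuous_on S (%y. lim (%n. P n y))"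
  by (rule continuous_on_eq) (simp add: le)
 show "\<bar>lim (%n. P n y)\<bar> <= t + c / (1 - \<sigma>)" if y: "y \<in> S" for y
 proof -
  have sm: "summable (%i. \<bar>P (Suc i) y - P i y\<bar>)"
   by (rule summable_comparison_test'[OF gs, of 0]) (simp add: step[OF y])
  have "\<bar>\<Sum>i. (P (Suc i) y - P i y)\<bar> <= (\<Sum>i. \<bar>P (Suc i) y - P i y\<bar>)"
   by (rule summable_rabs[OF sm])
  also have "\<dots> <= (\<Sum>i. c * \<sigma> ^ i)"
   by (rule suminf_le[OF step[OF y] sm gs])
  also have "\<dots> = c / (1 - \<sigma>)" using sums_unique[OF geo] by simp
  finally show ?thesis using init[OF y] le[OF y] by linarith
 qed
qed

subsection \<open>Continuous representatives\<close>

context Sobolev_domain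
begin

abbreviation pts :: "nat set => (nat => real^'d) set" where
 "pts I \<equiv> I \<rightarrow>\<^sub>E closure D"

text \<open>The empty set A gives the bound of the norm, one-element sets the ordinary Hoelder
  bound. Larger sets serve the induction over the variables: a difference in one variable has to be
  Hoelder in the others, with the constant scaled by the step.\<close>

definition mixed_holder :: "nat set => real => real => ((nat => real^'d) => real^'d => real) => bool" where
 "mixed_holder I \<gamma> B f \<longleftrightarrow>
   (\<forall>A\<subseteq>I. \<forall>y\<in>pts I. \<forall>h. (\<forall>l\<in>A. y l + h l \<in> closure D) -->
    nrm (mdiff A h f y) <= B * (\<Prod>l\<in>A. norm (h l) powr \<gamma>))"

definition Lp_continuous :: "nat set => ((nat => real^'d) => real^'d => real) => bool" where
 "Lp_continuous I f \<longleftrightarrow>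
   (\<forall>y\<in>pts I. f y \<in> LP & (\<forall>\<epsilon>>0. \<exists>\<delta>>0. \<forall>z\<in>pts I. (\<forall>l\<in>I. dist (z l) (y l) < \<delta>) -->
    nrm (%x. f z x - f y x) < \<epsilon>))"

text \<open>The notion \<open>continuous_representative\<close> for an arbitrary index set, so that
  variables can be added one at a time and split into two groups.\<close>

definition cont_rep :: "nat set => ((nat => real^'d) => real^'d => real) => ((nat => real^'d) => real^'d => real) => bool" where
 "cont_rep I f \<psi> \<longleftrightarrow>
   (\<forall>y\<in>pts I. AE x in L. \<psi> y x = f y x) & (AE x in L. continuous_on (pts I) (%y. \<psi> y x))"

lemma Lp_continuousD: "Lp_continuous I f ==> y \<in> pts I ==> f y \<in> LP"
 by (simp add: Lp_continuous_def)

lemma mixed_holder_mdiff_Lp: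
 assumes "Lp_continuous I f" "A \<subseteq> I" "y \<in> pts I" "!!l. l \<in> A ==> y l + h l \<in> closure D"
 shows "mdiff A h f y \<in> LP"
proof -
 have "(%x. \<Sum>S\<in>Pow A. (-1) ^ card (A - S) * f (%l. if l \<in> S then y l + h l else y l) x) \<in> LP"
  using assms by (intro Lp_sum Lp_scale Lp_continuousD[OF assms(1)] mdiff_point_mem) auto
 then show ?thesis by (simp add: mdiff_def[abs_def])
qed

lemma dense_net_points:
 assumes I: "finite I" and net: "!!i y. y \<in> closure D ==> \<exists>q\<in>G i. dist y q < 1 / 2 ^ i"
  and y: "y \<in> pts I"
 obtains z where "!!n. z n \<in> I \<rightarrow>\<^sub>E (\<Union>i. G i)" "z \<longlonglongrightarrow> y"
proof -
 have "\<forall>n l. \<exists>q. l \<in> I --> q \<in> G n & dist (y l) q < 1 / 2 ^ n"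
  using net y by (metis PiE_mem)
 then obtain q where q: "!!n l. l \<in> I ==> q n l \<in> G n & dist (y l) (q n l) < 1 / 2 ^ n" by metis
 define z where "z n = (%l. if l \<in> I then q n l else undefined)" for n
 show ?thesis
 proof (rule that)
  show "z n \<in> I \<rightarrow>\<^sub>E (\<Union>i. G i)" for n using q by (auto simp: z_def PiE_iff extensional_def)
  show "z \<longlonglongrightarrow> y"
   unfolding tendsto_fun_iff
  proof
   fix l
   show "(%n. z n l) \<longlonglongrightarrow> y l"
   proof (cases "l \<in> I")
    case True
    show ?thesis
    proof (rule metric_LIMSEQ_I)
     fix r :: real assume "r > 0"
     then obtain N where N: "(1/2) ^ N < r" using real_arch_pow_inv[of r "1/2"] by auto
     have "dist (z n l) (y l) < r" if "n \<ge> N" for n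
     proof -
      have "(1/2::real) ^ n <= (1/2) ^ N" using that by (intro power_decreasing) auto
      then show ?thesis using q[OF True, of n] N True by (simp add: z_def dist_commute power_one_over)
     qed
     then show "\<exists>N. \<forall>n\<ge>N. dist (z n l) (y l) < r" by blast
    qed
   next
    case False
    then show ?thesis using y by (simp add: z_def PiE_iff extensional_def)
   qed
  qed
 qed
qed

text \<open>At the countably many points with coordinates in the nets both representatives agree off
  a single null set. These points are dense, so continuity in y extends the equality to all y for
  the same x.\<close>

lemma cont_rep_AE_unique:
 assumes I: "finite I" and r: "cont_rep I f \<psi>" "cont_rep I f' \<psi>'"
  and eq: "!!y. y \<in> pts I ==> AE x in L. f y x = f' y x"
 shows "AE x in L. \<forall>y\<in>pts I. \<psi> y x = \<psi>' y x"
proof -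
 obtain G where G: "!!i. finite (G i)" "!!i. G i \<subseteq> D" "!!i y. y \<in> closure D ==> \<exists>q\<in>G i. dist y q < 1 / 2 ^ i"
  using finite_nets[OF bounded_D] by metis
 define T where "T = I \<rightarrow>\<^sub>E (\<Union>i. G i)"
 have "countable T" unfolding T_def
  by (intro countable_PiE I countable_UN) (auto intro: countable_finite G)
 have TS: "T \<subseteq> pts I" unfolding T_def
 proof (rule PiE_mono)
  show "(\<Union>i. G i) \<subseteq> closure D" using G(2) closure_subset[of D] by (meson UN_least order_trans)
 qed
 have "AE x in L. \<forall>y\<in>T. \<psi> y x = \<psi>' y x"
 proof (subst AE_ball_countable[OF \<open>countable T\<close>], rule ballI)
  fix y assume "y \<in> T"
  then have y: "y \<in> pts I" using TS by blast
  have "AE x in L. \<psi> y x = f y x" "AE x in L. \<psi>' y x = f' y x"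
   using r y by (auto simp: cont_rep_def)
  with eq[OF y] show "AE x in L. \<psi> y x = \<psi>' y x" by eventually_elim simp
 qed
 moreover have "AE x in L. continuous_on (pts I) (%y. \<psi> y x)" "AE x in L. continuous_on (pts I) (%y. \<psi>' y x)"
  using r by (auto simp: cont_rep_def)
 ultimately show ?thesis
 proof eventually_elim
  case (elim x)
  show ?case
  proof
   fix y assume y: "y \<in> pts I"
   obtain z where z: "!!n. z n \<in> T" "z \<longlonglongrightarrow> y"
    using dense_net_points[OF I G(3) y] unfolding T_def by metis
   have "(%n. \<psi> (z n) x) \<longlonglongrightarrow> \<psi> y x"
    by (rule continuous_on_tendsto_compose[OF elim(2) z(2) y]) (use z(1) TS in \<open>auto intro!: always_eventually\<close>)
   moreover have "(%n. \<psi>' (z n) x) \<longlonglongrightarrow> \<psi>' y x"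
    by (rule continuous_on_tendsto_compose[OF elim(3) z(2) y]) (use z(1) TS in \<open>auto intro!: always_eventually\<close>)
   moreover have "(%n. \<psi>' (z n) x) = (%n. \<psi> (z n) x)" using elim(1) z(1) by auto
   ultimately show "\<psi> y x = \<psi>' y x" by (simp add: LIMSEQ_unique)
  qed
 qed
qed

lemma cont_rep_diff:
 assumes "cont_rep I f \<psi>" "cont_rep I f' \<psi>'"
 shows "cont_rep I (%y x. f y x - f' y x) (%y x. \<psi> y x - \<psi>' y x)"
 unfolding cont_rep_def
proof (intro conjI ballI)
 fix y assume "y \<in> pts I"
 then have "AE x in L. \<psi> y x = f y x" "AE x in L. \<psi>' y x = f' y x"
  using assms by (auto simp: cont_rep_def)
 then show "AE x in L. \<psi> y x - \<psi>' y x = f y x - f' y x" by eventually_elim simp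
next
 have "AE x in L. continuous_on (pts I) (%y. \<psi> y x)" "AE x in L. continuous_on (pts I) (%y. \<psi>' y x)"
  using assms by (auto simp: cont_rep_def)
 then show "AE x in L. continuous_on (pts I) (%y. \<psi> y x - \<psi>' y x)"
  by eventually_elim (intro continuous_intros)
qed

lemma Lp_continuous_section:
 assumes f: "Lp_continuous (insert l I) f" and l: "l \<notin> I" and q: "q \<in> closure D"
 shows "Lp_continuous I (%y. f (y(l := q)))"
 unfolding Lp_continuous_def
proof (intro ballI conjI allI impI)
 fix y assume y: "y \<in> pts I"
 then have y': "y(l := q) \<in> pts (insert l I)" using q l by (auto simp: PiE_iff extensional_def)
 then show "f (y(l := q)) \<in> LP" using f by (simp add: Lp_continuous_def)
 fix \<epsilon> :: real assume "\<epsilon> > 0"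
 then obtain \<delta> where d: "\<delta> > 0" "!!z. z \<in> pts (insert l I) ==> (\<forall>i\<in>insert l I. dist (z i) ((y(l := q)) i) < \<delta>) ==> nrm (%x. f z x - f (y(l := q)) x) < \<epsilon>"
  using f y' unfolding Lp_continuous_def by meson
 show "\<exists>\<delta>>0. \<forall>z\<in>pts I. (\<forall>i\<in>I. dist (z i) (y i) < \<delta>) --> nrm (%x. f (z(l := q)) x - f (y(l := q)) x) < \<epsilon>"
 proof (intro exI conjI ballI impI)
  fix z assume z: "z \<in> pts I" "\<forall>i\<in>I. dist (z i) (y i) < \<delta>"
  then have "z(l := q) \<in> pts (insert l I)" using q l by (auto simp: PiE_iff extensional_def)
  then show "nrm (%x. f (z(l := q)) x - f (y(l := q)) x) < \<epsilon>"
   using d(1) z(2) by (intro d(2)) auto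
 qed (rule d(1))
qed

lemma Lp_continuous_diff:
 assumes f: "Lp_continuous I f" and g: "Lp_continuous I g"
 shows "Lp_continuous I (%y x. f y x - g y x)"
 unfolding Lp_continuous_def
proof (intro ballI conjI allI impI)
 fix y assume y: "y \<in> pts I"
 show "(%x. f y x - g y x) \<in> LP" using f g y by (intro Lp_diff) (auto simp: Lp_continuous_def)
 fix \<epsilon> :: real assume "\<epsilon> > 0"
 then have e2: "\<epsilon> / 2 > 0" by simp
 obtain \<delta>1 where d1: "\<delta>1 > 0" "!!z. z \<in> pts I ==> (\<forall>i\<in>I. dist (z i) (y i) < \<delta>1) ==> nrm (%x. f z x - f y x) < \<epsilon> / 2"
  using f y e2 unfolding Lp_continuous_def by meson
 obtain \<delta>2 where d2: "\<delta>2 > 0" "!!z. z \<in> pts I ==> (\<forall>i\<in>I. dist (z i) (y i) < \<delta>2) ==> nrm (%x. g z x - g y x) < \<epsilon> / 2"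
  using g y e2 unfolding Lp_continuous_def by meson
 show "\<exists>\<delta>>0. \<forall>z\<in>pts I. (\<forall>i\<in>I. dist (z i) (y i) < \<delta>) --> nrm (%x. (f z x - g z x) - (f y x - g y x)) < \<epsilon>"
 proof (intro exI[of _ "min \<delta>1 \<delta>2"] conjI ballI impI)
  fix z assume z: "z \<in> pts I" "\<forall>i\<in>I. dist (z i) (y i) < min \<delta>1 \<delta>2"
  have "nrm (%x. (f z x - f y x) - (g z x - g y x)) <= nrm (%x. f z x - f y x) + nrm (%x. g z x - g y x)"
   using f g y z(1) by (intro Lp_norm_triangle_diff Lp_diff) (auto simp: Lp_continuous_def)
  also have "\<dots> < \<epsilon> / 2 + \<epsilon> / 2" using d1 d2 z by (intro add_strict_mono) auto
  finally show "nrm (%x. (f z x - g z x) - (f y x - g y x)) < \<epsilon>" by (simp add: algebra_simps)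
 qed (use d1 d2 in simp)
qed

lemma mixed_holder_section:
 assumes f: "mixed_holder (insert l I) \<gamma> B f" and l: "l \<notin> I" and q: "q \<in> closure D"
 shows "mixed_holder I \<gamma> B (%y. f (y(l := q)))"
 unfolding mixed_holder_def
proof (intro allI impI ballI)
 fix A y h assume a: "A \<subseteq> I" "y \<in> pts I" "\<forall>i\<in>A. y i + h i \<in> closure D"
 have lA: "l \<notin> A" using a l by auto
 have "mdiff A h (%y. f (y(l := q))) y = mdiff A h f (y(l := q))"
  using mdiff_fun_upd[OF lA] by (rule ext)
 moreover have "y(l := q) \<in> pts (insert l I)" using a q l by (auto simp: PiE_iff extensional_def)
 moreover have "\<forall>i\<in>A. (y(l := q)) i + h i \<in> closure D" using a lA by auto
 ultimately show "nrm (mdiff A h (%y. f (y(l := q))) y) <= B * (\<Prod>l\<in>A. norm (h l) powr \<gamma>)"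
  using f a(1) unfolding mixed_holder_def by (metis insert_subset subset_insertI2)
qed

text \<open>Subtracting two sections in y_l is one more difference inside a mixed difference, so the
  factor |q - q'|^\<gamma> moves into the constant. In this way the increments of the chain become
  accessible to the induction hypothesis.\<close>

lemma mixed_holder_section_diff:
 assumes f: "mixed_holder (insert l I) \<gamma> B f" and l: "l \<notin> I" "finite I" and q: "q \<in> closure D" "q' \<in> closure D"
 shows "mixed_holder I \<gamma> (B * norm (q - q') powr \<gamma>) (%y x. f (y(l := q)) x - f (y(l := q')) x)"
 unfolding mixed_holder_def
proof (intro allI impI ballI)
 fix A y h assume a: "A \<subseteq> I" "y \<in> pts I" "\<forall>i\<in>A. y i + h i \<in> closure D"
 have lA: "l \<notin> A" "finite A" using a l finite_subset by auto
 define h' where "h' = h(l := q - q')"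
 have "mdiff A h (%y x. f (y(l := q)) x - f (y(l := q')) x) y = mdiff (insert l A) h' f (y(l := q'))"
 proof
  fix x
  have "mdiff A h (%y x. f (y(l := q)) x - f (y(l := q')) x) y x = mdiff A h f (y(l := q)) x - mdiff A h f (y(l := q')) x"
   using mdiff_sub[of A h "%y. f (y(l := q))" "%y. f (y(l := q'))" y x]
   unfolding mdiff_fun_upd[OF lA(1), of h f q y x] mdiff_fun_upd[OF lA(1), of h f q' y x] .
  also have "\<dots> = mdiff (insert l A) h' f (y(l := q')) x"
  proof -
   have c: "mdiff A h' f z x = mdiff A h f z x" for z
    by (rule mdiff_cong) (use lA in \<open>auto simp: h'_def\<close>)
   have "h' l = q - q'" by (simp add: h'_def)
   then show ?thesis using lA by (simp add: mdiff_insert c)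
  qed
  finally show "mdiff A h (%y x. f (y(l := q)) x - f (y(l := q')) x) y x = mdiff (insert l A) h' f (y(l := q')) x" .
 qed
 moreover have "nrm (mdiff (insert l A) h' f (y(l := q'))) <= B * (\<Prod>i\<in>insert l A. norm (h' i) powr \<gamma>)"
 proof -
  have 1: "insert l A \<subseteq> insert l I" using a by auto
  have 2: "y(l := q') \<in> pts (insert l I)" using a q l by (auto simp: PiE_iff extensional_def)
  have 3: "\<forall>i\<in>insert l A. (y(l := q')) i + h' i \<in> closure D" using a lA q by (auto simp: h'_def)
  show ?thesis using f 1 2 3 unfolding mixed_holder_def by blast
 qed
 moreover have "(\<Prod>i\<in>insert l A. norm (h' i) powr \<gamma>) = norm (q - q') powr \<gamma> * (\<Prod>i\<in>A. norm (h i) powr \<gamma>)"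
  using lA by (auto simp: h'_def intro!: prod.cong)
 ultimately show "nrm (mdiff A h (%y x. f (y(l := q)) x - f (y(l := q')) x) y)
   <= B * norm (q - q') powr \<gamma> * (\<Prod>l\<in>A. norm (h l) powr \<gamma>)" by (simp add: mult.assoc)
qed

end

section \<open>Kolmogorov chaining over one more variable\<close>

lemma convex_sum_abs_le:
 fixes w a :: "'q => real"
 assumes "!!q. q \<in> G ==> 0 <= w q" "sum w G = 1" "!!q. q \<in> G ==> w q ~= 0 ==> \<bar>a q\<bar> <= t"
 shows "\<bar>\<Sum>q\<in>G. w q * a q\<bar> <= t"
proof -
 have "\<bar>\<Sum>q\<in>G. w q * a q\<bar> <= (\<Sum>q\<in>G. \<bar>w q * a q\<bar>)" by (rule sum_abs)
 also have "\<dots> <= (\<Sum>q\<in>G. w q * t)"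
 proof (rule sum_mono)
  fix q assume "q \<in> G"
  then show "\<bar>w q * a q\<bar> <= w q * t"
   using assms(1,3)[of q] by (cases "w q = 0") (auto simp: abs_mult intro: mult_left_mono)
 qed
 also have "\<dots> = t" using assms(2) by (simp add: sum_distrib_right[symmetric])
 finally show ?thesis .
qed

text \<open>Both averages are rewritten as one double average of the differences a q - a q', in
  which only pairs with nonzero weights count.\<close>

lemma convex_double_sum_abs_le:
 fixes w w' a :: "'q => real"
 assumes "!!q. q \<in> G ==> 0 <= w q" "sum w G = 1" and "!!q. q \<in> G' ==> 0 <= w' q" "sum w' G' = 1"
  and "!!q q'. q \<in> G ==> w q ~= 0 ==> q' \<in> G' ==> w' q' ~= 0 ==> \<bar>a q - a q'\<bar> <= t"
 shows "\<bar>(\<Sum>q\<in>G. w q * a q) - (\<Sum>q\<in>G'. w' q * a q)\<bar> <= t"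
proof -
 have "(\<Sum>q\<in>G. w q * a q) - (\<Sum>q\<in>G'. w' q * a q) = (\<Sum>q\<in>G. w q * (a q - (\<Sum>q\<in>G'. w' q * a q)))"
  using assms(2) by (simp add: right_diff_distrib sum_subtractf sum_distrib_right[symmetric])
 also have "\<bar>\<dots>\<bar> <= t"
 proof (rule convex_sum_abs_le[OF assms(1,2)])
  fix q assume q: "q \<in> G" "w q ~= 0"
  have "a q - (\<Sum>q\<in>G'. w' q * a q) = (\<Sum>q'\<in>G'. w' q' * (a q - a q'))"
   using assms(4) by (simp add: right_diff_distrib sum_subtractf sum_distrib_right[symmetric])
  also have "\<bar>\<dots>\<bar> <= t" by (rule convex_sum_abs_le[OF assms(3,4)]) (use assms(5) q in auto)
  finally show "\<bar>a q - (\<Sum>q\<in>G'. w' q * a q)\<bar> <= t" .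
 qed
 finally show ?thesis .
qed

lemma ennreal_powr_le_imp_le:
 assumes "ennreal (\<bar>a\<bar> powr p) <= ennreal b" "0 < p" "0 <= b"
 shows "\<bar>a\<bar> <= b powr (1 / p)"
proof -
 have "(\<bar>a\<bar> powr p) powr (1/p) <= b powr (1/p)"
  using assms by (intro powr_mono2) auto
 then show ?thesis using assms by (simp add: powr_powr)
qed

context Sobolev_domain
begin

text \<open>The variable y_l is interpolated: P_n(y) averages the sections \<open>\<Psi> q\<close>
  over net points q near y_l. The increment P_(n+1) - P_n averages differences of sections at
  neighbouring net points, and each of these has a majorant \<open>M2\<close> by the induction
  hypothesis, applied through \<open>mixed_holder_section_diff\<close>. The sum S_n of the majorants
  has integral at most a multiple of B^p \<rho>^n. Hence the series Q of the \<tau>^(-n) S_n is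
  integrable, so finite a.e., and at such x the increments are at most a multiple of
  \<sigma>^n.\<close>

lemma cont_rep_exists_insert:
 fixes \<gamma> K0 :: real
 assumes \<gamma>: "0 < \<gamma>" "2 * real CARD('d) / \<gamma> < p" and I: "finite I" "l \<notin> I" and K0: "0 <= K0"
  and IH: "!!B f. 0 <= B ==> Lp_continuous I f ==> mixed_holder I \<gamma> B f ==>
    \<exists>\<psi> M. cont_rep I f \<psi> & M \<in> borel_measurable L & (\<integral>\<^sup>+x. M x \<partial>L) <= ennreal (K0 * B powr p) \<and>
     (AE x in L. \<forall>y\<in>pts I. ennreal (\<bar>\<psi> y x\<bar> powr p) <= M x)"
 shows "\<exists>K\<ge>0. \<forall>B f. 0 <= B --> Lp_continuous (insert l I) f --> mixed_holder (insert l I) \<gamma> B f -->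
   (\<exists>\<psi> M. cont_rep (insert l I) f \<psi> & M \<in> borel_measurable L & (\<integral>\<^sup>+x. M x \<partial>L) <= ennreal (K * B powr p) \<and>
    (AE x in L. \<forall>y\<in>pts (insert l I). ennreal (\<bar>\<psi> y x\<bar> powr p) <= M x))"
proof -
 define N where "N = CARD('d)"
 \<comment> \<open>The lower bound on p enters here. There are at most a multiple of 2^(2 N n) pairs
   at level n, each contributing a multiple of 2^(-\<gamma> p n); \<rho> is the ratio of the
   resulting geometric series.\<close>
 have exp_neg: "2 * real N - \<gamma> * p < 0" using \<gamma> by (simp add: N_def field_simps)
 define \<rho> where "\<rho> = 2 powr (2 * real N - \<gamma> * p)"
 have \<rho>: "0 < \<rho>" "\<rho> < 1" using exp_neg powr_less_mono[of "2 * real N - \<gamma> * p" 0 2] by (auto simp: \<rho>_def)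
 \<comment> \<open>The splitting \<rho> = \<tau> \<tau>: one factor makes the series with weights
   \<tau>^(-n) converge in the mean, the other one remains as the pointwise decay S_n <= \<tau>^n
   Q.\<close>
 define \<tau> where "\<tau> = \<rho> powr (1 / 2)"
 have \<tau>: "0 < \<tau>" "\<tau> < 1" "\<tau> * \<tau> = \<rho>"
  using \<rho> powr_less_mono2[of "1/2" \<rho> 1] by (auto simp: \<tau>_def powr_add[symmetric])
 define \<sigma> where "\<sigma> = \<tau> powr (1 / p)"
 have \<sigma>: "0 < \<sigma>" "\<sigma> < 1" using \<tau> powr_less_mono2[of "1/p" \<tau> 1] p_pos by (auto simp: \<sigma>_def)
 obtain G C where G: "!!i. finite (G i)" "!!i. G i \<subseteq> D" "0 <= C"
  "!!i. real (card (G i)) <= C * 2 ^ (i * N)"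
  "!!i y. y \<in> closure D ==> \<exists>q\<in>G i. dist y q < 1 / 2 ^ i"
  using finite_nets[OF bounded_D] unfolding N_def by metis
 have Gcl: "q \<in> closure D" if "q \<in> G i" for q i using that G(2) closure_subset[of D] by auto
 have "\<exists>w :: real^'d => real^'d => real. (\<forall>q. continuous_on (closure D) (w q)) & (\<forall>q y. 0 <= w q y) \<and>
   (\<forall>y\<in>closure D. (\<Sum>q\<in>G i. w q y) = 1) & (\<forall>q y. w q y ~= 0 --> dist y q < 2 * (1 / 2 ^ i))" for i
 proof -
  obtain v :: "real^'d => real^'d => real" where "!!q. continuous_on (closure D) (v q)" "!!q y. 0 <= v q y"
   "!!y. y \<in> closure D ==> (\<Sum>q\<in>G i. v q y) = 1" "!!q y. v q y ~= 0 ==> dist y q < 2 * (1 / 2 ^ i)"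
   using partition_of_unity_net[OF G(1)[of i] G(5)] by metis
  then show ?thesis by (intro exI[of _ v] conjI allI ballI impI)
 qed
 then obtain w :: "nat => real^'d => real^'d => real" where w: "!!i q. continuous_on (closure D) (w i q)" "!!i q y. 0 <= w i q y"
   "!!i y. y \<in> closure D ==> (\<Sum>q\<in>G i. w i q y) = 1" "!!i q y. w i q y ~= 0 ==> dist y q < 2 * (1 / 2 ^ i)"
  by metis
 \<comment> \<open>C * C comes from the sizes of the two nets, 2^N from the finer of them, and
   3^(\<gamma> p) from the distance 3 / 2^n of paired points.\<close>
 define K1 where "K1 = C * C * 2 ^ N * K0 * 3 powr (\<gamma> * p)"
 have K1: "0 <= K1" using G(3) K0 by (simp add: K1_def)
 define K where "K = 2 powr p * (C * K0 + (1 / (1 - \<sigma>)) powr p * (K1 / (1 - \<tau>)))"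
 have K: "0 <= K" using G(3) K0 K1 \<tau> by (simp add: K_def)
 show ?thesis
 proof (intro exI[of _ K] conjI allI impI K)
  fix B f assume B: "0 <= B" and fc: "Lp_continuous (insert l I) f" and fm: "mixed_holder (insert l I) \<gamma> B f"
  have "\<forall>q\<in>closure D. \<exists>\<psi>M. cont_rep I (%y. f (y(l := q))) (fst \<psi>M) & snd \<psi>M \<in> borel_measurable L \<and>
    (\<integral>\<^sup>+x. snd \<psi>M x \<partial>L) <= ennreal (K0 * B powr p) \<and>
     (AE x in L. \<forall>y\<in>pts I. ennreal (\<bar>fst \<psi>M y x\<bar> powr p) <= snd \<psi>M x)"
  proof
   fix q assume "q \<in> closure D"
   from IH[OF B Lp_continuous_section[OF fc I(2) this] mixed_holder_section[OF fm I(2) this]]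
   obtain \<psi> M where "cont_rep I (%y. f (y(l := q))) \<psi> & M \<in> borel_measurable L \<and>
    (\<integral>\<^sup>+x. M x \<partial>L) <= ennreal (K0 * B powr p) \<and>
     (AE x in L. \<forall>y\<in>pts I. ennreal (\<bar>\<psi> y x\<bar> powr p) <= M x)" by blast
   then show "\<exists>\<psi>M. cont_rep I (%y. f (y(l := q))) (fst \<psi>M) & snd \<psi>M \<in> borel_measurable L \<and>
    (\<integral>\<^sup>+x. snd \<psi>M x \<partial>L) <= ennreal (K0 * B powr p) \<and>
     (AE x in L. \<forall>y\<in>pts I. ennreal (\<bar>fst \<psi>M y x\<bar> powr p) <= snd \<psi>M x)"
    by (intro exI[of _ "(\<psi>, M)"]) simp
  qed
  from bchoice[OF this] obtain \<Psi>M where \<Psi>M: "\<forall>q\<in>closure D. cont_rep I (%y. f (y(l := q))) (fst (\<Psi>M q)) & snd (\<Psi>M q) \<in> borel_measurable L \<and>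
    (\<integral>\<^sup>+x. snd (\<Psi>M q) x \<partial>L) <= ennreal (K0 * B powr p) \<and>
     (AE x in L. \<forall>y\<in>pts I. ennreal (\<bar>fst (\<Psi>M q) y x\<bar> powr p) <= snd (\<Psi>M q) x)" ..
  define \<Psi> M1 where "\<Psi> q = fst (\<Psi>M q)" and "M1 q = snd (\<Psi>M q)" for q
  have \<Psi>: "cont_rep I (%y. f (y(l := q))) (\<Psi> q)" "M1 q \<in> borel_measurable L"
    "(\<integral>\<^sup>+x. M1 q x \<partial>L) <= ennreal (K0 * B powr p)"
    "AE x in L. \<forall>y\<in>pts I. ennreal (\<bar>\<Psi> q y x\<bar> powr p) <= M1 q x" if "q \<in> closure D" for q
   using \<Psi>M that by (auto simp: \<Psi>_def M1_def)
  \<comment> \<open>The induction hypothesis yields some representative of the difference of two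
    sections. Uniqueness identifies it with the difference of the representatives already chosen, so
    the majorant applies to the latter.\<close>
  have "\<forall>qq\<in>closure D \<times> closure D. \<exists>M. M \<in> borel_measurable L \<and>
    (\<integral>\<^sup>+x. M x \<partial>L) <= ennreal (K0 * (B * norm (fst qq - snd qq) powr \<gamma>) powr p) \<and>
     (AE x in L. \<forall>y\<in>pts I. ennreal (\<bar>\<Psi> (fst qq) y x - \<Psi> (snd qq) y x\<bar> powr p) <= M x)"
  proof
   fix qq assume "qq \<in> closure D \<times> closure D"
   then have qq: "fst qq \<in> closure D" "snd qq \<in> closure D" by auto
   have B': "0 <= B * norm (fst qq - snd qq) powr \<gamma>" using B by simp
   from IH[OF B' Lp_continuous_diff[OF Lp_continuous_section[OF fc I(2) qq(1)] Lp_continuous_section[OF fc I(2) qq(2)]]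
     mixed_holder_section_diff[OF fm I(2,1) qq]]
   obtain \<psi> M where M: "cont_rep I (%y x. f (y(l := fst qq)) x - f (y(l := snd qq)) x) \<psi>" "M \<in> borel_measurable L"
    "(\<integral>\<^sup>+x. M x \<partial>L) <= ennreal (K0 * (B * norm (fst qq - snd qq) powr \<gamma>) powr p)"
    "AE x in L. \<forall>y\<in>pts I. ennreal (\<bar>\<psi> y x\<bar> powr p) <= M x" by blast
   have "AE x in L. \<forall>y\<in>pts I. \<psi> y x = \<Psi> (fst qq) y x - \<Psi> (snd qq) y x"
    by (rule cont_rep_AE_unique[OF I(1) M(1) cont_rep_diff[OF \<Psi>(1)[OF qq(1)] \<Psi>(1)[OF qq(2)]]]) simp
   with M(4) have "AE x in L. \<forall>y\<in>pts I. ennreal (\<bar>\<Psi> (fst qq) y x - \<Psi> (snd qq) y x\<bar> powr p) <= M x"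
    by eventually_elim simp
   with M(2,3) show "\<exists>M. M \<in> borel_measurable L \<and>
    (\<integral>\<^sup>+x. M x \<partial>L) <= ennreal (K0 * (B * norm (fst qq - snd qq) powr \<gamma>) powr p) \<and>
     (AE x in L. \<forall>y\<in>pts I. ennreal (\<bar>\<Psi> (fst qq) y x - \<Psi> (snd qq) y x\<bar> powr p) <= M x)" by blast
  qed
  from bchoice[OF this] obtain M2 where M2: "\<forall>qq\<in>closure D \<times> closure D. M2 qq \<in> borel_measurable L \<and>
    (\<integral>\<^sup>+x. M2 qq x \<partial>L) <= ennreal (K0 * (B * norm (fst qq - snd qq) powr \<gamma>) powr p) \<and>
     (AE x in L. \<forall>y\<in>pts I. ennreal (\<bar>\<Psi> (fst qq) y x - \<Psi> (snd qq) y x\<bar> powr p) <= M2 qq x)" ..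
  \<comment> \<open>The weights of levels n + 1 and n reach net points within 2 / 2^(n+1) and 2 /
    2^n of y_l, so these are within 3 / 2^n of each other.\<close>
  define Pn where "Pn n = {qq \<in> G (Suc n) \<times> G n. dist (fst qq) (snd qq) <= 3 / 2 ^ n}" for n
  have Pn_fin: "finite (Pn n)" for n unfolding Pn_def by (rule finite_subset[of _ "G (Suc n) \<times> G n"]) (auto simp: G)
  have Pn_cl: "qq \<in> closure D \<times> closure D" if "qq \<in> Pn n" for qq n
   using that Gcl by (auto simp: Pn_def)
  have Pn_card: "real (card (Pn n)) <= C * C * 2 ^ N * (2 ^ (2 * n * N))" for n
  proof -
   have "card (Pn n) <= card (G (Suc n) \<times> G n)"
    unfolding Pn_def by (rule card_mono) (auto simp: G)
   then have "real (card (Pn n)) <= real (card (G (Suc n))) * real (card (G n))"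
    by (simp add: card_cartesian_product flip: of_nat_mult)
   also have "\<dots> <= (C * 2 ^ (Suc n * N)) * (C * 2 ^ (n * N))"
    using G(3) by (intro mult_mono G(4)) auto
   also have "\<dots> = C * C * 2 ^ N * (2 ^ (2 * n * N))"
   proof -
    have "2 * n * N = n * N + n * N" by simp
    then have "(2::real) ^ (2 * n * N) = 2 ^ (n * N) * 2 ^ (n * N)" by (simp only: power_add)
    then show ?thesis by (simp add: power_add)
   qed
   finally show ?thesis .
  qed
  define S where "S n x = (\<Sum>qq\<in>Pn n. M2 qq x)" for n x
  define T where "T x = (\<Sum>q\<in>G 0. M1 q x)" for x
  define Q where "Q x = (\<Sum>n. ennreal ((1 / \<tau>) ^ n) * S n x)" for x
  define M where "M x = ennreal (2 powr p) * (T x + ennreal ((1 / (1 - \<sigma>)) powr p) * Q x)" for x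
  have S_meas [measurable]: "S n \<in> borel_measurable L" for n
   unfolding S_def using M2 Pn_cl by (intro borel_measurable_sum) blast
  have T_meas [measurable]: "T \<in> borel_measurable L"
   unfolding T_def using \<Psi>(2) Gcl by (intro borel_measurable_sum) blast
  have Q_meas [measurable]: "Q \<in> borel_measurable L" unfolding Q_def by measurable
  have M_meas: "M \<in> borel_measurable L" unfolding M_def by measurable
  have S_int: "(\<integral>\<^sup>+x. S n x \<partial>L) <= ennreal (K1 * B powr p * \<rho> ^ n)" for n
  proof -
   have e: "2 ^ (2 * n * N) * (1 / 2 ^ n) powr (\<gamma> * p) = \<rho> ^ n"
   proof -
    have "(2::real) ^ (2 * n * N) = 2 powr (real n * (2 * real N))" by (simp add: powr_realpow[symmetric] mult_ac)
    moreover have "(1 / 2 ^ n) powr (\<gamma> * p) = 2 powr (- (real n * (\<gamma> * p)))"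
     by (simp add: powr_divide powr_realpow[symmetric] powr_powr powr_minus_divide)
    moreover have "\<rho> ^ n = 2 powr (real n * (2 * real N - \<gamma> * p))"
     using \<rho>(1) by (simp add: \<rho>_def powr_realpow[symmetric] powr_powr mult.commute)
    ultimately show ?thesis by (simp add: powr_add[symmetric] right_diff_distrib)
   qed
   have "(\<integral>\<^sup>+x. S n x \<partial>L) = (\<Sum>qq\<in>Pn n. \<integral>\<^sup>+x. M2 qq x \<partial>L)"
    unfolding S_def using M2 Pn_cl by (intro nn_integral_sum) blast
   also have "\<dots> <= (\<Sum>qq\<in>Pn n. ennreal (K0 * (B powr p * (3 powr (\<gamma> * p) * (1 / 2 ^ n) powr (\<gamma> * p)))))"
   proof (rule sum_mono)
    fix qq assume qq: "qq \<in> Pn n"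
    have "norm (fst qq - snd qq) <= 3 * (1 / 2 ^ n)" using qq by (simp add: Pn_def dist_norm)
    then have "norm (fst qq - snd qq) powr (\<gamma> * p) <= (3 * (1 / 2 ^ n)) powr (\<gamma> * p)"
     using \<gamma> p_pos by (intro powr_mono2) auto
    then have "norm (fst qq - snd qq) powr (\<gamma> * p) <= 3 powr (\<gamma> * p) * (1 / 2 ^ n) powr (\<gamma> * p)"
     by (simp only: powr_mult)
    then have "K0 * (B * norm (fst qq - snd qq) powr \<gamma>) powr p <= K0 * (B powr p * (3 powr (\<gamma> * p) * (1 / 2 ^ n) powr (\<gamma> * p)))"
     using B K0 by (simp only: powr_mult powr_powr) (intro mult_left_mono; simp)
    then show "(\<integral>\<^sup>+x. M2 qq x \<partial>L) <= ennreal (K0 * (B powr p * (3 powr (\<gamma> * p) * (1 / 2 ^ n) powr (\<gamma> * p))))"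
     using M2 Pn_cl[OF qq] by (meson ennreal_leI order_trans)
   qed
   also have "\<dots> = ennreal (real (card (Pn n)) * (K0 * (B powr p * (3 powr (\<gamma> * p) * (1 / 2 ^ n) powr (\<gamma> * p)))))"
    by (simp add: ennreal_mult' ennreal_of_nat_eq_real_of_nat)
   also have "\<dots> <= ennreal (C * C * 2 ^ N * (2 ^ (2 * n * N)) * (K0 * (B powr p * (3 powr (\<gamma> * p) * (1 / 2 ^ n) powr (\<gamma> * p)))))"
    using K0 by (intro ennreal_leI mult_right_mono Pn_card) simp
   also have "C * C * 2 ^ N * (2 ^ (2 * n * N)) * (K0 * (B powr p * (3 powr (\<gamma> * p) * (1 / 2 ^ n) powr (\<gamma> * p))))
     = K1 * B powr p * (2 ^ (2 * n * N) * (1 / 2 ^ n) powr (\<gamma> * p))" by (simp only: K1_def mult_ac)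
   finally show ?thesis by (simp only: e)
  qed
  have T_int: "(\<integral>\<^sup>+x. T x \<partial>L) <= ennreal (C * K0 * B powr p)"
  proof -
   have "(\<integral>\<^sup>+x. T x \<partial>L) = (\<Sum>q\<in>G 0. \<integral>\<^sup>+x. M1 q x \<partial>L)"
    unfolding T_def using \<Psi>(2) Gcl by (intro nn_integral_sum) blast
   also have "\<dots> <= (\<Sum>q\<in>G 0. ennreal (K0 * B powr p))" by (intro sum_mono \<Psi>(3) Gcl)
   also have "\<dots> = ennreal (real (card (G 0)) * (K0 * B powr p))"
    by (simp add: ennreal_mult' ennreal_of_nat_eq_real_of_nat)
   also have "\<dots> <= ennreal (C * (K0 * B powr p))"
    using G(4)[of 0] K0 by (intro ennreal_leI mult_right_mono) auto
   finally show ?thesis by (simp add: mult.assoc)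
  qed
  have Q_int: "(\<integral>\<^sup>+x. Q x \<partial>L) <= ennreal (K1 / (1 - \<tau>) * B powr p)"
  proof -
   have "(\<integral>\<^sup>+x. Q x \<partial>L) = (\<Sum>n. ennreal ((1 / \<tau>) ^ n) * (\<integral>\<^sup>+x. S n x \<partial>L))"
    unfolding Q_def by (simp add: nn_integral_suminf nn_integral_cmult)
   also have "\<dots> <= (\<Sum>n. ennreal (K1 * B powr p * \<tau> ^ n))"
   proof (intro suminf_le summableI)
    fix n
    have "ennreal ((1 / \<tau>) ^ n) * (\<integral>\<^sup>+x. S n x \<partial>L) <= ennreal ((1 / \<tau>) ^ n) * ennreal (K1 * B powr p * \<rho> ^ n)"
     by (intro mult_left_mono S_int) simp
    also have "\<dots> = ennreal ((1 / \<tau>) ^ n * (K1 * B powr p * \<rho> ^ n))"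
     using \<tau> K1 \<rho> by (intro ennreal_mult[symmetric]) auto
    also have "(1 / \<tau>) ^ n * (K1 * B powr p * \<rho> ^ n) = K1 * B powr p * \<tau> ^ n"
     using \<tau>(1) by (simp add: \<tau>(3)[symmetric] power_mult_distrib power_one_over field_simps)
    finally show "ennreal ((1 / \<tau>) ^ n) * (\<integral>\<^sup>+x. S n x \<partial>L) <= ennreal (K1 * B powr p * \<tau> ^ n)" .
   qed
   also have "\<dots> = ennreal (\<Sum>n. K1 * B powr p * \<tau> ^ n)"
    using K1 \<tau> by (intro suminf_ennreal2 summable_mult summable_geometric) auto
   also have "(\<Sum>n. K1 * B powr p * \<tau> ^ n) = K1 * B powr p * (1 / (1 - \<tau>))"
    using \<tau> by (subst suminf_mult) (auto simp: suminf_geometric)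
   finally show ?thesis by (simp add: mult_ac)
  qed
  have M_int: "(\<integral>\<^sup>+x. M x \<partial>L) <= ennreal (K * B powr p)"
  proof -
   have "(\<integral>\<^sup>+x. M x \<partial>L) = ennreal (2 powr p) * ((\<integral>\<^sup>+x. T x \<partial>L) + ennreal ((1 / (1 - \<sigma>)) powr p) * (\<integral>\<^sup>+x. Q x \<partial>L))"
    unfolding M_def by (simp add: nn_integral_cmult nn_integral_add)
   also have "\<dots> <= ennreal (2 powr p) * (ennreal (C * K0 * B powr p) + ennreal ((1 / (1 - \<sigma>)) powr p) * ennreal (K1 / (1 - \<tau>) * B powr p))"
    by (intro mult_left_mono add_mono T_int Q_int) auto
   also have "\<dots> = ennreal (2 powr p * (C * K0 * B powr p + (1 / (1 - \<sigma>)) powr p * (K1 / (1 - \<tau>) * B powr p)))"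
   proof -
    have gen: "ennreal u * (ennreal a + ennreal b * ennreal c) = ennreal (u * (a + b * c))"
     if "0 <= u" "0 <= a" "0 <= b" "0 <= c" for u a b c
     using that by (simp add: ennreal_mult ennreal_plus)
    show ?thesis by (rule gen) (use G(3) K0 K1 \<tau> in auto)
   qed
   also have "2 powr p * (C * K0 * B powr p + (1 / (1 - \<sigma>)) powr p * (K1 / (1 - \<tau>) * B powr p)) = K * B powr p"
    by (simp add: K_def algebra_simps)
   finally show ?thesis .
  qed
  define U where "U = (\<Union>i. G i)"
  have U: "countable U" "!!q. q \<in> U ==> q \<in> closure D" "!!q i. q \<in> G i ==> q \<in> U"
   using G(1) Gcl by (auto simp: U_def intro: countable_finite)
  \<comment> \<open>Resetting the coordinate l to undefined turns a point indexed by
    \<open>insert l I\<close> into one indexed by I, as extensionality demands.\<close>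
  define P where "P x n y = (\<Sum>q\<in>G n. w n q (y l) * \<Psi> q (y(l := undefined)) x)" for x n y
  define \<psi> where "\<psi> y x = lim (%n. P x n y)" for y x
  have proj: "y(l := undefined) \<in> pts I" "y l \<in> closure D" if "y \<in> pts (insert l I)" for y
   using that I(2) by (auto simp: PiE_iff extensional_def)
  have AE1: "AE x in L. \<forall>q\<in>U. continuous_on (pts I) (%y. \<Psi> q y x)"
   unfolding AE_ball_countable[OF U(1)] using \<Psi>(1) U(2) by (simp add: cont_rep_def)
  have AE2: "AE x in L. \<forall>qq\<in>U \<times> U. \<forall>y\<in>pts I. ennreal (\<bar>\<Psi> (fst qq) y x - \<Psi> (snd qq) y x\<bar> powr p) <= M2 qq x"
   unfolding AE_ball_countable[OF countable_SIGMA[OF U(1) U(1)]] using M2 U(2) by auto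
  have AE3: "AE x in L. \<forall>q\<in>U. \<forall>y\<in>pts I. ennreal (\<bar>\<Psi> q y x\<bar> powr p) <= M1 q x"
   unfolding AE_ball_countable[OF U(1)] using \<Psi>(4) U(2) by simp
  have AE4: "AE x in L. T x ~= \<infinity>"
   by (rule nn_integral_PInf_AE[OF T_meas]) (use T_int in \<open>auto simp: top_unique\<close>)
  have AE5: "AE x in L. Q x ~= \<infinity>"
   by (rule nn_integral_PInf_AE[OF Q_meas]) (use Q_int in \<open>auto simp: top_unique\<close>)
  have good: "AE x in L. continuous_on (pts (insert l I)) (%y. \<psi> y x) \<and>
    (\<forall>y\<in>pts (insert l I). ((%n. P x n y) \<longlonglongrightarrow> \<psi> y x) & ennreal (\<bar>\<psi> y x\<bar> powr p) <= M x)"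
   using AE1 AE2 AE3 AE4 AE5
  proof eventually_elim
   case (elim x)
   define t where "t = enn2real (T x) powr (1 / p)"
   define c where "c = enn2real (Q x) powr (1 / p)"
   have cont: "continuous_on (pts (insert l I)) (P x n)" for n
    unfolding P_def
   proof (intro continuous_on_sum continuous_on_mult)
    fix q assume q: "q \<in> G n"
    have "continuous_on (pts (insert l I)) (%y. y l)"
     by (rule continuous_on_product_then_coordinatewise[OF continuous_on_id])
    then show "continuous_on (pts (insert l I)) (%y. w n q (y l))"
     by (rule continuous_on_compose2[OF w(1)]) (use proj in auto)
    have "continuous_on (pts (insert l I)) (%y. y(l := undefined))"
    proof (rule continuous_on_coordinatewise_then_product)
     fix i
     have "continuous_on (pts (insert l I)) (%y. y i)"
      by (rule continuous_on_product_then_coordinatewise[OF continuous_on_id])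
     then show "continuous_on (pts (insert l I)) (%y. (y(l := undefined)) i)"
      by (cases "i = l") auto
    qed
    then show "continuous_on (pts (insert l I)) (%y. \<Psi> q (y(l := undefined)) x)"
     by (rule continuous_on_compose2[OF elim(1)[rule_format, OF U(3)[OF q]]]) (use proj in auto)
   qed
   have step: "\<bar>P x (Suc n) y - P x n y\<bar> <= c * \<sigma> ^ n" if y: "y \<in> pts (insert l I)" for n y
    unfolding P_def
   proof (rule convex_double_sum_abs_le[OF w(2) w(3)[OF proj(2)[OF y]] w(2) w(3)[OF proj(2)[OF y]]])
    fix q q' assume q: "q \<in> G (Suc n)" "w (Suc n) q (y l) ~= 0" "q' \<in> G n" "w n q' (y l) ~= 0"
    have "dist q q' <= dist (y l) q + dist (y l) q'" using dist_triangle3[of q q' "y l"] by simp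
    also have "\<dots> <= 3 / 2 ^ n" using w(4)[OF q(2)] w(4)[OF q(4)] by (simp add: field_simps)
    finally have qq: "(q, q') \<in> Pn n" using q by (simp add: Pn_def)
    have "ennreal (\<bar>\<Psi> q (y(l := undefined)) x - \<Psi> q' (y(l := undefined)) x\<bar> powr p) <= M2 (q, q') x"
     using elim(2)[rule_format, of "(q, q')" "y(l := undefined)"] U(3) q proj(1)[OF y] by simp
    also have "\<dots> <= S n x" unfolding S_def using qq Pn_fin by (intro member_le_sum) auto
    also have "S n x = ennreal (\<tau> ^ n) * (ennreal ((1 / \<tau>) ^ n) * S n x)"
     using \<tau> by (simp add: mult.assoc[symmetric] ennreal_mult[symmetric] power_mult_distrib[symmetric])
    also have "\<dots> <= ennreal (\<tau> ^ n) * Q x"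
    proof (rule mult_left_mono)
     have "sum (%n. ennreal ((1 / \<tau>) ^ n) * S n x) {n} <= (\<Sum>n. ennreal ((1 / \<tau>) ^ n) * S n x)"
      by (rule sum_le_suminf) auto
     then show "ennreal ((1 / \<tau>) ^ n) * S n x <= Q x" by (simp add: Q_def)
    qed simp
    also have "\<dots> = ennreal (\<tau> ^ n * enn2real (Q x))"
     using elim(5) \<tau> by (simp add: ennreal_mult less_top)
    finally have "\<bar>\<Psi> q (y(l := undefined)) x - \<Psi> q' (y(l := undefined)) x\<bar> <= (\<tau> ^ n * enn2real (Q x)) powr (1 / p)"
     using \<tau> p_pos by (intro ennreal_powr_le_imp_le) auto
    also have "\<dots> = c * \<sigma> ^ n"
     using \<tau> \<sigma> by (simp add: powr_mult c_def \<sigma>_def powr_realpow[symmetric] powr_powr mult.commute)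
    finally show "\<bar>\<Psi> q (y(l := undefined)) x - \<Psi> q' (y(l := undefined)) x\<bar> <= c * \<sigma> ^ n" .
   qed
   have init: "\<bar>P x 0 y\<bar> <= t" if y: "y \<in> pts (insert l I)" for y
    unfolding P_def
   proof (rule convex_sum_abs_le[OF w(2) w(3)[OF proj(2)[OF y]]])
    fix q assume q: "q \<in> G 0"
    have "ennreal (\<bar>\<Psi> q (y(l := undefined)) x\<bar> powr p) <= M1 q x"
     using elim(3) U(3)[OF q] proj(1)[OF y] by simp
    also have "\<dots> <= T x" unfolding T_def using q G(1) by (intro member_le_sum) auto
    also have "\<dots> = ennreal (enn2real (T x))" using elim(4) by (simp add: less_top)
    finally show "\<bar>\<Psi> q (y(l := undefined)) x\<bar> <= t"
     unfolding t_def using p_pos by (intro ennreal_powr_le_imp_le) auto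
   qed
   have \<sigma>0: "0 <= \<sigma>" using \<sigma>(1) by simp
   have chain1: "continuous_on (pts (insert l I)) (%y. lim (%n. P x n y))"
    by (rule geometric_chain_limit(1)[where P="P x" and c=c and \<sigma>=\<sigma> and t=t, OF cont _ _ \<sigma>0 \<sigma>(2)]) (erule step init)+
   have chain2: "(%n. P x n y) \<longlonglongrightarrow> lim (%n. P x n y)" if "y \<in> pts (insert l I)" for y
    by (rule geometric_chain_limit(2)[where P="P x" and c=c and \<sigma>=\<sigma> and t=t, OF cont _ _ \<sigma>0 \<sigma>(2) that]) (erule step init)+
   have chain3: "\<bar>lim (%n. P x n y)\<bar> <= t + c / (1 - \<sigma>)" if "y \<in> pts (insert l I)" for y
    by (rule geometric_chain_limit(3)[where P="P x" and c=c and \<sigma>=\<sigma> and t=t, OF cont _ _ \<sigma>0 \<sigma>(2) that]) (erule step init)+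
   have "ennreal (\<bar>\<psi> y x\<bar> powr p) <= M x" if y: "y \<in> pts (insert l I)" for y
   proof -
    have s1: "0 <= 1 / (1 - \<sigma>)" using \<sigma> by simp
    have "\<bar>\<psi> y x\<bar> <= t + c * (1 / (1 - \<sigma>))" using chain3[OF y] by (simp add: \<psi>_def)
    also have "\<dots> <= 2 * max t (c * (1 / (1 - \<sigma>)))" by linarith
    finally have "\<bar>\<psi> y x\<bar> powr p <= (2 * max t (c * (1 / (1 - \<sigma>)))) powr p"
     using p_pos by (intro powr_mono2) auto
    also have "\<dots> = 2 powr p * (max t (c * (1 / (1 - \<sigma>)))) powr p"
     by (simp add: powr_mult)
    also have "\<dots> <= 2 powr p * (t powr p + (c * (1 / (1 - \<sigma>))) powr p)"
     by (intro mult_left_mono) (auto simp: max_def)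
    also have "\<dots> = 2 powr p * (enn2real (T x) + (1 / (1 - \<sigma>)) powr p * enn2real (Q x))"
    proof -
     have "c powr p = enn2real (Q x)" "t powr p = enn2real (T x)"
      using p_pos by (simp_all add: c_def t_def powr_powr)
     then show ?thesis by (simp only: powr_mult mult.commute)
    qed
    finally have "ennreal (\<bar>\<psi> y x\<bar> powr p) <= ennreal (2 powr p * (enn2real (T x) + (1 / (1 - \<sigma>)) powr p * enn2real (Q x)))"
     by (rule ennreal_leI)
    also have "\<dots> = M x"
     using elim(4,5) by (simp add: M_def ennreal_mult ennreal_plus less_top)
    finally show ?thesis .
   qed
   then show ?case using chain1 chain2 by (simp add: \<psi>_def)
  qed
  have "cont_rep (insert l I) f \<psi>"
   unfolding cont_rep_def
  proof (intro conjI ballI)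
   show "AE x in L. continuous_on (pts (insert l I)) (%y. \<psi> y x)"
    using good by eventually_elim simp
   fix y assume y: "y \<in> pts (insert l I)"
   have yq: "y(l := q) \<in> pts (insert l I)" if "q \<in> closure D" for q
    using that y by (auto simp: PiE_iff extensional_def)
   define u where "u n x = (\<Sum>q\<in>G n. w n q (y l) * f (y(l := q)) x)" for n x
   have fy: "f y \<in> LP" using Lp_continuousD[OF fc y] .
   have fyq: "f (y(l := q)) \<in> LP" if "q \<in> G n" for q n using Lp_continuousD[OF fc yq[OF Gcl[OF that]]] .
   have u_Lp: "u n \<in> LP" for n
    unfolding u_def by (intro Lp_sum Lp_scale fyq)
   have "AE x in L. \<forall>q\<in>U. \<Psi> q (y(l := undefined)) x = f (y(l := q)) x"
    unfolding AE_ball_countable[OF U(1)]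
   proof
    fix q assume "q \<in> U"
    then have "AE x in L. \<Psi> q (y(l := undefined)) x = f ((y(l := undefined))(l := q)) x"
     by (rule \<Psi>(1)[OF U(2), unfolded cont_rep_def, THEN conjunct1, THEN bspec, OF _ proj(1)[OF y]])
    then show "AE x in L. \<Psi> q (y(l := undefined)) x = f (y(l := q)) x" by simp
   qed
   with good have conv: "AE x in L. (%n. u n x) \<longlonglongrightarrow> \<psi> y x"
   proof eventually_elim
    case (elim x)
    have "u n x = P x n y" for n
     unfolding u_def P_def using elim(2) U(3) by (intro sum.cong) auto
    then show ?case using elim(1) y by simp
   qed
   \<comment> \<open>The averages of the sections converge to f y in the mean, by continuity of f at
     y, and to \<psi> y a.e.; the two limits then agree a.e., so \<psi> represents f.\<close>
   have "(%n. nrm (%x. u n x - f y x)) \<longlonglongrightarrow> 0"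
   proof (rule LIMSEQ_I)
    fix r :: real assume "r > 0"
    then have r2: "r / 2 > 0" by simp
    obtain \<delta> where \<delta>: "\<delta> > 0" "!!z. z \<in> pts (insert l I) ==> (\<forall>i\<in>insert l I. dist (z i) (y i) < \<delta>) ==> nrm (%x. f z x - f y x) < r / 2"
     using fc y r2 unfolding Lp_continuous_def by meson
    obtain n0 where n0: "(1/2) ^ n0 < \<delta> / 2" using real_arch_pow_inv[of "\<delta>/2" "1/2"] \<delta>(1) by auto
    have "nrm (%x. u n x - f y x) < r" if "n \<ge> n0" for n
    proof -
     have e: "(%x. u n x - f y x) = (%x. \<Sum>q\<in>G n. w n q (y l) * (f (y(l := q)) x - f y x))"
      using w(3)[OF proj(2)[OF y], of n]
      by (simp add: u_def right_diff_distrib sum_subtractf sum_distrib_right[symmetric])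
     have "nrm (%x. u n x - f y x) <= (\<Sum>q\<in>G n. nrm (%x. w n q (y l) * (f (y(l := q)) x - f y x)))"
      unfolding e by (intro Lp_norm_sum Lp_scale Lp_diff fyq fy)
     also have "\<dots> <= (\<Sum>q\<in>G n. w n q (y l) * (r / 2))"
     proof (rule sum_mono)
      fix q assume q: "q \<in> G n"
      show "nrm (%x. w n q (y l) * (f (y(l := q)) x - f y x)) <= w n q (y l) * (r / 2)"
      proof (cases "w n q (y l) = 0")
       case False
       have "dist (y l) q < 2 * (1/2) ^ n" using w(4)[OF False] by (simp add: power_one_over)
       also have "\<dots> <= 2 * (1/2) ^ n0" using that by (intro mult_left_mono power_decreasing) auto
       finally have "dist q (y l) < \<delta>" using n0 by (simp add: dist_commute)
       then have "nrm (%x. f (y(l := q)) x - f y x) < r / 2"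
        using \<delta>(1) by (intro \<delta>(2) yq Gcl[OF q]) auto
       then show ?thesis using w(2)[of n q "y l"] unfolding Lp_norm_scale
        by (simp only: abs_of_nonneg mult_left_mono less_imp_le)
      qed simp
     qed
     also have "\<dots> = r / 2"
      unfolding sum_distrib_right[symmetric] w(3)[OF proj(2)[OF y], of n] by simp
     finally show ?thesis using \<open>r > 0\<close> by linarith
    qed
    then show "\<exists>no. \<forall>n\<ge>no. norm (nrm (%x. u n x - f y x) - 0) < r"
     by (intro exI[of _ n0]) simp
   qed
   from AE_lim_eq_Lp_lim[OF u_Lp fy conv this] show "AE x in L. \<psi> y x = f y x" .
  qed
  moreover have "AE x in L. \<forall>y\<in>pts (insert l I). ennreal (\<bar>\<psi> y x\<bar> powr p) <= M x"
   using good by eventually_elim simp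
  ultimately show "\<exists>\<psi> M. cont_rep (insert l I) f \<psi> & M \<in> borel_measurable L & (\<integral>\<^sup>+x. M x \<partial>L) <= ennreal (K * B powr p) \<and>
    (AE x in L. \<forall>y\<in>pts (insert l I). ennreal (\<bar>\<psi> y x\<bar> powr p) <= M x)"
   using M_meas M_int by blast
 qed
qed

text \<open>Induction over the variables. The majorant M, uniform in y, is part of the statement
  because the chain in the next variable sums such majorants. Its integral is bounded by a multiple
  of B^p, so small increments have small majorants.\<close>

theorem cont_rep_exists:
 fixes \<gamma> :: real
 assumes \<gamma>: "0 < \<gamma>" "2 * real CARD('d) / \<gamma> < p" and I: "finite I"
 shows "\<exists>K\<ge>0. \<forall>B f. 0 <= B --> Lp_continuous I f --> mixed_holder I \<gamma> B f -->
   (\<exists>\<psi> M. cont_rep I f \<psi> & M \<in> borel_measurable L & (\<integral>\<^sup>+x. M x \<partial>L) <= ennreal (K * B powr p) \<and>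
    (AE x in L. \<forall>y\<in>pts I. ennreal (\<bar>\<psi> y x\<bar> powr p) <= M x))"
 using I
proof induction
 case empty
 show ?case
 proof (intro exI[of _ 1] conjI allI impI)
  fix B :: real and f
  assume B: "0 <= B" and fc: "Lp_continuous {} f" and fm: "mixed_holder {} \<gamma> B f"
  let ?u = "%_::nat. undefined :: real^'d"
  have u: "f ?u \<in> LP" using fc by (simp add: Lp_continuous_def)
  have "mdiff {} (%_. 0) f ?u = f ?u" by (rule ext) simp
  then have "nrm (f ?u) <= B"
   using fm by (auto simp: mixed_holder_def)
  then have "nrm (f ?u) powr p <= B powr p" using p_pos by (intro powr_mono2) auto
  then have "(\<integral>\<^sup>+x. ennreal (\<bar>f ?u x\<bar> powr p) \<partial>L) <= ennreal (1 * B powr p)"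
   using nn_integral_Lp[OF u] by (simp add: ennreal_leI)
  moreover have "cont_rep {} f f" by (simp add: cont_rep_def)
  moreover have "(%x. ennreal (\<bar>f ?u x\<bar> powr p)) \<in> borel_measurable L" using Lp_measurable[OF u] by measurable
  ultimately show "\<exists>\<psi> M. cont_rep {} f \<psi> & M \<in> borel_measurable L & (\<integral>\<^sup>+x. M x \<partial>L) <= ennreal (1 * B powr p) \<and>
    (AE x in L. \<forall>y\<in>pts {}. ennreal (\<bar>\<psi> y x\<bar> powr p) <= M x)"
   by (intro exI[of _ f] exI[of _ "%x. ennreal (\<bar>f ?u x\<bar> powr p)"]) simp
 qed simp
next
 case (insert l I)
 then obtain K0 where K0: "K0 \<ge> 0" "!!B f. 0 <= B ==> Lp_continuous I f ==> mixed_holder I \<gamma> B f ==>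
   (\<exists>\<psi> M. cont_rep I f \<psi> & M \<in> borel_measurable L & (\<integral>\<^sup>+x. M x \<partial>L) <= ennreal (K0 * B powr p) \<and>
    (AE x in L. \<forall>y\<in>pts I. ennreal (\<bar>\<psi> y x\<bar> powr p) <= M x))" by blast
 show ?case by (rule cont_rep_exists_insert[OF \<gamma> insert.hyps K0])
qed

end

context Sobolev_domain
begin

subsection \<open>Calculus in the mean\<close>

lemma Lp_quotient_deriv:
 assumes lim: "((%t. nrm (%x. (E t x - e x) / t - e' x)) \<longlongrightarrow> 0) (at 0)"
  and E0: "E 0 = e" and "\<epsilon> > 0"
 shows "\<exists>d>0. \<forall>t. \<bar>t\<bar> < d --> nrm (%x. E t x - e x - t * e' x) <= \<epsilon> * \<bar>t\<bar>"
proof -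
 have "\<forall>\<^sub>F t in at 0. nrm (%x. (E t x - e x) / t - e' x) < \<epsilon>"
  using order_tendstoD(2)[OF lim \<open>\<epsilon> > 0\<close>] .
 then obtain d where d: "d > 0" "!!t. t ~= 0 ==> dist t 0 < d ==> nrm (%x. (E t x - e x) / t - e' x) < \<epsilon>"
  unfolding eventually_at by auto
 show ?thesis
 proof (intro exI[of _ d] conjI d(1) allI impI)
  fix t :: real assume t: "\<bar>t\<bar> < d"
  show "nrm (%x. E t x - e x - t * e' x) <= \<epsilon> * \<bar>t\<bar>"
  proof (cases "t = 0")
   case False
   then have "(%x. E t x - e x - t * e' x) = (%x. t * ((E t x - e x) / t - e' x))"
    by (auto simp: field_simps)
   then have "nrm (%x. E t x - e x - t * e' x) = \<bar>t\<bar> * nrm (%x. (E t x - e x) / t - e' x)"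
    by (simp only: Lp_norm_scale)
   also have "\<dots> <= \<bar>t\<bar> * \<epsilon>" using d(2)[OF False] t by (intro mult_left_mono) auto
   finally show ?thesis by (simp add: mult.commute)
  qed (simp add: E0)
 qed
qed

text \<open>Bisection replaces the duality or integration argument that is usual for the mean value inequality.\<close>

lemma Lp_mvt:
 fixes E E' :: "real => real^'d => real"
 assumes "a <= b" and E: "!!\<tau>. a <= \<tau> ==> \<tau> <= b ==> E \<tau> \<in> LP" and E': "!!\<tau>. a <= \<tau> ==> \<tau> <= b ==> E' \<tau> \<in> LP"
  and c: "c \<in> LP" and k: "!!\<tau>. a <= \<tau> ==> \<tau> <= b ==> nrm (%x. E' \<tau> x - c x) <= \<kappa>"
  and d: "!!\<tau> \<epsilon>. a <= \<tau> ==> \<tau> <= b ==> \<epsilon> > 0 ==>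
   \<exists>d>0. \<forall>t. \<bar>t\<bar> < d --> nrm (%x. E (\<tau> + t) x - E \<tau> x - t * E' \<tau> x) <= \<epsilon> * \<bar>t\<bar>"
 shows "nrm (%x. E b x - E a x - (b - a) * c x) <= \<kappa> * (b - a)"
proof (rule field_le_epsilon)
 fix e :: real assume "e > 0"
 define \<epsilon> where "\<epsilon> = e / (b - a + 1)"
 have \<epsilon>: "\<epsilon> > 0" using \<open>e > 0\<close> \<open>a <= b\<close> by (simp add: \<epsilon>_def)
 define P where "P s t \<longleftrightarrow> (a <= s & t <= b --> nrm (%x. E t x - E s x - (t - s) * c x) <= (\<kappa> + \<epsilon>) * (t - s))" for s t
 have Lpi: "(%x. E t x - E s x - r * c x) \<in> LP" if "a <= s" "s <= b" "a <= t" "t <= b" for s t r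
  using that by (intro Lp_diff Lp_scale E c) auto
 have "P a b"
  using \<open>a <= b\<close>
 proof (induction rule: Bolzano)
  case (trans r s t)
  show ?case
   unfolding P_def
  proof
   assume rt: "a <= r & t <= b"
   have "nrm (%x. E t x - E r x - (t - r) * c x)
     = nrm (%x. (E s x - E r x - (s - r) * c x) + (E t x - E s x - (t - s) * c x))"
    by (rule arg_cong[where f="nrm"]) (auto simp: algebra_simps)
   also have "\<dots> <= nrm (%x. E s x - E r x - (s - r) * c x) + nrm (%x. E t x - E s x - (t - s) * c x)"
    using rt trans(3,4) by (intro Lp_norm_triangle Lpi) auto
   also have "\<dots> <= (\<kappa> + \<epsilon>) * (s - r) + (\<kappa> + \<epsilon>) * (t - s)"
    using trans rt unfolding P_def by (intro add_mono) auto
   finally show "nrm (%x. E t x - E r x - (t - r) * c x) <= (\<kappa> + \<epsilon>) * (t - r)"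
    by (simp add: algebra_simps)
  qed
 next
  case (local \<tau>)
  obtain d where dd: "d > 0" "!!t. \<bar>t\<bar> < d ==> nrm (%x. E (\<tau> + t) x - E \<tau> x - t * E' \<tau> x) <= \<epsilon> * \<bar>t\<bar>"
   using d[OF local \<epsilon>] by auto
  show ?case
  proof (intro exI[of _ d] conjI dd(1) allI impI)
   fix s t assume st: "s <= \<tau> & \<tau> <= t & t - s < d"
   show "P s t"
    unfolding P_def
   proof
    assume ab: "a <= s & t <= b"
    have m: "(%x. E r x - E \<tau> x - u * E' \<tau> x) \<in> LP" if "a <= r" "r <= b" for r u
     using that local by (intro Lp_diff Lp_scale E E') auto
    have kk: "0 <= \<kappa>" using k[OF local] Lp_norm_nonneg order_trans by blast
    have 1: "nrm (%x. E t x - E \<tau> x - (t - \<tau>) * E' \<tau> x) <= \<epsilon> * (t - \<tau>)"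
     using dd(2)[of "t - \<tau>"] st by simp
    have 2: "nrm (%x. E s x - E \<tau> x - (s - \<tau>) * E' \<tau> x) <= \<epsilon> * (\<tau> - s)"
     using dd(2)[of "s - \<tau>"] st by simp
    have 3: "nrm (%x. (t - s) * (E' \<tau> x - c x)) <= \<kappa> * (t - s)"
    proof -
     have "(t - s) * nrm (%x. E' \<tau> x - c x) <= (t - s) * \<kappa>"
      using k[OF local] st by (intro mult_left_mono) auto
     then show ?thesis using st by (simp add: Lp_norm_scale mult.commute[of \<kappa>])
    qed
    have "nrm (%x. E t x - E s x - (t - s) * c x)
     = nrm (%x. ((E t x - E \<tau> x - (t - \<tau>) * E' \<tau> x) - (E s x - E \<tau> x - (s - \<tau>) * E' \<tau> x)) + (t - s) * (E' \<tau> x - c x))"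
     by (rule arg_cong[where f="nrm"]) (auto simp: algebra_simps)
    also have "\<dots> <= nrm (%x. (E t x - E \<tau> x - (t - \<tau>) * E' \<tau> x) - (E s x - E \<tau> x - (s - \<tau>) * E' \<tau> x))
      + nrm (%x. (t - s) * (E' \<tau> x - c x))"
     using ab st local by (intro Lp_norm_triangle Lp_diff[OF m m] Lp_scale Lp_diff E' c) auto
    also have "\<dots> <= (nrm (%x. E t x - E \<tau> x - (t - \<tau>) * E' \<tau> x) + nrm (%x. E s x - E \<tau> x - (s - \<tau>) * E' \<tau> x))
      + nrm (%x. (t - s) * (E' \<tau> x - c x))"
     using ab st local by (intro add_right_mono Lp_norm_triangle_diff m) auto
    also have "\<dots> <= (\<epsilon> * (t - \<tau>) + \<epsilon> * (\<tau> - s)) + \<kappa> * (t - s)" using 1 2 3 by linarith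
    finally show "nrm (%x. E t x - E s x - (t - s) * c x) <= (\<kappa> + \<epsilon>) * (t - s)"
     by (simp add: algebra_simps)
   qed
  qed
 qed
 then have "nrm (%x. E b x - E a x - (b - a) * c x) <= (\<kappa> + \<epsilon>) * (b - a)" using \<open>a <= b\<close> by (simp add: P_def)
 also have "\<dots> <= \<kappa> * (b - a) + e"
 proof -
  have "\<epsilon> * (b - a) <= \<epsilon> * (b - a + 1)" using \<epsilon> by (intro mult_left_mono) auto
  also have "\<dots> = e" using \<open>a <= b\<close> by (simp add: \<epsilon>_def)
  finally show ?thesis by (simp add: distrib_right)
 qed
 finally show "nrm (%x. E b x - E a x - (b - a) * c x) <= \<kappa> * (b - a) + e" .
qed

subsection \<open>Restriction to the diagonal\<close>

text \<open>All variables that are to be identified with x are set equal to one point s before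
  anything else. The trace is then the diagonal s = x of a family in a single variable, described by
  this predicate and \<open>rep1\<close>.\<close>

definition holder_Lp :: "real => real => (real^'d => real^'d => real) => bool" where
 "holder_Lp \<gamma> B F \<longleftrightarrow> (\<forall>s\<in>closure D. F s \<in> LP & nrm (F s) <= B) \<and>
   (\<forall>s\<in>closure D. \<forall>t\<in>closure D. nrm (%x. F t x - F s x) <= B * norm (t - s) powr \<gamma>)"

definition rep1 :: "(real^'d => real^'d => real) => (real^'d => real^'d => real) => bool" where
 "rep1 F \<psi> \<longleftrightarrow> (\<forall>s\<in>closure D. AE x in L. \<psi> s x = F s x) & (AE x in L. continuous_on (closure D) (%s. \<psi> s x))"

text \<open>The single variable s is stored at the index 0. Evaluation at 0 and the embedding of s
  as a point over {0} are both continuous, so the two notions of continuity agree.\<close>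

lemma rep1_iff_cont_rep: "rep1 F \<psi> \<longleftrightarrow> cont_rep {0} (%y. F (y 0)) (%y. \<psi> (y 0))"
proof -
 let ?e = "%s. (%l::nat. if l = 0 then s else undefined) :: nat => real^'d"
 have e: "?e s \<in> pts {0}" if "s \<in> closure D" for s using that by (auto simp: PiE_iff extensional_def)
 have c1: "continuous_on (pts {0}) (%y. y 0)"
  by (rule continuous_on_product_then_coordinatewise[OF continuous_on_id])
 have c2: "continuous_on (closure D) ?e"
 proof (rule continuous_on_coordinatewise_then_product)
  show "continuous_on (closure D) (%s. ?e s i)" for i by (cases "i = 0") (auto intro: continuous_intros)
 qed
 have "continuous_on (closure D) (%s. g s) \<longleftrightarrow> continuous_on (pts {0}) (%y. g (y 0))" for g :: "real^'d => real"
 proof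
  assume "continuous_on (closure D) (%s. g s)"
  then show "continuous_on (pts {0}) (%y. g (y 0))"
   by (rule continuous_on_compose2[OF _ c1]) auto
 next
  assume "continuous_on (pts {0}) (%y. g (y 0))"
  then have "continuous_on (closure D) (%s. g (?e s 0))"
   by (rule continuous_on_compose2[OF _ c2]) (use e in auto)
  then show "continuous_on (closure D) (%s. g s)" by simp
 qed
 moreover have "(\<forall>s\<in>closure D. Q s) \<longleftrightarrow> (\<forall>y\<in>pts {0}. Q (y 0))" for Q
 proof
  assume "\<forall>s\<in>closure D. Q s"
  then show "\<forall>y\<in>pts {0}. Q (y 0)" by (auto simp: PiE_iff)
 next
  assume a: "\<forall>y\<in>pts {0}. Q (y 0)"
  show "\<forall>s\<in>closure D. Q s"
  proof
   fix s assume "s \<in> closure D"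
   from bspec[OF a e[OF this]] show "Q s" by simp
  qed
 qed
 ultimately show ?thesis unfolding rep1_def cont_rep_def by (simp only:)
qed

lemma holder_Lp_D:
 assumes "holder_Lp \<gamma> B F" "s \<in> closure D"
 shows "F s \<in> LP" "nrm (F s) <= B"
 using assms by (auto simp: holder_Lp_def)

lemma holder_Lp_diff_le:
 assumes "holder_Lp \<gamma> B F" "s \<in> closure D" "t \<in> closure D"
 shows "nrm (%x. F t x - F s x) <= B * norm (t - s) powr \<gamma>"
 using assms by (auto simp: holder_Lp_def)

text \<open>The chaining theorem for the index set {0}. The majorant is claimed for every
  representative, since any two of them agree in all s off one null set.\<close>

lemma rep1_exists_bound:
 assumes \<gamma>: "0 < \<gamma>" "2 * real CARD('d) / \<gamma> < p"
 shows "\<exists>K\<ge>0. \<forall>B F. 0 <= B --> holder_Lp \<gamma> B F --> (\<exists>\<psi>. rep1 F \<psi>) \<and>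
  (\<forall>\<psi>. rep1 F \<psi> --> (\<exists>M. M \<in> borel_measurable L & (\<integral>\<^sup>+x. M x \<partial>L) <= ennreal (K * B powr p) \<and>
    (AE x in L. \<forall>s\<in>closure D. ennreal (\<bar>\<psi> s x\<bar> powr p) <= M x)))"
proof -
 obtain K where K: "K \<ge> 0" "!!B f. 0 <= B ==> Lp_continuous {0} f ==> mixed_holder {0} \<gamma> B f ==>
   (\<exists>\<psi> M. cont_rep {0} f \<psi> & M \<in> borel_measurable L & (\<integral>\<^sup>+x. M x \<partial>L) <= ennreal (K * B powr p) \<and>
    (AE x in L. \<forall>y\<in>pts {0}. ennreal (\<bar>\<psi> y x\<bar> powr p) <= M x))"
  using cont_rep_exists[OF \<gamma>, of "{0}"] by blast
 let ?e = "%s. (%l::nat. if l = 0 then s else undefined) :: nat => real^'d"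
 have e: "?e s \<in> pts {0}" if "s \<in> closure D" for s using that by (auto simp: PiE_iff extensional_def)
 have e': "?e (y 0) = y" if "y \<in> pts {0}" for y using that by (auto simp: PiE_iff extensional_def fun_eq_iff)
 show ?thesis
 proof (intro exI[of _ K] conjI K(1) allI impI)
  fix B F assume B: "0 <= B" and F: "holder_Lp \<gamma> B F"
  define f where "f y = F (y 0)" for y :: "nat => real^'d"
  have fc: "Lp_continuous {0} f"
   unfolding Lp_continuous_def
  proof (intro ballI conjI allI impI)
   fix y assume y: "y \<in> pts {0}"
   then have y0: "y 0 \<in> closure D" by auto
   then show "f y \<in> LP" using holder_Lp_D[OF F] by (simp add: f_def)
   fix \<epsilon> :: real assume e: "\<epsilon> > 0"
   \<comment> \<open>The denominator B + 1 covers the case B = 0.\<close>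
   define \<delta> where "\<delta> = (\<epsilon> / (B + 1)) powr (1 / \<gamma>)"
   have \<delta>: "\<delta> > 0" using e B by (simp add: \<delta>_def)
   show "\<exists>\<delta>>0. \<forall>z\<in>pts {0}. (\<forall>l\<in>{0}. dist (z l) (y l) < \<delta>) --> nrm (%x. f z x - f y x) < \<epsilon>"
   proof (intro exI[of _ \<delta>] conjI \<delta> ballI impI)
    fix z assume z: "z \<in> pts {0}" "\<forall>l\<in>{0}. dist (z l) (y l) < \<delta>"
    have z0: "z 0 \<in> closure D" using z(1) by auto
    have "nrm (%x. f z x - f y x) <= B * norm (z 0 - y 0) powr \<gamma>"
     unfolding f_def by (rule holder_Lp_diff_le[OF F y0 z0])
    also have "\<dots> <= B * \<delta> powr \<gamma>"
     using z(2) B \<gamma> by (intro mult_left_mono powr_mono2) (auto simp: dist_norm)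
    also have "\<dots> = B * (\<epsilon> / (B + 1))" using \<gamma> e B by (simp add: \<delta>_def powr_powr)
    also have "\<dots> < \<epsilon>" using e B by (simp add: field_simps)
    finally show "nrm (%x. f z x - f y x) < \<epsilon>" .
   qed
  qed
  have fm: "mixed_holder {0} \<gamma> B f"
   unfolding mixed_holder_def
  proof (intro allI impI ballI)
   fix A y h assume A: "A \<subseteq> {0::nat}" and y: "y \<in> pts {0}" and h: "\<forall>l\<in>A. y l + h l \<in> closure D"
   have y0: "y 0 \<in> closure D" using y by auto
   consider "A = {}" | "A = {0}" using A by blast
   then show "nrm (mdiff A h f y) <= B * (\<Prod>l\<in>A. norm (h l) powr \<gamma>)"
   proof cases
    case 1
    have "mdiff A h f y = F (y 0)" using 1 by (intro ext) (simp add: f_def)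
    then show ?thesis using holder_Lp_D[OF F y0] 1 by simp
   next
    case 2
    have "mdiff A h f y = (%x. F (y 0 + h 0) x - F (y 0) x)"
     using 2 by (intro ext) (simp add: f_def mdiff_insert)
    then show ?thesis using holder_Lp_diff_le[OF F y0, of "y 0 + h 0"] h 2 by simp
   qed
  qed
  obtain \<psi>0 M where M: "cont_rep {0} f \<psi>0" "M \<in> borel_measurable L" "(\<integral>\<^sup>+x. M x \<partial>L) <= ennreal (K * B powr p)"
    "AE x in L. \<forall>y\<in>pts {0}. ennreal (\<bar>\<psi>0 y x\<bar> powr p) <= M x"
   using K(2)[OF B fc fm] by blast
  have "cont_rep {0} f (%y. \<psi>0 (?e (y 0)))"
   using M(1) e' unfolding cont_rep_def by (simp cong: continuous_on_cong)
  then have "rep1 F (%s. \<psi>0 (?e s))" unfolding rep1_iff_cont_rep f_def .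
  then show "\<exists>\<psi>. rep1 F \<psi>" by blast
  fix \<psi> assume "rep1 F \<psi>"
  then have "cont_rep {0} f (%y. \<psi> (y 0))" unfolding rep1_iff_cont_rep f_def .
  from cont_rep_AE_unique[OF _ this M(1)]
  have "AE x in L. \<forall>y\<in>pts {0}. \<psi> (y 0) x = \<psi>0 y x" by simp
  with M(4) have "AE x in L. \<forall>s\<in>closure D. ennreal (\<bar>\<psi> s x\<bar> powr p) <= M x"
  proof eventually_elim
   case (elim x)
   show ?case
   proof
    fix s assume "s \<in> closure D"
    from bspec[OF elim(1) e[OF this]] bspec[OF elim(2) e[OF this]]
    show "ennreal (\<bar>\<psi> s x\<bar> powr p) <= M x" by simp
   qed
  qed
  with M(2,3) show "\<exists>M. M \<in> borel_measurable L & (\<integral>\<^sup>+x. M x \<partial>L) <= ennreal (K * B powr p) \<and>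
    (AE x in L. \<forall>s\<in>closure D. ennreal (\<bar>\<psi> s x\<bar> powr p) <= M x)" by blast
 qed
qed

text \<open>Writes \<psi> as a limit of finite sums of products of a continuous function of s and a
  function of x, for all s at once off one null set of x. This form yields measurability of the
  diagonal and of the function of the pair (x, s).\<close>

lemma rep1_approx:
 assumes r: "rep1 F \<psi>"
 obtains G :: "nat => (real^'d) set" and w :: "nat => real^'d => real^'d => real" where
  "!!n. finite (G n)" "!!n. G n \<subseteq> closure D" "!!n q. continuous_on (closure D) (w n q)"
  "AE x in L. \<forall>s\<in>closure D. (%n. \<Sum>q\<in>G n. w n q s * F q x) \<longlonglongrightarrow> \<psi> s x"
proof -
 obtain G where G: "!!i. finite (G i)" "!!i. G i \<subseteq> D"
  "!!i y. y \<in> closure D ==> \<exists>q\<in>G i. dist y q < 1 / 2 ^ i"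
  using finite_nets[OF bounded_D] by metis
 have Gcl: "G i \<subseteq> closure D" for i using G(2)[of i] closure_subset[of D] by (rule order_trans)
 have "\<exists>w :: real^'d => real^'d => real. (\<forall>q. continuous_on (closure D) (w q)) & (\<forall>q y. 0 <= w q y) \<and>
   (\<forall>y\<in>closure D. (\<Sum>q\<in>G i. w q y) = 1) & (\<forall>q y. w q y ~= 0 --> dist y q < 2 * (1 / 2 ^ i))" for i
 proof -
  obtain v :: "real^'d => real^'d => real" where "!!q. continuous_on (closure D) (v q)" "!!q y. 0 <= v q y"
   "!!y. y \<in> closure D ==> (\<Sum>q\<in>G i. v q y) = 1" "!!q y. v q y ~= 0 ==> dist y q < 2 * (1 / 2 ^ i)"
   using partition_of_unity_net[OF G(1)[of i] G(3)] by metis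
  then show ?thesis by (intro exI[of _ v] conjI allI ballI impI)
 qed
 then obtain w :: "nat => real^'d => real^'d => real" where w: "!!i q. continuous_on (closure D) (w i q)" "!!i q y. 0 <= w i q y"
   "!!i y. y \<in> closure D ==> (\<Sum>q\<in>G i. w i q y) = 1" "!!i q y. w i q y ~= 0 ==> dist y q < 2 * (1 / 2 ^ i)"
  by metis
 have U: "countable (\<Union>i. G i)" using G(1) by (auto intro: countable_finite)
 have "AE x in L. \<forall>q\<in>(\<Union>i. G i). \<psi> q x = F q x"
  unfolding AE_ball_countable[OF U]
 proof
  fix q assume "q \<in> (\<Union>i. G i)"
  then have "q \<in> closure D" using Gcl by blast
  with r show "AE x in L. \<psi> q x = F q x" unfolding rep1_def by (elim conjE) (erule bspec)
 qed
 moreover have "AE x in L. continuous_on (closure D) (%s. \<psi> s x)" using r by (simp add: rep1_def)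
 ultimately have "AE x in L. \<forall>s\<in>closure D. (%n. \<Sum>q\<in>G n. w n q s * F q x) \<longlonglongrightarrow> \<psi> s x"
 proof eventually_elim
  case (elim x)
  show ?case
  proof
   fix s assume s: "s \<in> closure D"
   show "(%n. \<Sum>q\<in>G n. w n q s * F q x) \<longlonglongrightarrow> \<psi> s x"
   proof (rule LIMSEQ_I)
    fix e :: real assume "e > 0"
    then have e2: "e / 2 > 0" by simp
    obtain d where d: "d > 0" "!!t. t \<in> closure D ==> dist t s < d ==> dist (\<psi> t x) (\<psi> s x) < e / 2"
     using elim(2) s e2 unfolding continuous_on_iff by meson
    obtain n0 where n0: "(1/2) ^ n0 < d / 2" using real_arch_pow_inv[of "d/2" "1/2"] d(1) by auto
    have "norm ((\<Sum>q\<in>G n. w n q s * F q x) - \<psi> s x) < e" if n: "n \<ge> n0" for n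
    proof -
     have "(\<Sum>q\<in>G n. w n q s * F q x) - \<psi> s x = (\<Sum>q\<in>G n. w n q s * (\<psi> q x - \<psi> s x))"
     proof -
      have "(\<Sum>q\<in>G n. w n q s * F q x) = (\<Sum>q\<in>G n. w n q s * \<psi> q x)"
       using elim(1) by (intro sum.cong) auto
      then show ?thesis
       unfolding right_diff_distrib sum_subtractf sum_distrib_right[symmetric] w(3)[OF s] by simp
     qed
     also have "\<bar>\<dots>\<bar> <= e / 2"
     proof (rule convex_sum_abs_le[OF w(2) w(3)[OF s]])
      fix q assume q: "q \<in> G n" "w n q s ~= 0"
      have "dist s q < 2 * (1/2) ^ n" using w(4)[OF q(2)] by (simp add: power_one_over)
      also have "\<dots> <= 2 * (1/2) ^ n0" using n by (intro mult_left_mono power_decreasing) auto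
      finally have "dist q s < d" using n0 by (simp add: dist_commute)
      then show "\<bar>\<psi> q x - \<psi> s x\<bar> <= e / 2" using d(2)[of q] q(1) Gcl[of n] by (auto simp: dist_norm)
     qed
     finally show ?thesis using \<open>e > 0\<close> by simp
    qed
    then show "\<exists>no. \<forall>n\<ge>no. norm ((\<Sum>q\<in>G n. w n q s * F q x) - \<psi> s x) < e" by blast
   qed
  qed
 qed
 from that[OF G(1) Gcl w(1) this] show ?thesis .
qed

lemma continuous_on_closure_measurable:
 fixes g :: "real^'d => real"
 assumes "continuous_on (closure D) g"
 shows "g \<in> borel_measurable L"
proof -
 have "continuous_on D g" using assms closure_subset[of D] by (rule continuous_on_subset)
 then show ?thesis using D_sets by (rule continuous_imp_measurable_on_sets_lebesgue)
qed

text \<open>For a.e. x the value at s = x is among those dominated by the majorant, so the p-th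
  power of the diagonal has integral at most that of M. Measurability comes from the approximating
  sums evaluated at s = x.\<close>

lemma diag_bound:
 assumes \<gamma>: "0 < \<gamma>" "2 * real CARD('d) / \<gamma> < p"
 shows "\<exists>K\<ge>0. \<forall>B F \<psi>. 0 <= B --> holder_Lp \<gamma> B F --> rep1 F \<psi> -->
  (%x. \<psi> x x) \<in> LP & nrm (%x. \<psi> x x) <= K * B"
proof -
 obtain K where K: "K \<ge> 0" "!!B F \<psi>. 0 <= B ==> holder_Lp \<gamma> B F ==> rep1 F \<psi> ==> (\<exists>M. M \<in> borel_measurable L & (\<integral>\<^sup>+x. M x \<partial>L) <= ennreal (K * B powr p) \<and>
    (AE x in L. \<forall>s\<in>closure D. ennreal (\<bar>\<psi> s x\<bar> powr p) <= M x))"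
  using rep1_exists_bound[OF \<gamma>] by blast
 show ?thesis
 proof (intro exI[of _ "K powr (1/p)"] allI impI conjI[of "0 <= K powr (1/p)"])
  fix B F \<psi> assume B: "0 <= B" and F: "holder_Lp \<gamma> B F" and r: "rep1 F \<psi>"
  obtain M where M: "M \<in> borel_measurable L" "(\<integral>\<^sup>+x. M x \<partial>L) <= ennreal (K * B powr p)"
    "AE x in L. \<forall>s\<in>closure D. ennreal (\<bar>\<psi> s x\<bar> powr p) <= M x"
   using K(2)[OF B F r] by blast
  obtain G :: "nat => (real^'d) set" and w where
   G: "!!n. finite (G n)" "!!n. G n \<subseteq> closure D" and w: "!!n q. continuous_on (closure D) (w n q)"
   and lim: "AE x in L. \<forall>s\<in>closure D. (%n. \<Sum>q\<in>G n. w n q s * F q x) \<longlonglongrightarrow> \<psi> s x"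
   by (rule rep1_approx[OF r]) (rule that, assumption+)
  define g where "g x = lim (%n. \<Sum>q\<in>G n. w n q x * F q x)" for x
  have "(%x. \<Sum>q\<in>G n. w n q x * F q x) \<in> borel_measurable L" for n
   using holder_Lp_D(1)[OF F] G(2)[of n]
   by (intro borel_measurable_sum borel_measurable_times continuous_on_closure_measurable[OF w] Lp_measurable) auto
  then have gm: "g \<in> borel_measurable L" unfolding g_def by (rule borel_measurable_lim_metric)
  have D: "AE x in L. x \<in> D" by (rule AE_I2) simp
  with lim have eq: "AE x in L. \<psi> x x = g x"
  proof eventually_elim
   case (elim x)
   have "x \<in> closure D" using elim(2) closure_subset[of D] by blast
   then show ?case using elim(1) limI[of "%n. \<Sum>q\<in>G n. w n q x * F q x" "\<psi> x x"] by (simp add: g_def)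
  qed
  have "AE x in L. ennreal (\<bar>g x\<bar> powr p) <= M x"
   using eq D M(3)
  proof eventually_elim
   case (elim x)
   have "x \<in> closure D" using elim(2) closure_subset[of D] by blast
   then show ?case using elim(1,3) by metis
  qed
  then have "(\<integral>\<^sup>+x. ennreal (\<bar>g x\<bar> powr p) \<partial>L) <= (\<integral>\<^sup>+x. M x \<partial>L)" by (rule nn_integral_mono_AE)
  also have "\<dots> <= ennreal ((K powr (1/p) * B) powr p)"
   using M(2) K(1) B p_pos by (simp add: powr_mult powr_powr)
  finally have g: "g \<in> LP" "nrm g <= K powr (1/p) * B"
   using Lp_normI[OF gm, of "K powr (1/p) * B"] B by auto
  have d: "(%x. \<psi> x x) \<in> LP" by (rule Lp_cong_AE[OF g(1) eq])
  have "nrm (%x. \<psi> x x) = nrm g"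
   by (rule Lp_norm_cong_AE[OF eq Lp_measurable[OF d] gm])
  then show "(%x. \<psi> x x) \<in> LP & nrm (%x. \<psi> x x) <= K powr (1/p) * B"
   using g(2) d by simp
 qed simp
qed

end

subsection \<open>Mollification\<close>

text \<open>A kernel supported in the cube of half side r and not normalised; its integral is
  divided out in \<open>diag_mollify\<close>. Its symmetry turns x - s into s - x, which reduces
  integrals over s to translation invariance.\<close>

definition bump :: "real => real^'d => real" where
 "bump r z = box_bump 1 (- vec r) (vec r) z"

lemma bump_bounds: "0 <= bump r z" "bump r z <= 1"
 by (auto simp: bump_def box_bump_bounds)

lemma bump_nonzero_norm_le:
 fixes z :: "real^'d"
 assumes "bump r z ~= 0"
 shows "norm z <= real CARD('d) * r"
proof -
 have "bump r z > 0" using assms bump_bounds(1)[of r z] by linarith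
 then have "z \<in> box (- vec r) (vec r)" unfolding bump_def by (subst (asm) box_bump_pos_iff) auto
 then have "\<bar>z $ i\<bar> <= r" for i by (auto simp: mem_box_cart abs_le_iff less_imp_le dest: spec[of _ i])
 then have "norm z <= (\<Sum>i\<in>(UNIV::'d set). r)" by (intro order.trans[OF norm_le_l1_cart] sum_mono)
 then show ?thesis by simp
qed

lemma bump_minus: "bump r (x - y) = bump r (y - x)"
 unfolding bump_def box_bump_def by (intro prod.cong) (auto simp: algebra_simps)

lemma continuous_on_bump: "continuous_on A (bump r)"
 unfolding bump_def[abs_def] by (rule continuous_on_box_bump)

lemma bump_borel [measurable]: "bump r \<in> borel_measurable borel"
 by (intro borel_measurable_continuous_onI continuous_on_bump)

lemma integrable_bump: "integrable lborel (bump r :: real^'d => real)"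
proof -
 have "integrable lborel (%z :: real^'d. indicator (cball 0 (real CARD('d) * r)) z *\<^sub>R bump r z)"
  using continuous_on_bump by (intro borel_integrable_compact) auto
 moreover have "(%z. indicator (cball 0 (real CARD('d) * r)) z *\<^sub>R bump r z) = (bump r :: real^'d => real)"
 proof
  show "indicator (cball 0 (real CARD('d) * r)) z *\<^sub>R bump r z = bump r z" for z :: "real^'d"
   using bump_nonzero_norm_le[of r z] by (auto simp: indicator_def)
 qed
 ultimately show ?thesis by (simp only:)
qed

lemma integral_bump_pos:
 assumes "r > 0"
 shows "0 < (\<integral>z. bump r (z :: real^'d) \<partial>lborel)"
proof -
 have "(\<integral>z. bump r (z :: real^'d) \<partial>lborel) ~= 0"
 proof
  assume "(\<integral>z. bump r (z :: real^'d) \<partial>lborel) = 0"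
  then have "AE z :: real^'d in lborel. bump r z = 0"
   using integral_nonneg_eq_0_iff_AE[OF integrable_bump] bump_bounds by auto
  then have "AE z :: real^'d in lborel. z \<notin> box (- vec r) (vec r)"
  proof eventually_elim
   case (elim z)
   then show ?case using box_bump_pos_iff[of 1 "- vec r :: real^'d" "vec r" z] by (simp add: bump_def)
  qed
  then have "emeasure lborel (box (- vec r) (vec r) :: (real^'d) set) = 0"
   by (subst (asm) AE_iff_measurable[OF _ refl]) auto
  moreover have "box (- vec r) (vec r :: real^'d) ~= {}" 
  proof -
   have "(0 :: real^'d) \<in> box (- vec r) (vec r)" using assms by (simp add: mem_box_cart)
   then show ?thesis by blast
  qed
  ultimately show False
   using negligible_iff_null_sets[of "box (- vec r) (vec r :: real^'d)"] open_not_negligible[OF open_box]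
   by (auto simp: null_sets_def)
 qed
 moreover have "0 <= (\<integral>z. bump r (z :: real^'d) \<partial>lborel)"
  by (rule Bochner_Integration.integral_nonneg) (simp add: bump_bounds)
 ultimately show ?thesis by simp
qed

lemma integral_lborel_translate:
 fixes f :: "real^'d => real"
 assumes [measurable]: "f \<in> borel_measurable borel"
 shows "(\<integral>x. f (c + x) \<partial>lborel) = (\<integral>x. f x \<partial>lborel)"
proof -
 have "(\<integral>x. f x \<partial>lborel) = (\<integral>x. f x \<partial>(distr lborel borel ((+) c)))" by (simp add: lborel_distr_plus)
 also have "\<dots> = (\<integral>x. f (c + x) \<partial>lborel)" by (subst integral_distr) auto
 finally show ?thesis by simp
qed

lemma integral_bump_translate: "(\<integral>s. bump r (x - s :: real^'d) \<partial>lborel) = (\<integral>z. bump r (z :: real^'d) \<partial>lborel)"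
proof -
 have "(\<integral>s. bump r (x - s) \<partial>lborel) = (\<integral>s. bump r ((- x) + s) \<partial>lborel)"
  by (simp add: bump_minus[of r x])
 also have "\<dots> = (\<integral>z. bump r (z :: real^'d) \<partial>lborel)"
  by (rule integral_lborel_translate[OF bump_borel])
 finally show ?thesis .
qed

lemma integrable_bump_translate: "integrable lborel (%s. bump r (x - s :: real^'d))"
proof -
 have "integrable (distr lborel borel ((+) (- x))) (bump r :: real^'d => real)"
  using integrable_bump by (simp add: lborel_distr_plus)
 then have "integrable lborel (%s. bump r (- x + s))" by (subst (asm) integrable_distr_eq) auto
 then show ?thesis by (simp add: bump_minus[of r x])
qed

context Sobolev_domain
begin

lemma id_measurable_L: "(%x. x) \<in> borel_measurable L"
 by (intro measurable_restrict_space1 measurable_completion) simp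

lemma integral_L_eq_lborel:
 fixes f :: "real^'d => real"
 assumes "f \<in> borel_measurable borel"
 shows "(\<integral>s. f s \<partial>L) = (\<integral>s. indicator D s * f s \<partial>lborel)"
proof -
 have [measurable]: "D \<in> sets borel" using open_D by simp
 have "(\<integral>s. f s \<partial>L) = (\<integral>s. indicator D s *\<^sub>R f s \<partial>lebesgue)"
  using D_sets by (simp add: integral_restrict_space)
 also have "\<dots> = (\<integral>s. indicator D s *\<^sub>R f s \<partial>lborel)"
  using assms by (intro integral_completion) simp
 finally show ?thesis by simp
qed

lemma bump_measurable_L: "(%s. bump r (x - s)) \<in> borel_measurable L"
 by (intro measurable_compose[OF _ bump_borel] borel_measurable_diff id_measurable_L) auto

lemma bump_integrable_L: "integrable L (%s. bump r (x - s))"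
proof -
 interpret finite_measure L by (rule finite_measure_L)
 show ?thesis
  by (rule integrable_const_bound[of _ 1, OF AE_I2]) (simp_all add: bump_bounds bump_measurable_L)
qed

lemma integral_bump_L_le: "(\<integral>s. bump r (x - s) \<partial>L) <= (\<integral>z. bump r (z :: real^'d) \<partial>lborel)"
proof -
 have [measurable]: "D \<in> sets borel" using open_D by simp
 have "(\<integral>s. bump r (x - s) \<partial>L) = (\<integral>s. indicator D s * bump r (x - s) \<partial>lborel)"
  by (rule integral_L_eq_lborel) simp
 also have "\<dots> <= (\<integral>s. bump r (x - s) \<partial>lborel)"
 proof (rule integral_mono)
  show "integrable lborel (%s. indicat_real D s * bump r (x - s))"
   using integrable_mult_indicator[OF _ integrable_bump_translate[of r x], of D] by simp
 qed (use integrable_bump_translate bump_bounds in \<open>auto simp: indicator_def\<close>)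
 finally show ?thesis by (simp only: integral_bump_translate)
qed

lemma integral_bump_L_eq:
 assumes "ball x \<delta> \<subseteq> D" "real CARD('d) * r < \<delta>"
 shows "(\<integral>s. bump r (x - s) \<partial>L) = (\<integral>z. bump r (z :: real^'d) \<partial>lborel)"
proof -
 have "(\<integral>s. bump r (x - s) \<partial>L) = (\<integral>s. indicator D s * bump r (x - s) \<partial>lborel)"
  by (rule integral_L_eq_lborel) simp
 also have "\<dots> = (\<integral>s. bump r (x - s) \<partial>lborel)"
 proof (rule Bochner_Integration.integral_cong[OF refl])
  fix s
  show "indicat_real D s * bump r (x - s) = bump r (x - s)"
  proof (cases "bump r (x - s) = 0")
   case False
   then have "dist x s < \<delta>" using bump_nonzero_norm_le[OF False] assms(2) by (simp add: dist_norm)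
   then show ?thesis using assms(1) by auto
  qed simp
 qed
 finally show ?thesis by (simp only: integral_bump_translate)
qed

text \<open>For fixed x, averages of \<psi> s x over s near x tend to \<psi> x x by continuity in s.
  Fubini rewrites the result as an iterated integral whose inner integrand contains only the class F
  s for a fixed s, where weak derivatives are available. The p-th root m of the majorant lies in L^p
  and dominates. Where \<zeta> is nonzero, x has distance at least \<delta> from the complement of
  D, so no mass of a small kernel is lost.\<close>

lemma diag_mollify:
 assumes \<gamma>: "0 < \<gamma>" "2 * real CARD('d) / \<gamma> < p" and B: "0 <= B" and F: "holder_Lp \<gamma> B F" and r: "rep1 F \<psi>"
  and z: "continuous_on UNIV \<zeta>" "!!x. \<bar>\<zeta> x\<bar> <= Cz" and d: "0 < \<delta>" "!!x. \<zeta> x ~= 0 ==> ball x \<delta> \<subseteq> D"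
 shows "integrable L (%s. \<integral>x. F s x * (\<zeta> x * bump \<rho> (x - s)) \<partial>L)"
  and "(!!k. 0 < \<rho>' k) ==> \<rho>' \<longlonglongrightarrow> 0 ==>
   (%k. (\<integral>s. (\<integral>x. F s x * (\<zeta> x * bump (\<rho>' k) (x - s)) \<partial>L) \<partial>L) / (\<integral>z. bump (\<rho>' k) (z :: real^'d) \<partial>lborel))
    \<longlonglongrightarrow> (\<integral>x. \<psi> x x * \<zeta> x \<partial>L)"
proof -
 interpret fm: finite_measure L by (rule finite_measure_L)
 interpret P: pair_sigma_finite L L by (rule pair_sigma_finite.intro) (rule fm.sigma_finite_measure_axioms)+
 obtain K where K: "K \<ge> 0" "!!B F \<psi>. 0 <= B ==> holder_Lp \<gamma> B F ==> rep1 F \<psi> ==> (\<exists>M. M \<in> borel_measurable L & (\<integral>\<^sup>+x. M x \<partial>L) <= ennreal (K * B powr p) \<and>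
    (AE x in L. \<forall>s\<in>closure D. ennreal (\<bar>\<psi> s x\<bar> powr p) <= M x))"
  using rep1_exists_bound[OF \<gamma>] by blast
 obtain M where M: "M \<in> borel_measurable L" "(\<integral>\<^sup>+x. M x \<partial>L) <= ennreal (K * B powr p)"
    "AE x in L. \<forall>s\<in>closure D. ennreal (\<bar>\<psi> s x\<bar> powr p) <= M x"
  using K(2)[OF B F r] by blast
 obtain G :: "nat => (real^'d) set" and w where
   G: "!!n. finite (G n)" "!!n. G n \<subseteq> closure D" and w: "!!n q. continuous_on (closure D) (w n q)"
   and lim: "AE x in L. \<forall>s\<in>closure D. (%n. \<Sum>q\<in>G n. w n q s * F q x) \<longlonglongrightarrow> \<psi> s x"
  by (rule rep1_approx[OF r]) (rule that, assumption+)
 have Dcl: "s \<in> closure D" if "s \<in> D" for s using that closure_subset[of D] by blast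
 \<comment> \<open>F s is given as a class for each s separately. The function g is a jointly
   measurable substitute for \<psi> s x as a function of (x, s), so that Fubini applies.\<close>
 define g where "g z = lim (%n. \<Sum>q\<in>G n. w n q (snd z) * F q (fst z))" for z :: "(real^'d) \<times> (real^'d)"
 have gm: "g \<in> borel_measurable (L \<Otimes>\<^sub>M L)"
  unfolding g_def
 proof (intro borel_measurable_lim_metric borel_measurable_sum borel_measurable_times)
  fix n q assume q: "q \<in> G n"
  show "(%x. w n q (snd x)) \<in> borel_measurable (L \<Otimes>\<^sub>M L)"
   by (rule measurable_compose[OF measurable_snd continuous_on_closure_measurable[OF w]])
  show "(%x. F q (fst x)) \<in> borel_measurable (L \<Otimes>\<^sub>M L)"
   by (rule measurable_compose[OF measurable_fst Lp_measurable[OF holder_Lp_D(1)[OF F]]]) (use q G(2) in blast)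
 qed
 have zm: "\<zeta> \<in> borel_measurable L" by (rule continuous_measurable_lebesgue_on[OF z(1)])
 define H where "H \<rho> z = g z * (\<zeta> (fst z) * bump \<rho> (fst z - snd z))" for \<rho> z
 have Hm: "H \<rho> \<in> borel_measurable (L \<Otimes>\<^sub>M L)" for \<rho>
  unfolding H_def
 proof (intro borel_measurable_times gm)
  show "(%x. \<zeta> (fst x)) \<in> borel_measurable (L \<Otimes>\<^sub>M L)" by (rule measurable_compose[OF measurable_fst zm])
  show "(%x. bump \<rho> (fst x - snd x)) \<in> borel_measurable (L \<Otimes>\<^sub>M L)"
   by (intro measurable_compose[OF _ bump_borel] borel_measurable_diff measurable_compose[OF measurable_fst id_measurable_L]
     measurable_compose[OF measurable_snd id_measurable_L])
 qed
 have g_eq: "AE x in L. \<forall>s\<in>closure D. g (x, s) = \<psi> s x"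
  using lim by eventually_elim (auto simp: g_def intro!: limI)
 define m where "m x = enn2real (M x) powr (1 / p)" for x
 have "AE x in L. M x ~= \<infinity>" by (rule nn_integral_PInf_AE[OF M(1)]) (use M(2) in \<open>auto simp: top_unique\<close>)
 then have M_eq: "AE x in L. ennreal (\<bar>m x\<bar> powr p) = M x"
  by eventually_elim (use p_pos in \<open>simp add: m_def powr_powr less_top\<close>)
 have "(\<integral>\<^sup>+x. ennreal (\<bar>m x\<bar> powr p) \<partial>L) <= ennreal ((K powr (1/p) * B) powr p)"
  using nn_integral_cong_AE[OF M_eq] M(2) K(1) B p_pos by (simp add: powr_mult powr_powr)
 note m_le = this
 have m_meas: "m \<in> borel_measurable L" unfolding m_def[abs_def] using M(1) by measurable
 have m_Lp: "m \<in> LP" by (rule Lp_normI(1)[OF m_meas _ m_le]) (use B in simp)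
 have m_bound: "AE x in L. \<forall>s\<in>closure D. \<bar>\<psi> s x\<bar> <= m x"
  using M(3) M_eq
 proof eventually_elim
  case (elim x)
  show ?case
  proof
   fix s assume "s \<in> closure D"
   then have "ennreal (\<bar>\<psi> s x\<bar> powr p) <= ennreal (\<bar>m x\<bar> powr p)" using elim by simp
   then have "\<bar>\<psi> s x\<bar> <= (\<bar>m x\<bar> powr p) powr (1 / p)" using p_pos by (intro ennreal_powr_le_imp_le) auto
   then show "\<bar>\<psi> s x\<bar> <= m x" using p_pos by (simp add: powr_powr m_def)
  qed
 qed
 have Cz: "0 <= Cz" using z(2)[of 0] by linarith
 have m0: "0 <= m x" for x by (simp add: m_def)
 have Hb: "AE x in L. \<forall>s\<in>D. \<bar>H \<rho> (x, s)\<bar> <= m x * Cz * bump \<rho> (x - s)" for \<rho>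
  using g_eq m_bound
 proof eventually_elim
  case (elim x)
  show ?case
  proof
   fix s assume s: "s \<in> D"
   have "\<bar>H \<rho> (x, s)\<bar> = \<bar>\<psi> s x\<bar> * (\<bar>\<zeta> x\<bar> * bump \<rho> (x - s))"
    using elim(1) Dcl[OF s] bump_bounds(1)[of \<rho> "x - s"] by (simp add: H_def abs_mult)
   also have "\<dots> <= m x * (Cz * bump \<rho> (x - s))"
    using elim(2) Dcl[OF s] bump_bounds(1)[of \<rho> "x - s"] z(2)[of x] Cz m0 by (intro mult_mono) auto
   finally show "\<bar>H \<rho> (x, s)\<bar> <= m x * Cz * bump \<rho> (x - s)" by (simp add: mult.assoc)
  qed
 qed
 have Hs_meas: "x \<in> D ==> (%s. H \<rho> (x, s)) \<in> borel_measurable L" for x \<rho>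
  by (rule measurable_Pair2[OF Hm]) simp
 have Hs_int: "AE x in L. integrable L (%s. H \<rho> (x, s))" for \<rho>
  using Hb[of \<rho>] AE_space
 proof eventually_elim
  case (elim x)
  have xD: "x \<in> D" using elim(2) by simp
  show ?case
  proof (rule Bochner_Integration.integrable_bound[where f="%s. m x * Cz * bump \<rho> (x - s)"])
   show "integrable L (%s. m x * Cz * bump \<rho> (x - s))" using bump_integrable_L by simp
   show "(%s. H \<rho> (x, s)) \<in> borel_measurable L" by (rule Hs_meas[OF xD])
   show "AE s in L. norm (H \<rho> (x, s)) <= norm (m x * Cz * bump \<rho> (x - s))"
   proof (rule AE_I2)
    fix s assume "s \<in> space L"
    then have "\<bar>H \<rho> (x, s)\<bar> <= m x * Cz * bump \<rho> (x - s)" using elim(1) by simp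
    then show "norm (H \<rho> (x, s)) <= norm (m x * Cz * bump \<rho> (x - s))" by simp
   qed
  qed
 qed
 let ?c = "%\<rho>. \<integral>z. bump \<rho> (z :: real^'d) \<partial>lborel"
 have Hs_norm: "AE x in L. (\<integral>s. \<bar>H \<rho> (x, s)\<bar> \<partial>L) <= m x * Cz * ?c \<rho>" for \<rho>
  using Hb[of \<rho>] Hs_int[of \<rho>]
 proof eventually_elim
  case (elim x)
  have "(\<integral>s. \<bar>H \<rho> (x, s)\<bar> \<partial>L) <= (\<integral>s. m x * Cz * bump \<rho> (x - s) \<partial>L)"
   using elim bump_integrable_L by (intro integral_mono) auto
  also have "\<dots> <= m x * Cz * ?c \<rho>"
   using integral_bump_L_le[of \<rho> x] m0 Cz by (simp add: mult_left_mono)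
  finally show ?case .
 qed
 have Hi: "integrable (L \<Otimes>\<^sub>M L) (H \<rho>)" for \<rho>
 proof (rule P.Fubini_integrable[OF Hm])
  show "integrable L (%x. \<integral>s. norm (H \<rho> (x, s)) \<partial>L)"
  proof (rule Bochner_Integration.integrable_bound[where f="%x. m x * Cz * ?c \<rho>"])
   show "integrable L (%x. m x * Cz * ?c \<rho>)" using Lp_integrable[OF m_Lp] by simp
   show "(%x. \<integral>s. norm (H \<rho> (x, s)) \<partial>L) \<in> borel_measurable L"
    using Hm[of \<rho>] by measurable
   show "AE x in L. norm (\<integral>s. norm (H \<rho> (x, s)) \<partial>L) <= norm (m x * Cz * ?c \<rho>)"
    using Hs_norm[of \<rho>]
   proof eventually_elim
    case (elim x)
    have "0 <= (\<integral>s. \<bar>H \<rho> (x, s)\<bar> \<partial>L)" by (rule Bochner_Integration.integral_nonneg) simp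
    then show ?case using elim by (simp add: order_trans[OF _ abs_ge_self])
   qed
  qed
  show "AE x in L. integrable L (%s. H \<rho> (x, s))" by (rule Hs_int)
 qed
 have inner: "(\<integral>x. H \<rho> (x, s) \<partial>L) = (\<integral>x. F s x * (\<zeta> x * bump \<rho> (x - s)) \<partial>L)" if s: "s \<in> D" for s \<rho>
 proof (rule integral_cong_AE)
  show "(%x. H \<rho> (x, s)) \<in> borel_measurable L"
   by (rule measurable_Pair1[OF Hm]) (use s in simp)
  show "(%x. F s x * (\<zeta> x * bump \<rho> (x - s))) \<in> borel_measurable L"
   using Lp_measurable[OF holder_Lp_D(1)[OF F Dcl[OF s]]] zm
   by (intro borel_measurable_times measurable_compose[OF _ bump_borel] borel_measurable_diff id_measurable_L) auto
  have "AE x in L. \<psi> s x = F s x" using r Dcl[OF s] by (simp add: rep1_def)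
  with g_eq show "AE x in L. H \<rho> (x, s) = F s x * (\<zeta> x * bump \<rho> (x - s))"
   by eventually_elim (use Dcl[OF s] in \<open>simp add: H_def\<close>)
 qed
 have "integrable L (%s. \<integral>x. H \<rho> (x, s) \<partial>L)" for \<rho>
  using P.integrable_snd[of "%x s. H \<rho> (x, s)"] Hi[of \<rho>] by simp
 moreover have "integrable L (%s. \<integral>x. F s x * (\<zeta> x * bump \<rho> (x - s)) \<partial>L) = integrable L (%s. \<integral>x. H \<rho> (x, s) \<partial>L)" for \<rho>
  by (rule Bochner_Integration.integrable_cong[OF refl]) (simp add: inner)
 ultimately show "integrable L (%s. \<integral>x. F s x * (\<zeta> x * bump \<rho> (x - s)) \<partial>L)" by simp
 assume \<rho>': "!!k. 0 < \<rho>' k" "\<rho>' \<longlonglongrightarrow> 0"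
 have cpos: "0 < ?c (\<rho>' k)" for k by (rule integral_bump_pos[OF \<rho>'(1)])
 have swap: "(\<integral>s. (\<integral>x. F s x * (\<zeta> x * bump \<rho> (x - s)) \<partial>L) \<partial>L) = (\<integral>x. (\<integral>s. H \<rho> (x, s) \<partial>L) \<partial>L)" for \<rho>
 proof -
  have "(\<integral>s. (\<integral>x. F s x * (\<zeta> x * bump \<rho> (x - s)) \<partial>L) \<partial>L) = (\<integral>s. (\<integral>x. H \<rho> (x, s) \<partial>L) \<partial>L)"
   by (rule Bochner_Integration.integral_cong[OF refl]) (simp add: inner)
  also have "\<dots> = (\<integral>x. (\<integral>s. H \<rho> (x, s) \<partial>L) \<partial>L)"
   using P.Fubini_integral[of "%x s. H \<rho> (x, s)"] Hi[of \<rho>] by simp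
  finally show ?thesis .
 qed
 have "(%k. \<integral>x. (\<integral>s. H (\<rho>' k) (x, s) \<partial>L) / ?c (\<rho>' k) \<partial>L) \<longlonglongrightarrow> (\<integral>x. \<psi> x x * \<zeta> x \<partial>L)"
 proof (rule integral_dominated_convergence[where w="%x. m x * Cz"])
  have "(%x. \<psi> x x) \<in> LP" using diag_bound[OF \<gamma>] B F r by (elim exE conjE) simp
  from Lp_measurable[OF this] show "(%x. \<psi> x x * \<zeta> x) \<in> borel_measurable L" using zm by (intro borel_measurable_times)
  show "(%x. (\<integral>s. H (\<rho>' k) (x, s) \<partial>L) / ?c (\<rho>' k)) \<in> borel_measurable L" for k
   using Hm[of "\<rho>' k"] by measurable
  show "integrable L (%x. m x * Cz)" using Lp_integrable[OF m_Lp] by simp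
  show "AE x in L. norm ((\<integral>s. H (\<rho>' k) (x, s) \<partial>L) / ?c (\<rho>' k)) <= m x * Cz" for k
   using Hs_norm[of "\<rho>' k"]
  proof eventually_elim
   case (elim x)
   have "\<bar>\<integral>s. H (\<rho>' k) (x, s) \<partial>L\<bar> <= m x * Cz * ?c (\<rho>' k)" 
    by (rule order_trans[OF integral_abs_bound elim])
   then show ?case using cpos[of k] by (simp add: divide_le_eq)
  qed
  have cont: "AE x in L. continuous_on (closure D) (%s. \<psi> s x)" using r by (simp add: rep1_def)
  have ints: "AE x in L. \<forall>k. integrable L (%s. H (\<rho>' k) (x, s))"
   unfolding AE_all_countable using Hs_int by simp
  show "AE x in L. (%k. (\<integral>s. H (\<rho>' k) (x, s) \<partial>L) / ?c (\<rho>' k)) \<longlonglongrightarrow> \<psi> x x * \<zeta> x"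
   using cont g_eq ints AE_space
  proof eventually_elim
   case (elim x)
   have xD: "x \<in> D" using elim(4) by simp
   show ?case
   proof (cases "\<zeta> x = 0")
    case True
    then show ?thesis by (simp add: H_def)
   next
    case False
    then have bx: "ball x \<delta> \<subseteq> D" by (rule d(2))
    show ?thesis
    proof (rule LIMSEQ_I)
     fix e0 :: real assume "e0 > 0"
     define e where "e = e0 / (2 * (Cz + 1))"
     have e: "e > 0" using \<open>e0 > 0\<close> Cz by (simp add: e_def)
     obtain \<eta> where eta: "\<eta> > 0" "!!t. t \<in> closure D ==> dist t x < \<eta> ==> dist (\<psi> t x) (\<psi> x x) < e"
      using elim(1) Dcl[OF xD] e unfolding continuous_on_iff by meson
     \<comment> \<open>A kernel of half side r reaches at most the distance d r, hence the division
       by the dimension.\<close>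
     define \<mu> where "\<mu> = min \<eta> \<delta> / real CARD('d)"
     have \<mu>: "\<mu> > 0" using eta(1) d(1) by (simp add: \<mu>_def)
     have N0: "0 < real CARD('d)" by simp
     obtain n0 where n0: "!!k. k \<ge> n0 ==> \<rho>' k < \<mu>"
      using order_tendstoD(2)[OF \<rho>'(2) \<mu>] unfolding eventually_sequentially by blast
     have "norm ((\<integral>s. H (\<rho>' k) (x, s) \<partial>L) / ?c (\<rho>' k) - \<psi> x x * \<zeta> x) < e0" if k: "k \<ge> n0" for k
     proof -
      have small: "real CARD('d) * \<rho>' k < min \<eta> \<delta>" using n0[OF k] N0 by (simp add: \<mu>_def field_simps)
      have cD: "(\<integral>s. bump (\<rho>' k) (x - s) \<partial>L) = ?c (\<rho>' k)"
       by (rule integral_bump_L_eq[OF bx]) (use small in simp)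
      have "(\<integral>s. H (\<rho>' k) (x, s) \<partial>L) - \<psi> x x * \<zeta> x * ?c (\<rho>' k)
        = (\<integral>s. H (\<rho>' k) (x, s) - \<psi> x x * \<zeta> x * bump (\<rho>' k) (x - s) \<partial>L)"
       using elim(3) bump_integrable_L by (subst Bochner_Integration.integral_diff) (auto simp: cD)
      also have "\<bar>\<dots>\<bar> <= (\<integral>s. \<bar>H (\<rho>' k) (x, s) - \<psi> x x * \<zeta> x * bump (\<rho>' k) (x - s)\<bar> \<partial>L)"
       by (rule integral_abs_bound)
      also have "\<dots> <= (\<integral>s. e * Cz * bump (\<rho>' k) (x - s) \<partial>L)"
      proof (rule integral_mono)
       show "integrable L (%s. \<bar>H (\<rho>' k) (x, s) - \<psi> x x * \<zeta> x * bump (\<rho>' k) (x - s)\<bar>)"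
        using elim(3) bump_integrable_L by (intro integrable_abs Bochner_Integration.integrable_diff integrable_mult_right) auto
       show "integrable L (%s. e * Cz * bump (\<rho>' k) (x - s))" using bump_integrable_L by simp
       fix s assume "s \<in> space L"
       then have s: "s \<in> D" by simp
       show "\<bar>H (\<rho>' k) (x, s) - \<psi> x x * \<zeta> x * bump (\<rho>' k) (x - s)\<bar> <= e * Cz * bump (\<rho>' k) (x - s)"
       proof (cases "bump (\<rho>' k) (x - s) = 0")
        case True
        then show ?thesis by (simp add: H_def)
       next
        case False
        have "dist s x < \<eta>" using bump_nonzero_norm_le[OF False] small by (simp add: dist_norm norm_minus_commute)
        then have "\<bar>\<psi> s x - \<psi> x x\<bar> <= e" using eta(2)[OF Dcl[OF s]] by (simp add: dist_norm)
        then have "\<bar>\<psi> s x - \<psi> x x\<bar> * (\<bar>\<zeta> x\<bar> * bump (\<rho>' k) (x - s)) <= e * (Cz * bump (\<rho>' k) (x - s))"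
         using z(2)[of x] bump_bounds(1)[of "\<rho>' k" "x - s"] Cz e by (intro mult_mono) auto
        moreover have "H (\<rho>' k) (x, s) - \<psi> x x * \<zeta> x * bump (\<rho>' k) (x - s) = (\<psi> s x - \<psi> x x) * (\<zeta> x * bump (\<rho>' k) (x - s))"
         using elim(2) Dcl[OF s] by (simp add: H_def algebra_simps)
        ultimately show ?thesis using bump_bounds(1)[of "\<rho>' k" "x - s"] by (simp add: abs_mult mult.assoc)
       qed
      qed
      also have "\<dots> = e * Cz * ?c (\<rho>' k)" by (simp add: cD)
      finally have "\<bar>(\<integral>s. H (\<rho>' k) (x, s) \<partial>L) - \<psi> x x * \<zeta> x * ?c (\<rho>' k)\<bar> / ?c (\<rho>' k) <= e * Cz"
       using cpos[of k] by (simp add: divide_le_eq)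
      moreover have "\<bar>(\<integral>s. H (\<rho>' k) (x, s) \<partial>L) - \<psi> x x * \<zeta> x * ?c (\<rho>' k)\<bar> / ?c (\<rho>' k)
        = \<bar>(\<integral>s. H (\<rho>' k) (x, s) \<partial>L) / ?c (\<rho>' k) - \<psi> x x * \<zeta> x\<bar>"
       using cpos[of k] by (subst abs_div_pos) (auto simp: diff_divide_distrib)
      moreover have "e * Cz < e0"
      proof -
       have "e * Cz <= e * (Cz + 1)" using e by (intro mult_left_mono) auto
       also have "\<dots> = e0 / 2" using Cz by (simp add: e_def field_simps)
       finally show ?thesis using \<open>e0 > 0\<close> by linarith
      qed
      ultimately show ?thesis by simp
     qed
     then show "\<exists>no. \<forall>k\<ge>no. norm ((\<integral>s. H (\<rho>' k) (x, s) \<partial>L) / ?c (\<rho>' k) - \<psi> x x * \<zeta> x) < e0" by blast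
    qed
   qed
  qed
 qed
 then show "(%k. (\<integral>s. (\<integral>x. F s x * (\<zeta> x * bump (\<rho>' k) (x - s)) \<partial>L) \<partial>L) / ?c (\<rho>' k)) \<longlonglongrightarrow> (\<integral>x. \<psi> x x * \<zeta> x \<partial>L)"
  by (simp add: swap)
qed

end

subsection \<open>The chain rule on the diagonal\<close>

context Sobolev_domain
begin

text \<open>A sequence converging in the mean is paired with a bounded sequence converging
  pointwise: exchanging the first factor costs an L^1 norm, exchanging the second is dominated
  convergence.\<close>

lemma Lp_integral_tendsto:
 assumes u: "!!n. u n \<in> LP" "v \<in> LP" and lim: "(%n. nrm (%x. u n x - v x)) \<longlonglongrightarrow> 0"
  and h: "!!n. h n \<in> borel_measurable L" "h' \<in> borel_measurable L" "!!n x. \<bar>h n x\<bar> <= C" "!!x. (%n. h n x) \<longlonglongrightarrow> h' x"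
 shows "(%n. \<integral>x. u n x * h n x \<partial>L) \<longlonglongrightarrow> (\<integral>x. v x * h' x \<partial>L)"
proof -
 have i1: "integrable L (%x. v x * h n x)" for n
  by (rule Lp_integrable[OF Lp_mult_bounded[OF u(2) h(1) h(3)]])
 have i2: "integrable L (%x. u n x * h n x)" for n
  by (rule Lp_integrable[OF Lp_mult_bounded[OF u(1) h(1) h(3)]])
 have "(%n. \<integral>x. v x * h n x \<partial>L) \<longlonglongrightarrow> (\<integral>x. v x * h' x \<partial>L)"
 proof (rule integral_dominated_convergence[where w="%x. \<bar>v x\<bar> * C"])
  show "integrable L (%x. \<bar>v x\<bar> * C)" using Lp_integrable[OF u(2)] by simp
  show "AE x in L. norm (v x * h n x) <= \<bar>v x\<bar> * C" for n
   using h(3) by (intro AE_I2) (simp add: abs_mult mult_left_mono)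
  show "AE x in L. (%n. v x * h n x) \<longlonglongrightarrow> v x * h' x" by (intro AE_I2 tendsto_mult_left h(4))
 qed (use h(1,2) Lp_measurable[OF u(2)] in \<open>auto intro!: borel_measurable_times\<close>)
 moreover have "(%n. \<integral>x. (u n x - v x) * h n x \<partial>L) \<longlonglongrightarrow> 0"
 proof (rule tendsto_rabs_zero_cancel, rule tendsto_sandwich[OF _ _ tendsto_const])
  show "\<forall>\<^sub>F n in sequentially. \<bar>\<integral>x. (u n x - v x) * h n x \<partial>L\<bar> <= C * ((measure lebesgue D + 1) * nrm (%x. u n x - v x))"
   using h(3) by (intro always_eventually allI Lp_integral_mult_bound Lp_diff u h(1))
  show "(%n. C * ((measure lebesgue D + 1) * nrm (%x. u n x - v x))) \<longlonglongrightarrow> 0"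
   by (intro tendsto_mult_right_zero lim)
 qed simp
 ultimately have "(%n. (\<integral>x. v x * h n x \<partial>L) + (\<integral>x. (u n x - v x) * h n x \<partial>L)) \<longlonglongrightarrow> (\<integral>x. v x * h' x \<partial>L) + 0"
  by (rule tendsto_add)
 moreover have "(\<integral>x. v x * h n x \<partial>L) + (\<integral>x. (u n x - v x) * h n x \<partial>L) = (\<integral>x. u n x * h n x \<partial>L)" for n
  using i1 i2 by (simp add: left_diff_distrib)
 ultimately show ?thesis by simp
qed

text \<open>Lebesgue measure is translation invariant, so each difference quotient of \<Theta> has
  integral 0, and dominated convergence passes this to the limit. It takes the place of an
  integration by parts in s.\<close>

lemma integral_shift_quotient_eq_0:
 fixes \<Theta> :: "real^'d => real"
 assumes cont: "continuous_on UNIV \<Theta>" and supp: "!!s. \<Theta> s ~= 0 ==> norm s <= R"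
  and q: "!!s. (%n. (\<Theta> (t n *\<^sub>R e + s) - \<Theta> s) / t n) \<longlonglongrightarrow> \<theta> s"
  and bd: "!!n s. \<bar>(\<Theta> (t n *\<^sub>R e + s) - \<Theta> s) / t n\<bar> <= C * indicator (cball 0 R) s"
 shows "(\<integral>s. \<theta> s \<partial>lborel) = 0" "\<theta> \<in> borel_measurable borel"
proof -
 have m: "\<Theta> \<in> borel_measurable borel" using cont by (rule borel_measurable_continuous_onI)
 have m2: "(%s. (\<Theta> (t n *\<^sub>R e + s) - \<Theta> s) / t n) \<in> borel_measurable borel" for n
  using m by measurable
 show mt: "\<theta> \<in> borel_measurable borel" by (rule borel_measurable_LIMSEQ_real[OF q m2])
 have e: "(%s. indicator (cball 0 R) s *\<^sub>R \<Theta> s) = \<Theta>"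
  using supp by (auto simp: indicator_def fun_eq_iff)
 have "integrable lborel (%s. indicator (cball 0 R) s *\<^sub>R \<Theta> s)"
  using cont by (intro borel_integrable_compact) (auto intro: continuous_on_subset)
 then have i: "integrable lborel \<Theta>" by (simp only: e)
 have "integrable (distr lborel borel ((+) (t n *\<^sub>R e))) \<Theta>" for n using i by (simp add: lborel_distr_plus)
 then have i2: "integrable lborel (%s. \<Theta> (t n *\<^sub>R e + s))" for n
  using m by (subst (asm) integrable_distr_eq) auto
 have z: "(\<integral>s. (\<Theta> (t n *\<^sub>R e + s) - \<Theta> s) / t n \<partial>lborel) = 0" for n
  using i i2 integral_lborel_translate[OF m, of "t n *\<^sub>R e"] by simp
 have "(%n. \<integral>s. (\<Theta> (t n *\<^sub>R e + s) - \<Theta> s) / t n \<partial>lborel) \<longlonglongrightarrow> (\<integral>s. \<theta> s \<partial>lborel)"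
 proof (rule integral_dominated_convergence[where w="%s. C * indicator (cball 0 R) s"])
  have "integrable lborel (%s. indicator (cball 0 R) s *\<^sub>R C)" for C :: real
   by (rule borel_integrable_compact) auto
  then show "integrable lborel (%s. C * indicator (cball 0 R) s)" by (simp add: mult.commute)
  show "AE s in lborel. norm ((\<Theta> (t n *\<^sub>R e + s) - \<Theta> s) / t n) <= C * indicator (cball 0 R) s" for n
   using bd by (intro AE_I2) simp
  show "AE s in lborel. (%n. (\<Theta> (t n *\<^sub>R e + s) - \<Theta> s) / t n) \<longlonglongrightarrow> \<theta> s" using q by (intro AE_I2)
 qed (use m2 mt in auto)
 then show "(\<integral>s. \<theta> s \<partial>lborel) = 0" unfolding z by (simp add: LIMSEQ_const_iff)
qed

text \<open>The mean value theorem on a coordinate line; it bounds the difference quotients of the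
  mollifying kernel uniformly.\<close>

lemma smooth_derivs_axis_Lipschitz:
 assumes Y: "smooth_derivs Y" and C: "!!z. \<bar>Y ((%_. 0)(i := 1)) z\<bar> <= C"
 shows "\<bar>Y (%_. 0) (z + t *\<^sub>R axis i 1) - Y (%_. 0) z\<bar> <= C * \<bar>t\<bar>"
proof -
 have d: "((%t. Y (%_. 0) (z + t *\<^sub>R axis i 1)) has_real_derivative Y ((%_. 0)(i := 1)) (z + \<tau> *\<^sub>R axis i 1)) (at \<tau>)" for \<tau>
 proof -
  have "((%t. Y (%_. 0) ((z + \<tau> *\<^sub>R axis i 1) + t *\<^sub>R axis i 1)) has_real_derivative Y ((%_. 0)(i := Suc 0)) (z + \<tau> *\<^sub>R axis i 1)) (at 0)"
   using Y unfolding smooth_derivs_def by (elim conjE allE)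
  then have "((%t. Y (%_. 0) (z + (\<tau> + t) *\<^sub>R axis i 1)) has_real_derivative Y ((%_. 0)(i := Suc 0)) (z + \<tau> *\<^sub>R axis i 1)) (at 0)"
   by (simp add: scaleR_add_left add.assoc)
  then show ?thesis
   using DERIV_at_within_shift[of "%t. Y (%_. 0) (z + t *\<^sub>R axis i 1)" "Y ((%_. 0)(i := Suc 0)) (z + \<tau> *\<^sub>R axis i 1)" \<tau> 0 UNIV]
   by (simp add: add.commute)
 qed
 have "norm (Y (%_. 0) (z + t *\<^sub>R axis i 1) - Y (%_. 0) (z + 0 *\<^sub>R axis i 1)) <= C * norm (t - 0)"
  by (rule field_differentiable_bound[of UNIV "%t. Y (%_. 0) (z + t *\<^sub>R axis i 1)"]) (use d C in auto)
 then show ?thesis by simp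
qed

text \<open>For a test function Z and the kernel k put \<Theta>(s) = \<integral> F s x Z(x) k(x - s)
  dx. Its derivative in s is \<integral> v s Z k - \<integral> F s Z \<partial>_i k, and this has
  integral 0 over s. The weak derivative of F s, tested with Z times the translated kernel, gives
  \<integral> F s (\<partial>_i Z k + Z \<partial>_i k) = - \<integral> w s Z k. Eliminating the
  term with \<partial>_i k yields \<open>key\<close>, in which the kernel is no longer
  differentiated. Letting it shrink to a point leaves the chain rule, with w as derivative in x and
  v as derivative in s.\<close>

lemma weak_deriv_diag:
 assumes \<gamma>: "0 < \<gamma>" "2 * real CARD('d) / \<gamma> < p" and B: "0 <= B"
  and F: "holder_Lp \<gamma> B F" "rep1 F \<psi>" and w: "holder_Lp \<gamma> B w" "rep1 w \<omega>" and v: "holder_Lp \<gamma> B v" "rep1 v \<upsilon>"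
  and weak: "!!s. s \<in> D ==> has_weak_deriv D ((%_. 0)(i := 1)) (F s) (w s)"
  and deriv: "!!s. s \<in> D ==> ((%t. nrm (%x. (F (s + t *\<^sub>R axis i 1) x - F s x) / t - v s x)) \<longlongrightarrow> 0) (at 0)"
 shows "has_weak_deriv D ((%_. 0)(i := 1)) (%x. \<psi> x x) (%x. \<omega> x x + \<upsilon> x x)"
 unfolding has_weak_deriv_def
proof (intro allI impI)
 fix Z assume Z: "test_derivs D Z"
 let ?ei = "(%_. 0)(i := 1::nat)" and ?e = "axis i 1 :: real^'d"
 let ?N = "real CARD('d)"
 let ?Z0 = "Z (%_. 0)" and ?Z1 = "Z ?ei"
 have Zs: "smooth_derivs Z" using Z by (simp add: test_derivs_def)
 obtain C0 where C0: "C0 \<ge> 0" "!!x. \<bar>?Z0 x\<bar> <= C0"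
  by (rule test_derivs_bounded[OF Z, of "%_. 0"]) (rule that, assumption+)
 obtain C1 where C1: "C1 \<ge> 0" "!!x. \<bar>?Z1 x\<bar> <= C1"
  by (rule test_derivs_bounded[OF Z, of "?ei"]) (rule that, assumption+)
 define S where "S = mi_support Z"
 have S: "compact S" "S \<subseteq> D" using Z by (auto simp only: test_derivs_def S_def)
 have ZS: "x \<in> S" if "Z \<alpha> x ~= 0" for \<alpha> x
  using smooth_derivs_zero_outside[OF Zs, of x \<alpha>] that unfolding S_def by blast
 obtain \<delta> where \<delta>: "\<delta> > 0" "(\<Union>x\<in>S. ball x \<delta>) \<subseteq> D"
  by (rule compact_subset_open_imp_ball_epsilon_subset[OF S(1) open_D S(2)])
 have ballD: "ball x \<delta> \<subseteq> D" if "x \<in> S" for x using \<delta>(2) that by blast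
 \<comment> \<open>A quarter of the margin: the kernel reaches at most \<eta>, the relevant s lie
   within 2 \<eta> of the support of Z, and moving such s by less than 2 \<eta> stays within
   \<delta>, hence in D.\<close>
 define \<eta> where "\<eta> = \<delta> / 4"
 have \<eta>: "\<eta> > 0" using \<delta> by (simp add: \<eta>_def)
 have ei1: "mi_order ?ei = 1" using mi_order_Suc[of "%_. 0" i] by (simp add: mi_order_def)
 have Dcl: "s \<in> closure D" if "s \<in> D" for s using that closure_subset[of D] by blast
 define near where "near s \<longleftrightarrow> (\<exists>x\<in>S. dist x s <= 2 * \<eta>)" for s
 have nearD: "s' \<in> D" if ns: "near s" "dist s s' < 2 * \<eta>" for s s'
 proof -
  obtain x where "x \<in> S" "dist x s <= 2 * \<eta>" using ns(1) by (auto simp: near_def)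
  then have "dist x s' < \<delta>" using ns(2) dist_triangle[of x s' s] by (simp add: \<eta>_def)
  then show ?thesis using ballD[OF \<open>x \<in> S\<close>] by auto
 qed
 obtain R0 where R0: "!!x. x \<in> S ==> norm x <= R0" using compact_imp_bounded[OF S(1)] by (auto simp: bounded_iff)
 define R where "R = R0 + 2 * \<eta>"
 have nearR: "norm s <= R" if ns: "near s" for s
 proof -
  obtain x where "x \<in> S" "dist x s <= 2 * \<eta>" using ns by (auto simp: near_def)
  then show ?thesis using R0[of x] norm_triangle_ineq4[of x "x - s"] by (simp add: R_def dist_norm)
 qed
 have key: "(\<integral>s. (\<integral>x. F s x * (?Z1 x * bump \<rho> (x - s)) \<partial>L) \<partial>L) + (\<integral>s. (\<integral>x. w s x * (?Z0 x * bump \<rho> (x - s)) \<partial>L) \<partial>L)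
   + (\<integral>s. (\<integral>x. v s x * (?Z0 x * bump \<rho> (x - s)) \<partial>L) \<partial>L) = 0" if \<rho>: "0 < \<rho>" "?N * \<rho> <= \<eta>" for \<rho>
 proof -
  obtain Y :: "('d => nat) => real^'d => real" where Y: "test_derivs UNIV Y" "Y (%_. 0) = bump \<rho>"
   using box_bump_test_derivs[of "- vec \<rho>" "vec \<rho> :: real^'d" UNIV 1] unfolding bump_def[abs_def] by auto
  have Ys: "smooth_derivs Y" using Y by (simp add: test_derivs_def)
  let ?Y1 = "Y ?ei"
  obtain CY where CY: "CY \<ge> 0" "!!x. \<bar>?Y1 x\<bar> <= CY"
   by (rule test_derivs_bounded[OF Y(1), of "?ei"]) (rule that, assumption+)
  have bump_supp: "norm z <= \<eta>" if "bump \<rho> z ~= 0" for z :: "real^'d"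
   using bump_nonzero_norm_le[OF that] \<rho>(2) by simp
  have Y1_supp: "norm z <= \<eta>" if "?Y1 z ~= 0" for z
  proof -
   have "z \<in> mi_support Y" using smooth_derivs_zero_outside[OF Ys, of z ?ei] that by blast
   moreover have "mi_support Y \<subseteq> cball 0 \<eta>"
    unfolding Y(2) using bump_supp by (intro closure_minimal) auto
   ultimately show ?thesis by auto
  qed
  have Y1_cont: "continuous_on UNIV ?Y1" using Ys by (simp add: smooth_derivs_def)
  have Y1_borel: "?Y1 \<in> borel_measurable borel" using Y1_cont by (rule borel_measurable_continuous_onI)
  have Z0m: "?Z0 \<in> borel_measurable L" "?Z1 \<in> borel_measurable L" by (rule test_derivs_measurable[OF Z])+
  have bm: "(%x. bump \<rho> (x - s)) \<in> borel_measurable L" for s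
   by (intro measurable_compose[OF _ bump_borel] borel_measurable_diff id_measurable_L) auto
  have Y1m: "(%x. ?Y1 (x - s)) \<in> borel_measurable L" for s
   by (intro measurable_compose[OF _ Y1_borel] borel_measurable_diff id_measurable_L) auto
  have b1: "\<bar>?Z0 x * bump \<rho> y\<bar> <= C0" for x and y :: "real^'d"
   using mult_mono[OF C0(2)[of x] bump_bounds(2)[of \<rho> y] C0(1) bump_bounds(1)] bump_bounds(1)[of \<rho> y] by (simp add: abs_mult)
  have b1': "\<bar>?Z1 x * bump \<rho> y\<bar> <= C1" for x and y :: "real^'d"
   using mult_mono[OF C1(2)[of x] bump_bounds(2)[of \<rho> y] C1(1) bump_bounds(1)] bump_bounds(1)[of \<rho> y] by (simp add: abs_mult)
  have b2: "\<bar>?Z0 x * ?Y1 y\<bar> <= C0 * CY" for x and y :: "real^'d"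
   using mult_mono[OF C0(2)[of x] CY(2)[of y] C0(1)] by (simp add: abs_mult)
  have m1: "(%x. ?Z0 x * bump \<rho> (x - s)) \<in> borel_measurable L" for s by (intro borel_measurable_times Z0m bm)
  have m1': "(%x. ?Z1 x * bump \<rho> (x - s)) \<in> borel_measurable L" for s by (intro borel_measurable_times Z0m bm)
  have m2: "(%x. ?Z0 x * ?Y1 (x - s)) \<in> borel_measurable L" for s by (intro borel_measurable_times Z0m Y1m)
  \<comment> \<open>For fixed s the product of Z with the translated kernel is itself a test
    function on D, so the weak derivative of F s may be tested with it.\<close>
  have prod_rule: "(\<integral>x. F s x * (?Z1 x * bump \<rho> (x - s)) \<partial>L) + (\<integral>x. F s x * (?Z0 x * ?Y1 (x - s)) \<partial>L)
    = - (\<integral>x. w s x * (?Z0 x * bump \<rho> (x - s)) \<partial>L)" if s: "s \<in> D" for s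
  proof -
   obtain W where W: "smooth_derivs W" "!!x. W (%_. 0) x = ?Z0 x * box_bump 1 (s - vec \<rho>) (s + vec \<rho>) x"
    using smooth_derivs_box_bump[OF Zs, of 1 "s - vec \<rho>" "s + vec \<rho>"] by blast
   have bb: "box_bump 1 (s - vec \<rho>) (s + vec \<rho>) x = bump \<rho> (x - s)" for x
    unfolding bump_def box_bump_def by (intro prod.cong) (auto simp: algebra_simps)
   have W0: "W (%_. 0) x = ?Z0 x * bump \<rho> (x - s)" for x using W(2) by (simp only: bb)
   have sub: "mi_support W \<subseteq> S"
   proof (rule closure_minimal)
    show "{x. W (%_. 0) x ~= 0} \<subseteq> S" using ZS by (auto simp: W0)
    show "closed S" using S(1) by (rule compact_imp_closed)
   qed
   have Wt: "test_derivs D W"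
    unfolding test_derivs_def
   proof (intro conjI W(1))
    have "bounded (mi_support W)" using sub compact_imp_bounded[OF S(1)] by (rule bounded_subset[rotated])
    then show "compact (mi_support W)" unfolding compact_eq_bounded_closed by (intro conjI closed_closure)
    show "mi_support W \<subseteq> D" using sub S(2) by (rule order_trans)
   qed
   have W1: "W ?ei x = ?Z1 x * bump \<rho> (x - s) + ?Z0 x * ?Y1 (x - s)" for x
   proof (rule DERIV_unique)
    have "((%t. W (%_. 0) (x + t *\<^sub>R ?e)) has_real_derivative W ((%_. 0)(i := Suc 0)) x) (at 0)"
     using W(1) unfolding smooth_derivs_def by (elim conjE allE)
    then show "((%t. W (%_. 0) (x + t *\<^sub>R ?e)) has_real_derivative W ?ei x) (at 0)" by simp
    have dZ: "((%t. ?Z0 (x + t *\<^sub>R ?e)) has_real_derivative Z ((%_. 0)(i := Suc 0)) x) (at 0)"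
     using Zs unfolding smooth_derivs_def by (elim conjE allE)
    have "((%t. Y (%_. 0) ((x - s) + t *\<^sub>R ?e)) has_real_derivative Y ((%_. 0)(i := Suc 0)) (x - s)) (at 0)"
     using Ys unfolding smooth_derivs_def by (elim conjE allE)
    then have dY: "((%t. bump \<rho> ((x + t *\<^sub>R ?e) - s)) has_real_derivative Y ((%_. 0)(i := Suc 0)) (x - s)) (at 0)"
     by (simp add: Y(2) algebra_simps)
    from DERIV_mult[OF dZ dY]
    show "((%t. W (%_. 0) (x + t *\<^sub>R ?e)) has_real_derivative ?Z1 x * bump \<rho> (x - s) + ?Z0 x * ?Y1 (x - s)) (at 0)"
     by (simp add: W0 mult.commute)
   qed
   have "(\<integral>x. F s x * W ?ei x \<partial>L) = (- 1) ^ mi_order ?ei * (\<integral>x. w s x * W (%_. 0) x \<partial>L)"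
    using weak[OF s] Wt unfolding has_weak_deriv_def by (elim allE impE)
   moreover have "(\<integral>x. F s x * W ?ei x \<partial>L) = (\<integral>x. F s x * (?Z1 x * bump \<rho> (x - s)) \<partial>L) + (\<integral>x. F s x * (?Z0 x * ?Y1 (x - s)) \<partial>L)"
    unfolding W1 distrib_left using holder_Lp_D(1)[OF F(1) Dcl[OF s]]
    by (intro Bochner_Integration.integral_add Lp_integrable Lp_mult_bounded[OF _ m1' b1'] Lp_mult_bounded[OF _ m2 b2])
   ultimately show ?thesis unfolding ei1 by (simp add: W0)
  qed
  \<comment> \<open>Extended by 0 outside D. The function vanishes away from the compact support of
    Z, so the extension is continuous on the whole space, as the translation argument
    requires.\<close>
  define \<Theta> where "\<Theta> s = (if s \<in> D then \<integral>x. F s x * (?Z0 x * bump \<rho> (x - s)) \<partial>L else 0)" for s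
  define \<theta> where "\<theta> s = (if s \<in> D then (\<integral>x. v s x * (?Z0 x * bump \<rho> (x - s)) \<partial>L) - (\<integral>x. F s x * (?Z0 x * ?Y1 (x - s)) \<partial>L) else 0)" for s
  have far: "?Z0 x * bump \<rho> (x - s) = 0" "?Z0 x * ?Y1 (x - s) = 0" if "!!x. x \<in> S ==> dist x s > \<eta>" for s x
   using ZS[of "%_. 0" x] that[of x] bump_supp[of "x - s"] Y1_supp[of "x - s"] by (force simp: dist_norm)+
  have far0: "\<Theta> s = 0" "\<theta> s = 0" if "!!x. x \<in> S ==> dist x s > \<eta>" for s
  proof -
   have f: "?Z0 x * bump \<rho> (x - s) = 0" "?Z0 x * ?Y1 (x - s) = 0" for x
    by (rule far, erule that)+
   show "\<Theta> s = 0" "\<theta> s = 0" unfolding \<Theta>_def \<theta>_def f by simp_all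
  qed
  have not_near: "dist x s' > \<eta>" if "\<not> near s" "dist s s' <= \<eta>" "x \<in> S" for s s' x
   using that dist_triangle[of x s s'] by (force simp: near_def dist_commute)
  have cont: "continuous_on UNIV \<Theta>"
  proof (intro continuous_at_imp_continuous_on ballI)
   fix s
   show "continuous (at s) \<Theta>"
   proof (cases "near s")
    case False
    have "((%_. 0) \<longlongrightarrow> 0) (at s)" by simp
    then have "(\<Theta> \<longlongrightarrow> 0) (at s)"
    proof (rule Lim_transform_eventually)
     have "\<forall>\<^sub>F s' in at s. dist s' s < \<eta>" using \<eta> eventually_at_ball[of \<eta> s UNIV] by (simp add: dist_commute)
     then show "\<forall>\<^sub>F s' in at s. 0 = \<Theta> s'"
     proof eventually_elim
      case (elim s')
      then show ?case using far0(1)[of s'] not_near[OF False, of s'] by (simp add: dist_commute less_imp_le)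
     qed
    qed
    moreover have "\<Theta> s = 0" using far0(1)[of s] not_near[OF False, of s] \<eta> by simp
    ultimately show ?thesis by (simp add: isCont_def)
   next
    case True
    have sD: "s \<in> D" using nearD[OF True, of s] \<eta> by simp
    show ?thesis
     unfolding continuous_at_sequentially
    proof (intro allI impI)
     fix a assume a: "a \<longlonglongrightarrow> s"
     have "\<forall>\<^sub>F n in sequentially. a n \<in> D" using a open_D sD by (rule topological_tendstoD)
     then obtain n0 where n0: "!!n. n \<ge> n0 ==> a n \<in> D" by (auto simp: eventually_sequentially)
     have a': "(%n. a (n + n0)) \<longlonglongrightarrow> s" using a by (rule LIMSEQ_ignore_initial_segment)
     have "(%n. \<integral>x. F (a (n + n0)) x * (?Z0 x * bump \<rho> (x - a (n + n0))) \<partial>L) \<longlonglongrightarrow> (\<integral>x. F s x * (?Z0 x * bump \<rho> (x - s)) \<partial>L)"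
     proof (rule Lp_integral_tendsto[OF _ _ _ m1 m1 b1])
      show "F (a (n + n0)) \<in> LP" for n using holder_Lp_D(1)[OF F(1) Dcl[OF n0]] by simp
      show "F s \<in> LP" using holder_Lp_D(1)[OF F(1) Dcl[OF sD]] .
      show "(%n. nrm (%x. F (a (n + n0)) x - F s x)) \<longlonglongrightarrow> 0"
      proof (rule tendsto_sandwich[OF _ _ tendsto_const])
       show "\<forall>\<^sub>F n in sequentially. nrm (%x. F (a (n + n0)) x - F s x) <= B * norm (a (n + n0) - s) powr \<gamma>"
        using holder_Lp_diff_le[OF F(1) Dcl[OF sD] Dcl[OF n0]] by (intro always_eventually) simp
       have "(%n. norm (a (n + n0) - s)) \<longlonglongrightarrow> 0" using a' LIM_zero tendsto_norm_zero by blast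
       then have "(%n. norm (a (n + n0) - s) powr \<gamma>) \<longlonglongrightarrow> 0 powr \<gamma>" using \<gamma>(1) by (intro tendsto_powr') auto
       then show "(%n. B * norm (a (n + n0) - s) powr \<gamma>) \<longlonglongrightarrow> 0" by (intro tendsto_mult_right_zero) simp
      qed simp
      show "(%n. ?Z0 x * bump \<rho> (x - a (n + n0))) \<longlonglongrightarrow> ?Z0 x * bump \<rho> (x - s)" for x
      proof (intro tendsto_mult_left)
       have "(%n. x - a (n + n0)) \<longlonglongrightarrow> x - s" by (intro tendsto_diff tendsto_const a')
       then show "(%n. bump \<rho> (x - a (n + n0))) \<longlonglongrightarrow> bump \<rho> (x - s)"
        by (rule continuous_on_tendsto_compose[OF continuous_on_bump[of UNIV]]) auto
      qed
     qed
     then have "(%n. \<Theta> (a (n + n0))) \<longlonglongrightarrow> \<Theta> s" using n0 sD by (simp add: \<Theta>_def)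
     then show "(\<Theta> \<circ> a) \<longlonglongrightarrow> \<Theta> s" unfolding comp_def by (rule LIMSEQ_offset)
    qed
   qed
  qed
  define t where "t n = \<eta> / (real n + 1)" for n
  have t: "0 < t n" "t n <= \<eta>" "t n ~= 0" for n using \<eta> by (auto simp: t_def divide_le_eq)
  have t0: "t \<longlonglongrightarrow> 0"
  proof -
   have "(%n. \<eta> * inverse (real (Suc n))) \<longlonglongrightarrow> \<eta> * 0" by (intro tendsto_mult_left LIMSEQ_inverse_real_of_nat)
   then show ?thesis by (simp add: t_def[abs_def] divide_inverse add.commute)
  qed
  have tn: "norm (t n *\<^sub>R ?e) = t n" for n using t(1)[of n] by (simp add: norm_axis_1)
  have quot: "(\<Theta> (t n *\<^sub>R ?e + s) - \<Theta> s) / t n =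
    (\<integral>x. ((F (s + t n *\<^sub>R ?e) x - F s x) / t n) * (?Z0 x * bump \<rho> (x - (s + t n *\<^sub>R ?e))) \<partial>L)
    + (\<integral>x. F s x * (?Z0 x * ((bump \<rho> (x - (s + t n *\<^sub>R ?e)) - bump \<rho> (x - s)) / t n)) \<partial>L)"
   if D2: "s \<in> D" "s + t n *\<^sub>R ?e \<in> D" for s n
  proof -
   let ?s' = "s + t n *\<^sub>R ?e"
   note Fs = holder_Lp_D(1)[OF F(1) Dcl[OF D2(1)]] holder_Lp_D(1)[OF F(1) Dcl[OF D2(2)]]
   have i: "integrable L (%x. F s x * (?Z0 x * bump \<rho> (x - ?s')))" "integrable L (%x. F ?s' x * (?Z0 x * bump \<rho> (x - ?s')))"
    "integrable L (%x. F s x * (?Z0 x * bump \<rho> (x - s)))"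
    by (rule Lp_integrable, rule Lp_mult_bounded[OF _ m1 b1], rule Fs)+
   have 1: "(%x. ((F ?s' x - F s x) / t n) * (?Z0 x * bump \<rho> (x - ?s')))
     = (%x. (F ?s' x * (?Z0 x * bump \<rho> (x - ?s')) - F s x * (?Z0 x * bump \<rho> (x - ?s'))) / t n)"
    by (auto simp: field_simps)
   have 2: "(%x. F s x * (?Z0 x * ((bump \<rho> (x - ?s') - bump \<rho> (x - s)) / t n)))
     = (%x. (F s x * (?Z0 x * bump \<rho> (x - ?s')) - F s x * (?Z0 x * bump \<rho> (x - s))) / t n)"
    by (auto simp: field_simps)
   show ?thesis
    unfolding 1 2 using i D2 by (simp add: \<Theta>_def add.commute diff_divide_distrib)
  qed
  have shiftD: "s + \<tau> *\<^sub>R ?e \<in> D" if "near s" "0 <= \<tau>" "\<tau> <= \<eta>" for s \<tau>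
   using that \<eta> by (intro nearD[OF that(1)]) (simp add: dist_norm norm_axis_1)
  have h2b: "\<bar>?Z0 x * ((bump \<rho> (x - (s + t n *\<^sub>R ?e)) - bump \<rho> (x - s)) / t n)\<bar> <= C0 * CY" for x s n
  proof -
   have "\<bar>bump \<rho> ((x - s) + (- t n) *\<^sub>R ?e) - bump \<rho> (x - s)\<bar> <= CY * \<bar>- t n\<bar>"
    using smooth_derivs_axis_Lipschitz[OF Ys CY(2), of "x - s" "- t n"] by (simp only: Y(2))
   then have "\<bar>(bump \<rho> (x - (s + t n *\<^sub>R ?e)) - bump \<rho> (x - s)) / t n\<bar> <= CY"
    using t(1)[of n] by (simp add: divide_le_eq algebra_simps)
   then show ?thesis
    using C0 by (simp only: abs_mult) (intro mult_mono, auto)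
  qed
  have h2m: "(%x. ?Z0 x * ((bump \<rho> (x - (s + t n *\<^sub>R ?e)) - bump \<rho> (x - s)) / t n)) \<in> borel_measurable L" for s n
   by (intro borel_measurable_times borel_measurable_divide borel_measurable_diff Z0m bm) auto
  have qlim: "(%n. (\<Theta> (t n *\<^sub>R ?e + s) - \<Theta> s) / t n) \<longlonglongrightarrow> \<theta> s" for s
  proof (cases "near s")
   case False
   have "\<Theta> (t n *\<^sub>R ?e + s) = 0" for n
    using t(2)[of n] tn[of n] by (intro far0(1) not_near[OF False]) (auto simp: dist_norm)
   moreover have "\<Theta> s = 0" "\<theta> s = 0" using far0[of s] not_near[OF False, of s] \<eta> by auto
   ultimately show ?thesis by simp
  next
   case True
   have sD: "s \<in> D" using shiftD[OF True, of 0] \<eta> by simp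
   have s'D: "s + t n *\<^sub>R ?e \<in> D" for n using shiftD[OF True] t[of n] by simp
   have s'lim: "(%n. s + t n *\<^sub>R ?e) \<longlonglongrightarrow> s + 0 *\<^sub>R ?e" by (intro tendsto_intros t0)
   have "(%n. \<integral>x. ((F (s + t n *\<^sub>R ?e) x - F s x) / t n) * (?Z0 x * bump \<rho> (x - (s + t n *\<^sub>R ?e))) \<partial>L)
     \<longlonglongrightarrow> (\<integral>x. v s x * (?Z0 x * bump \<rho> (x - s)) \<partial>L)"
   proof (rule Lp_integral_tendsto[OF _ _ _ m1 m1 b1])
    have "(%x. (1 / t n) * (F (s + t n *\<^sub>R ?e) x - F s x)) \<in> LP" for n
     by (intro Lp_scale Lp_diff holder_Lp_D(1)[OF F(1)] Dcl sD s'D)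
    then show "(%x. (F (s + t n *\<^sub>R ?e) x - F s x) / t n) \<in> LP" for n by simp
    show "v s \<in> LP" by (intro holder_Lp_D(1)[OF v(1)] Dcl sD)
    have "filterlim t (at 0) sequentially" unfolding filterlim_at using t0 t(3) by simp
    from filterlim_compose[OF deriv[OF sD] this]
    show "(%n. nrm (%x. (F (s + t n *\<^sub>R ?e) x - F s x) / t n - v s x)) \<longlonglongrightarrow> 0" .
    show "(%n. ?Z0 x * bump \<rho> (x - (s + t n *\<^sub>R ?e))) \<longlonglongrightarrow> ?Z0 x * bump \<rho> (x - s)" for x
    proof (intro tendsto_mult_left)
     have "(%n. x - (s + t n *\<^sub>R ?e)) \<longlonglongrightarrow> x - (s + 0 *\<^sub>R ?e)" by (intro tendsto_diff tendsto_const s'lim)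
     then have "(%n. x - (s + t n *\<^sub>R ?e)) \<longlonglongrightarrow> x - s" by simp
     then show "(%n. bump \<rho> (x - (s + t n *\<^sub>R ?e))) \<longlonglongrightarrow> bump \<rho> (x - s)"
      by (rule continuous_on_tendsto_compose[OF continuous_on_bump[of UNIV]]) auto
    qed
   qed
   moreover have "(%n. \<integral>x. F s x * (?Z0 x * ((bump \<rho> (x - (s + t n *\<^sub>R ?e)) - bump \<rho> (x - s)) / t n)) \<partial>L)
     \<longlonglongrightarrow> (\<integral>x. F s x * (?Z0 x * (- ?Y1 (x - s))) \<partial>L)"
   proof (rule Lp_integral_tendsto[OF _ _ _ h2m _ h2b])
    show "F s \<in> LP" "F s \<in> LP" by (intro holder_Lp_D(1)[OF F(1)] Dcl sD)+
    show "(%x. ?Z0 x * - ?Y1 (x - s)) \<in> borel_measurable L" using m2[of s] by simp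
    show "(%n. ?Z0 x * ((bump \<rho> (x - (s + t n *\<^sub>R ?e)) - bump \<rho> (x - s)) / t n)) \<longlonglongrightarrow> ?Z0 x * - ?Y1 (x - s)" for x
    proof (intro tendsto_mult_left)
     have "((%t. Y (%_. 0) ((x - s) + t *\<^sub>R ?e)) has_real_derivative Y ((%_. 0)(i := Suc 0)) (x - s)) (at 0)"
      using Ys unfolding smooth_derivs_def by (elim conjE allE)
     then have dq: "((%h. (bump \<rho> ((x - s) + h *\<^sub>R ?e) - bump \<rho> (x - s)) / h) \<longlongrightarrow> ?Y1 (x - s)) (at 0)"
      by (simp add: has_field_derivative_iff Y(2))
     have "filterlim (%n. - t n) (at 0) sequentially"
      unfolding filterlim_at using tendsto_minus[OF t0] t(3) by simp
     from tendsto_minus[OF filterlim_compose[OF dq this]]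
     show "(%n. (bump \<rho> (x - (s + t n *\<^sub>R ?e)) - bump \<rho> (x - s)) / t n) \<longlonglongrightarrow> - ?Y1 (x - s)"
      by (simp add: algebra_simps)
    qed
   qed simp
   ultimately have "(%n. (\<Theta> (t n *\<^sub>R ?e + s) - \<Theta> s) / t n) \<longlonglongrightarrow>
     (\<integral>x. v s x * (?Z0 x * bump \<rho> (x - s)) \<partial>L) + (\<integral>x. F s x * (?Z0 x * (- ?Y1 (x - s))) \<partial>L)"
    unfolding quot[OF sD s'D] by (rule tendsto_add)
   then show ?thesis using sD by (simp add: \<theta>_def)
  qed
  \<comment> \<open>3 B bounds the difference quotients of F in the mean: B for v s and 2 B for the
    deviation of v along the segment. The second summand uses the bound CY of the derivative of the
    kernel.\<close>
  define Cq where "Cq = C0 * ((measure lebesgue D + 1) * (3 * B)) + C0 * CY * ((measure lebesgue D + 1) * B)"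
  have Cq: "0 <= Cq" using C0 CY B by (simp add: Cq_def)
  have qbd: "\<bar>(\<Theta> (t n *\<^sub>R ?e + s) - \<Theta> s) / t n\<bar> <= Cq * indicator (cball 0 R) s" for n s
  proof (cases "near s")
   case False
   have "\<Theta> (t n *\<^sub>R ?e + s) = 0"
    using t(2)[of n] tn[of n] by (intro far0(1) not_near[OF False]) (auto simp: dist_norm)
   moreover have "\<Theta> s = 0" using far0[of s] not_near[OF False, of s] \<eta> by auto
   ultimately show ?thesis using Cq by simp
  next
   case True
   have sD: "s \<in> D" using shiftD[OF True, of 0] \<eta> by simp
   have s'D: "s + t n *\<^sub>R ?e \<in> D" using shiftD[OF True] t[of n] by simp
   have FL: "F (s + \<tau> *\<^sub>R ?e) \<in> LP" "v (s + \<tau> *\<^sub>R ?e) \<in> LP" "nrm (v (s + \<tau> *\<^sub>R ?e)) <= B"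
    if "0 <= \<tau>" "\<tau> <= \<eta>" for \<tau>
    using holder_Lp_D[OF F(1)] holder_Lp_D[OF v(1)] Dcl[OF shiftD[OF True that]] by auto
   have "nrm (%x. F (s + t n *\<^sub>R ?e) x - F (s + 0 *\<^sub>R ?e) x - (t n - 0) * v s x) <= (2 * B) * (t n - 0)"
   proof (rule Lp_mvt[where E="%\<tau>. F (s + \<tau> *\<^sub>R ?e)" and E'="%\<tau>. v (s + \<tau> *\<^sub>R ?e)"])
    show "0 <= t n" using t(1)[of n] by simp
    show "v s \<in> LP" using FL(2)[of 0] \<eta> by simp
    fix \<tau> assume "0 <= \<tau>" "\<tau> <= t n"
    then have \<tau>: "0 <= \<tau>" "\<tau> <= \<eta>" using t(2)[of n] by auto
    show "F (s + \<tau> *\<^sub>R ?e) \<in> LP" "v (s + \<tau> *\<^sub>R ?e) \<in> LP" using FL[OF \<tau>] by auto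
    show "nrm (%x. v (s + \<tau> *\<^sub>R ?e) x - v s x) <= 2 * B"
     using Lp_norm_triangle_diff[OF FL(2)[OF \<tau>] FL(2)[of 0]] FL(3)[OF \<tau>] FL(3)[of 0] \<eta> by simp
    fix \<epsilon> :: real assume "\<epsilon> > 0"
    from Lp_quotient_deriv[OF deriv[OF shiftD[OF True \<tau>]] _ this]
    show "\<exists>d>0. \<forall>u. \<bar>u\<bar> < d --> nrm (%x. F (s + (\<tau> + u) *\<^sub>R ?e) x - F (s + \<tau> *\<^sub>R ?e) x - u * v (s + \<tau> *\<^sub>R ?e) x) <= \<epsilon> * \<bar>u\<bar>"
     by (simp add: scaleR_add_left add.assoc)
   qed
   then have mv: "nrm (%x. F (s + t n *\<^sub>R ?e) x - F s x - t n * v s x) <= 2 * B * t n" by simp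
   have Fd: "(%x. F (s + t n *\<^sub>R ?e) x - F s x) \<in> LP"
    by (intro Lp_diff holder_Lp_D(1)[OF F(1)] Dcl sD s'D)
   have vs: "v s \<in> LP" "nrm (v s) <= B" using holder_Lp_D[OF v(1) Dcl[OF sD]] by auto
   have "nrm (%x. F (s + t n *\<^sub>R ?e) x - F s x) <= nrm (%x. t n * v s x) + nrm (%x. F (s + t n *\<^sub>R ?e) x - F s x - t n * v s x)"
    by (rule Lp_norm_le_add_diff[OF Fd Lp_scale[OF vs(1)]])
   also have "\<dots> <= t n * B + 2 * B * t n"
   proof -
    have "t n * nrm (v s) <= t n * B" using vs(2) t(1)[of n] by (intro mult_left_mono) auto
    from add_mono[OF this mv] show ?thesis using t(1)[of n] by (simp only: Lp_norm_scale abs_of_pos)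
   qed
   finally have "nrm (%x. (1 / t n) * (F (s + t n *\<^sub>R ?e) x - F s x)) <= 3 * B"
    unfolding Lp_norm_scale using t(1)[of n] by (simp add: field_simps)
   then have q3: "nrm (%x. (F (s + t n *\<^sub>R ?e) x - F s x) / t n) <= 3 * B" by simp
   have qL: "(%x. (F (s + t n *\<^sub>R ?e) x - F s x) / t n) \<in> LP"
    using Lp_scale[OF Fd, of "1 / t n"] by simp
   have mD: "0 <= measure lebesgue D + 1" by (simp add: add_nonneg_nonneg)
   have "\<bar>\<integral>x. ((F (s + t n *\<^sub>R ?e) x - F s x) / t n) * (?Z0 x * bump \<rho> (x - (s + t n *\<^sub>R ?e))) \<partial>L\<bar> <= C0 * ((measure lebesgue D + 1) * (3 * B))"
    by (rule order_trans[OF Lp_integral_mult_bound[OF qL m1 b1]]) (intro mult_left_mono q3 C0(1) mD)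
   moreover have "\<bar>\<integral>x. F s x * (?Z0 x * ((bump \<rho> (x - (s + t n *\<^sub>R ?e)) - bump \<rho> (x - s)) / t n)) \<partial>L\<bar> <= C0 * CY * ((measure lebesgue D + 1) * B)"
    by (rule order_trans[OF Lp_integral_mult_bound[OF holder_Lp_D(1)[OF F(1) Dcl[OF sD]] h2m h2b]])
     (intro mult_left_mono holder_Lp_D(2)[OF F(1) Dcl[OF sD]] mult_nonneg_nonneg C0(1) CY(1) mD)
   ultimately have "\<bar>(\<Theta> (t n *\<^sub>R ?e + s) - \<Theta> s) / t n\<bar> <= Cq"
    unfolding quot[OF sD s'D] Cq_def by linarith
   then show ?thesis using nearR[OF True] by simp
  qed
  have supp: "norm s <= R" if "\<Theta> s ~= 0" for s
  proof (rule nearR, rule ccontr)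
   assume "\<not> near s"
   then show False using far0(1)[of s] not_near[of s s] \<eta> that by simp
  qed
  note zero = integral_shift_quotient_eq_0[OF cont supp qlim qbd]
  have "(\<integral>s. \<theta> s \<partial>L) = (\<integral>s. indicator D s * \<theta> s \<partial>lborel)" by (rule integral_L_eq_lborel[OF zero(2)])
  also have "(%s. indicator D s * \<theta> s) = \<theta>" by (auto simp: \<theta>_def fun_eq_iff)
  finally have "(\<integral>s. \<theta> s \<partial>L) = 0" using zero(1) by simp
  moreover have "(\<integral>s. \<theta> s \<partial>L) = (\<integral>s. (\<integral>x. F s x * (?Z1 x * bump \<rho> (x - s)) \<partial>L) + (\<integral>x. w s x * (?Z0 x * bump \<rho> (x - s)) \<partial>L)
    + (\<integral>x. v s x * (?Z0 x * bump \<rho> (x - s)) \<partial>L) \<partial>L)"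
  proof (rule Bochner_Integration.integral_cong[OF refl])
   fix s assume "s \<in> space L"
   then have "s \<in> D" by simp
   from prod_rule[OF this] this
   show "\<theta> s = (\<integral>x. F s x * (?Z1 x * bump \<rho> (x - s)) \<partial>L) + (\<integral>x. w s x * (?Z0 x * bump \<rho> (x - s)) \<partial>L)
    + (\<integral>x. v s x * (?Z0 x * bump \<rho> (x - s)) \<partial>L)" by (simp add: \<theta>_def)
  qed
  moreover have "integrable L (%s. \<integral>x. F s x * (?Z1 x * bump \<rho> (x - s)) \<partial>L)"
   by (rule diag_mollify(1)[OF \<gamma> B F test_derivs_continuous[OF Z] C1(2) \<delta>(1) ballD[OF ZS]])
  moreover have "integrable L (%s. \<integral>x. w s x * (?Z0 x * bump \<rho> (x - s)) \<partial>L)"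
   by (rule diag_mollify(1)[OF \<gamma> B w test_derivs_continuous[OF Z] C0(2) \<delta>(1) ballD[OF ZS]])
  moreover have "integrable L (%s. \<integral>x. v s x * (?Z0 x * bump \<rho> (x - s)) \<partial>L)"
   by (rule diag_mollify(1)[OF \<gamma> B v test_derivs_continuous[OF Z] C0(2) \<delta>(1) ballD[OF ZS]])
  ultimately show ?thesis by simp
 qed
 define \<rho>' where "\<rho>' k = \<eta> / ?N * inverse (real (Suc k))" for k
 have N0: "0 < ?N" by simp
 have \<rho>'1: "0 < \<rho>' k" for k using \<eta> N0 by (simp add: \<rho>'_def)
 have \<rho>'2: "?N * \<rho>' k <= \<eta>" for k
 proof -
  have "?N * \<rho>' k = \<eta> * inverse (real (Suc k))" by (simp add: \<rho>'_def)
  also have "\<dots> <= \<eta> * 1" using \<eta> by (intro mult_left_mono) (auto simp: inverse_le_1_iff)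
  finally show ?thesis by simp
 qed
 have \<rho>'3: "\<rho>' \<longlonglongrightarrow> 0"
  unfolding \<rho>'_def[abs_def] by (intro tendsto_mult_right_zero LIMSEQ_inverse_real_of_nat)
 let ?c = "%k. \<integral>z. bump (\<rho>' k) (z :: real^'d) \<partial>lborel"
 have "(%k. (\<integral>s. (\<integral>x. F s x * (?Z1 x * bump (\<rho>' k) (x - s)) \<partial>L) \<partial>L) / ?c k
   + (\<integral>s. (\<integral>x. w s x * (?Z0 x * bump (\<rho>' k) (x - s)) \<partial>L) \<partial>L) / ?c k
   + (\<integral>s. (\<integral>x. v s x * (?Z0 x * bump (\<rho>' k) (x - s)) \<partial>L) \<partial>L) / ?c k)
   \<longlonglongrightarrow> (\<integral>x. \<psi> x x * ?Z1 x \<partial>L) + (\<integral>x. \<omega> x x * ?Z0 x \<partial>L) + (\<integral>x. \<upsilon> x x * ?Z0 x \<partial>L)"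
  by (intro tendsto_add
    diag_mollify(2)[OF \<gamma> B F test_derivs_continuous[OF Z] C1(2) \<delta>(1) ballD[OF ZS] \<rho>'1 \<rho>'3]
    diag_mollify(2)[OF \<gamma> B w test_derivs_continuous[OF Z] C0(2) \<delta>(1) ballD[OF ZS] \<rho>'1 \<rho>'3]
    diag_mollify(2)[OF \<gamma> B v test_derivs_continuous[OF Z] C0(2) \<delta>(1) ballD[OF ZS] \<rho>'1 \<rho>'3])
 moreover have "(\<integral>s. (\<integral>x. F s x * (?Z1 x * bump (\<rho>' k) (x - s)) \<partial>L) \<partial>L) / ?c k
   + (\<integral>s. (\<integral>x. w s x * (?Z0 x * bump (\<rho>' k) (x - s)) \<partial>L) \<partial>L) / ?c k
   + (\<integral>s. (\<integral>x. v s x * (?Z0 x * bump (\<rho>' k) (x - s)) \<partial>L) \<partial>L) / ?c k = 0" for k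
  using key[OF \<rho>'1 \<rho>'2, of k] by (simp only: add_divide_distrib[symmetric] div_0)
 ultimately have sum0: "(\<integral>x. \<psi> x x * ?Z1 x \<partial>L) + (\<integral>x. \<omega> x x * ?Z0 x \<partial>L) + (\<integral>x. \<upsilon> x x * ?Z0 x \<partial>L) = 0"
  by (simp add: LIMSEQ_const_iff)
 have dL: "(%x. \<omega> x x) \<in> LP" "(%x. \<upsilon> x x) \<in> LP"
  using diag_bound[OF \<gamma>] B w v by auto
 have "(\<integral>x. (\<omega> x x + \<upsilon> x x) * ?Z0 x \<partial>L) = (\<integral>x. \<omega> x x * ?Z0 x \<partial>L) + (\<integral>x. \<upsilon> x x * ?Z0 x \<partial>L)"
  unfolding distrib_right using dL Z by (intro Bochner_Integration.integral_add test_mult_integrable)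
 then show "(\<integral>x. \<psi> x x * ?Z1 x \<partial>L) = (- 1) ^ mi_order ?ei * (\<integral>x. (\<omega> x x + \<upsilon> x x) * ?Z0 x \<partial>L)"
  using sum0 unfolding ei1 by simp
qed

end

section \<open>Higher derivatives on the diagonal\<close>

context Sobolev_domain
begin

text \<open>F has m levels of derivatives; at each level there is a weak derivative w in x and a
  derivative v in s, all Hoelder with the constant B. Existential witnesses avoid indexing the mixed
  derivatives. By the chain rule a derivative of the diagonal of F is the diagonal of w plus that of
  v, so the recursion matches the induction on m.\<close>

primrec jet :: "nat => real => real => (real^'d => real^'d => real) => bool" where
 "jet 0 \<gamma> B F \<longleftrightarrow> holder_Lp \<gamma> B F"
| "jet (Suc m) \<gamma> B F \<longleftrightarrow> holder_Lp \<gamma> B F \<and>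
   (\<forall>i. \<exists>w v. jet m \<gamma> B w & jet m \<gamma> B v \<and>
    (\<forall>s\<in>D. has_weak_deriv D ((%_. 0)(i := 1)) (F s) (w s)) \<and>
    (\<forall>s\<in>D. ((%t. nrm (%x. (F (s + t *\<^sub>R axis i 1) x - F s x) / t - v s x)) \<longlongrightarrow> 0) (at 0)))"

lemma jet_holder: "jet m \<gamma> B F ==> holder_Lp \<gamma> B F"
 by (cases m) auto

lemma holder_Lp_mono:
 assumes "holder_Lp \<gamma> B F" "B <= B'"
 shows "holder_Lp \<gamma> B' F"
proof -
 have "B * norm (t - s) powr \<gamma> <= B' * norm (t - s) powr \<gamma>" for s t :: "real^'d"
  using assms(2) by (intro mult_right_mono) auto
 with assms show ?thesis unfolding holder_Lp_def by (meson order_trans)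
qed

lemma jet_mono:
 assumes "B <= B'"
 shows "jet m \<gamma> B F ==> jet m \<gamma> B' F"
proof (induction m arbitrary: F)
 case 0
 then show ?case using holder_Lp_mono[OF _ assms] by simp
next
 case (Suc m)
 show ?case
  unfolding jet.simps
 proof (intro conjI allI)
  show "holder_Lp \<gamma> B' F" using Suc.prems holder_Lp_mono[OF _ assms] by simp
  fix i
  from Suc.prems[unfolded jet.simps, THEN conjunct2, rule_format, of i]
  obtain w v where "jet m \<gamma> B w" "jet m \<gamma> B v"
    "\<forall>s\<in>D. has_weak_deriv D ((%_. 0)(i := 1)) (F s) (w s)"
    "\<forall>s\<in>D. ((%t. nrm (%x. (F (s + t *\<^sub>R axis i 1) x - F s x) / t - v s x)) \<longlongrightarrow> 0) (at 0)"
   by (elim exE conjE)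
  then show "\<exists>w v. jet m \<gamma> B' w & jet m \<gamma> B' v \<and>
    (\<forall>s\<in>D. has_weak_deriv D ((%_. 0)(i := 1)) (F s) (w s)) \<and>
    (\<forall>s\<in>D. ((%t. nrm (%x. (F (s + t *\<^sub>R axis i 1) x - F s x) / t - v s x)) \<longlongrightarrow> 0) (at 0))"
   using Suc.IH by (intro exI[of _ w] exI[of _ v] conjI)
 qed
qed

lemma holder_Lp_add:
 assumes F: "holder_Lp \<gamma> B F" and G: "holder_Lp \<gamma> B' G"
 shows "holder_Lp \<gamma> (B + B') (%s x. F s x + G s x)"
 unfolding holder_Lp_def
proof (intro conjI ballI)
 fix s assume s: "s \<in> closure D"
 note FG = holder_Lp_D[OF F s] holder_Lp_D[OF G s]
 show "(%x. F s x + G s x) \<in> LP" by (intro Lp_add FG)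
 show "nrm (%x. F s x + G s x) <= B + B'" using Lp_norm_triangle[OF FG(1,3)] FG(2,4) by linarith
 fix t assume t: "t \<in> closure D"
 note FGt = holder_Lp_D[OF F t] holder_Lp_D[OF G t]
 have "nrm (%x. (F t x - F s x) + (G t x - G s x)) <= nrm (%x. F t x - F s x) + nrm (%x. G t x - G s x)"
  by (intro Lp_norm_triangle Lp_diff FG FGt)
 also have "\<dots> <= (B + B') * norm (t - s) powr \<gamma>"
  using holder_Lp_diff_le[OF F s t] holder_Lp_diff_le[OF G s t] by (simp add: distrib_right)
 finally show "nrm (%x. F t x + G t x - (F s x + G s x)) <= (B + B') * norm (t - s) powr \<gamma>"
  by (simp add: algebra_simps)
qed

lemma eventually_shift_mem:
 assumes "s \<in> D"
 shows "\<forall>\<^sub>F t in at 0. s + t *\<^sub>R e \<in> D"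
proof -
 have "((%t. s + t *\<^sub>R e) \<longlongrightarrow> s + 0 *\<^sub>R e) (at 0)" by (intro tendsto_intros)
 then show ?thesis using topological_tendstoD[OF _ open_D] assms by fastforce
qed

text \<open>Sums arise because the s-derivative of f(s, ..., s) is a sum over the variables. The
  constants add at every level.\<close>

lemma jet_add:
 "jet m \<gamma> B F ==> jet m \<gamma> B' G ==> jet m \<gamma> (B + B') (%s x. F s x + G s x)"
proof (induction m arbitrary: F G)
 case 0
 then show ?case using holder_Lp_add by simp
next
 case (Suc m)
 note hF = jet_holder[OF Suc.prems(1)] and hG = jet_holder[OF Suc.prems(2)]
 have Dcl: "s \<in> closure D" if "s \<in> D" for s using that closure_subset[of D] by blast
 show ?case
  unfolding jet.simps
 proof (intro conjI allI)
  show "holder_Lp \<gamma> (B + B') (%s x. F s x + G s x)" by (rule holder_Lp_add[OF hF hG])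
  fix i
  from Suc.prems(1)[unfolded jet.simps, THEN conjunct2, rule_format, of i]
  obtain w v where w: "jet m \<gamma> B w" "jet m \<gamma> B v"
    "\<forall>s\<in>D. has_weak_deriv D ((%_. 0)(i := 1)) (F s) (w s)"
    "\<forall>s\<in>D. ((%t. nrm (%x. (F (s + t *\<^sub>R axis i 1) x - F s x) / t - v s x)) \<longlongrightarrow> 0) (at 0)"
   by (elim exE conjE)
  from Suc.prems(2)[unfolded jet.simps, THEN conjunct2, rule_format, of i]
  obtain w' v' where w': "jet m \<gamma> B' w'" "jet m \<gamma> B' v'"
    "\<forall>s\<in>D. has_weak_deriv D ((%_. 0)(i := 1)) (G s) (w' s)"
    "\<forall>s\<in>D. ((%t. nrm (%x. (G (s + t *\<^sub>R axis i 1) x - G s x) / t - v' s x)) \<longlongrightarrow> 0) (at 0)"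
   by (elim exE conjE)
  show "\<exists>w v. jet m \<gamma> (B + B') w & jet m \<gamma> (B + B') v \<and>
    (\<forall>s\<in>D. has_weak_deriv D ((%_. 0)(i := 1)) (%x. F s x + G s x) (w s)) \<and>
    (\<forall>s\<in>D. ((%t. nrm (%x. (F (s + t *\<^sub>R axis i 1) x + G (s + t *\<^sub>R axis i 1) x - (F s x + G s x)) / t - v s x)) \<longlongrightarrow> 0) (at 0))"
  proof (rule exI[of _ "%s x. w s x + w' s x"], rule exI[of _ "%s x. v s x + v' s x"], intro conjI ballI)
   show "jet m \<gamma> (B + B') (%s x. w s x + w' s x)" by (rule Suc.IH[OF w(1) w'(1)])
   show "jet m \<gamma> (B + B') (%s x. v s x + v' s x)" by (rule Suc.IH[OF w(2) w'(2)])
   fix s assume s: "s \<in> D"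
   note L = holder_Lp_D(1)[OF hF Dcl[OF s]] holder_Lp_D(1)[OF hG Dcl[OF s]]
    holder_Lp_D(1)[OF jet_holder[OF w(1)] Dcl[OF s]] holder_Lp_D(1)[OF jet_holder[OF w'(1)] Dcl[OF s]]
    holder_Lp_D(1)[OF jet_holder[OF w(2)] Dcl[OF s]] holder_Lp_D(1)[OF jet_holder[OF w'(2)] Dcl[OF s]]
   show "has_weak_deriv D ((%_. 0)(i := 1)) (%x. F s x + G s x) (%x. w s x + w' s x)"
    by (rule has_weak_deriv_add[OF L(1,3) bspec[OF w(3) s] L(2,4) bspec[OF w'(3) s]])
   let ?q = "%t. nrm (%x. (F (s + t *\<^sub>R axis i 1) x - F s x) / t - v s x) + nrm (%x. (G (s + t *\<^sub>R axis i 1) x - G s x) / t - v' s x)"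
   show "((%t. nrm (%x. (F (s + t *\<^sub>R axis i 1) x + G (s + t *\<^sub>R axis i 1) x - (F s x + G s x)) / t - (v s x + v' s x))) \<longlongrightarrow> 0) (at 0)"
   proof (rule tendsto_sandwich[OF _ _ tendsto_const])
    show "(?q \<longlongrightarrow> 0) (at 0)" using tendsto_add[OF bspec[OF w(4) s] bspec[OF w'(4) s]] by simp
    show "\<forall>\<^sub>F t in at 0. nrm (%x. (F (s + t *\<^sub>R axis i 1) x + G (s + t *\<^sub>R axis i 1) x - (F s x + G s x)) / t - (v s x + v' s x)) <= ?q t"
     using eventually_shift_mem[OF s, of "axis i 1"]
    proof eventually_elim
     case (elim t)
     note Lt = holder_Lp_D(1)[OF hF Dcl[OF elim]] holder_Lp_D(1)[OF hG Dcl[OF elim]]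
     have "(%x. (1 / t) * (F (s + t *\<^sub>R axis i 1) x - F s x) - v s x) \<in> LP"
      "(%x. (1 / t) * (G (s + t *\<^sub>R axis i 1) x - G s x) - v' s x) \<in> LP"
      by (intro Lp_diff Lp_scale L Lt)+
     then have "nrm (%x. ((F (s + t *\<^sub>R axis i 1) x - F s x) / t - v s x) + ((G (s + t *\<^sub>R axis i 1) x - G s x) / t - v' s x)) <= ?q t"
      by (intro Lp_norm_triangle) simp_all
     moreover have "(%x. ((F (s + t *\<^sub>R axis i 1) x - F s x) / t - v s x) + ((G (s + t *\<^sub>R axis i 1) x - G s x) / t - v' s x))
      = (%x. (F (s + t *\<^sub>R axis i 1) x + G (s + t *\<^sub>R axis i 1) x - (F s x + G s x)) / t - (v s x + v' s x))"
      by (rule ext) (simp add: add_divide_distrib diff_divide_distrib)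
     ultimately show ?case by simp
    qed
   qed simp
  qed
 qed
qed

lemma jet_zero: "jet m \<gamma> 0 (%s x. 0)"
proof (induction m)
 case (Suc m)
 have "holder_Lp \<gamma> 0 (%s x. 0)" using jet_holder[OF Suc] .
 moreover have "has_weak_deriv D \<alpha> (%x. 0) (%x. 0)" for \<alpha> by (simp add: has_weak_deriv_def)
 ultimately show ?case using Suc by (auto intro!: exI[of _ "%s x. 0"])
qed (simp add: holder_Lp_def)

lemma jet_sum:
 assumes "finite S" "!!l. l \<in> S ==> jet m \<gamma> B (F l)"
 shows "jet m \<gamma> (real (card S) * B) (%s x. \<Sum>l\<in>S. F l s x)"
 using assms
proof induction
 case empty
 then show ?case using jet_zero by simp
next
 case (insert l S)
 have "jet m \<gamma> (B + real (card S) * B) (%s x. F l s x + (\<Sum>l\<in>S. F l s x))"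
  using insert by (intro jet_add) auto
 then show ?case using insert.hyps by (simp add: distrib_right)
qed

text \<open>Each derivative of a diagonal splits into two diagonals one level further down, and
  after at most m derivatives this gives the factor 2^m.\<close>

lemma jet_diag:
 assumes \<gamma>: "0 < \<gamma>" "2 * real CARD('d) / \<gamma> < p"
 obtains K where "0 <= K" "!!m B F \<psi> \<beta>. 0 <= B ==> jet m \<gamma> B F ==> rep1 F \<psi> ==> mi_order \<beta> <= m ==>
  \<exists>u. u \<in> LP & has_weak_deriv D \<beta> (%x. \<psi> x x) u & nrm u <= 2 ^ m * K * B"
proof -
 obtain K where K: "0 <= K" "!!B F \<psi>. 0 <= B ==> holder_Lp \<gamma> B F ==> rep1 F \<psi> ==>
   (%x. \<psi> x x) \<in> LP & nrm (%x. \<psi> x x) <= K * B"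
  using diag_bound[OF \<gamma>] by (elim exE conjE) (rule that, auto)
 have ex: "\<exists>\<psi>. rep1 F \<psi>" if "0 <= B" "holder_Lp \<gamma> B F" for B F
  using rep1_exists_bound[OF \<gamma>] that by (elim exE conjE) simp
 have main: "\<exists>u. u \<in> LP & has_weak_deriv D \<beta> (%x. \<psi> x x) u & nrm u <= 2 ^ m * K * B"
  if B: "0 <= B" and j: "jet m \<gamma> B F" and r: "rep1 F \<psi>" and b: "mi_order \<beta> <= m" for m B F \<psi> \<beta>
  using j r b
 proof (induction m arbitrary: F \<psi> \<beta>)
  case 0
  then have "\<beta> = (%_. 0)" by (simp add: mi_order_eq_0_iff)
  moreover have "(%x. \<psi> x x) \<in> LP & nrm (%x. \<psi> x x) <= K * B"
   by (rule K(2)[OF B jet_holder[OF 0(1)] 0(2)])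
  ultimately show ?case using has_weak_deriv_0 by (intro exI[of _ "%x. \<psi> x x"]) simp
 next
  case (Suc m)
  have hF: "holder_Lp \<gamma> B F" by (rule jet_holder[OF Suc.prems(1)])
  show ?case
  proof (cases "mi_order \<beta>")
   case 0
   then have "\<beta> = (%_. 0)" by (simp add: mi_order_eq_0_iff)
   moreover have d: "(%x. \<psi> x x) \<in> LP & nrm (%x. \<psi> x x) <= K * B"
    by (rule K(2)[OF B hF Suc.prems(2)])
   moreover have "1 * (K * B) <= 2 ^ Suc m * (K * B)"
    using K(1) B by (intro mult_right_mono one_le_power) auto
   ultimately show ?thesis using has_weak_deriv_0 by (intro exI[of _ "%x. \<psi> x x"]) (auto simp: mult.assoc)
  next
   case (Suc n)
   obtain i \<beta>' where b: "\<beta> = \<beta>'(i := Suc (\<beta>' i))" "mi_order \<beta>' = n" by (rule mi_order_SucE[OF Suc])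
   have n: "mi_order \<beta>' <= m" using Suc b(2) Suc.prems(3) by simp
   from Suc.prems(1)[unfolded jet.simps, THEN conjunct2, rule_format, of i]
   obtain w v where w: "jet m \<gamma> B w" "jet m \<gamma> B v"
     "\<forall>s\<in>D. has_weak_deriv D ((%_. 0)(i := 1)) (F s) (w s)"
     "\<forall>s\<in>D. ((%t. nrm (%x. (F (s + t *\<^sub>R axis i 1) x - F s x) / t - v s x)) \<longlongrightarrow> 0) (at 0)"
    by (elim exE conjE)
   obtain \<omega> where \<omega>: "rep1 w \<omega>" using ex[OF B jet_holder[OF w(1)]] by (elim exE)
   obtain \<upsilon> where \<upsilon>: "rep1 v \<upsilon>" using ex[OF B jet_holder[OF w(2)]] by (elim exE)
   have d1: "has_weak_deriv D ((%_. 0)(i := 1)) (%x. \<psi> x x) (%x. \<omega> x x + \<upsilon> x x)"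
    by (rule weak_deriv_diag[OF \<gamma> B hF Suc.prems(2) jet_holder[OF w(1)] \<omega> jet_holder[OF w(2)] \<upsilon>
      bspec[OF w(3)] bspec[OF w(4)]])
   obtain u1 where u1: "u1 \<in> LP" "has_weak_deriv D \<beta>' (%x. \<omega> x x) u1" "nrm u1 <= 2 ^ m * K * B"
    using Suc.IH[OF w(1) \<omega> n] by (elim exE conjE)
   obtain u2 where u2: "u2 \<in> LP" "has_weak_deriv D \<beta>' (%x. \<upsilon> x x) u2" "nrm u2 <= 2 ^ m * K * B"
    using Suc.IH[OF w(2) \<upsilon> n] by (elim exE conjE)
   have dL: "(%x. \<omega> x x) \<in> LP" "(%x. \<upsilon> x x) \<in> LP"
    using K(2)[OF B jet_holder[OF w(1)] \<omega>] K(2)[OF B jet_holder[OF w(2)] \<upsilon>] by auto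
   have "has_weak_deriv D \<beta>' (%x. \<omega> x x + \<upsilon> x x) (%x. u1 x + u2 x)"
    by (rule has_weak_deriv_add[OF dL(1) u1(1,2) dL(2) u2(1,2)])
   from has_weak_deriv_compose[OF d1 this]
   have "has_weak_deriv D (%j. \<beta>' j + ((%_. 0)(i := 1)) j) (%x. \<psi> x x) (%x. u1 x + u2 x)" .
   moreover have "(%j. \<beta>' j + ((%_. 0)(i := 1)) j) = \<beta>" by (auto simp: b(1))
   ultimately have "has_weak_deriv D \<beta> (%x. \<psi> x x) (%x. u1 x + u2 x)" by simp
   moreover have "nrm (%x. u1 x + u2 x) <= 2 ^ Suc m * K * B"
    using Lp_norm_triangle[OF u1(1) u2(1)] u1(3) u2(3) by simp
   ultimately show ?thesis using Lp_add[OF u1(1) u2(1)] by blast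
  qed
 qed
 show ?thesis by (rule that[OF K(1)], rule main)
qed

lemma Lp_mvt_abs:
 fixes E E' :: "real => real^'d => real"
 assumes E: "!!\<tau>. \<bar>\<tau>\<bar> <= \<bar>t\<bar> ==> E \<tau> \<in> LP" and E': "!!\<tau>. \<bar>\<tau>\<bar> <= \<bar>t\<bar> ==> E' \<tau> \<in> LP"
  and c: "c \<in> LP" and k: "!!\<tau>. \<bar>\<tau>\<bar> <= \<bar>t\<bar> ==> nrm (%x. E' \<tau> x - c x) <= \<kappa>"
  and d: "!!\<tau>. \<bar>\<tau>\<bar> <= \<bar>t\<bar> ==> ((%h. nrm (%x. (E (\<tau> + h) x - E \<tau> x) / h - E' \<tau> x)) \<longlongrightarrow> 0) (at 0)"
 shows "nrm (%x. E t x - E 0 x - t * c x) <= \<kappa> * \<bar>t\<bar>"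
proof -
 have d': "\<exists>d>0. \<forall>h. \<bar>h\<bar> < d --> nrm (%x. E (\<tau> + h) x - E \<tau> x - h * E' \<tau> x) <= \<epsilon> * \<bar>h\<bar>"
  if "\<bar>\<tau>\<bar> <= \<bar>t\<bar>" "\<epsilon> > 0" for \<tau> \<epsilon>
  by (rule Lp_quotient_deriv[OF d[OF that(1)] _ that(2)]) simp
 show ?thesis
 proof (cases "0 <= t")
  case True
  have "nrm (%x. E t x - E 0 x - (t - 0) * c x) <= \<kappa> * (t - 0)"
   by (rule Lp_mvt[where E' = E', OF True E E' c k d']) auto
  then show ?thesis using True by simp
 next
  case False
  have "nrm (%x. E 0 x - E t x - (0 - t) * c x) <= \<kappa> * (0 - t)"
   by (rule Lp_mvt[where E' = E', OF _ E E' c k d']) (use False in auto)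
  moreover have "(%x. E t x - E 0 x - t * c x) = (%x. - (E 0 x - E t x - (0 - t) * c x))" by auto
  ultimately show ?thesis using False by (simp only: Lp_norm_minus) simp
 qed
qed

end

section \<open>Several variables set equal to one point\<close>

context Sobolev_domain
begin

text \<open>The member \<open>f \<beta> \<delta>\<close> stands for the derivative of order \<beta>
  in x and \<delta> in the variables. The members are linked by derivative relations instead of
  being defined as derivatives, so that finite linear combinations of such families are families of
  the same kind.\<close>

definition trace_data :: "nat set => nat => real => real =>
  (('d => nat) => (nat => 'd => nat) => (nat => real^'d) => real^'d => real) => bool" where
 "trace_data I m \<gamma> B f \<longleftrightarrow>
   (\<forall>\<beta> \<delta>. mi_order \<beta> <= m --> \<delta> \<in> mix_indices I m -->
    (\<forall>z\<in>pts I. f \<beta> \<delta> z \<in> LP & nrm (f \<beta> \<delta> z) <= B \<and>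
     (\<forall>l\<in>I. \<forall>s\<in>closure D. nrm (%x. f \<beta> \<delta> (z(l := s)) x - f \<beta> \<delta> z x) <= B * norm (s - z l) powr \<gamma>)) \<and>
    (\<forall>i. Suc (mi_order \<beta>) <= m --> (\<forall>z\<in>pts I.
     has_weak_deriv D ((%_. 0)(i := 1)) (f \<beta> \<delta> z) (f (\<beta>(i := Suc (\<beta> i))) \<delta> z))) \<and>
    (\<forall>l\<in>I. \<forall>i. (mi_inc \<delta> l i) \<in> mix_indices I m --> (\<forall>z\<in>I \<rightarrow>\<^sub>E D.
     ((%t. nrm (%x. (f \<beta> \<delta> (z(l := z l + t *\<^sub>R axis i 1)) x - f \<beta> \<delta> z x) / t
        - f \<beta> (mi_inc \<delta> l i) z x)) \<longlongrightarrow> 0) (at 0))))"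

lemma const_pts: "s \<in> C ==> (\<lambda>l\<in>I. s) \<in> I \<rightarrow>\<^sub>E C"
 by auto

text \<open>The coordinates are changed from those of z' to those of z one at a time.\<close>

lemma holder_telescope:
 assumes I: "finite I" and f: "!!z. z \<in> pts I ==> f z \<in> LP"
  "!!z l s. z \<in> pts I ==> l \<in> I ==> s \<in> closure D ==> nrm (%x. f (z(l := s)) x - f z x) <= B * norm (s - z l) powr \<gamma>"
  and z: "z \<in> pts I" "z' \<in> pts I"
 shows "nrm (%x. f z x - f z' x) <= (\<Sum>l\<in>I. B * norm (z l - z' l) powr \<gamma>)"
proof -
 define w where "w A = (%l. if l \<in> A then z l else z' l)" for A
 have w: "w A \<in> pts I" if "A \<subseteq> I" for A using z that by (auto simp: w_def PiE_iff extensional_def)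
 have "nrm (%x. f (w A) x - f (w {}) x) <= (\<Sum>l\<in>A. B * norm (z l - z' l) powr \<gamma>)" if "A \<subseteq> I" for A
  using finite_subset[OF that I] that
 proof (induction A rule: finite_induct)
  case (insert l A)
  then have A: "A \<subseteq> I" "l \<in> I" by auto
  have e: "w (insert l A) = (w A)(l := z l)" by (auto simp: w_def)
  have zl: "z l \<in> closure D" using z(1) A(2) by auto
  have wl: "(w A) l = z' l" using insert.hyps by (simp add: w_def)
  have "nrm (%x. f (w (insert l A)) x - f (w {}) x)
    <= nrm (%x. f (w (insert l A)) x - f (w A) x) + nrm (%x. f (w A) x - f (w {}) x)"
   using A insert.prems by (intro Lp_norm_dist_triangle f w) auto
  also have "\<dots> <= B * norm (z l - z' l) powr \<gamma> + (\<Sum>l\<in>A. B * norm (z l - z' l) powr \<gamma>)"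
   using f(2)[OF w[OF A(1)] A(2) zl] insert.IH[OF A(1)] by (intro add_mono) (simp_all add: e wl)
  finally show ?case using insert.hyps by simp
 qed simp
 from this[of I] have "nrm (%x. f (w I) x - f (w {}) x) <= (\<Sum>l\<in>I. B * norm (z l - z' l) powr \<gamma>)" by simp
 moreover have "w I = z" "w {} = z'" using z by (auto simp: w_def PiE_iff extensional_def fun_eq_iff)
 ultimately show ?thesis by simp
qed

lemma trace_dataD:
 assumes "trace_data I m \<gamma> B f" "mi_order \<beta> <= m" "\<delta> \<in> mix_indices I m"
 shows "z \<in> pts I ==> f \<beta> \<delta> z \<in> LP" "z \<in> pts I ==> nrm (f \<beta> \<delta> z) <= B"
  "z \<in> pts I ==> l \<in> I ==> s \<in> closure D ==> nrm (%x. f \<beta> \<delta> (z(l := s)) x - f \<beta> \<delta> z x) <= B * norm (s - z l) powr \<gamma>"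
  "z \<in> pts I ==> Suc (mi_order \<beta>) <= m ==> has_weak_deriv D ((%_. 0)(i := 1)) (f \<beta> \<delta> z) (f (\<beta>(i := Suc (\<beta> i))) \<delta> z)"
  "y \<in> I \<rightarrow>\<^sub>E D ==> l \<in> I ==> (mi_inc \<delta> l i) \<in> mix_indices I m ==>
    ((%t. nrm (%x. (f \<beta> \<delta> (y(l := y l + t *\<^sub>R axis i 1)) x - f \<beta> \<delta> y x) / t
        - f \<beta> (mi_inc \<delta> l i) y x)) \<longlongrightarrow> 0) (at 0)"
 using assms unfolding trace_data_def by blast+

lemma trace_data_diag_holder:
 assumes I: "finite I" and B: "0 <= B" and f: "trace_data I m \<gamma> B f" "mi_order \<beta> <= m" "\<delta> \<in> mix_indices I m"
 shows "holder_Lp \<gamma> ((1 + real (card I)) * B) (%s. f \<beta> \<delta> (\<lambda>l\<in>I. s))"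
 unfolding holder_Lp_def
proof (intro conjI ballI)
 fix s assume s: "s \<in> closure D"
 note cs = const_pts[OF s, of I]
 show "f \<beta> \<delta> (\<lambda>l\<in>I. s) \<in> LP" by (rule trace_dataD(1)[OF f cs])
 have "nrm (f \<beta> \<delta> (\<lambda>l\<in>I. s)) <= B" by (rule trace_dataD(2)[OF f cs])
 also have "B <= (1 + real (card I)) * B" using B by (simp add: distrib_right)
 finally show "nrm (f \<beta> \<delta> (\<lambda>l\<in>I. s)) <= (1 + real (card I)) * B" .
 fix t assume t: "t \<in> closure D"
 have "nrm (%x. f \<beta> \<delta> (\<lambda>l\<in>I. t) x - f \<beta> \<delta> (\<lambda>l\<in>I. s) x) <= (\<Sum>l\<in>I. B * norm ((\<lambda>l\<in>I. t) l - (\<lambda>l\<in>I. s) l) powr \<gamma>)"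
  by (rule holder_telescope[OF I trace_dataD(1)[OF f] trace_dataD(3)[OF f] const_pts[OF t] cs])
 also have "\<dots> = real (card I) * (B * norm (t - s) powr \<gamma>)" by simp
 also have "\<dots> <= (1 + real (card I)) * (B * norm (t - s) powr \<gamma>)" using B by (intro mult_right_mono) auto
 finally show "nrm (%x. f \<beta> \<delta> (\<lambda>l\<in>I. t) x - f \<beta> \<delta> (\<lambda>l\<in>I. s) x) <= (1 + real (card I)) * B * norm (t - s) powr \<gamma>"
  by (simp add: mult.assoc)
qed

text \<open>The variables are moved from s to s + t e_i one after another. Each move is compared, by
  the mean value inequality, with the derivative at (s, ..., s); the derivatives met on the way
  deviate from it by at most \<open>\<kappa> t\<close>, which is of order |t|^\<gamma>. After
  division by t an error remains that tends to 0.\<close>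

lemma trace_data_diag_deriv:
 assumes I: "finite I" and B: "0 <= B" and \<gamma>: "0 < \<gamma>" and f: "trace_data I m \<gamma> B f" "mi_order \<beta> <= m" "\<delta> \<in> mix_indices I m"
  and \<delta>: "!!l. l \<in> I ==> (mi_inc \<delta> l i) \<in> mix_indices I m" and s: "s \<in> D"
 shows "((%t. nrm (%x. (f \<beta> \<delta> (\<lambda>l\<in>I. s + t *\<^sub>R axis i 1) x - f \<beta> \<delta> (\<lambda>l\<in>I. s) x) / t
      - (\<Sum>l\<in>I. f \<beta> (mi_inc \<delta> l i) (\<lambda>l\<in>I. s) x))) \<longlongrightarrow> 0) (at 0)"
proof -
 let ?e = "axis i 1 :: real^'d"
 define fl where "fl l = f \<beta> (mi_inc \<delta> l i)" for l
 define c where "c = (\<lambda>l\<in>I. s)"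
 have Dcl: "s \<in> closure D" if "s \<in> D" for s using that closure_subset[of D] by blast
 have cp: "c \<in> pts I" unfolding c_def by (rule const_pts[OF Dcl[OF s]])
 obtain r where r: "r > 0" "ball s r \<subseteq> D" using open_D s by (meson openE)
 have line: "s + \<tau> *\<^sub>R ?e \<in> D" if "\<bar>\<tau>\<bar> < r" for \<tau>
  using r(2) that by (auto simp: subset_iff dist_norm norm_axis_1)
 have flL: "fl l z \<in> LP" if "l \<in> I" "z \<in> pts I" for l z
  unfolding fl_def by (rule trace_dataD(1)[OF f(1,2) \<delta>[OF that(1)] that(2)])
 have fL: "f \<beta> \<delta> z \<in> LP" if "z \<in> pts I" for z by (rule trace_dataD(1)[OF f that])
 define \<kappa> where "\<kappa> t = real (card I) * (B * \<bar>t\<bar> powr \<gamma>)" for t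
 have est: "nrm (%x. f \<beta> \<delta> (\<lambda>l\<in>I. s + t *\<^sub>R ?e) x - f \<beta> \<delta> c x - t * (\<Sum>l\<in>I. fl l c x)) <= real (card I) * (\<kappa> t * \<bar>t\<bar>)"
  if t: "\<bar>t\<bar> < r" for t
 proof -
  define zz where "zz A = (\<lambda>l\<in>I. if l \<in> A then s + t *\<^sub>R ?e else s)" for A
  have zzD: "zz A \<in> I \<rightarrow>\<^sub>E D" for A using line[OF t] s by (auto simp: zz_def)
  have zzp: "zz A \<in> pts I" for A using zzD[of A] Dcl by (auto simp: PiE_iff)
  have "nrm (%x. f \<beta> \<delta> (zz A) x - f \<beta> \<delta> c x - t * (\<Sum>l\<in>A. fl l c x)) <= real (card A) * (\<kappa> t * \<bar>t\<bar>)" if "A \<subseteq> I" for A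
   using finite_subset[OF that I] that
  proof (induction A rule: finite_induct)
   case empty
   have "zz {} = c" by (auto simp: zz_def c_def)
   then show ?case by simp
  next
   case (insert l A)
   then have A: "A \<subseteq> I" "l \<in> I" by auto
   define E where "E \<tau> = f \<beta> \<delta> ((zz A)(l := s + \<tau> *\<^sub>R ?e))" for \<tau>
   have pD: "(zz A)(l := s + \<tau> *\<^sub>R ?e) \<in> I \<rightarrow>\<^sub>E D" if "\<bar>\<tau>\<bar> <= \<bar>t\<bar>" for \<tau>
    using zzD[of A] line[of \<tau>] t that A(2) by (auto simp: PiE_iff extensional_def)
   have pp: "(zz A)(l := s + \<tau> *\<^sub>R ?e) \<in> pts I" if "\<bar>\<tau>\<bar> <= \<bar>t\<bar>" for \<tau>
    using pD[OF that] Dcl by (auto simp: PiE_iff)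
   have "nrm (%x. E t x - E 0 x - t * fl l c x) <= \<kappa> t * \<bar>t\<bar>"
   proof (rule Lp_mvt_abs[where E'="%\<tau>. fl l ((zz A)(l := s + \<tau> *\<^sub>R ?e))"])
    show "fl l c \<in> LP" by (rule flL[OF A(2) cp])
    fix \<tau> assume \<tau>: "\<bar>\<tau>\<bar> <= \<bar>t\<bar>"
    show "E \<tau> \<in> LP" unfolding E_def by (rule fL[OF pp[OF \<tau>]])
    show "fl l ((zz A)(l := s + \<tau> *\<^sub>R ?e)) \<in> LP" by (rule flL[OF A(2) pp[OF \<tau>]])
    have "nrm (%x. fl l ((zz A)(l := s + \<tau> *\<^sub>R ?e)) x - fl l c x)
      <= (\<Sum>k\<in>I. B * norm (((zz A)(l := s + \<tau> *\<^sub>R ?e)) k - c k) powr \<gamma>)"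
     unfolding fl_def
     by (rule holder_telescope[OF I trace_dataD(1)[OF f(1,2) \<delta>[OF A(2)]] trace_dataD(3)[OF f(1,2) \<delta>[OF A(2)]] pp[OF \<tau>] cp])
    also have "\<dots> <= (\<Sum>k\<in>I. B * \<bar>t\<bar> powr \<gamma>)"
    proof (intro sum_mono mult_left_mono B powr_mono2)
     fix k assume "k \<in> I"
     then show "norm (((zz A)(l := s + \<tau> *\<^sub>R ?e)) k - c k) <= \<bar>t\<bar>"
      using \<tau> by (auto simp: zz_def c_def norm_axis_1)
    qed (use \<gamma> in auto)
    also have "\<dots> = \<kappa> t" by (simp add: \<kappa>_def)
    finally show "nrm (%x. fl l ((zz A)(l := s + \<tau> *\<^sub>R ?e)) x - fl l c x) <= \<kappa> t" .
    have "((%h. nrm (%x. (f \<beta> \<delta> (((zz A)(l := s + \<tau> *\<^sub>R ?e))(l := ((zz A)(l := s + \<tau> *\<^sub>R ?e)) l + h *\<^sub>R ?e)) x - f \<beta> \<delta> ((zz A)(l := s + \<tau> *\<^sub>R ?e)) x) / h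
        - f \<beta> (mi_inc \<delta> l i) ((zz A)(l := s + \<tau> *\<^sub>R ?e)) x)) \<longlongrightarrow> 0) (at 0)"
     by (rule trace_dataD(5)[OF f pD[OF \<tau>] A(2) \<delta>[OF A(2)]])
    then show "((%h. nrm (%x. (E (\<tau> + h) x - E \<tau> x) / h - fl l ((zz A)(l := s + \<tau> *\<^sub>R ?e)) x)) \<longlongrightarrow> 0) (at 0)"
     by (simp add: E_def fl_def scaleR_add_left add.assoc)
   qed
   moreover have "E t = f \<beta> \<delta> (zz (insert l A))"
    unfolding E_def using A(2) by (intro arg_cong[where f="f \<beta> \<delta>"]) (auto simp: zz_def)
   moreover have "E 0 = f \<beta> \<delta> (zz A)"
    unfolding E_def using A(2) insert.hyps by (intro arg_cong[where f="f \<beta> \<delta>"]) (auto simp: zz_def)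
   ultimately have 1: "nrm (%x. f \<beta> \<delta> (zz (insert l A)) x - f \<beta> \<delta> (zz A) x - t * fl l c x) <= \<kappa> t * \<bar>t\<bar>" by simp
   have "(%x. f \<beta> \<delta> (zz (insert l A)) x - f \<beta> \<delta> c x - t * (\<Sum>k\<in>insert l A. fl k c x))
     = (%x. (f \<beta> \<delta> (zz (insert l A)) x - f \<beta> \<delta> (zz A) x - t * fl l c x) + (f \<beta> \<delta> (zz A) x - f \<beta> \<delta> c x - t * (\<Sum>k\<in>A. fl k c x)))"
    using insert.hyps by (auto simp: algebra_simps)
   then have "nrm (%x. f \<beta> \<delta> (zz (insert l A)) x - f \<beta> \<delta> c x - t * (\<Sum>k\<in>insert l A. fl k c x))
     <= nrm (%x. f \<beta> \<delta> (zz (insert l A)) x - f \<beta> \<delta> (zz A) x - t * fl l c x)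
      + nrm (%x. f \<beta> \<delta> (zz A) x - f \<beta> \<delta> c x - t * (\<Sum>k\<in>A. fl k c x))"
   proof (simp only:, intro Lp_norm_triangle Lp_diff Lp_scale Lp_sum fL zzp cp flL)
    show "k \<in> I" if "k \<in> A" for k using that A(1) by blast
   qed (rule A(2))
   then show ?case using 1 insert.IH[OF A(1)] insert.hyps by (simp add: distrib_right)
  qed
  from this[of I] have "nrm (%x. f \<beta> \<delta> (zz I) x - f \<beta> \<delta> c x - t * (\<Sum>l\<in>I. fl l c x)) <= real (card I) * (\<kappa> t * \<bar>t\<bar>)" by simp
  moreover have "zz I = (\<lambda>l\<in>I. s + t *\<^sub>R ?e)" by (auto simp: zz_def)
  ultimately show ?thesis by simp
 qed
 have "((%t. nrm (%x. (f \<beta> \<delta> (\<lambda>l\<in>I. s + t *\<^sub>R ?e) x - f \<beta> \<delta> c x) / t - (\<Sum>l\<in>I. fl l c x))) \<longlongrightarrow> 0) (at 0)"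
 proof (rule tendsto_sandwich[OF _ _ tendsto_const])
  show "((%t. real (card I) * (real (card I) * (B * \<bar>t\<bar> powr \<gamma>))) \<longlongrightarrow> 0) (at 0)"
  proof -
   have "((%t::real. \<bar>t\<bar>) \<longlongrightarrow> 0) (at 0)" by (rule tendsto_rabs_zero) simp
   then have "((%t::real. \<bar>t\<bar> powr \<gamma>) \<longlongrightarrow> 0 powr \<gamma>) (at 0)" using \<gamma> by (intro tendsto_powr') auto
   then show ?thesis by (intro tendsto_mult_right_zero) simp
  qed
  have "\<forall>\<^sub>F t in at 0. \<bar>t\<bar> < r & t ~= 0" using r(1) unfolding eventually_at by (auto intro!: exI[of _ r])
  then show "\<forall>\<^sub>F t in at 0. nrm (%x. (f \<beta> \<delta> (\<lambda>l\<in>I. s + t *\<^sub>R ?e) x - f \<beta> \<delta> c x) / t - (\<Sum>l\<in>I. fl l c x))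
    <= real (card I) * (real (card I) * (B * \<bar>t\<bar> powr \<gamma>))"
  proof eventually_elim
   case (elim t)
   have "(%x. (f \<beta> \<delta> (\<lambda>l\<in>I. s + t *\<^sub>R ?e) x - f \<beta> \<delta> c x) / t - (\<Sum>l\<in>I. fl l c x))
     = (%x. (1 / t) * (f \<beta> \<delta> (\<lambda>l\<in>I. s + t *\<^sub>R ?e) x - f \<beta> \<delta> c x - t * (\<Sum>l\<in>I. fl l c x)))"
    using elim by (auto simp: field_simps)
   then have "nrm (%x. (f \<beta> \<delta> (\<lambda>l\<in>I. s + t *\<^sub>R ?e) x - f \<beta> \<delta> c x) / t - (\<Sum>l\<in>I. fl l c x))
     = (1 / \<bar>t\<bar>) * nrm (%x. f \<beta> \<delta> (\<lambda>l\<in>I. s + t *\<^sub>R ?e) x - f \<beta> \<delta> c x - t * (\<Sum>l\<in>I. fl l c x))"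
    by (simp only: Lp_norm_scale abs_divide abs_one)
   also have "\<dots> <= (1 / \<bar>t\<bar>) * (real (card I) * (\<kappa> t * \<bar>t\<bar>))" using elim by (intro mult_left_mono est) auto
   also have "\<dots> = real (card I) * \<kappa> t" using elim by simp
   finally show ?case by (simp add: \<kappa>_def)
  qed
 qed simp
 then show ?thesis by (simp add: fl_def c_def)
qed

text \<open>The orders already spent, in x and in all variables together, plus the r levels still to
  come stay within m. The s-derivative has one term per variable in I, which costs a factor 1 +
  \<open>card I\<close> per level.\<close>

lemma trace_data_jet:
 assumes I: "finite I" and B: "0 <= B" and \<gamma>: "0 < \<gamma>" and f: "trace_data I m \<gamma> B f"
 shows "mi_order \<beta> + (\<Sum>l\<in>I. mi_order (\<delta> l)) + r <= m ==> (\<forall>l. l \<notin> I --> \<delta> l = (%_. 0)) ==>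
   jet r \<gamma> ((1 + real (card I)) ^ Suc r * B) (%s. f \<beta> \<delta> (\<lambda>l\<in>I. s))"
proof (induction r arbitrary: \<beta> \<delta>)
 case 0
 have le: "mi_order (\<delta> l) <= (\<Sum>l\<in>I. mi_order (\<delta> l))" if "l \<in> I" for l using I that by (intro member_le_sum) auto
 then have "\<delta> \<in> mix_indices I m" using 0 unfolding mix_indices_def by fastforce
 moreover have "mi_order \<beta> <= m" using 0 by simp
 ultimately have "holder_Lp \<gamma> ((1 + real (card I)) * B) (%s. f \<beta> \<delta> (\<lambda>l\<in>I. s))"
  by (intro trace_data_diag_holder[OF I B f])
 then show ?case by (simp only: jet.simps(1) power_Suc power_0 mult_1_right)
next
 case (Suc r)
 let ?\<Lambda> = "1 + real (card I)"
 have le: "mi_order (\<delta> l) <= (\<Sum>l\<in>I. mi_order (\<delta> l))" if "l \<in> I" for l using I that by (intro member_le_sum) auto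
 then have \<delta>m: "\<delta> \<in> mix_indices I m" using Suc.prems unfolding mix_indices_def by fastforce
 have \<beta>m: "mi_order \<beta> <= m" using Suc.prems(1) by simp
 have \<Lambda>1: "?\<Lambda> ^ Suc n * B <= ?\<Lambda> ^ Suc (Suc n) * B" for n
  using B by (intro mult_right_mono power_increasing) auto
 define \<delta>' where "\<delta>' l i = (mi_inc \<delta> l i)" for l i
 have sum': "(\<Sum>k\<in>I. mi_order (\<delta>' l i k)) = Suc (\<Sum>l\<in>I. mi_order (\<delta> l))" if "l \<in> I" for l i
 proof -
  have "(\<Sum>k\<in>I. mi_order (\<delta>' l i k)) = mi_order (\<delta>' l i l) + (\<Sum>k\<in>I - {l}. mi_order (\<delta>' l i k))"
   using I that by (rule sum.remove)
  also have "\<dots> = Suc (mi_order (\<delta> l) + (\<Sum>k\<in>I - {l}. mi_order (\<delta> k)))" by (simp add: \<delta>'_def)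
  also have "\<dots> = Suc (\<Sum>l\<in>I. mi_order (\<delta> l))" using sum.remove[OF I that, of "%l. mi_order (\<delta> l)"] by simp
  finally show ?thesis .
 qed
 have \<delta>'0: "\<forall>k. k \<notin> I --> \<delta>' l i k = (%_. 0)" if "l \<in> I" for l i using Suc.prems(2) that by (auto simp: \<delta>'_def)
 have \<delta>'m: "\<delta>' l i \<in> mix_indices I m" if "l \<in> I" for l i
 proof -
  have "mi_order (\<delta>' l i k) <= (\<Sum>k\<in>I. mi_order (\<delta>' l i k))" if "k \<in> I" for k using I that by (intro member_le_sum) auto
  then have "mi_order (\<delta>' l i k) <= m" if "k \<in> I" for k using that sum'[OF \<open>l \<in> I\<close>, of i] Suc.prems(1) by fastforce
  then show ?thesis using \<delta>'0[OF that] by (simp add: mix_indices_def)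
 qed
 show ?case
  unfolding jet.simps
 proof (intro conjI allI)
  have "holder_Lp \<gamma> (?\<Lambda> * B) (%s. f \<beta> \<delta> (\<lambda>l\<in>I. s))" by (rule trace_data_diag_holder[OF I B f \<beta>m \<delta>m])
  moreover have "?\<Lambda> * B <= ?\<Lambda> ^ Suc (Suc r) * B"
   using B power_increasing[of 1 "Suc (Suc r)" ?\<Lambda>] by (intro mult_right_mono) auto
  ultimately show "holder_Lp \<gamma> (?\<Lambda> ^ Suc (Suc r) * B) (%s. f \<beta> \<delta> (\<lambda>l\<in>I. s))" by (rule holder_Lp_mono)
  fix i
  show "\<exists>w v. jet r \<gamma> (?\<Lambda> ^ Suc (Suc r) * B) w & jet r \<gamma> (?\<Lambda> ^ Suc (Suc r) * B) v \<and>
    (\<forall>s\<in>D. has_weak_deriv D ((%_. 0)(i := 1)) (f \<beta> \<delta> (\<lambda>l\<in>I. s)) (w s)) \<and>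
    (\<forall>s\<in>D. ((%t. nrm (%x. (f \<beta> \<delta> (\<lambda>l\<in>I. s + t *\<^sub>R axis i 1) x - f \<beta> \<delta> (\<lambda>l\<in>I. s) x) / t - v s x)) \<longlongrightarrow> 0) (at 0))"
  proof (rule exI[of _ "%s. f (\<beta>(i := Suc (\<beta> i))) \<delta> (\<lambda>l\<in>I. s)"],
    rule exI[of _ "%s x. \<Sum>l\<in>I. f \<beta> (\<delta>' l i) (\<lambda>l\<in>I. s) x"], intro conjI ballI)
   have "jet r \<gamma> (?\<Lambda> ^ Suc r * B) (%s. f (\<beta>(i := Suc (\<beta> i))) \<delta> (\<lambda>l\<in>I. s))"
   proof (rule Suc.IH[OF _ Suc.prems(2)])
    show "mi_order (\<beta>(i := Suc (\<beta> i))) + (\<Sum>l\<in>I. mi_order (\<delta> l)) + r <= m"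
     unfolding mi_order_Suc using Suc.prems(1) by simp
   qed
   then show "jet r \<gamma> (?\<Lambda> ^ Suc (Suc r) * B) (%s. f (\<beta>(i := Suc (\<beta> i))) \<delta> (\<lambda>l\<in>I. s))" by (rule jet_mono[OF \<Lambda>1])
   have "jet r \<gamma> (real (card I) * (?\<Lambda> ^ Suc r * B)) (%s x. \<Sum>l\<in>I. f \<beta> (\<delta>' l i) (\<lambda>l\<in>I. s) x)"
   proof (rule jet_sum[OF I])
    fix l assume l: "l \<in> I"
    show "jet r \<gamma> (?\<Lambda> ^ Suc r * B) (%s. f \<beta> (\<delta>' l i) (\<lambda>l\<in>I. s))"
     by (rule Suc.IH[OF _ \<delta>'0[OF l]]) (use Suc.prems(1) sum'[OF l, of i] in simp)
   qed
   moreover have "real (card I) * (?\<Lambda> ^ Suc r * B) <= ?\<Lambda> ^ Suc (Suc r) * B"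
    using B by (simp only: power_Suc[of _ "Suc r"] mult.assoc) (intro mult_right_mono, auto)
   ultimately show "jet r \<gamma> (?\<Lambda> ^ Suc (Suc r) * B) (%s x. \<Sum>l\<in>I. f \<beta> (\<delta>' l i) (\<lambda>l\<in>I. s) x)" by (rule jet_mono[rotated])
   fix s assume s: "s \<in> D"
   then have sc: "s \<in> closure D" using closure_subset[of D] by blast
   show "has_weak_deriv D ((%_. 0)(i := 1)) (f \<beta> \<delta> (\<lambda>l\<in>I. s)) (f (\<beta>(i := Suc (\<beta> i))) \<delta> (\<lambda>l\<in>I. s))"
    by (rule trace_dataD(4)[OF f \<beta>m \<delta>m const_pts[OF sc]]) (use Suc.prems(1) in simp)
   show "((%t. nrm (%x. (f \<beta> \<delta> (\<lambda>l\<in>I. s + t *\<^sub>R axis i 1) x - f \<beta> \<delta> (\<lambda>l\<in>I. s) x) / t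
      - (\<Sum>l\<in>I. f \<beta> (\<delta>' l i) (\<lambda>l\<in>I. s) x))) \<longlongrightarrow> 0) (at 0)"
    unfolding \<delta>'_def by (rule trace_data_diag_deriv[OF I B \<gamma> f \<beta>m \<delta>m \<delta>'m[unfolded \<delta>'_def] s])
  qed
 qed
qed

text \<open>K is fixed before the family and its size B, so the bound applies to differences and
  difference quotients of families as well as to the families themselves.\<close>

theorem diag_sobolev_bound:
 assumes \<gamma>: "0 < \<gamma>" "2 * real CARD('d) / \<gamma> < p" and I: "finite I"
 obtains K where "0 <= K" "!!B f \<psi>. 0 <= B ==> trace_data I m \<gamma> B f ==> cont_rep I (f (%_. 0) (%_ _. 0)) \<psi> ==>
  (%x. \<psi> (\<lambda>l\<in>I. x) x) \<in> sobolev D m p & sobolev_norm D m p (%x. \<psi> (\<lambda>l\<in>I. x) x) <= K * B"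
proof -
 obtain K where K: "0 <= K" "!!m B F \<psi> \<beta>. 0 <= B ==> jet m \<gamma> B F ==> rep1 F \<psi> ==> mi_order \<beta> <= m ==>
  \<exists>u. u \<in> LP & has_weak_deriv D \<beta> (%x. \<psi> x x) u & nrm u <= 2 ^ m * K * B"
  by (rule jet_diag[OF \<gamma>]) (rule that, assumption+)
 obtain Kd where Kd: "!!B F \<psi>. 0 <= B ==> holder_Lp \<gamma> B F ==> rep1 F \<psi> ==>
   (%x. \<psi> x x) \<in> LP & nrm (%x. \<psi> x x) <= Kd * B"
  using diag_bound[OF \<gamma>] by (elim exE conjE) (rule that, auto)
 let ?\<Lambda> = "(1 + real (card I)) ^ Suc m"
 define K' where "K' = real (card {\<alpha> :: 'd => nat. mi_order \<alpha> <= m}) * (2 ^ m * K * ?\<Lambda>)"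
 have main: "(%x. \<psi> (\<lambda>l\<in>I. x) x) \<in> sobolev D m p & sobolev_norm D m p (%x. \<psi> (\<lambda>l\<in>I. x) x) <= K' * B"
  if B: "0 <= B" and f: "trace_data I m \<gamma> B f" and r: "cont_rep I (f (%_. 0) (%_ _. 0)) \<psi>" for B f \<psi>
 proof -
  let ?F = "%s. f (%_. 0) (%_ _. 0) (\<lambda>l\<in>I. s)" and ?u = "%x. \<psi> (\<lambda>l\<in>I. x) x"
  have z: "mi_order (%_ :: 'd. 0) = 0" by (simp add: mi_order_def)
  have j: "jet m \<gamma> (?\<Lambda> * B) ?F" by (rule trace_data_jet[OF I B \<gamma>(1) f]) (simp_all add: z)
  have B': "0 <= ?\<Lambda> * B" using B by simp
  have cont: "continuous_on (closure D) (%s. (\<lambda>l\<in>I. s))"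
  proof (rule continuous_on_coordinatewise_then_product)
   show "continuous_on (closure D) (%s. (\<lambda>l\<in>I. s) i)" for i by (cases "i \<in> I") (auto intro: continuous_intros)
  qed
  have r1: "rep1 ?F (%s. \<psi> (\<lambda>l\<in>I. s))"
   unfolding rep1_def
  proof (intro conjI ballI)
   fix s assume "s \<in> closure D"
   from const_pts[OF this, of I] r show "AE x in L. \<psi> (\<lambda>l\<in>I. s) x = f (%_. 0) (%_ _. 0) (\<lambda>l\<in>I. s) x"
    unfolding cont_rep_def by (elim conjE) (erule bspec)
  next
   have "AE x in L. continuous_on (pts I) (%y. \<psi> y x)" using r by (simp add: cont_rep_def)
   then show "AE x in L. continuous_on (closure D) (%s. \<psi> (\<lambda>l\<in>I. s) x)"
   proof eventually_elim
    case (elim x)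
    show ?case by (rule continuous_on_compose2[OF elim cont]) (auto intro: const_pts)
   qed
  qed
  have u: "?u \<in> LP" using Kd[OF B' jet_holder[OF j] r1] by (rule conjunct1)
  have ex: "\<exists>v. v \<in> LP & has_weak_deriv D \<beta> ?u v & nrm v <= 2 ^ m * K * (?\<Lambda> * B)" if "mi_order \<beta> <= m" for \<beta>
   by (rule K(2)[OF B' j r1 that])
  have S: "?u \<in> sobolev D m p"
   unfolding sobolev_def
  proof (intro CollectI conjI u allI impI)
   fix \<alpha> :: "'d => nat" assume "mi_order \<alpha> <= m"
   from ex[OF this] show "\<exists>v\<in>LP. has_weak_deriv D \<alpha> ?u v" by (elim exE conjE) (rule bexI)
  qed
  have "sobolev_norm D m p ?u <= real (card {\<alpha> :: 'd => nat. mi_order \<alpha> <= m}) * (2 ^ m * K * (?\<Lambda> * B))"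
  proof (rule sobolev_norm_le)
   show "0 <= 2 ^ m * K * (?\<Lambda> * B)" using K(1) B' by simp
   fix \<alpha> :: "'d => nat" assume a: "mi_order \<alpha> <= m"
   obtain v where v: "v \<in> LP" "has_weak_deriv D \<alpha> ?u v" "nrm v <= 2 ^ m * K * (?\<Lambda> * B)"
    using ex[OF a] by (elim exE conjE)
   have "nrm (weak_deriv D p \<alpha> ?u) = nrm v"
    by (rule Lp_norm_cong_AE[OF weak_deriv_AE_eq[OF v(1,2)] Lp_measurable[OF weak_deriv_props(1)[OF S a]] Lp_measurable[OF v(1)]])
   then show "nrm (weak_deriv D p \<alpha> ?u) <= 2 ^ m * K * (?\<Lambda> * B)" using v(3) by simp
  qed
  then show ?thesis using S by (simp add: K'_def mult_ac)
 qed
 show ?thesis by (rule that[of K']) (use K(1) main in \<open>auto simp: K'_def\<close>)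
qed

end

subsection \<open>Interior cones\<close>

text \<open>In the local graph coordinates a move by t along \<nu> raises the height above the graph
  by t, while a further displacement of norm below c t changes it by less than (1 + C) c t = t / 2,
  where C is a Lipschitz constant of g. One radius \<rho> serves all y of the closure near z, which
  prepares a compactness argument.\<close>

lemma C1_domain_interior_cone:
 fixes D :: "(real^'d) set"
 assumes D: "bounded_C1_domain D" and z: "z \<in> closure D"
 shows "\<exists>\<nu> c \<rho>. 0 < c & c <= 1 & 0 < \<rho> & norm \<nu> = 1 & (\<forall>y\<in>closure D \<inter> ball z \<rho>. \<forall>t. 0 < t --> t < \<rho> --> ball (y + t *\<^sub>R \<nu>) (c * t) \<subseteq> D)"
proof (cases "z \<in> D")
 case True
 then obtain r where r: "r > 0" "ball z r \<subseteq> D" using D unfolding bounded_C1_domain_def by (meson openE)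
 \<comment> \<open>Any unit vector does at an interior point; the index undefined just names some
   coordinate.\<close>
 define \<nu> :: "real^'d" where "\<nu> = axis undefined 1"
 have \<nu>: "norm \<nu> = 1" by (simp add: \<nu>_def norm_axis_1)
 show ?thesis
 proof (rule exI[of _ \<nu>], rule exI[of _ 1], rule exI[of _ "r / 3"], intro conjI ballI allI impI \<nu>)
  fix y t assume y: "y \<in> closure D \<inter> ball z (r / 3)" and t: "0 < t" "t < r / 3"
  show "ball (y + t *\<^sub>R \<nu>) (1 * t) \<subseteq> D"
  proof
   fix x assume "x \<in> ball (y + t *\<^sub>R \<nu>) (1 * t)"
   then have "dist (y + t *\<^sub>R \<nu>) x < t" by simp
   moreover have "dist y (y + t *\<^sub>R \<nu>) = t" using t \<nu> by (simp add: dist_norm)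
   moreover have "dist z y < r / 3" using y by simp
   ultimately have "dist z x < r" using t dist_triangle[of z x y] dist_triangle[of y x "y + t *\<^sub>R \<nu>"] by linarith
   then show "x \<in> D" using r(2) by auto
  qed
 qed (use r in auto)
next
 case False
 have "open D" using D by (simp add: bounded_C1_domain_def)
 have fr: "z \<in> frontier D" using z False \<open>open D\<close> by (simp add: frontier_def interior_open)
 have bd: "C1_boundary D" using D by (simp add: bounded_C1_domain_def)
 from bspec[OF bd[unfolded C1_boundary_def] fr]
 obtain r \<nu> g G where r': "r > 0" "norm \<nu> = 1" "\<forall>x t. g (x + t *\<^sub>R \<nu>) = g x"
  "\<forall>x. (g has_derivative (%h. G x \<bullet> h)) (at x)" "continuous_on UNIV G" "D \<inter> ball z r = {x \<in> ball z r. g x < x \<bullet> \<nu>}"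
  by (elim exE conjE)
 note r = r'(1,2) r'(3,4)[rule_format] r'(5,6)
 have Gc: "compact (G ` cball z r)"
  by (rule compact_continuous_image[OF continuous_on_subset[OF r(5) subset_UNIV] compact_cball])
 obtain C0 where C0: "!!x. x \<in> cball z r ==> norm (G x) <= C0"
 proof -
  obtain a where "\<forall>v\<in>G ` cball z r. norm v <= a" using compact_imp_bounded[OF Gc] unfolding bounded_iff by (elim exE)
  then show ?thesis by (intro that[of a]) simp
 qed
 define C where "C = max C0 0"
 have lip: "\<bar>g a - g b\<bar> <= C * norm (a - b)" if "a \<in> cball z r" "b \<in> cball z r" for a b
 proof -
  have "norm (g a - g b) <= C * norm (a - b)"
  proof (rule differentiable_bound[where S="cball z r" and f'="%x h. G x \<bullet> h"])
   show "(g has_derivative (%h. G x \<bullet> h)) (at x within cball z r)" for x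
    using r(4) by (rule has_derivative_at_withinI)
   show "onorm (%h. G x \<bullet> h) <= C" if "x \<in> cball z r" for x
   proof (rule onorm_le)
    fix h show "norm (G x \<bullet> h) <= C * norm h"
    proof -
     have "norm (G x) <= C" using C0[OF that] by (simp add: C_def)
     then have "norm (G x) * norm h <= C * norm h" by (intro mult_right_mono) auto
     then show ?thesis using Cauchy_Schwarz_ineq2[of "G x" h] by simp
    qed
   qed
  qed (use that in auto)
  then show ?thesis by simp
 qed
 have C: "0 <= C" by (simp add: C_def)
 define c where "c = 1 / (2 * (1 + C))"
 have c: "0 < c" "c <= 1 / 2" using C by (auto simp: c_def field_simps)
 \<comment> \<open>Points of the closure satisfy the non-strict inequality: otherwise an open
   neighbourhood of y would lie strictly below the graph and could not meet D.\<close>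
 have gle: "g y <= y \<bullet> \<nu>" if y: "y \<in> closure D" "y \<in> ball z r" for y
 proof (rule ccontr)
  assume "\<not> g y <= y \<bullet> \<nu>"
  define U where "U = {x. x \<bullet> \<nu> < g x} \<inter> ball z r"
  have gc: "continuous_on UNIV g" using r(4) by (intro has_derivative_continuous_on) (auto intro: has_derivative_at_withinI)
  have "open {x. x \<bullet> \<nu> < g x}" by (intro open_Collect_less gc continuous_intros)
  then have "open U" unfolding U_def by blast
  moreover have "y \<in> U" using \<open>\<not> g y <= y \<bullet> \<nu>\<close> y by (simp add: U_def)
  ultimately have "U \<inter> D ~= {}" using y(1) open_Int_closure_eq_empty[of U D] by blast
  then obtain x where "x \<in> U" "x \<in> D" by blast
  then have "x \<in> D \<inter> ball z r" "x \<bullet> \<nu> < g x" by (auto simp: U_def)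
  then show False using r(6) by auto
 qed
 show ?thesis
 proof (rule exI[of _ \<nu>], rule exI[of _ c], rule exI[of _ "r / 4"], intro conjI ballI allI impI r(2))
  fix y t assume y: "y \<in> closure D \<inter> ball z (r / 4)" and t: "0 < t" "t < r / 4"
  show "ball (y + t *\<^sub>R \<nu>) (c * t) \<subseteq> D"
  proof
   fix x assume x: "x \<in> ball (y + t *\<^sub>R \<nu>) (c * t)"
   define w where "w = x - (y + t *\<^sub>R \<nu>)"
   have w: "norm w < c * t" using x by (simp add: w_def dist_norm norm_minus_commute)
   have ct: "c * t <= t / 2" using c t mult_right_mono[of c "1/2" t] by simp
   have yz: "norm (y - z) < r / 4" using y by (simp add: dist_norm norm_minus_commute)
   have xe: "x = (y + w) + t *\<^sub>R \<nu>" by (simp add: w_def)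
   have ywz: "norm (y + w - z) < r"
   proof -
    have "y + w - z = (y - z) + w" by simp
    then have "norm (y + w - z) <= norm (y - z) + norm w" by (simp only: norm_triangle_ineq)
    then show ?thesis using yz w ct t by linarith
   qed
   have "norm (x - z) <= norm (y - z) + norm w + norm (t *\<^sub>R \<nu>)"
   proof -
    have "x - z = (y - z + w) + t *\<^sub>R \<nu>" by (simp add: xe)
    then have "norm (x - z) <= norm (y - z + w) + norm (t *\<^sub>R \<nu>)" by (simp only: norm_triangle_ineq)
    then show ?thesis using norm_triangle_ineq[of "y - z" w] by linarith
   qed
   also have "\<dots> < r"
   proof -
    have "norm (t *\<^sub>R \<nu>) = t" using t(1) r(2) by simp
    then show ?thesis using yz w ct t by linarith
   qed
   finally have xz: "x \<in> ball z r" by (simp add: dist_norm norm_minus_commute)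
   have "g x = g (y + w)" unfolding xe by (rule r(3))
   also have "\<dots> <= g y + C * norm w"
    using lip[of "y + w" y] ywz yz r(1) by (simp add: dist_norm norm_minus_commute)
   also have "\<dots> <= y \<bullet> \<nu> + C * norm w" using gle[of y] y r(1) by simp
   also have "\<dots> < y \<bullet> \<nu> + t + w \<bullet> \<nu>"
   proof -
    have "(1 + C) * norm w <= (1 + C) * (c * t)" using w C by (intro mult_left_mono) auto
    also have "\<dots> = t / 2" using C by (simp add: c_def field_simps)
    finally have "C * norm w + norm w < t" using t(1) by (simp add: distrib_right)
    moreover have "- norm w <= w \<bullet> \<nu>" using Cauchy_Schwarz_ineq2[of w \<nu>] r(2) by (simp add: abs_le_iff)
    ultimately show ?thesis by linarith
   qed
   also have "\<dots> = x \<bullet> \<nu>"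
   proof -
    have "\<nu> \<bullet> \<nu> = 1" using r(2) by (simp add: dot_square_norm)
    then show ?thesis by (simp add: xe inner_add_left)
   qed
   finally have "x \<in> {x \<in> ball z r. g x < x \<bullet> \<nu>}" using xz by simp
   then show "x \<in> D" using r(6) by blast
  qed
 qed (use c r in auto)
qed

text \<open>Both endpoints are moved into D by the same vector t \<nu> of a common cone direction,
  and the shifted points are joined inside one ball provided by the cone. A finite subcover and a
  Lebesgue number make the cone data uniform.\<close>

lemma C1_domain_three_segments:
 fixes D :: "(real^'d) set"
 assumes D: "bounded_C1_domain D"
 obtains \<delta> Q where "0 < \<delta>" "0 <= Q" "!!a b. a \<in> D ==> b \<in> D ==> norm (b - a) < \<delta> ==>
   \<exists>c e. closed_segment a c \<subseteq> D & closed_segment c e \<subseteq> D & closed_segment e b \<subseteq> D \<and>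
    norm (c - a) <= Q * norm (b - a) & norm (e - c) <= Q * norm (b - a) & norm (b - e) <= Q * norm (b - a)"
proof -
 have "\<forall>z\<in>closure D. \<exists>\<nu>c\<rho>. 0 < fst (snd \<nu>c\<rho>) & fst (snd \<nu>c\<rho>) <= 1 & 0 < snd (snd \<nu>c\<rho>) & norm (fst \<nu>c\<rho>) = 1 \<and>
   (\<forall>y\<in>closure D \<inter> ball z (snd (snd \<nu>c\<rho>)). \<forall>t. 0 < t --> t < snd (snd \<nu>c\<rho>) --> ball (y + t *\<^sub>R fst \<nu>c\<rho>) (fst (snd \<nu>c\<rho>) * t) \<subseteq> D)"
 proof
  fix z assume "z \<in> closure D"
  from C1_domain_interior_cone[OF D this] obtain \<nu> c \<rho> where "0 < c & c <= 1 & 0 < \<rho> & norm \<nu> = 1 & (\<forall>y\<in>closure D \<inter> ball z \<rho>. \<forall>t. 0 < t --> t < \<rho> --> ball (y + t *\<^sub>R \<nu>) (c * t) \<subseteq> D)"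
   by (elim exE)
  then show "\<exists>\<nu>c\<rho>. 0 < fst (snd \<nu>c\<rho>) & fst (snd \<nu>c\<rho>) <= 1 & 0 < snd (snd \<nu>c\<rho>) & norm (fst \<nu>c\<rho>) = 1 \<and>
   (\<forall>y\<in>closure D \<inter> ball z (snd (snd \<nu>c\<rho>)). \<forall>t. 0 < t --> t < snd (snd \<nu>c\<rho>) --> ball (y + t *\<^sub>R fst \<nu>c\<rho>) (fst (snd \<nu>c\<rho>) * t) \<subseteq> D)"
   by (intro exI[of _ "(\<nu>, c, \<rho>)"]) simp
 qed
 from bchoice[OF this] obtain h where h: "\<forall>z\<in>closure D. 0 < fst (snd (h z)) & fst (snd (h z)) <= 1 & 0 < snd (snd (h z)) & norm (fst (h z)) = 1 \<and>
   (\<forall>y\<in>closure D \<inter> ball z (snd (snd (h z))). \<forall>t. 0 < t --> t < snd (snd (h z)) --> ball (y + t *\<^sub>R fst (h z)) (fst (snd (h z)) * t) \<subseteq> D)" ..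
 define \<nu> c \<rho> where "\<nu> z = fst (h z)" and "c z = fst (snd (h z))" and "\<rho> z = snd (snd (h z))" for z
 have cone: "0 < c z" "c z <= 1" "0 < \<rho> z" "norm (\<nu> z) = 1"
  "!!y t. y \<in> closure D ==> y \<in> ball z (\<rho> z) ==> 0 < t ==> t < \<rho> z ==> ball (y + t *\<^sub>R \<nu> z) (c z * t) \<subseteq> D"
  if "z \<in> closure D" for z
  using bspec[OF h that] by (auto simp: \<nu>_def c_def \<rho>_def)
 have comp: "compact (closure D)" using D by (simp add: bounded_C1_domain_def)
 obtain Z where Z: "Z \<subseteq> closure D" "finite Z" "closure D \<subseteq> (\<Union>z\<in>Z. ball z (\<rho> z))"
 proof (rule compactE_image[OF comp, of "closure D" "%z. ball z (\<rho> z)"])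
  show "closure D \<subseteq> (\<Union>z\<in>closure D. ball z (\<rho> z))" using cone(3) by fastforce
 qed auto
 obtain \<epsilon> where \<epsilon>: "0 < \<epsilon>" "!!x. x \<in> closure D ==> \<exists>G\<in>(%z. ball z (\<rho> z)) ` Z. ball x \<epsilon> \<subseteq> G"
  by (rule Heine_Borel_lemma[OF comp Z(3)]) (auto intro: that)
 define c0 where "c0 = Min (insert 1 (c ` Z))"
 define \<rho>0 where "\<rho>0 = Min (insert 1 (\<rho> ` Z))"
 have c0: "0 < c0" "!!z. z \<in> Z ==> c0 <= c z" using Z cone(1) by (auto simp: c0_def)
 have \<rho>0: "0 < \<rho>0" "!!z. z \<in> Z ==> \<rho>0 <= \<rho> z" using Z cone(3) by (auto simp: \<rho>0_def)
 show ?thesis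
 \<comment> \<open>The two moves along the cone have length (2 / c0) |b - a| and the middle segment
   has length |b - a|; the sum of the two factors serves all three.\<close>
 proof (rule that[of "min \<epsilon> (\<rho>0 * c0 / 2)" "2 / c0 + 1"])
  show "0 < min \<epsilon> (\<rho>0 * c0 / 2)" "0 <= 2 / c0 + 1" using \<epsilon>(1) c0(1) \<rho>0(1) by (auto intro: add_nonneg_nonneg)
  fix a b assume ab: "a \<in> D" "b \<in> D" "norm (b - a) < min \<epsilon> (\<rho>0 * c0 / 2)"
  show "\<exists>c e. closed_segment a c \<subseteq> D & closed_segment c e \<subseteq> D & closed_segment e b \<subseteq> D \<and>
    norm (c - a) <= (2 / c0 + 1) * norm (b - a) & norm (e - c) <= (2 / c0 + 1) * norm (b - a) & norm (b - e) <= (2 / c0 + 1) * norm (b - a)"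
  proof (cases "a = b")
   case True
   then show ?thesis using ab by (intro exI[of _ a]) auto
  next
   case False
   have acl: "a \<in> closure D" "b \<in> closure D" using ab closure_subset[of D] by blast+
   obtain z where z: "z \<in> Z" "ball a \<epsilon> \<subseteq> ball z (\<rho> z)" using \<epsilon>(2)[OF acl(1)] by blast
   have zc: "z \<in> closure D" using z(1) Z(1) by blast
   have abz: "a \<in> ball z (\<rho> z)" "b \<in> ball z (\<rho> z)"
    using z(2) \<epsilon>(1) ab(3) by (auto simp: subset_iff dist_norm norm_minus_commute)
   \<comment> \<open>Long enough for the ball of radius c0 t = 2 |b - a| around the shifted a to
     contain the shifted b, and, by the restriction on |b - a|, shorter than every radius \<rho>
     z.\<close>
   define t where "t = 2 * norm (b - a) / c0"
   have t: "0 < t" using False c0 by (simp add: t_def)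
   have "t < \<rho>0" using ab(3) c0(1) by (simp add: t_def field_simps)
   then have t\<rho>: "t < \<rho> z" using \<rho>0(2)[OF z(1)] by linarith
   have tn: "norm (t *\<^sub>R \<nu> z) = t" using t cone(4)[OF zc] by simp
   have ray: "closed_segment y (y + t *\<^sub>R \<nu> z) \<subseteq> D" if y: "y \<in> D" "y \<in> ball z (\<rho> z)" for y
   proof
    fix x assume "x \<in> closed_segment y (y + t *\<^sub>R \<nu> z)"
    then obtain u where u: "0 <= u" "u <= 1" "x = (1 - u) *\<^sub>R y + u *\<^sub>R (y + t *\<^sub>R \<nu> z)" by (auto simp: in_segment)
    then have x: "x = y + (u * t) *\<^sub>R \<nu> z" by (simp add: algebra_simps)
    show "x \<in> D"
    proof (cases "u = 0")
     case False
     then have "0 < u * t" using u t by simp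
     moreover have "u * t < \<rho> z" using mult_right_mono[OF u(2), of t] t t\<rho> by linarith
     ultimately have "ball (y + (u * t) *\<^sub>R \<nu> z) (c z * (u * t)) \<subseteq> D"
      using y closure_subset[of D] by (intro cone(5)[OF zc]) auto
     moreover have "x \<in> ball (y + (u * t) *\<^sub>R \<nu> z) (c z * (u * t))"
      using cone(1)[OF zc] \<open>0 < u * t\<close> by (simp add: x)
     ultimately show ?thesis by blast
    qed (use x y in simp)
   qed
   have mid: "closed_segment (a + t *\<^sub>R \<nu> z) (b + t *\<^sub>R \<nu> z) \<subseteq> D"
   proof -
    have "c0 * t = 2 * norm (b - a)" using c0(1) by (simp add: t_def)
    then have "norm (b - a) < c z * t"
    proof -
     have "0 < norm (b - a)" using False by simp
     moreover have "c0 * t <= c z * t" using c0(2)[OF z(1)] t by (intro mult_right_mono) auto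
     ultimately show ?thesis using \<open>c0 * t = 2 * norm (b - a)\<close> by linarith
    qed
    then have "closed_segment (a + t *\<^sub>R \<nu> z) (b + t *\<^sub>R \<nu> z) \<subseteq> ball (a + t *\<^sub>R \<nu> z) (c z * t)"
     using cone(1)[OF zc] t
     by (intro closed_segment_subset) (auto simp: dist_norm norm_minus_commute)
    also have "\<dots> \<subseteq> D" by (rule cone(5)[OF zc acl(1) abz(1) t t\<rho>])
    finally show ?thesis .
   qed
   have t_le: "t <= (2 / c0 + 1) * norm (b - a)" by (simp add: t_def field_simps)
   have nab: "norm (b - a) <= (2 / c0 + 1) * norm (b - a)" using c0(1) by (simp add: distrib_right)
   show ?thesis
   proof (rule exI[of _ "a + t *\<^sub>R \<nu> z"], rule exI[of _ "b + t *\<^sub>R \<nu> z"], intro conjI)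
    show "closed_segment a (a + t *\<^sub>R \<nu> z) \<subseteq> D" by (rule ray[OF ab(1) abz(1)])
    show "closed_segment (b + t *\<^sub>R \<nu> z) b \<subseteq> D"
     using ray[OF ab(2) abz(2)] by (simp only: closed_segment_commute)
    show "norm (a + t *\<^sub>R \<nu> z - a) <= (2 / c0 + 1) * norm (b - a)" using tn t_le by simp
    show "norm (b - (b + t *\<^sub>R \<nu> z)) <= (2 / c0 + 1) * norm (b - a)" using tn t_le by simp
    show "norm (b + t *\<^sub>R \<nu> z - (a + t *\<^sub>R \<nu> z)) <= (2 / c0 + 1) * norm (b - a)" using nab by simp
   qed (rule mid)
  qed
 qed
qed

section \<open>Lipschitz and Hoelder estimates from bounded derivatives\<close>

context Sobolev_domain
begin

text \<open>Only partial derivatives are given, so a is joined to s by changing one coordinate at a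
  time. The intermediate points are in no component farther from a than s, hence in the ball. The
  dimension in the constant counts the moves.\<close>

lemma Lp_Lipschitz_ball:
 assumes E: "!!s. s \<in> D ==> E s \<in> LP" and E': "!!s i. s \<in> D ==> E' i s \<in> LP"
  and d: "!!s i. s \<in> D ==> ((%h. nrm (%x. (E (s + h *\<^sub>R axis i 1) x - E s x) / h - E' i s x)) \<longlongrightarrow> 0) (at 0)"
  and Q: "!!s i. s \<in> D ==> nrm (E' i s) <= Q" and b: "ball a r \<subseteq> D" "norm (s - a) < r"
 shows "nrm (%x. E s x - E a x) <= real CARD('d) * Q * norm (s - a)"
proof -
 define w where "w A = (\<chi> j. if j \<in> A then s $ j else a $ j)" for A
 have inD: "w A + \<tau> *\<^sub>R axis i 1 \<in> D" if "i \<notin> A" "\<bar>\<tau>\<bar> <= \<bar>s $ i - a $ i\<bar>" for A i \<tau>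
 proof -
  have "norm (w A + \<tau> *\<^sub>R axis i 1 - a) <= norm (s - a)"
   using that by (intro norm_le_componentwise_cart) (auto simp: w_def axis_def)
  then show ?thesis using b by (auto simp: subset_iff dist_norm norm_minus_commute)
 qed
 have wD: "w A \<in> D" for A
 proof -
  have "norm (w A - a) <= norm (s - a)" by (intro norm_le_componentwise_cart) (auto simp: w_def)
  then show ?thesis using b by (auto simp: subset_iff dist_norm norm_minus_commute)
 qed
 have Q0: "0 <= Q" using Q[OF wD[of "{}"]] Lp_norm_nonneg order_trans by blast
 have "nrm (%x. E (w A) x - E (w {}) x) <= real (card A) * (Q * norm (s - a))" if "finite A" for A
  using that
 proof (induction A rule: finite_induct)
  case (insert i A)
  have e: "w A + (s $ i - a $ i) *\<^sub>R axis i 1 = w (insert i A)"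
   using insert.hyps by (simp add: w_def axis_def vec_eq_iff)
  have "nrm (%x. E (w A + (s $ i - a $ i) *\<^sub>R axis i 1) x - E (w A + 0 *\<^sub>R axis i 1) x - (s $ i - a $ i) * 0) <= Q * \<bar>s $ i - a $ i\<bar>"
  proof (rule Lp_mvt_abs[where E="%\<tau>. E (w A + \<tau> *\<^sub>R axis i 1)" and E'="%\<tau>. E' i (w A + \<tau> *\<^sub>R axis i 1)"])
   fix \<tau> assume \<tau>: "\<bar>\<tau>\<bar> <= \<bar>s $ i - a $ i\<bar>"
   note iD = inD[OF insert.hyps(2) \<tau>]
   show "E (w A + \<tau> *\<^sub>R axis i 1) \<in> LP" by (rule E[OF iD])
   show "E' i (w A + \<tau> *\<^sub>R axis i 1) \<in> LP" by (rule E'[OF iD])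
   show "nrm (%x. E' i (w A + \<tau> *\<^sub>R axis i 1) x - 0) <= Q" using Q[OF iD] by simp
   show "((%h. nrm (%x. (E (w A + (\<tau> + h) *\<^sub>R axis i 1) x - E (w A + \<tau> *\<^sub>R axis i 1) x) / h - E' i (w A + \<tau> *\<^sub>R axis i 1) x)) \<longlongrightarrow> 0) (at 0)"
    using d[OF iD, of i] by (simp add: scaleR_add_left add.assoc)
  qed simp
  also have "\<dots> <= Q * norm (s - a)"
   using component_le_norm_cart[of "s - a" i] Q0 by (intro mult_left_mono) auto
  finally have 1: "nrm (%x. E (w (insert i A)) x - E (w A) x) <= Q * norm (s - a)" by (simp add: e)
  have "nrm (%x. E (w (insert i A)) x - E (w {}) x) <= nrm (%x. E (w (insert i A)) x - E (w A) x) + nrm (%x. E (w A) x - E (w {}) x)"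
   by (intro Lp_norm_dist_triangle E wD)
  then show ?case using 1 insert.IH insert.hyps by (simp add: distrib_right)
 qed simp
 from this[of UNIV] have "nrm (%x. E (w UNIV) x - E (w {}) x) <= real CARD('d) * (Q * norm (s - a))" by simp
 moreover have "w UNIV = s" "w {} = a" by (simp_all add: w_def)
 ultimately show ?thesis by (simp add: mult.assoc)
qed

text \<open>On a segment the local estimates add up with the same constant, because the lengths of
  the pieces add. Bisection replaces an explicit subdivision into pieces contained in balls of
  D.\<close>

lemma Lp_Lipschitz_segment:
 assumes E: "!!s. s \<in> D ==> E s \<in> LP" and E': "!!s i. s \<in> D ==> E' i s \<in> LP"
  and d: "!!s i. s \<in> D ==> ((%h. nrm (%x. (E (s + h *\<^sub>R axis i 1) x - E s x) / h - E' i s x)) \<longlongrightarrow> 0) (at 0)"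
  and Q: "!!s i. s \<in> D ==> nrm (E' i s) <= Q" and seg: "closed_segment a b \<subseteq> D"
 shows "nrm (%x. E b x - E a x) <= real CARD('d) * Q * norm (b - a)"
proof -
 define c where "c u = a + u *\<^sub>R (b - a)" for u
 have cD: "c u \<in> D" if "0 <= u" "u <= 1" for u
 proof -
  have "c u = (1 - u) *\<^sub>R a + u *\<^sub>R b" by (simp add: c_def algebra_simps)
  then have "c u \<in> closed_segment a b" using that unfolding in_segment by blast
  then show ?thesis using seg by blast
 qed
 have cn: "norm (c v - c u) = \<bar>v - u\<bar> * norm (b - a)" for u v
  by (simp add: c_def scaleR_diff_left[symmetric])
 define K where "K = real CARD('d) * Q * norm (b - a)"
 define P where "P u v \<longleftrightarrow> (0 <= u & v <= 1 --> nrm (%x. E (c v) x - E (c u) x) <= K * (v - u))" for u v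
 have "P 0 1"
 proof (rule Bolzano)
  fix u v w assume uv: "P u v" "P v w" "u <= v" "v <= w"
  show "P u w"
   unfolding P_def
  proof
   assume uw: "0 <= u & w <= 1"
   have "nrm (%x. E (c w) x - E (c u) x) <= nrm (%x. E (c w) x - E (c v) x) + nrm (%x. E (c v) x - E (c u) x)"
    using uw uv by (intro Lp_norm_dist_triangle E cD) auto
   also have "\<dots> <= K * (w - v) + K * (v - u)" using uv uw unfolding P_def by (intro add_mono) auto
   finally show "nrm (%x. E (c w) x - E (c u) x) <= K * (w - u)" by (simp add: algebra_simps)
  qed
 next
  fix \<tau> :: real assume \<tau>: "0 <= \<tau>" "\<tau> <= 1"
  obtain r where r: "r > 0" "ball (c \<tau>) r \<subseteq> D" using open_D cD[OF \<tau>] by (meson openE)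
  have loc: "nrm (%x. E (c v) x - E (c \<tau>) x) <= K * \<bar>v - \<tau>\<bar>" if "norm (c v - c \<tau>) < r" for v
  proof -
   have "nrm (%x. E (c v) x - E (c \<tau>) x) <= real CARD('d) * Q * norm (c v - c \<tau>)"
    by (rule Lp_Lipschitz_ball[OF E E' d Q r(2) that])
   then show ?thesis by (simp add: cn K_def mult_ac)
  qed
  define \<eta> where "\<eta> = r / (norm (b - a) + 1)"
  have n1: "0 < norm (b - a) + 1" using norm_ge_zero[of "b - a"] by linarith
  have \<eta>: "\<eta> > 0" using r(1) n1 by (simp add: \<eta>_def)
  have close: "norm (c v - c \<tau>) < r" if "\<bar>v - \<tau>\<bar> < \<eta>" for v
  proof -
   have "\<bar>v - \<tau>\<bar> * norm (b - a) <= \<bar>v - \<tau>\<bar> * (norm (b - a) + 1)" by (intro mult_left_mono) auto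
   also have "\<dots> < \<eta> * (norm (b - a) + 1)" using that n1 by (intro mult_strict_right_mono)
   also have "\<dots> = r" using n1 by (simp add: \<eta>_def)
   finally show ?thesis by (simp add: cn)
  qed
  show "\<exists>d>0. \<forall>u v. u <= \<tau> & \<tau> <= v & v - u < d --> P u v"
  proof (intro exI[of _ \<eta>] conjI \<eta> allI impI)
   fix u v assume uv: "u <= \<tau> & \<tau> <= v & v - u < \<eta>"
   show "P u v"
    unfolding P_def
   proof
    assume "0 <= u & v <= 1"
    then have "nrm (%x. E (c v) x - E (c u) x) <= nrm (%x. E (c v) x - E (c \<tau>) x) + nrm (%x. E (c \<tau>) x - E (c u) x)"
     using uv \<tau> by (intro Lp_norm_dist_triangle E cD) auto
    also have "\<dots> <= K * \<bar>v - \<tau>\<bar> + K * \<bar>u - \<tau>\<bar>"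
     using loc[OF close, of v] loc[OF close, of u] uv Lp_norm_minus_commute[of "E (c \<tau>)" "E (c u)"] by (intro add_mono) auto
    also have "\<dots> = K * (v - u)" using uv by (simp add: algebra_simps)
    finally show "nrm (%x. E (c v) x - E (c u) x) <= K * (v - u)" .
   qed
  qed
 qed simp
 then show ?thesis by (simp add: P_def K_def c_def)
qed

text \<open>For |b - a| < \<delta> the Lipschitz bound along three segments becomes a Hoelder bound
  through |b - a| <= (1 + \<delta>) |b - a|^\<gamma>, where \<gamma> <= 1 is used. For larger
  distances the bound of E itself suffices.\<close>

lemma Lp_C1_imp_holder:
 assumes dom: "bounded_C1_domain D" and \<gamma>: "0 < \<gamma>" "\<gamma> <= 1"
 obtains K where "1 <= K" "!!E E' Q a b. (!!s. s \<in> D ==> E s \<in> LP) ==> (!!s i. s \<in> D ==> E' i s \<in> LP) ==>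
  (!!s i. s \<in> D ==> ((%h. nrm (%x. (E (s + h *\<^sub>R axis i 1) x - E s x) / h - E' i s x)) \<longlongrightarrow> 0) (at 0)) ==>
  (!!s i. s \<in> D ==> nrm (E' i s) <= Q) ==> (!!s. s \<in> D ==> nrm (E s) <= Q) ==> a \<in> D ==> b \<in> D ==>
  nrm (%x. E b x - E a x) <= K * Q * norm (b - a) powr \<gamma>"
proof -
 obtain \<delta> R where \<delta>: "0 < \<delta>" and R: "0 <= R" and seg: "!!a b. a \<in> D ==> b \<in> D ==> norm (b - a) < \<delta> ==>
   \<exists>c e. closed_segment a c \<subseteq> D & closed_segment c e \<subseteq> D & closed_segment e b \<subseteq> D \<and>
    norm (c - a) <= R * norm (b - a) & norm (e - c) <= R * norm (b - a) & norm (b - e) <= R * norm (b - a)"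
  by (rule C1_domain_three_segments[OF dom]) (rule that, assumption+)
 let ?N = "real CARD('d)"
 define K where "K = 1 + 3 * ?N * R * (1 + \<delta>) + 2 * (1 / \<delta>) powr \<gamma>"
 have K1: "1 <= K" using R \<delta> by (simp add: K_def)
 have main: "nrm (%x. E b x - E a x) <= K * Q * norm (b - a) powr \<gamma>"
  if E: "!!s. s \<in> D ==> E s \<in> LP" and E': "!!s i. s \<in> D ==> E' i s \<in> LP"
  and d: "!!s i. s \<in> D ==> ((%h. nrm (%x. (E (s + h *\<^sub>R axis i 1) x - E s x) / h - E' i s x)) \<longlongrightarrow> 0) (at 0)"
  and Q: "!!s i. s \<in> D ==> nrm (E' i s) <= Q" and Q': "!!s. s \<in> D ==> nrm (E s) <= Q" and ab: "a \<in> D" "b \<in> D"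
  for E E' Q a b
 proof -
  have Q0: "0 <= Q" using Q'[OF ab(1)] Lp_norm_nonneg[of "E a"] by linarith
  let ?n = "norm (b - a)"
  show ?thesis
  proof (cases "?n < \<delta>")
   case True
   obtain c e where ce: "closed_segment a c \<subseteq> D" "closed_segment c e \<subseteq> D" "closed_segment e b \<subseteq> D"
    "norm (c - a) <= R * ?n" "norm (e - c) <= R * ?n" "norm (b - e) <= R * ?n"
    using seg[OF ab True] by (elim exE conjE)
   have D4: "c \<in> D" "e \<in> D" using ce by auto
   have seg_le: "nrm (%x. E v x - E u x) <= ?N * Q * (R * ?n)" if "closed_segment u v \<subseteq> D" "norm (v - u) <= R * ?n" for u v
   proof -
    have "nrm (%x. E v x - E u x) <= ?N * Q * norm (v - u)" by (rule Lp_Lipschitz_segment[OF E E' d Q that(1)])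
    also have "\<dots> <= ?N * Q * (R * ?n)" using that(2) Q0 by (intro mult_left_mono) auto
    finally show ?thesis .
   qed
   have "nrm (%x. E b x - E a x) <= nrm (%x. E b x - E e x) + nrm (%x. E e x - E a x)"
    by (intro Lp_norm_dist_triangle E ab D4)
   also have "nrm (%x. E e x - E a x) <= nrm (%x. E e x - E c x) + nrm (%x. E c x - E a x)"
    by (intro Lp_norm_dist_triangle E ab D4)
   finally have "nrm (%x. E b x - E a x) <= 3 * (?N * Q * (R * ?n))"
    using seg_le[OF ce(1,4)] seg_le[OF ce(2,5)] seg_le[OF ce(3,6)] by linarith
   also have "?n <= (1 + \<delta>) * ?n powr \<gamma>"
   proof (cases "?n = 0")
    case False
    then have "?n = ?n powr (1 - \<gamma>) * ?n powr \<gamma>" by (simp add: powr_add[symmetric])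
    also have "\<dots> <= (1 + \<delta>) * ?n powr \<gamma>"
    proof (intro mult_right_mono)
     have "?n powr (1 - \<gamma>) <= (1 + \<delta>) powr (1 - \<gamma>)" using True \<gamma> by (intro powr_mono2) auto
     also have "\<dots> <= (1 + \<delta>) powr 1" using \<delta> \<gamma> by (intro powr_mono) auto
     finally show "?n powr (1 - \<gamma>) <= 1 + \<delta>" using \<delta> by simp
    qed simp
    finally show ?thesis .
   qed simp
   then have "3 * (?N * Q * (R * ?n)) <= 3 * (?N * Q * (R * ((1 + \<delta>) * ?n powr \<gamma>)))"
    using Q0 R by (intro mult_left_mono) auto
   also have "\<dots> = (3 * ?N * R * (1 + \<delta>)) * (Q * ?n powr \<gamma>)" by simp
   also have "\<dots> <= K * (Q * ?n powr \<gamma>)" using Q0 by (intro mult_right_mono) (auto simp: K_def)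
   finally show ?thesis by (simp add: mult.assoc)
  next
   case False
   have "nrm (%x. E b x - E a x) <= nrm (E b) + nrm (E a)"
    by (intro Lp_norm_triangle_diff E ab)
   also have "\<dots> <= 2 * Q * 1" using Q'[OF ab(1)] Q'[OF ab(2)] by simp
   also have "\<dots> <= 2 * Q * ((1 / \<delta>) powr \<gamma> * ?n powr \<gamma>)"
   proof (intro mult_left_mono)
    have "1 <= (?n / \<delta>) powr \<gamma>" using False \<delta> \<gamma> by (intro ge_one_powr_ge_zero) auto
    also have "\<dots> = (1 / \<delta> * ?n) powr \<gamma>" by simp
    also have "\<dots> = (1 / \<delta>) powr \<gamma> * ?n powr \<gamma>" by (rule powr_mult)
    finally show "1 <= (1 / \<delta>) powr \<gamma> * ?n powr \<gamma>" .
   qed (use Q0 in simp)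
   also have "\<dots> = (2 * (1 / \<delta>) powr \<gamma>) * (Q * ?n powr \<gamma>)" by simp
   also have "\<dots> <= K * (Q * ?n powr \<gamma>)" using Q0 R \<delta> by (intro mult_right_mono) (auto simp: K_def)
   finally show ?thesis by (simp add: mult.assoc)
  qed
 qed
 show ?thesis by (rule that[OF K1], rule main)
qed

end

subsection \<open>Mixed Hoelder bounds from mixed derivatives\<close>

lemma mdiff_eq_0:
 assumes "finite A" "l \<in> A" "h l = 0"
 shows "mdiff A h f y x = 0"
proof -
 have "mdiff (insert l (A - {l})) h f y x = mdiff (A - {l}) h f (y(l := y l + h l)) x - mdiff (A - {l}) h f y x"
  using assms by (intro mdiff_insert) auto
 then show ?thesis using assms by (simp add: insert_absorb)
qed

context Sobolev_domain
begin

lemma Dcl: "s \<in> D ==> s \<in> closure D"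
 using closure_subset[of D] by blast

lemma D_pts: "y \<in> I \<rightarrow>\<^sub>E D ==> y \<in> pts I"
 using Dcl by (auto simp: PiE_iff)

text \<open>For finitely many variables closeness in every coordinate describes the product
  topology. The converse is argued with a sequence at coordinate distance below 1 / (n + 1) along
  which the estimate fails.\<close>

lemma Lp_continuous_iff_tendsto:
 assumes I: "finite I"
 shows "Lp_continuous I f \<longleftrightarrow> (\<forall>y\<in>pts I. f y \<in> LP \<and>
  ((%z. nrm (%x. f z x - f y x)) \<longlongrightarrow> 0) (at y within pts I))"
proof
 assume f: "Lp_continuous I f"
 show "\<forall>y\<in>pts I. f y \<in> LP & ((%z. nrm (%x. f z x - f y x)) \<longlongrightarrow> 0) (at y within pts I)"
 proof (intro ballI conjI)
  fix y assume y: "y \<in> pts I"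
  then show "f y \<in> LP" using f by (simp add: Lp_continuous_def)
  show "((%z. nrm (%x. f z x - f y x)) \<longlongrightarrow> 0) (at y within pts I)"
  proof (rule tendstoI)
   fix \<epsilon> :: real assume "\<epsilon> > 0"
   then obtain \<delta> where \<delta>: "\<delta> > 0" "!!z. z \<in> pts I ==> (\<forall>l\<in>I. dist (z l) (y l) < \<delta>) ==> nrm (%x. f z x - f y x) < \<epsilon>"
    using f y unfolding Lp_continuous_def by meson
   have "((%z. z) \<longlongrightarrow> y) (at y within pts I)" by (rule tendsto_ident_at)
   then have "((%z. z l) \<longlongrightarrow> y l) (at y within pts I)" for l unfolding tendsto_fun_iff by simp
   then have "\<forall>\<^sub>F z in at y within pts I. \<forall>l\<in>I. dist (z l) (y l) < \<delta>"
    using I \<delta>(1) by (auto intro!: eventually_ball_finite tendstoD)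
   moreover have "\<forall>\<^sub>F z in at y within pts I. z \<in> pts I"
    by (simp add: eventually_at_topological) (use open_UNIV in blast)
   ultimately show "\<forall>\<^sub>F z in at y within pts I. dist (nrm (%x. f z x - f y x)) 0 < \<epsilon>"
    by eventually_elim (use \<delta>(2) in simp)
  qed
 qed
next
 assume f: "\<forall>y\<in>pts I. f y \<in> LP & ((%z. nrm (%x. f z x - f y x)) \<longlongrightarrow> 0) (at y within pts I)"
 show "Lp_continuous I f"
  unfolding Lp_continuous_def
 proof (intro ballI conjI allI impI)
  fix y assume y: "y \<in> pts I"
  then show "f y \<in> LP" using f by blast
  fix \<epsilon> :: real assume \<epsilon>: "\<epsilon> > 0"
  show "\<exists>\<delta>>0. \<forall>z\<in>pts I. (\<forall>l\<in>I. dist (z l) (y l) < \<delta>) --> nrm (%x. f z x - f y x) < \<epsilon>"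
  proof (rule ccontr)
   assume neg: "\<not> ?thesis"
   have "\<exists>z. z \<in> pts I & (\<forall>l\<in>I. dist (z l) (y l) < \<delta>) & \<not> nrm (%x. f z x - f y x) < \<epsilon>" if "0 < \<delta>" for \<delta>
    using neg that by blast
   then have "\<forall>n. \<exists>z. z \<in> pts I & (\<forall>l\<in>I. dist (z l) (y l) < inverse (real (Suc n))) & \<not> nrm (%x. f z x - f y x) < \<epsilon>"
    by simp
   from choice[OF this] obtain z where z': "\<forall>n. z n \<in> pts I & (\<forall>l\<in>I. dist (z n l) (y l) < inverse (real (Suc n))) & \<not> nrm (%x. f (z n) x - f y x) < \<epsilon>" ..
   have z: "!!n. z n \<in> pts I" "!!n l. l \<in> I ==> dist (z n l) (y l) < inverse (real (Suc n))"
    "!!n. \<not> nrm (%x. f (z n) x - f y x) < \<epsilon>"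
    using z' by auto
   have "z \<longlonglongrightarrow> y"
    unfolding tendsto_fun_iff
   proof
    fix l
    show "(%n. z n l) \<longlonglongrightarrow> y l"
    proof (cases "l \<in> I")
     case True
     have "(%n. dist (z n l) (y l)) \<longlonglongrightarrow> 0"
      by (rule tendsto_sandwich[OF _ _ tendsto_const LIMSEQ_inverse_real_of_nat])
       (use z(2)[OF True] in \<open>auto intro!: always_eventually less_imp_le\<close>)
     then show ?thesis by (subst tendsto_dist_iff)
    next
     case False
     then have "z n l = y l" for n using z(1)[of n] y by (simp add: PiE_iff extensional_def)
     then show ?thesis by simp
    qed
   qed
   moreover have "z n ~= y" for n using z(3)[of n] \<epsilon> by auto
   ultimately have "filterlim z (at y within pts I) sequentially"
    using z(1) by (simp add: filterlim_at)
   with f y have "(%n. nrm (%x. f (z n) x - f y x)) \<longlonglongrightarrow> 0"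
    by (intro filterlim_compose[of "%z. nrm (%x. f z x - f y x)" "nhds 0" "at y within pts I" z]) auto
   from order_tendstoD(2)[OF this \<epsilon>] show False using z(3) by (simp add: eventually_sequentially)
  qed
 qed
qed

lemma Lp_continuous_LIMSEQ:
 assumes I: "finite I" and f: "Lp_continuous I f" and y: "y \<in> pts I" and z: "!!n. z n \<in> pts I" "!!l. l \<in> I ==> (%n. z n l) \<longlonglongrightarrow> y l"
 shows "(%n. nrm (%x. f (z n) x - f y x)) \<longlonglongrightarrow> 0"
proof (rule tendstoI)
 fix \<epsilon> :: real assume "\<epsilon> > 0"
 then obtain \<delta> where \<delta>: "\<delta> > 0" "!!z. z \<in> pts I ==> (\<forall>l\<in>I. dist (z l) (y l) < \<delta>) ==> nrm (%x. f z x - f y x) < \<epsilon>"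
  using f y unfolding Lp_continuous_def by meson
 have "\<forall>\<^sub>F n in sequentially. \<forall>l\<in>I. dist (z n l) (y l) < \<delta>"
  using I \<delta>(1) z(2) by (auto intro!: eventually_ball_finite tendstoD)
 then show "\<forall>\<^sub>F n in sequentially. dist (nrm (%x. f (z n) x - f y x)) 0 < \<epsilon>"
  by eventually_elim (use \<delta>(2) z(1) in simp)
qed

text \<open>The analogue of \<open>mix_derivs\<close> with values in L^p; it is applied to one weak
  x-derivative of a Sobolev-valued family at a time.\<close>

definition Lp_derivs :: "nat set => nat => ((nat => 'd => nat) => (nat => real^'d) => real^'d => real) => bool" where
 "Lp_derivs I n g \<longleftrightarrow> (\<forall>\<alpha>\<in>mix_indices I n. Lp_continuous I (g \<alpha>)) \<and>
   (\<forall>\<alpha> l i. l \<in> I --> (mi_inc \<alpha> l i) \<in> mix_indices I n -->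
    (\<forall>y\<in>I \<rightarrow>\<^sub>E D.
      ((%t. nrm (%x. (g \<alpha> (y(l := y l + t *\<^sub>R axis i 1)) x - g \<alpha> y x) / t
            - g (mi_inc \<alpha> l i) y x)) \<longlongrightarrow> 0) (at 0)))"

lemma Lp_derivs_continuous: "Lp_derivs I n g ==> \<alpha> \<in> mix_indices I n ==> Lp_continuous I (g \<alpha>)"
 by (simp add: Lp_derivs_def)

lemma Lp_derivsD:
 assumes "Lp_derivs I n g" "l \<in> I" "(mi_inc \<alpha> l i) \<in> mix_indices I n" "y \<in> I \<rightarrow>\<^sub>E D"
 shows "((%t. nrm (%x. (g \<alpha> (y(l := y l + t *\<^sub>R axis i 1)) x - g \<alpha> y x) / t
            - g (mi_inc \<alpha> l i) y x)) \<longlongrightarrow> 0) (at 0)"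
 using assms unfolding Lp_derivs_def by blast

lemma mix_indices_mono_upd:
 assumes "(mi_inc \<alpha> l i) \<in> mix_indices I n" "l \<in> I"
 shows "\<alpha> \<in> mix_indices I n"
proof -
 have "mi_order (\<alpha> k) <= n" if "k \<in> I" for k
 proof (cases "k = l")
  case True
  have "mi_order ((mi_inc \<alpha> l i) l) <= n" using assms by (auto simp only: mix_indices_def)
  then have "Suc (mi_order (\<alpha> l)) <= n" by (simp only: fun_upd_same mi_order_Suc)
  then show ?thesis using True by simp
 next
  case False
  have "mi_order ((mi_inc \<alpha> l i) k) <= n" using assms that by (auto simp only: mix_indices_def)
  then show ?thesis unfolding fun_upd_other[OF False] .
 qed
 moreover have "\<alpha> k = (%_. 0)" if "k \<notin> I" for k
 proof -
  have "(mi_inc \<alpha> l i) k = (%_. 0)" using assms that by (auto simp only: mix_indices_def)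
  then show ?thesis using that assms(2) by (metis fun_upd_other)
 qed
 ultimately show ?thesis by (simp add: mix_indices_def)
qed

lemma mix_indices_upd:
 assumes "\<alpha> \<in> mix_indices I n" "l \<in> I" "mi_order (\<alpha> l) < n"
 shows "(mi_inc \<alpha> l i) \<in> mix_indices I n"
proof -
 have "mi_order ((mi_inc \<alpha> l i) k) <= n" if "k \<in> I" for k
 proof (cases "k = l")
  case True
  then show ?thesis using assms(3) by (simp only: fun_upd_same mi_order_Suc)
 next
  case False
  then show ?thesis using assms(1) that by (simp add: mix_indices_def)
 qed
 then show ?thesis using assms(1,2) by (auto simp: mix_indices_def)
qed

text \<open>A mixed difference in other variables is a finite sum of values, so it commutes with the
  derivative in y_l. All vertices lie in the open product, where the derivative exists.\<close>

lemma mdiff_deriv: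
 assumes g: "Lp_derivs I n g" and l: "l \<in> I" and \<alpha>: "(mi_inc \<alpha> l i) \<in> mix_indices I n"
  and A: "finite A" "A \<subseteq> I" "l \<notin> A" and y: "y \<in> I \<rightarrow>\<^sub>E D" "!!j. j \<in> A ==> y j + h j \<in> D"
 shows "((%t. nrm (%x. (mdiff A h (g \<alpha>) (y(l := y l + t *\<^sub>R axis i 1)) x - mdiff A h (g \<alpha>) y x) / t
      - mdiff A h (g (mi_inc \<alpha> l i)) y x)) \<longlongrightarrow> 0) (at 0)"
proof -
 let ?g' = "g (mi_inc \<alpha> l i)"
 define w where "w S = (%j. if j \<in> S then y j + h j else y j)" for S
 have w: "w S \<in> I \<rightarrow>\<^sub>E D" if "S \<in> Pow A" for S
  unfolding w_def using that A(2) y by (intro mdiff_point_mem[of y I D A h S]) auto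
 have wl: "(w S) l = y l" if "S \<in> Pow A" for S using that A(3) by (auto simp: w_def)
 define q where "q S t x = (g \<alpha> ((w S)(l := (w S) l + t *\<^sub>R axis i 1)) x - g \<alpha> (w S) x) / t - ?g' (w S) x" for S t x
 have qlim: "((%t. nrm (q S t)) \<longlongrightarrow> 0) (at 0)" if "S \<in> Pow A" for S
  unfolding q_def by (rule Lp_derivsD[OF g l \<alpha> w[OF that]])
 have eq: "(mdiff A h (g \<alpha>) (y(l := y l + t *\<^sub>R axis i 1)) x - mdiff A h (g \<alpha>) y x) / t - mdiff A h ?g' y x
   = (\<Sum>S\<in>Pow A. (-1) ^ card (A - S) * q S t x)" for t x
 proof -
  have "mdiff A h (g \<alpha>) (y(l := v)) x = (\<Sum>S\<in>Pow A. (-1) ^ card (A - S) * g \<alpha> ((w S)(l := v)) x)" for v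
   unfolding mdiff_def
  proof (rule sum.cong[OF refl])
   fix S assume "S \<in> Pow A"
   then have "(%j. if j \<in> S then (y(l := v)) j + h j else (y(l := v)) j) = (w S)(l := v)"
    using A(3) by (auto simp: w_def fun_eq_iff)
   then show "(-1) ^ card (A - S) * g \<alpha> (%j. if j \<in> S then (y(l := v)) j + h j else (y(l := v)) j) x
    = (-1) ^ card (A - S) * g \<alpha> ((w S)(l := v)) x" by simp
  qed
  moreover have "(\<Sum>S\<in>Pow A. (-1) ^ card (A - S) * q S t x)
    = ((\<Sum>S\<in>Pow A. (-1) ^ card (A - S) * g \<alpha> ((w S)(l := y l + t *\<^sub>R axis i 1)) x) - (\<Sum>S\<in>Pow A. (-1) ^ card (A - S) * g \<alpha> (w S) x)) / t
     - (\<Sum>S\<in>Pow A. (-1) ^ card (A - S) * ?g' (w S) x)"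
   unfolding sum_subtractf[symmetric] sum_divide_distrib
   by (rule sum.cong[OF refl]) (simp add: q_def wl algebra_simps diff_divide_distrib)
  ultimately show ?thesis by (simp add: mdiff_def w_def)
 qed
 have "((%t. nrm (%x. \<Sum>S\<in>Pow A. (-1) ^ card (A - S) * q S t x)) \<longlongrightarrow> 0) (at 0)"
 proof (rule tendsto_sandwich[OF _ _ tendsto_const])
  show "((%t. \<Sum>S\<in>Pow A. nrm (q S t)) \<longlongrightarrow> 0) (at 0)"
   using tendsto_sum[of "Pow A" "%S t. nrm (q S t)" "%_. 0" "at 0"] qlim by simp
  have yl: "y l \<in> D" using y(1) l by auto
  show "\<forall>\<^sub>F t in at 0. nrm (%x. \<Sum>S\<in>Pow A. (-1) ^ card (A - S) * q S t x) <= (\<Sum>S\<in>Pow A. nrm (q S t))"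
   using eventually_shift_mem[OF yl, of "axis i 1"]
  proof eventually_elim
   case (elim t)
   have qL: "q S t \<in> LP" if S: "S \<in> Pow A" for S
   proof -
    have "(w S)(l := (w S) l + t *\<^sub>R axis i 1) \<in> I \<rightarrow>\<^sub>E D"
     using w[OF S] elim wl[OF S] l by (auto simp: PiE_iff extensional_def)
    then have "(%x. (1 / t) * (g \<alpha> ((w S)(l := (w S) l + t *\<^sub>R axis i 1)) x - g \<alpha> (w S) x) - ?g' (w S) x) \<in> LP"
     by (intro Lp_diff Lp_scale Lp_continuousD[OF Lp_derivs_continuous[OF g]] D_pts \<alpha> mix_indices_mono_upd[OF \<alpha> l] w[OF S])
    then show ?thesis by (simp add: q_def[abs_def])
   qed
   have "nrm (%x. \<Sum>S\<in>Pow A. (-1) ^ card (A - S) * q S t x) <= (\<Sum>S\<in>Pow A. nrm (%x. (-1) ^ card (A - S) * q S t x))"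
    by (intro Lp_norm_sum Lp_scale qL)
   then show ?case by (simp add: Lp_norm_scale power_abs)
  qed
 qed simp
 then show ?thesis by (simp only: eq)
qed

lemma mdiff_Lp:
 assumes "Lp_continuous I f" "A \<subseteq> I" "y \<in> pts I" "!!l. l \<in> A ==> y l + h l \<in> closure D"
 shows "mdiff A h f y \<in> LP"
 by (rule mixed_holder_mdiff_Lp[OF assms])

text \<open>A mixed difference is a finite sum of values that depend continuously on their points,
  so bounds on the open product pass to the closure.\<close>

lemma mixed_holder_closure:
 assumes I: "finite I" and \<gamma>: "0 < \<gamma>" and f: "Lp_continuous I f"
  and b: "!!A y h. A \<subseteq> I ==> y \<in> I \<rightarrow>\<^sub>E D ==> (!!l. l \<in> A ==> y l + h l \<in> D) ==> nrm (mdiff A h f y) <= B * (\<Prod>l\<in>A. norm (h l) powr \<gamma>)"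
 shows "mixed_holder I \<gamma> B f"
 unfolding mixed_holder_def
proof (intro allI impI ballI)
 fix A y h assume A: "A \<subseteq> I" and y: "y \<in> pts I" and h: "\<forall>l\<in>A. y l + h l \<in> closure D"
 have fA: "finite A" using finite_subset[OF A I] .
 have "\<forall>s\<in>closure D. \<exists>a. (\<forall>n. a n \<in> D) & a \<longlonglongrightarrow> s" using closure_sequential by blast
 from bchoice[OF this] obtain a where a: "!!s. s \<in> closure D ==> (\<forall>n. a s n \<in> D) & a s \<longlonglongrightarrow> s" by blast
 define yy where "yy n = (\<lambda>l\<in>I. a (y l) n)" for n
 \<comment> \<open>The increments are differences of approximating points, so that y_l and y_l + h_l
   are both approached from inside D.\<close>
 define hh where "hh n l = a (y l + h l) n - a (y l) n" for n l
 have yc: "y l \<in> closure D" if "l \<in> I" for l using y that by auto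
 have yyD: "yy n \<in> I \<rightarrow>\<^sub>E D" for n using a yc by (auto simp: yy_def)
 have hhD: "yy n l + hh n l \<in> D" if "l \<in> A" for n l
  using a[of "y l + h l"] h that A by (auto simp: yy_def hh_def)
 have ylim: "(%n. yy n l) \<longlonglongrightarrow> y l" if "l \<in> I" for l using a[OF yc[OF that]] that by (simp add: yy_def)
 have hlim: "(%n. hh n l) \<longlonglongrightarrow> h l" if "l \<in> A" for l
 proof -
  have "(%n. a (y l + h l) n - a (y l) n) \<longlonglongrightarrow> (y l + h l) - y l"
   using a[OF yc] a[of "y l + h l"] h that A by (intro tendsto_diff) auto
  then show ?thesis by (simp add: hh_def)
 qed
 let ?w = "%S. (%l. if l \<in> S then y l + h l else y l)" and ?w' = "%n S. (%l. if l \<in> S then yy n l + hh n l else yy n l)"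
 have wc: "?w S \<in> pts I" if "S \<in> Pow A" for S using that A y h by (intro mdiff_point_mem[of y I _ A]) auto
 have w'c: "?w' n S \<in> pts I" if "S \<in> Pow A" for S n
  using that A D_pts[OF yyD] hhD Dcl by (intro mdiff_point_mem[of "yy n" I _ A]) auto
 have dlim: "(%n. nrm (%x. f (?w' n S) x - f (?w S) x)) \<longlonglongrightarrow> 0" if S: "S \<in> Pow A" for S
 proof (rule Lp_continuous_LIMSEQ[OF I f wc[OF S] w'c[OF S]])
  fix l assume "l \<in> I"
  then show "(%n. ?w' n S l) \<longlonglongrightarrow> ?w S l"
   using ylim hlim S by (cases "l \<in> S") (auto intro!: tendsto_add)
 qed
 have le: "nrm (mdiff A h f y) <= B * (\<Prod>l\<in>A. norm (hh n l) powr \<gamma>) + (\<Sum>S\<in>Pow A. nrm (%x. f (?w' n S) x - f (?w S) x))" for n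
 proof -
  have m1: "mdiff A h f y \<in> LP" using h by (intro mdiff_Lp[OF f A y]) auto
  have m2: "mdiff A (hh n) f (yy n) \<in> LP" using hhD Dcl by (intro mdiff_Lp[OF f A D_pts[OF yyD]]) auto
  have "nrm (mdiff A h f y) <= nrm (mdiff A (hh n) f (yy n)) + nrm (%x. mdiff A h f y x - mdiff A (hh n) f (yy n) x)"
   by (rule Lp_norm_le_add_diff[OF m1 m2])
  also have "nrm (%x. mdiff A h f y x - mdiff A (hh n) f (yy n) x)
    = nrm (%x. mdiff A (hh n) f (yy n) x - mdiff A h f y x)" by (rule Lp_norm_minus_commute)
  also have "(%x. mdiff A (hh n) f (yy n) x - mdiff A h f y x) = (%x. \<Sum>S\<in>Pow A. (-1) ^ card (A - S) * (f (?w' n S) x - f (?w S) x))"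
   by (simp add: mdiff_def right_diff_distrib sum_subtractf)
  also have "nrm \<dots> <= (\<Sum>S\<in>Pow A. nrm (%x. (-1) ^ card (A - S) * (f (?w' n S) x - f (?w S) x)))"
   by (intro Lp_norm_sum Lp_scale Lp_diff Lp_continuousD[OF f] wc w'c)
  also have "\<dots> = (\<Sum>S\<in>Pow A. nrm (%x. f (?w' n S) x - f (?w S) x))"
   by (simp add: Lp_norm_scale power_abs)
  finally show ?thesis using b[OF A yyD hhD, of n] by linarith
 qed
 have "(%n. B * (\<Prod>l\<in>A. norm (hh n l) powr \<gamma>) + (\<Sum>S\<in>Pow A. nrm (%x. f (?w' n S) x - f (?w S) x)))
   \<longlonglongrightarrow> B * (\<Prod>l\<in>A. norm (h l) powr \<gamma>) + (\<Sum>S\<in>Pow A. 0)"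
  using \<gamma> by (intro tendsto_add tendsto_mult_left tendsto_prod tendsto_powr' tendsto_norm hlim tendsto_const tendsto_sum dlim) auto
 then show "nrm (mdiff A h f y) <= B * (\<Prod>l\<in>A. norm (h l) powr \<gamma>)"
  using le by (intro LIMSEQ_le_const) auto
qed

text \<open>Induction on the number of variables in A whose order is below n. If there is none, the
  assumed bounds apply, or a step is 0 and the difference vanishes. Otherwise such a variable y_l is
  singled out: the difference over the rest of A, as a function of y_l, and its derivatives in y_l
  are bounded by the induction hypothesis, and \<open>Lp_C1_imp_holder\<close> supplies the factor
  |h_l|^\<gamma>. Each round costs one factor K, hence the power \<open>card I\<close> in the
  constant.\<close>

theorem Lp_derivs_mixed_holder:
 assumes dom: "bounded_C1_domain D" and \<gamma>: "0 < \<gamma>" "\<gamma> <= 1" and I: "finite I"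
 obtains K where "0 <= K" "!!B g \<alpha>. 0 <= B ==> Lp_derivs I n g ==>
  (!!\<alpha> y. \<alpha> \<in> mix_indices I n ==> y \<in> pts I ==> nrm (g \<alpha> y) <= B) ==>
  (!!\<alpha> A y h. \<alpha> \<in> mix_indices I n ==> A \<subseteq> I ==> A ~= {} ==> (!!l. l \<in> A ==> mi_order (\<alpha> l) = n) ==> y \<in> pts I ==>
   (!!l. l \<in> A ==> y l + h l \<in> closure D) ==> (!!l. l \<in> A ==> h l ~= 0) ==>
   nrm (mdiff A h (g \<alpha>) y) <= B * (\<Prod>l\<in>A. norm (h l) powr \<gamma>)) ==>
  \<alpha> \<in> mix_indices I n ==> mixed_holder I \<gamma> (K * B) (g \<alpha>)"
proof (rule Lp_C1_imp_holder[OF dom \<gamma>])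
 fix K :: real assume K: "1 <= K" "!!E E' Q a b. (!!s. s \<in> D ==> E s \<in> LP) ==> (!!s i. s \<in> D ==> E' i s \<in> LP) ==>
  (!!s i. s \<in> D ==> ((%h. nrm (%x. (E (s + h *\<^sub>R axis i 1) x - E s x) / h - E' i s x)) \<longlongrightarrow> 0) (at 0)) ==>
  (!!s i. s \<in> D ==> nrm (E' i s) <= Q) ==> (!!s. s \<in> D ==> nrm (E s) <= Q) ==> a \<in> D ==> b \<in> D ==>
  nrm (%x. E b x - E a x) <= K * Q * norm (b - a) powr \<gamma>"
 have main: "mixed_holder I \<gamma> (K ^ card I * B) (g \<alpha>)"
  if B: "0 <= B" and g: "Lp_derivs I n g" and b0: "!!\<alpha> y. \<alpha> \<in> mix_indices I n ==> y \<in> pts I ==> nrm (g \<alpha> y) <= B"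
   and b1: "!!\<alpha> A y h. \<alpha> \<in> mix_indices I n ==> A \<subseteq> I ==> A ~= {} ==> (!!l. l \<in> A ==> mi_order (\<alpha> l) = n) ==> y \<in> pts I ==>
   (!!l. l \<in> A ==> y l + h l \<in> closure D) ==> (!!l. l \<in> A ==> h l ~= 0) ==>
   nrm (mdiff A h (g \<alpha>) y) <= B * (\<Prod>l\<in>A. norm (h l) powr \<gamma>)"
   and \<alpha>: "\<alpha> \<in> mix_indices I n" for B g \<alpha>
 proof -
  \<comment> \<open>Stated on the open product, where the derivatives in y_l exist;
    \<open>mixed_holder_closure\<close> reaches the boundary afterwards.\<close>
  have claim: "nrm (mdiff A h (g \<alpha>) y) <= K ^ k * B * (\<Prod>l\<in>A. norm (h l) powr \<gamma>)"
   if "card {l \<in> A. mi_order (\<alpha> l) < n} = k" "\<alpha> \<in> mix_indices I n" "A \<subseteq> I" "y \<in> I \<rightarrow>\<^sub>E D" "!!l. l \<in> A ==> y l + h l \<in> D"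
   for k \<alpha> A y h
   using that
  proof (induction k arbitrary: \<alpha> A y h)
   case (0 \<alpha> A y h)
   have fA: "finite A" using finite_subset[OF 0(3) I] .
   have ord: "mi_order (\<alpha> l) = n" if l: "l \<in> A" for l
   proof -
    have "{l \<in> A. mi_order (\<alpha> l) < n} = {}" using 0(1) fA by simp
    moreover have "mi_order (\<alpha> l) <= n" using 0(2,3) l by (auto simp: mix_indices_def)
    ultimately show ?thesis using l by force
   qed
   show ?case
   proof (cases "A = {}")
    case True
    have "mdiff {} h (g \<alpha>) y = g \<alpha> y" by (rule ext) simp
    then show ?thesis using b0[OF 0(2) D_pts[OF 0(4)]] True by simp
   next
    case ne: False
    show ?thesis
    proof (cases "\<exists>l\<in>A. h l = 0")
     case True
     then obtain l where l: "l \<in> A" "h l = 0" by blast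
     have "mdiff A h (g \<alpha>) y = (%x. 0)" by (rule ext) (rule mdiff_eq_0[where l=l and h=h, OF fA l])
     then show ?thesis using B by (simp add: prod_nonneg)
    next
     case False
     then have "nrm (mdiff A h (g \<alpha>) y) <= B * (\<Prod>l\<in>A. norm (h l) powr \<gamma>)"
      using ord Dcl 0(5) by (intro b1[OF 0(2,3) ne _ D_pts[OF 0(4)]]) auto
     then show ?thesis by simp
    qed
   qed
  next
   case (Suc k \<alpha> A y h)
   have fA: "finite A" using finite_subset[OF Suc(4) I] .
   have "{l \<in> A. mi_order (\<alpha> l) < n} ~= {}" using Suc(2) by (metis card.empty nat.distinct(1))
   then obtain l where l: "l \<in> A" "mi_order (\<alpha> l) < n" by blast
   define A' where "A' = A - {l}"
   have A': "finite A'" "A' \<subseteq> I" "l \<notin> A'" "A = insert l A'" "l \<in> I" using fA Suc(4) l by (auto simp: A'_def)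
   define \<alpha>' where "\<alpha>' i = (mi_inc \<alpha> l i)" for i
   have \<alpha>': "\<alpha>' i \<in> mix_indices I n" for i unfolding \<alpha>'_def by (rule mix_indices_upd[OF Suc(3) A'(5) l(2)])
   have ck: "card {j \<in> A'. mi_order (\<alpha> j) < n} = k"
   proof -
    have "{j \<in> A'. mi_order (\<alpha> j) < n} = {j \<in> A. mi_order (\<alpha> j) < n} - {l}" by (auto simp: A'_def)
    then show ?thesis using Suc(2) l fA by (simp add: card_Diff_singleton)
   qed
   \<comment> \<open>Raising the order in y_l leaves the count over A' unchanged, as l has been
     removed from it. Hence both the difference and its derivative fall under the induction
     hypothesis.\<close>
   have ck': "card {j \<in> A'. mi_order (\<alpha>' i j) < n} = k" for i
   proof -
    have "{j \<in> A'. mi_order (\<alpha>' i j) < n} = {j \<in> A'. mi_order (\<alpha> j) < n}"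
     using A'(3) by (auto simp: \<alpha>'_def)
    then show ?thesis using ck by simp
   qed
   define Q where "Q = K ^ k * B * (\<Prod>j\<in>A'. norm (h j) powr \<gamma>)"
   have ys: "y(l := s) \<in> I \<rightarrow>\<^sub>E D" if "s \<in> D" for s using Suc(5) that A'(5) by (auto simp: PiE_iff extensional_def)
   have hs: "(y(l := s)) j + h j \<in> D" if "j \<in> A'" for j s using Suc(6)[of j] that A'(3,4) by auto
   define E where "E s = mdiff A' h (g \<alpha>) (y(l := s))" for s
   define E' where "E' i s = mdiff A' h (g (\<alpha>' i)) (y(l := s))" for i s
   have "nrm (%x. E (y l + h l) x - E (y l) x) <= K * Q * norm ((y l + h l) - y l) powr \<gamma>"
   proof (rule K(2)[where E'=E'])
    fix s assume s: "s \<in> D"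
    show "E s \<in> LP" unfolding E_def
     by (rule mdiff_Lp[OF Lp_derivs_continuous[OF g Suc(3)] A'(2) D_pts[OF ys[OF s]] Dcl[OF hs]])
    show "E' i s \<in> LP" for i unfolding E'_def
     by (rule mdiff_Lp[OF Lp_derivs_continuous[OF g \<alpha>'] A'(2) D_pts[OF ys[OF s]] Dcl[OF hs]])
    show "nrm (E' i s) <= Q" for i unfolding E'_def Q_def
     by (rule Suc.IH[OF ck' \<alpha>' A'(2) ys[OF s] hs])
    show "nrm (E s) <= Q" unfolding E_def Q_def
     by (rule Suc.IH[OF ck Suc(3) A'(2) ys[OF s] hs])
    show "((%t. nrm (%x. (E (s + t *\<^sub>R axis i 1) x - E s x) / t - E' i s x)) \<longlongrightarrow> 0) (at 0)" for i
     using mdiff_deriv[where y="y(l := s)", OF g A'(5) \<alpha>'[of i, unfolded \<alpha>'_def] A'(1,2,3) ys[OF s] hs]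
     by (simp add: E_def E'_def \<alpha>'_def)
   qed (use Suc(5,6) l A'(5) in auto)
   moreover have "mdiff A h (g \<alpha>) y = (%x. E (y l + h l) x - E (y l) x)"
    unfolding A'(4) E_def by (rule ext) (simp add: mdiff_insert[OF A'(1,3)])
   moreover have "K * Q * norm ((y l + h l) - y l) powr \<gamma> = K ^ Suc k * B * (\<Prod>l\<in>A. norm (h l) powr \<gamma>)"
    unfolding A'(4) using A'(1,3) by (simp add: Q_def mult_ac)
   ultimately show ?case by (simp only:)
  qed
  show ?thesis
  proof (rule mixed_holder_closure[OF I \<gamma>(1) Lp_derivs_continuous[OF g \<alpha>]])
   fix A y h assume A: "A \<subseteq> I" and y: "y \<in> I \<rightarrow>\<^sub>E D" and h: "!!l. l \<in> A ==> y l + h l \<in> D"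
   let ?k = "card {l \<in> A. mi_order (\<alpha> l) < n}"
   have "nrm (mdiff A h (g \<alpha>) y) <= K ^ ?k * B * (\<Prod>l\<in>A. norm (h l) powr \<gamma>)"
    by (rule claim[where k="?k" and \<alpha>=\<alpha> and A=A and y=y and h=h, OF refl \<alpha> A y h])
   also have "\<dots> <= K ^ card I * B * (\<Prod>l\<in>A. norm (h l) powr \<gamma>)"
   proof (intro mult_right_mono power_increasing B K(1))
    show "?k <= card I" using A by (intro card_mono I) auto
   qed (auto intro: prod_nonneg)
   finally show "nrm (mdiff A h (g \<alpha>) y) <= K ^ card I * B * (\<Prod>l\<in>A. norm (h l) powr \<gamma>)" .
  qed
 qed
 show ?thesis
 proof (rule that[of "K ^ card I"])
  fix B :: real and g and \<alpha> :: "nat => 'd => nat"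
  assume B: "0 <= B" and g: "Lp_derivs I n g" and b0: "!!\<alpha> y. \<alpha> \<in> mix_indices I n ==> y \<in> pts I ==> nrm (g \<alpha> y) <= B"
   and b1: "!!\<alpha> A y h. \<alpha> \<in> mix_indices I n ==> A \<subseteq> I ==> A ~= {} ==> (!!l. l \<in> A ==> mi_order (\<alpha> l) = n) ==> y \<in> pts I ==>
   (!!l. l \<in> A ==> y l + h l \<in> closure D) ==> (!!l. l \<in> A ==> h l ~= 0) ==>
   nrm (mdiff A h (g \<alpha>) y) <= B * (\<Prod>l\<in>A. norm (h l) powr \<gamma>)"
   and \<alpha>: "\<alpha> \<in> mix_indices I n" 
  show "mixed_holder I \<gamma> (K ^ card I * B) (g \<alpha>)" by (rule main[where B=B and g=g and \<alpha>=\<alpha>, OF B g b0 b1 \<alpha>])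
 qed (use K(1) in simp)
qed

end

subsection \<open>Sobolev-valued families\<close>

text \<open>Tychonoff's theorem; the coordinates outside I range over the single point
  undefined.\<close>

lemma compact_pts:
 assumes "compact (C :: 'a::t1_space set)"
 shows "compact (I \<rightarrow>\<^sub>E C)"
proof -
 have e: "(I \<rightarrow>\<^sub>E C) = Pi\<^sub>E UNIV (%i. if i \<in> I then C else {undefined})" 
  by (auto simp: PiE_iff extensional_def split: if_splits)
 have "compactin (product_topology (%_::'b. euclidean :: 'a topology) UNIV) (Pi\<^sub>E UNIV (%i. if i \<in> I then C else {undefined}))"
  unfolding compactin_PiE using assms by auto
 then show ?thesis unfolding e by (simp add: euclidean_product_topology)
qed

context Sobolev_domain
begin

lemma sobolev_comb2:
 assumes u: "u \<in> sobolev D m p" "v \<in> sobolev D m p" and \<beta>: "mi_order \<beta> <= m"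
 shows "nrm (%x. weak_deriv D p \<beta> u x - weak_deriv D p \<beta> v x) <= sobolev_norm D m p (%x. u x - v x)"
proof -
 let ?W = "weak_deriv D p \<beta>"
 define U where "U i = (if i = (0::nat) then u else v)" for i
 define c where "c i = (if i = (0::nat) then 1 else - 1 :: real)" for i
 have U: "U i \<in> sobolev D m p" if "i \<in> {0,1}" for i using u by (simp add: U_def)
 have e: "(%x. \<Sum>i\<in>{0,1}. c i * U i x) = (%x. u x - v x)" by (simp add: U_def c_def)
 have s: "(%x. u x - v x) \<in> sobolev D m p"
  using sobolev_linear_combination(1)[where S="{0,1}" and c=c and u=U, OF U] unfolding e .
 have "AE x in L. ?W (%x. u x - v x) x = (\<Sum>i\<in>{0,1}. c i * ?W (U i) x)"
  using sobolev_linear_combination(2)[where S="{0,1}" and c=c and u=U, OF U \<beta>] unfolding e .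
 then have "AE x in L. ?W u x - ?W v x = ?W (%x. u x - v x) x"
  by eventually_elim (simp add: U_def c_def)
 then have "nrm (%x. ?W u x - ?W v x) = nrm (?W (%x. u x - v x))"
  by (rule Lp_norm_cong_AE) (intro Lp_measurable Lp_diff weak_deriv_props(1)[OF _ \<beta>] u s)+
 then show ?thesis using Lp_norm_weak_deriv_le[OF \<beta>] by simp
qed

lemma sobolev_comb3:
 assumes u: "u \<in> sobolev D m p" "v \<in> sobolev D m p" "w \<in> sobolev D m p" and \<beta>: "mi_order \<beta> <= m"
 shows "nrm (%x. (weak_deriv D p \<beta> u x - weak_deriv D p \<beta> v x) / t - weak_deriv D p \<beta> w x)
  <= sobolev_norm D m p (%x. (u x - v x) / t - w x)"
proof -
 let ?W = "weak_deriv D p \<beta>"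
 define U where "U i = (if i = (0::nat) then u else if i = 1 then v else w)" for i
 define c where "c i = (if i = (0::nat) then 1 / t else if i = 1 then - 1 / t else - 1 :: real)" for i
 have U: "U i \<in> sobolev D m p" if "i \<in> {0,1,2}" for i using u by (simp add: U_def)
 have e': "(\<Sum>i\<in>{0,1,2}. c i * U i x) = (u x - v x) / t - w x" for x by (simp add: U_def c_def diff_divide_distrib)
 have e: "(%x. \<Sum>i\<in>{0,1,2}. c i * U i x) = (%x. (u x - v x) / t - w x)" by (simp only: e')
 have s: "(%x. (u x - v x) / t - w x) \<in> sobolev D m p"
  using sobolev_linear_combination(1)[where S="{0,1,2}" and c=c and u=U, OF U] unfolding e .
 have "AE x in L. ?W (%x. (u x - v x) / t - w x) x = (\<Sum>i\<in>{0,1,2}. c i * ?W (U i) x)"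
  using sobolev_linear_combination(2)[where S="{0,1,2}" and c=c and u=U, OF U \<beta>] unfolding e .
 then have ae: "AE x in L. (?W u x - ?W v x) / t - ?W w x = ?W (%x. (u x - v x) / t - w x) x"
  by eventually_elim (simp add: U_def c_def diff_divide_distrib)
 have "(%x. (1 / t) * (?W u x - ?W v x) - ?W w x) \<in> LP"
  by (intro Lp_diff Lp_scale weak_deriv_props(1)[OF _ \<beta>] u)
 then have m: "(%x. (?W u x - ?W v x) / t - ?W w x) \<in> LP" by simp
 have "nrm (%x. (?W u x - ?W v x) / t - ?W w x) = nrm (?W (%x. (u x - v x) / t - w x))"
  by (rule Lp_norm_cong_AE[OF ae Lp_measurable[OF m] Lp_measurable[OF weak_deriv_props(1)[OF s \<beta>]]])
 then show ?thesis using Lp_norm_weak_deriv_le[OF \<beta>] by simp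
qed

lemma shift_mem_PiE:
 assumes "y \<in> I \<rightarrow>\<^sub>E C" "l \<in> I" "s \<in> C"
 shows "y(l := s) \<in> I \<rightarrow>\<^sub>E C"
 using assms by (auto simp: PiE_iff extensional_def)

lemma mix_derivs_memD:
 assumes "mix_derivs D I n V N \<phi> g" "\<alpha> \<in> mix_indices I n" "y \<in> pts I"
 shows "g \<alpha> y \<in> V" "((%z. N (%x. g \<alpha> z x - g \<alpha> y x)) \<longlongrightarrow> 0) (at y within pts I)"
 using assms unfolding mix_derivs_def by blast+

lemma mix_derivs_derivD:
 assumes "mix_derivs D I n V N \<phi> g" "l \<in> I" "(mi_inc \<alpha> l i) \<in> mix_indices I n" "y \<in> I \<rightarrow>\<^sub>E D"
 shows "((%t. N (%x. (g \<alpha> (y(l := y l + t *\<^sub>R axis i 1)) x - g \<alpha> y x) / t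
            - g (mi_inc \<alpha> l i) y x)) \<longlongrightarrow> 0) (at 0)"
 using assms unfolding mix_derivs_def by blast

text \<open>A weak derivative of order at most m is dominated in L^p by the Sobolev norm, so it
  carries over limits of values and of difference quotients. This reduces a Sobolev-valued family to
  finitely many L^p-valued ones.\<close>

lemma mix_derivs_imp_Lp_derivs:
 assumes g: "mix_derivs D I n (sobolev D m p) (sobolev_norm D m p) \<phi> g" and I: "finite I" and \<beta>: "mi_order \<beta> <= m"
 shows "Lp_derivs I n (%\<alpha> y. weak_deriv D p \<beta> (g \<alpha> y))"
 unfolding Lp_derivs_def
proof (intro conjI ballI allI impI)
 fix \<alpha> :: "nat => 'd => nat" assume \<alpha>: "\<alpha> \<in> mix_indices I n"
 note gm = mix_derivs_memD[OF g \<alpha>]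
 show "Lp_continuous I (%y. weak_deriv D p \<beta> (g \<alpha> y))"
  unfolding Lp_continuous_iff_tendsto[OF I]
 proof (intro ballI conjI)
  fix y assume y: "y \<in> pts I"
  show "weak_deriv D p \<beta> (g \<alpha> y) \<in> LP" by (rule weak_deriv_props(1)[OF gm(1)[OF y] \<beta>])
  show "((%z. nrm (%x. weak_deriv D p \<beta> (g \<alpha> z) x - weak_deriv D p \<beta> (g \<alpha> y) x)) \<longlongrightarrow> 0) (at y within pts I)"
  proof (rule tendsto_sandwich[OF _ _ tendsto_const gm(2)[OF y]])
   show "\<forall>\<^sub>F z in at y within pts I. nrm (%x. weak_deriv D p \<beta> (g \<alpha> z) x - weak_deriv D p \<beta> (g \<alpha> y) x)
     <= sobolev_norm D m p (%x. g \<alpha> z x - g \<alpha> y x)"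
    unfolding eventually_at_topological
    by (rule exI[of _ UNIV]) (auto intro!: sobolev_comb2 gm y \<beta>)
  qed simp
 qed
next
 fix \<alpha> :: "nat => 'd => nat" and l i y assume l: "l \<in> I" and \<alpha>': "(mi_inc \<alpha> l i) \<in> mix_indices I n" and y: "y \<in> I \<rightarrow>\<^sub>E D"
 note \<alpha> = mix_indices_mono_upd[OF \<alpha>' l]
 have yl: "y l \<in> D" using y l by auto
 show "((%t. nrm (%x. (weak_deriv D p \<beta> (g \<alpha> (y(l := y l + t *\<^sub>R axis i 1))) x - weak_deriv D p \<beta> (g \<alpha> y) x) / t
            - weak_deriv D p \<beta> (g (mi_inc \<alpha> l i) y) x)) \<longlongrightarrow> 0) (at 0)"
 proof (rule tendsto_sandwich[OF _ _ tendsto_const mix_derivs_derivD[OF g l \<alpha>' y]])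
  show "\<forall>\<^sub>F t in at 0. nrm (%x. (weak_deriv D p \<beta> (g \<alpha> (y(l := y l + t *\<^sub>R axis i 1))) x - weak_deriv D p \<beta> (g \<alpha> y) x) / t
            - weak_deriv D p \<beta> (g (mi_inc \<alpha> l i) y) x)
   <= sobolev_norm D m p (%x. (g \<alpha> (y(l := y l + t *\<^sub>R axis i 1)) x - g \<alpha> y x) / t
            - g (mi_inc \<alpha> l i) y x)"
   using eventually_shift_mem[OF yl, of "axis i 1"]
  proof eventually_elim
   case (elim t)
   show ?case
    by (rule sobolev_comb3[OF mix_derivs_memD(1)[OF g \<alpha> D_pts[OF shift_mem_PiE[OF y l elim]]]
      mix_derivs_memD(1)[OF g \<alpha> D_pts[OF y]] mix_derivs_memD(1)[OF g \<alpha>' D_pts[OF y]] \<beta>])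
  qed
 qed simp
qed

text \<open>The product of copies of the closure is compact and the norm is continuous along the
  family. This is behind the finiteness of \<open>C_mix_norm\<close>.\<close>

lemma Lp_continuous_bounded:
 assumes I: "finite I" and f: "Lp_continuous I f"
 shows "\<exists>M. \<forall>y\<in>pts I. nrm (f y) <= M"
proof -
 have f': "f y \<in> LP" "((%z. nrm (%x. f z x - f y x)) \<longlongrightarrow> 0) (at y within pts I)" if "y \<in> pts I" for y
  using f that unfolding Lp_continuous_iff_tendsto[OF I] by blast+
 have "continuous_on (pts I) (%y. nrm (f y))"
  unfolding continuous_on_def
 proof
  fix y assume y: "y \<in> pts I"
  have "((%z. nrm (f z) - nrm (f y)) \<longlongrightarrow> 0) (at y within pts I)"
  proof (rule Lim_null_comparison[OF _ f'(2)[OF y]])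
   show "\<forall>\<^sub>F z in at y within pts I. norm (nrm (f z) - nrm (f y)) <= nrm (%x. f z x - f y x)"
    unfolding eventually_at_topological real_norm_def
    by (rule exI[of _ UNIV]) (auto intro!: Lp_norm_reverse_triangle f' y)
  qed
  then show "((%z. nrm (f z)) \<longlongrightarrow> nrm (f y)) (at y within pts I)" by (rule LIM_zero_cancel)
 qed
 then have "compact ((%y. nrm (f y)) ` pts I)"
  using bounded_D by (intro compact_continuous_image compact_pts) auto
 then have "bounded ((%y. nrm (f y)) ` pts I)" by (rule compact_imp_bounded)
 then show ?thesis unfolding bounded_iff by (auto simp: bounded_iff)
qed

lemma D_approx:
 assumes y: "y \<in> pts I" "l \<in> I" "y l \<in> D"
 obtains a where "!!k. a k \<in> I \<rightarrow>\<^sub>E D" "!!k. a k l = y l" "!!j. j \<in> I ==> (%k. a k j) \<longlonglongrightarrow> y j"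
proof -
 have "\<forall>s\<in>closure D. \<exists>b. (\<forall>n. b n \<in> D) & b \<longlonglongrightarrow> s" using closure_sequential by blast
 from bchoice[OF this] obtain b where b: "!!s. s \<in> closure D ==> (\<forall>n. b s n \<in> D) & b s \<longlonglongrightarrow> s" by blast
 have yc: "y j \<in> closure D" if "j \<in> I" for j using y(1) that by auto
 define a where "a k = (\<lambda>j\<in>I. if j = l then y l else b (y j) k)" for k
 show thesis
 proof (rule that)
  show "a k \<in> I \<rightarrow>\<^sub>E D" for k using b[OF yc] y(3) by (auto simp: a_def)
  show "a k l = y l" for k using y(2) by (simp add: a_def)
  show "(%k. a k j) \<longlonglongrightarrow> y j" if j: "j \<in> I" for j
   using b[OF yc[OF j]] j by (cases "j = l") (simp_all add: a_def)
 qed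
qed

text \<open>The mean value inequality holds at nearby points of the open product; it passes to the limit by continuity.\<close>

lemma Lp_derivs_boundary:
 assumes I: "finite I" and g: "Lp_derivs I n g" and l: "l \<in> I"
  and \<alpha>': "(mi_inc \<alpha> l i) \<in> mix_indices I n" and y: "y \<in> pts I" "y l \<in> D"
 shows "((%t. nrm (%x. (g \<alpha> (y(l := y l + t *\<^sub>R axis i 1)) x - g \<alpha> y x) / t
            - g (mi_inc \<alpha> l i) y x)) \<longlongrightarrow> 0) (at 0)"
proof (rule tendstoI)
 fix e0 :: real assume e0: "e0 > 0"
 define \<epsilon> where "\<epsilon> = e0 / 2"
 have \<epsilon>: "\<epsilon> > 0" "\<epsilon> < e0" using e0 by (simp_all add: \<epsilon>_def)
 let ?\<alpha>' = "mi_inc \<alpha> l i" and ?e = "axis i 1 :: real^'d"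
 note \<alpha> = mix_indices_mono_upd[OF \<alpha>' l]
 note c = Lp_derivs_continuous[OF g \<alpha>] and c' = Lp_derivs_continuous[OF g \<alpha>']
 obtain \<delta> where \<delta>: "\<delta> > 0" "!!z. z \<in> pts I ==> (\<forall>j\<in>I. dist (z j) (y j) < \<delta>) ==> nrm (%x. g ?\<alpha>' z x - g ?\<alpha>' y x) < \<epsilon>"
  using c' y(1) \<epsilon>(1) unfolding Lp_continuous_def by meson
 obtain r where r: "r > 0" "ball (y l) r \<subseteq> D" using open_D y(2) openE by blast
 \<comment> \<open>The l-th coordinate is kept exact, so the segment in y_l used at y is also
   available at every approximating point.\<close>
 obtain a where a: "!!k. a k \<in> I \<rightarrow>\<^sub>E D" "!!k. a k l = y l" "!!j. j \<in> I ==> (%k. a k j) \<longlonglongrightarrow> y j"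
  using D_approx[OF y(1) l y(2)] by metis
 have main: "nrm (%x. g \<alpha> (y(l := y l + t *\<^sub>R ?e)) x - g \<alpha> y x - t * g ?\<alpha>' y x) <= \<epsilon> * \<bar>t\<bar>" if t: "\<bar>t\<bar> < min r \<delta>" for t
 proof -
  have sD: "y l + \<tau> *\<^sub>R ?e \<in> D" if "\<bar>\<tau>\<bar> <= \<bar>t\<bar>" for \<tau>
   using r(2) that t by (auto simp: subset_iff dist_norm)
  define E where "E k \<tau> = g \<alpha> ((a k)(l := y l + \<tau> *\<^sub>R ?e))" for k \<tau>
  define E' where "E' k \<tau> = g ?\<alpha>' ((a k)(l := y l + \<tau> *\<^sub>R ?e))" for k \<tau>
  have aD: "(a k)(l := y l + \<tau> *\<^sub>R ?e) \<in> I \<rightarrow>\<^sub>E D" if "\<bar>\<tau>\<bar> <= \<bar>t\<bar>" for k \<tau>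
   by (rule shift_mem_PiE[OF a(1) l sD[OF that]])
  have ev: "\<forall>\<^sub>F k in sequentially. nrm (%x. E k t x - E k 0 x - t * g ?\<alpha>' y x) <= \<epsilon> * \<bar>t\<bar>"
  proof -
   have "\<forall>\<^sub>F k in sequentially. \<forall>j\<in>I. dist (a k j) (y j) < \<delta>"
    using I \<delta>(1) a(3) by (auto intro!: eventually_ball_finite tendstoD)
   then show ?thesis
   proof eventually_elim
    case (elim k)
    show ?case
    proof (rule Lp_mvt_abs[where E' = "E' k"])
     fix \<tau> assume \<tau>: "\<bar>\<tau>\<bar> <= \<bar>t\<bar>"
     show "E k \<tau> \<in> LP" unfolding E_def by (rule Lp_continuousD[OF c D_pts[OF aD[OF \<tau>]]])
     show "E' k \<tau> \<in> LP" unfolding E'_def by (rule Lp_continuousD[OF c' D_pts[OF aD[OF \<tau>]]])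
     have "\<forall>j\<in>I. dist (((a k)(l := y l + \<tau> *\<^sub>R ?e)) j) (y j) < \<delta>"
      using elim \<tau> t by (auto simp: dist_norm)
     then show "nrm (%x. E' k \<tau> x - g ?\<alpha>' y x) <= \<epsilon>"
      unfolding E'_def using \<delta>(2)[OF D_pts[OF aD[OF \<tau>]]] by (simp add: less_imp_le)
     show "((%h. nrm (%x. (E k (\<tau> + h) x - E k \<tau> x) / h - E' k \<tau> x)) \<longlongrightarrow> 0) (at 0)"
      using Lp_derivsD[OF g l \<alpha>' aD[OF \<tau>], of k] by (simp add: E_def E'_def scaleR_left_distrib add.assoc)
    qed (rule Lp_continuousD[OF c' y(1)])
   qed
  qed
  have lim: "(%k. nrm (%x. E k \<tau> x - g \<alpha> (y(l := y l + \<tau> *\<^sub>R ?e)) x)) \<longlonglongrightarrow> 0" if \<tau>: "\<bar>\<tau>\<bar> <= \<bar>t\<bar>" for \<tau>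
   unfolding E_def
  proof (rule Lp_continuous_LIMSEQ[OF I c shift_mem_PiE[OF y(1) l Dcl[OF sD[OF \<tau>]]] D_pts[OF aD[OF \<tau>]]])
   show "(%k. ((a k)(l := y l + \<tau> *\<^sub>R ?e)) j) \<longlonglongrightarrow> (y(l := y l + \<tau> *\<^sub>R ?e)) j" if "j \<in> I" for j
    using a(3)[OF that] by simp
  qed
  let ?G = "%\<tau>. g \<alpha> (y(l := y l + \<tau> *\<^sub>R ?e))"
  have ev': "\<forall>\<^sub>F k in sequentially. nrm (%x. ?G t x - ?G 0 x - t * g ?\<alpha>' y x)
    <= \<epsilon> * \<bar>t\<bar> + nrm (%x. E k t x - ?G t x) + nrm (%x. E k 0 x - ?G 0 x)"
   using ev
  proof eventually_elim
   case (elim k)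
   have m: "E k \<tau> \<in> LP" "?G \<tau> \<in> LP" if \<tau>: "\<bar>\<tau>\<bar> <= \<bar>t\<bar>" for \<tau>
    unfolding E_def by (intro Lp_continuousD[OF c] D_pts[OF aD[OF \<tau>]] shift_mem_PiE[OF y(1) l Dcl[OF sD[OF \<tau>]]])+
   have mt: "E k t \<in> LP" "?G t \<in> LP" and m0: "E k 0 \<in> LP" "?G 0 \<in> LP" by (intro m; simp)+
   note mc = Lp_scale[OF Lp_continuousD[OF c' y(1)], of t]
   have "nrm (%x. (?G t x - ?G 0 x - t * g ?\<alpha>' y x)) <= nrm (%x. E k t x - E k 0 x - t * g ?\<alpha>' y x)
     + nrm (%x. (?G t x - ?G 0 x - t * g ?\<alpha>' y x) - (E k t x - E k 0 x - t * g ?\<alpha>' y x))"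
    by (rule Lp_norm_le_add_diff[OF Lp_diff[OF Lp_diff[OF mt(2) m0(2)] mc] Lp_diff[OF Lp_diff[OF mt(1) m0(1)] mc]])
   also have "(%x. (?G t x - ?G 0 x - t * g ?\<alpha>' y x) - (E k t x - E k 0 x - t * g ?\<alpha>' y x))
     = (%x. (E k 0 x - ?G 0 x) - (E k t x - ?G t x))" by auto
   also have "nrm \<dots> <= nrm (%x. E k 0 x - ?G 0 x) + nrm (%x. E k t x - ?G t x)"
    by (rule Lp_norm_triangle_diff[OF Lp_diff[OF m0] Lp_diff[OF mt]])
   finally show ?case using elim by linarith
  qed
  have "(%k. \<epsilon> * \<bar>t\<bar> + nrm (%x. E k t x - ?G t x) + nrm (%x. E k 0 x - ?G 0 x)) \<longlonglongrightarrow> \<epsilon> * \<bar>t\<bar> + 0 + 0"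
   by (intro tendsto_add tendsto_const lim) auto
  from tendsto_lowerbound[OF this ev'] show ?thesis by simp
 qed
 have "\<forall>\<^sub>F t in at (0::real). \<bar>t\<bar> < min r \<delta> & t ~= 0"
  unfolding eventually_at by (rule exI[of _ "min r \<delta>"]) (use r(1) \<delta>(1) in auto)
 then show "\<forall>\<^sub>F t in at 0. dist (nrm (%x. (g \<alpha> (y(l := y l + t *\<^sub>R ?e)) x - g \<alpha> y x) / t - g ?\<alpha>' y x)) 0 < e0"
 proof eventually_elim
  case (elim t)
  have "(%x. (g \<alpha> (y(l := y l + t *\<^sub>R ?e)) x - g \<alpha> y x) / t - g ?\<alpha>' y x)
   = (%x. (1 / t) * (g \<alpha> (y(l := y l + t *\<^sub>R ?e)) x - g \<alpha> y x - t * g ?\<alpha>' y x))"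
   using elim by (auto simp: field_simps)
  moreover have "\<bar>1 / t\<bar> * nrm (%x. g \<alpha> (y(l := y l + t *\<^sub>R ?e)) x - g \<alpha> y x - t * g ?\<alpha>' y x) <= \<bar>1 / t\<bar> * (\<epsilon> * \<bar>t\<bar>)"
   using main elim by (intro mult_left_mono) auto
  moreover have "\<bar>1 / t\<bar> * (\<epsilon> * \<bar>t\<bar>) = \<epsilon>" using elim by simp
  ultimately have "nrm (%x. (g \<alpha> (y(l := y l + t *\<^sub>R ?e)) x - g \<alpha> y x) / t - g ?\<alpha>' y x) <= \<epsilon>"
   by (simp only: Lp_norm_scale)
  then show ?case using \<epsilon> by simp
 qed
qed

text \<open>The selection in \<open>mix_partial\<close> may differ from an explicit family, and this
  lemma transfers estimates between the two. Induction on the total order: in the open product two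
  candidates are limits of a.e. equal quotients, and continuity settles the boundary.\<close>

lemma Lp_derivs_unique:
 assumes I: "finite I" and g: "Lp_derivs I n g" and g': "Lp_derivs I n g'"
  and eq: "!!y. y \<in> pts I ==> AE x in L. g (%_ _. 0) y x = g' (%_ _. 0) y x"
  and \<alpha>: "\<alpha> \<in> mix_indices I n" and y: "y \<in> pts I"
 shows "AE x in L. g \<alpha> y x = g' \<alpha> y x"
 using \<alpha> y
proof (induction "\<Sum>l\<in>I. mi_order (\<alpha> l)" arbitrary: \<alpha> y)
 case (0 \<alpha> y)
 have "\<forall>l\<in>I. mi_order (\<alpha> l) = 0" using 0(1) I by (simp add: sum_eq_0_iff)
 then have "\<alpha> l = (%_. 0)" for l using 0(2) by (cases "l \<in> I") (auto simp: mix_indices_def mi_order_eq_0_iff)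
 then have "\<alpha> = (%_ _. 0)" by auto
 then show ?case using eq[OF 0(3)] by simp
next
 case (Suc N \<alpha> y)
 have "\<exists>l\<in>I. mi_order (\<alpha> l) ~= 0"
 proof (rule ccontr)
  assume "\<not> ?thesis"
  then have "(\<Sum>l\<in>I. mi_order (\<alpha> l)) = 0" by simp
  then show False using Suc(2) by simp
 qed
 then obtain l where l: "l \<in> I" "mi_order (\<alpha> l) ~= 0" by blast
 then have "\<exists>i. \<alpha> l i ~= 0" by (auto simp: mi_order_def)
 then obtain i where i: "\<alpha> l i ~= 0" by blast
 define \<alpha>0 where "\<alpha>0 = \<alpha>(l := (\<alpha> l)(i := \<alpha> l i - 1))"
 have \<alpha>e: "(mi_inc \<alpha>0 l i) = \<alpha>" using i by (auto simp: \<alpha>0_def fun_eq_iff)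
 note \<alpha>' = Suc(3)[folded \<alpha>e]
 note \<alpha>0 = mix_indices_mono_upd[OF \<alpha>' l(1)]
 have o: "mi_order (\<alpha> l) = Suc (mi_order (\<alpha>0 l))"
 proof -
  have "mi_order ((\<alpha>0 l)(i := Suc (\<alpha>0 l i))) = Suc (mi_order (\<alpha>0 l))" by simp
  moreover have "(\<alpha>0 l)(i := Suc (\<alpha>0 l i)) = \<alpha> l" using i by (auto simp: \<alpha>0_def fun_eq_iff)
  ultimately show ?thesis by simp
 qed
 have "(\<Sum>l\<in>I. mi_order (\<alpha> l)) = mi_order (\<alpha> l) + (\<Sum>j\<in>I - {l}. mi_order (\<alpha> j))" by (rule sum.remove[OF I l(1)])
 moreover have "(\<Sum>l\<in>I. mi_order (\<alpha>0 l)) = mi_order (\<alpha>0 l) + (\<Sum>j\<in>I - {l}. mi_order (\<alpha>0 j))" by (rule sum.remove[OF I l(1)])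
 moreover have "(\<Sum>j\<in>I - {l}. mi_order (\<alpha>0 j)) = (\<Sum>j\<in>I - {l}. mi_order (\<alpha> j))" by (rule sum.cong) (auto simp: \<alpha>0_def)
 ultimately have N: "N = (\<Sum>l\<in>I. mi_order (\<alpha>0 l))" using Suc(2) o by simp
 note IH = Suc(1)[OF N \<alpha>0]
 note ga = Lp_derivs_continuous[OF g Suc(3)] and ga' = Lp_derivs_continuous[OF g' Suc(3)]
 have inner: "nrm (%x. g \<alpha> y x - g' \<alpha> y x) = 0" if yD: "y \<in> I \<rightarrow>\<^sub>E D" for y
 proof -
  have yl: "y l \<in> D" using yD l by auto
  let ?s = "%t. y(l := y l + t *\<^sub>R axis i 1)"
  let ?q = "%g t x. (g \<alpha>0 (?s t) x - g \<alpha>0 y x) / t - g \<alpha> y x"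
  have lim: "((%t. nrm (?q g t)) \<longlongrightarrow> 0) (at 0)" "((%t. nrm (?q g' t)) \<longlongrightarrow> 0) (at 0)"
   using Lp_derivsD[OF g l(1) \<alpha>' yD] Lp_derivsD[OF g' l(1) \<alpha>' yD] unfolding \<alpha>e .
  have "((%t. nrm (?q g' t) + nrm (?q g t)) \<longlongrightarrow> 0) (at 0)"
   using tendsto_add[OF lim(2,1)] by simp
  moreover have "\<forall>\<^sub>F t in at 0. nrm (%x. g \<alpha> y x - g' \<alpha> y x) <= nrm (?q g' t) + nrm (?q g t)"
   using eventually_shift_mem[OF yl, of "axis i 1"]
  proof eventually_elim
   case (elim t)
   note st = D_pts[OF shift_mem_PiE[OF yD l(1) elim]]
   have m: "?q h t \<in> LP" if "Lp_derivs I n h" for h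
   proof -
    have "(%x. (1 / t) * (h \<alpha>0 (?s t) x - h \<alpha>0 y x) - h \<alpha> y x) \<in> LP"
     by (intro Lp_diff Lp_scale Lp_continuousD[OF Lp_derivs_continuous[OF that]] \<alpha>0 Suc(3) st D_pts[OF yD])
    then show ?thesis by simp
   qed
   have ae: "AE x in L. g \<alpha> y x - g' \<alpha> y x = ?q g' t x - ?q g t x"
    using IH[OF st] IH[OF D_pts[OF yD]] by eventually_elim simp
   have "nrm (%x. g \<alpha> y x - g' \<alpha> y x) = nrm (%x. ?q g' t x - ?q g t x)"
    by (rule Lp_norm_cong_AE[OF ae])
     (intro Lp_measurable Lp_diff[OF m[OF g'] m[OF g]] Lp_diff[OF Lp_continuousD[OF ga] Lp_continuousD[OF ga']] D_pts[OF yD])+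
   also have "\<dots> <= nrm (?q g' t) + nrm (?q g t)" by (rule Lp_norm_triangle_diff[OF m[OF g'] m[OF g]])
   finally show ?case .
  qed
  ultimately have "nrm (%x. g \<alpha> y x - g' \<alpha> y x) <= 0" by (rule tendsto_lowerbound) simp
  then show ?thesis by (simp add: antisym)
 qed
 have u: "Lp_continuous I (%y x. g \<alpha> y x - g' \<alpha> y x)" by (rule Lp_continuous_diff[OF ga ga'])
 have "\<forall>s\<in>closure D. \<exists>b. (\<forall>n. b n \<in> D) & b \<longlonglongrightarrow> s" using closure_sequential by blast
 from bchoice[OF this] obtain b where b: "!!s. s \<in> closure D ==> (\<forall>n. b s n \<in> D) & b s \<longlonglongrightarrow> s" by blast
 define a where "a k = (\<lambda>j\<in>I. b (y j) k)" for k
 have aD: "a k \<in> I \<rightarrow>\<^sub>E D" for k using b Suc(4) by (auto simp: a_def PiE_iff)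
 have "(%k. nrm (%x. (g \<alpha> (a k) x - g' \<alpha> (a k) x) - (g \<alpha> y x - g' \<alpha> y x))) \<longlonglongrightarrow> 0"
 proof (rule Lp_continuous_LIMSEQ[OF I u Suc(4) D_pts[OF aD]])
  show "(%k. a k j) \<longlonglongrightarrow> y j" if "j \<in> I" for j using b[of "y j"] Suc(4) that by (auto simp: a_def)
 qed
 moreover have "nrm (%x. g \<alpha> y x - g' \<alpha> y x) <= nrm (%x. (g \<alpha> (a k) x - g' \<alpha> (a k) x) - (g \<alpha> y x - g' \<alpha> y x))" for k
  using Lp_norm_le_add_diff[OF Lp_continuousD[OF u Suc(4)] Lp_continuousD[OF u D_pts[OF aD[of k]]]] inner[OF aD]
   Lp_norm_minus_commute[of "%x. g \<alpha> y x - g' \<alpha> y x" "%x. g \<alpha> (a k) x - g' \<alpha> (a k) x"] by simp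
 ultimately have "nrm (%x. g \<alpha> y x - g' \<alpha> y x) <= 0" by (intro LIMSEQ_le_const) auto
 then have "nrm (%x. g \<alpha> y x - g' \<alpha> y x) = 0" by (simp add: antisym)
 then have "AE x in L. g \<alpha> y x - g' \<alpha> y x = 0" using Lp_norm_eq_0_iff[OF Lp_continuousD[OF u Suc(4)]] by simp
 then show ?case by eventually_elim simp
qed

end

subsection \<open>Traces of linear combinations\<close>

text \<open>Derivatives \<delta> in the traced variables J joined with derivatives \<alpha> in the
  remaining ones; the counterpart of \<open>merge\<close> for multi-indices.\<close>

definition mcomb :: "nat set => (nat => 'd => nat) => (nat => 'd => nat) => nat => 'd => nat" where
 "mcomb J \<delta> \<alpha> l = (if l \<in> J then \<delta> l else \<alpha> l)"

lemma mcomb_mix_indices: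
 assumes "\<delta> \<in> mix_indices J m" "\<alpha> \<in> mix_indices J' n" "m <= n"
 shows "mcomb J \<delta> \<alpha> \<in> mix_indices (J \<union> J') n"
 using assms by (auto simp: mcomb_def mix_indices_def)

lemma mcomb_upd: "l \<in> J ==> mcomb J (\<delta>(l := v)) \<alpha> = (mcomb J \<delta> \<alpha>)(l := v)"
 by (auto simp: mcomb_def fun_eq_iff)

lemma mcomb_upd': "l \<notin> J ==> mcomb J \<delta> (\<alpha>(l := v)) = (mcomb J \<delta> \<alpha>)(l := v)"
 by (auto simp: mcomb_def fun_eq_iff)

lemma mcomb_same: "l \<in> J ==> mcomb J \<delta> \<alpha> l = \<delta> l"
 by (simp add: mcomb_def)

lemma mcomb_other: "l \<notin> J ==> mcomb J \<delta> \<alpha> l = \<alpha> l"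
 by (simp add: mcomb_def)

lemma mcomb_0: "\<alpha> \<in> mix_indices J' n ==> J \<inter> J' = {} ==> mcomb J (%_ _. 0) \<alpha> = \<alpha>"
 by (auto simp: mcomb_def mix_indices_def fun_eq_iff)

lemma merge_PiE:
 assumes "z \<in> J \<rightarrow>\<^sub>E C" "y \<in> J' \<rightarrow>\<^sub>E C"
 shows "merge J J' (z, y) \<in> (J \<union> J') \<rightarrow>\<^sub>E C"
 using assms by (auto simp: merge_def PiE_iff extensional_def)

lemma merge_upd_left: "l \<in> J ==> merge J J' (z(l := s), y) = (merge J J' (z, y))(l := s)"
 by (auto simp: merge_def fun_eq_iff)

lemma merge_upd_right: "l \<in> J' ==> J \<inter> J' = {} ==> merge J J' (z, y(l := s)) = (merge J J' (z, y))(l := s)"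
 by (auto simp: merge_def fun_eq_iff)

lemma merge_left: "l \<in> J ==> merge J J' (z, y) l = z l"
 by (simp add: merge_def)

lemma merge_right: "l \<in> J' ==> J \<inter> J' = {} ==> merge J J' (z, y) l = y l"
 by (auto simp: merge_def)

lemma merge_const_restrict: "merge J J' ((\<lambda>l\<in>J. x), y) = merge J J' ((%_. x), y)"
 by (auto simp: merge_def fun_eq_iff)

lemma continuous_on_merge:
 fixes y :: "nat => 'a::topological_space"
 shows "continuous_on S (%z. merge J J' (z, y))"
proof (rule continuous_on_coordinatewise_then_product)
 fix i
 have c: "continuous_on S (%z. z i)" for S :: "(nat => 'a) set" by (rule continuous_on_subset[OF continuous_on_product_coordinates]) simp
 show "continuous_on S (%z. merge J J' (z, y) i)"
  using c by (cases "i \<in> J"; cases "i \<in> J'") (simp_all add: merge_def)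
qed

context Sobolev_domain
begin

text \<open>The member \<open>F \<beta> \<alpha>\<close> stands for the derivative of order \<beta>
  in x and \<alpha> in y; the order in x is at most m, the order in each y_l at most n.\<close>

definition sob_family :: "nat set => nat => nat =>
  (('d => nat) => (nat => 'd => nat) => (nat => real^'d) => real^'d => real) => bool" where
 "sob_family I m n F \<longleftrightarrow> (\<forall>\<beta>. mi_order \<beta> <= m --> Lp_derivs I n (F \<beta>) \<and>
   (\<forall>i. Suc (mi_order \<beta>) <= m --> (\<forall>\<alpha>\<in>mix_indices I n. \<forall>y\<in>pts I.
    has_weak_deriv D ((%_. 0)(i := 1)) (F \<beta> \<alpha> y) (F (\<beta>(i := Suc (\<beta> i))) \<alpha> y))))"

lemma mix_derivs_sob_family:
 assumes g: "mix_derivs D I n (sobolev D m p) (sobolev_norm D m p) \<phi> g" and I: "finite I"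
 shows "sob_family I m n (%\<beta> \<alpha> y. weak_deriv D p \<beta> (g \<alpha> y))"
 unfolding sob_family_def
 by (intro allI impI conjI ballI mix_derivs_imp_Lp_derivs[OF g I] weak_deriv_Suc[where m=m] mix_derivs_memD(1)[OF g])

text \<open>Makes the conclusion of \<open>diag_sobolev_bound\<close> a property of K, so that one
  constant can be fixed and handed on before the families are chosen.\<close>

definition diag_const :: "nat set => nat => real => real => bool" where
 "diag_const I m \<gamma> K \<longleftrightarrow> 0 <= K & (\<forall>B f \<psi>. 0 <= B --> trace_data I m \<gamma> B f --> cont_rep I (f (%_. 0) (%_ _. 0)) \<psi> -->
  (%x. \<psi> (\<lambda>l\<in>I. x) x) \<in> sobolev D m p & sobolev_norm D m p (%x. \<psi> (\<lambda>l\<in>I. x) x) <= K * B)"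

lemma diag_const_exists:
 assumes \<gamma>: "0 < \<gamma>" "2 * real CARD('d) / \<gamma> < p" and I: "finite I"
 shows "\<exists>K. diag_const I m \<gamma> K"
proof (rule diag_sobolev_bound[OF \<gamma> I])
 fix K :: real assume K: "0 <= K" "!!B f \<psi>. 0 <= B ==> trace_data I m \<gamma> B f ==> cont_rep I (f (%_. 0) (%_ _. 0)) \<psi> ==>
  (%x. \<psi> (\<lambda>l\<in>I. x) x) \<in> sobolev D m p & sobolev_norm D m p (%x. \<psi> (\<lambda>l\<in>I. x) x) <= K * B"
 have "diag_const I m \<gamma> K" unfolding diag_const_def
  by (intro conjI K(1) allI impI) (frule (2) K(2), simp)+
 then show ?thesis ..
qed

text \<open>A combination of traces with coefficients c r, derivatives \<alpha> r and points y r in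
  the remaining variables is again the diagonal of a family in the traced variables, whose members
  combine the mixed derivatives with the same coefficients. If this family is bounded by E and has
  Hoelder constant E in each traced variable, the combination is bounded by K E. Values, mixed
  differences and difference quotients of the trace are all instances.\<close>

lemma trace_combination:
 assumes K: "diag_const I' m \<gamma> K" and fin: "finite I'" "finite I''" and dj: "I' \<inter> I'' = {}" and mn: "m <= n"
  and F: "sob_family (I' \<union> I'') m n F" and R: "finite R"
  and \<alpha>: "!!r. r \<in> R ==> \<alpha> r \<in> mix_indices I'' n" and y: "!!r. r \<in> R ==> y r \<in> pts I''"
  and \<Psi>: "!!r. r \<in> R ==> cont_rep (I' \<union> I'') (F (%_. 0) (\<alpha> r)) (\<Psi> (\<alpha> r))"
  and E: "0 <= E"
  and b1: "!!\<beta> \<delta> z. mi_order \<beta> <= m ==> \<delta> \<in> mix_indices I' m ==> z \<in> pts I' ==>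
   nrm (%x. \<Sum>r\<in>R. c r * F \<beta> (mcomb I' \<delta> (\<alpha> r)) (merge I' I'' (z, y r)) x) <= E"
  and b2: "!!\<beta> \<delta> z l s. mi_order \<beta> <= m ==> \<delta> \<in> mix_indices I' m ==> z \<in> pts I' ==> l \<in> I' ==> s \<in> closure D ==>
   nrm (%x. (\<Sum>r\<in>R. c r * F \<beta> (mcomb I' \<delta> (\<alpha> r)) (merge I' I'' (z(l := s), y r)) x)
    - (\<Sum>r\<in>R. c r * F \<beta> (mcomb I' \<delta> (\<alpha> r)) (merge I' I'' (z, y r)) x)) <= E * norm (s - z l) powr \<gamma>"
 shows "(%x. \<Sum>r\<in>R. c r * \<Psi> (\<alpha> r) (merge I' I'' ((%_. x), y r)) x) \<in> sobolev D m p \<and>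
  sobolev_norm D m p (%x. \<Sum>r\<in>R. c r * \<Psi> (\<alpha> r) (merge I' I'' ((%_. x), y r)) x) <= K * E"
proof -
 let ?I = "I' \<union> I''"
 have finI: "finite ?I" using fin by simp
 define f where "f \<beta> \<delta> z x = (\<Sum>r\<in>R. c r * F \<beta> (mcomb I' \<delta> (\<alpha> r)) (merge I' I'' (z, y r)) x)" for \<beta> \<delta> z x
 define \<psi> where "\<psi> z x = (\<Sum>r\<in>R. c r * \<Psi> (\<alpha> r) (merge I' I'' (z, y r)) x)" for z x
 have FL: "Lp_derivs ?I n (F \<beta>)" if "mi_order \<beta> <= m" for \<beta> using F that unfolding sob_family_def by blast
 have mix: "mcomb I' \<delta> (\<alpha> r) \<in> mix_indices ?I n" if "\<delta> \<in> mix_indices I' m" "r \<in> R" for \<delta> r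
  by (rule mcomb_mix_indices[OF that(1) \<alpha>[OF that(2)] mn])
 have mp: "merge I' I'' (z, y r) \<in> pts ?I" if "z \<in> pts I'" "r \<in> R" for z r by (rule merge_PiE[OF that(1) y[OF that(2)]])
 have FLp: "F \<beta> (mcomb I' \<delta> (\<alpha> r)) (merge I' I'' (z, y r)) \<in> LP"
  if "mi_order \<beta> <= m" "\<delta> \<in> mix_indices I' m" "z \<in> pts I'" "r \<in> R" for \<beta> \<delta> z r
  by (rule Lp_continuousD[OF Lp_derivs_continuous[OF FL[OF that(1)] mix[OF that(2,4)]] mp[OF that(3,4)]])
 have fLp: "f \<beta> \<delta> z \<in> LP" if "mi_order \<beta> <= m" "\<delta> \<in> mix_indices I' m" "z \<in> pts I'" for \<beta> \<delta> z
  unfolding f_def[abs_def] by (intro Lp_sum Lp_scale FLp that)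
 have "trace_data I' m \<gamma> E f"
  unfolding trace_data_def
 proof (intro allI impI conjI ballI)
  fix \<beta> :: "'d => nat" and \<delta> :: "nat => 'd => nat" assume \<beta>: "mi_order \<beta> <= m" and \<delta>: "\<delta> \<in> mix_indices I' m"
  fix z assume z: "z \<in> pts I'"
  show "f \<beta> \<delta> z \<in> LP" by (rule fLp[OF \<beta> \<delta> z])
  show "nrm (f \<beta> \<delta> z) <= E" using b1[OF \<beta> \<delta> z] by (simp add: f_def[abs_def])
  fix l s assume l: "l \<in> I'" and s: "s \<in> closure D"
  show "nrm (%x. f \<beta> \<delta> (z(l := s)) x - f \<beta> \<delta> z x) <= E * norm (s - z l) powr \<gamma>"
   using b2[OF \<beta> \<delta> z l s] by (simp only: f_def)
 next
  fix \<beta> :: "'d => nat" and \<delta> :: "nat => 'd => nat" assume \<beta>: "mi_order \<beta> <= m" and \<delta>: "\<delta> \<in> mix_indices I' m"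
  fix i z assume \<beta>': "Suc (mi_order \<beta>) <= m" and z: "z \<in> pts I'"
  have o: "mi_order (\<beta>(i := Suc (\<beta> i))) <= m" using \<beta>' by simp
  show "has_weak_deriv D ((%_. 0)(i := 1)) (f \<beta> \<delta> z) (f (\<beta>(i := Suc (\<beta> i))) \<delta> z)"
   unfolding f_def[abs_def]
  proof (intro has_weak_deriv_sum Lp_scale FLp[OF \<beta> \<delta> z] FLp[OF o \<delta> z] has_weak_deriv_scale)
   fix r assume r: "r \<in> R"
   show "has_weak_deriv D ((%_. 0)(i := 1)) (%x. F \<beta> (mcomb I' \<delta> (\<alpha> r)) (merge I' I'' (z, y r)) x)
     (%x. F (\<beta>(i := Suc (\<beta> i))) (mcomb I' \<delta> (\<alpha> r)) (merge I' I'' (z, y r)) x)"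
    using F \<beta> \<beta>' mix[OF \<delta> r] mp[OF z r] unfolding sob_family_def by blast
  qed
 next
  fix \<beta> :: "'d => nat" and \<delta> :: "nat => 'd => nat" assume \<beta>: "mi_order \<beta> <= m" and \<delta>: "\<delta> \<in> mix_indices I' m"
  fix l i z assume l: "l \<in> I'" and \<delta>': "(mi_inc \<delta> l i) \<in> mix_indices I' m" and z: "z \<in> I' \<rightarrow>\<^sub>E D"
  let ?\<delta>' = "mi_inc \<delta> l i" and ?e = "axis i 1 :: real^'d"
  define w where "w r = merge I' I'' (z, y r)" for r
  define A where "A r = mcomb I' \<delta> (\<alpha> r)" for r
  define A' where "A' r = (A r)(l := ((A r) l)(i := Suc ((A r) l i)))" for r
  have A': "A' r = mcomb I' ?\<delta>' (\<alpha> r)" for r unfolding A'_def A_def mcomb_upd[OF l] mcomb_same[OF l] ..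
  have wl: "w r l = z l" for r unfolding w_def by (rule merge_left[OF l])
  have zl: "z l \<in> D" using z l by auto
  define q where "q r t x = (F \<beta> (A r) ((w r)(l := w r l + t *\<^sub>R ?e)) x - F \<beta> (A r) (w r) x) / t - F \<beta> (A' r) (w r) x" for r t x
  have mw: "merge I' I'' (z(l := z l + t *\<^sub>R ?e), y r) = (w r)(l := w r l + t *\<^sub>R ?e)" for t r
   unfolding merge_upd_left[OF l] wl unfolding w_def ..
  have eq: "(f \<beta> \<delta> (z(l := z l + t *\<^sub>R ?e)) x - f \<beta> \<delta> z x) / t - f \<beta> ?\<delta>' z x = (\<Sum>r\<in>R. c r * q r t x)" for t x
   unfolding f_def mw A'[symmetric] w_def[symmetric] A_def[symmetric] q_def
   by (simp add: sum_subtractf right_diff_distrib sum_divide_distrib diff_divide_distrib)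
  have lim: "((%t. nrm (q r t)) \<longlongrightarrow> 0) (at 0)" if r: "r \<in> R" for r
   unfolding q_def[abs_def] A'_def
  \<comment> \<open>The remaining variables y r may lie on the boundary, whereas the differentiated
    variable is a traced one and lies in D.\<close>
  proof (rule Lp_derivs_boundary[OF finI FL[OF \<beta>]])
   show "l \<in> ?I" using l by simp
   show "(A r)(l := ((A r) l)(i := Suc (A r l i))) \<in> mix_indices ?I n"
    using mix[OF \<delta>' r] unfolding A'[symmetric] A'_def .
   show "w r \<in> pts ?I" unfolding w_def by (rule mp[OF D_pts[OF z] r])
   show "w r l \<in> D" using wl zl by simp
  qed
  show "((%t. nrm (%x. (f \<beta> \<delta> (z(l := z l + t *\<^sub>R ?e)) x - f \<beta> \<delta> z x) / t - f \<beta> ?\<delta>' z x)) \<longlongrightarrow> 0) (at 0)"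
   unfolding eq
  proof (rule tendsto_sandwich[OF _ _ tendsto_const])
   have "((%t. \<Sum>r\<in>R. \<bar>c r\<bar> * nrm (q r t)) \<longlongrightarrow> (\<Sum>r\<in>R. \<bar>c r\<bar> * 0)) (at 0)"
    by (intro tendsto_sum tendsto_mult_left lim)
   then show "((%t. \<Sum>r\<in>R. \<bar>c r\<bar> * nrm (q r t)) \<longlongrightarrow> 0) (at 0)" by simp
   show "\<forall>\<^sub>F t in at 0. nrm (%x. \<Sum>r\<in>R. c r * q r t x) <= (\<Sum>r\<in>R. \<bar>c r\<bar> * nrm (q r t))"
    using eventually_shift_mem[OF zl, of ?e]
   proof eventually_elim
    case (elim t)
    have qL: "q r t \<in> LP" if r: "r \<in> R" for r
    proof -
     note zt = D_pts[OF shift_mem_PiE[OF z l elim]]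
     have "(%x. (1 / t) * (F \<beta> (mcomb I' \<delta> (\<alpha> r)) (merge I' I'' (z(l := z l + t *\<^sub>R ?e), y r)) x - F \<beta> (mcomb I' \<delta> (\<alpha> r)) (merge I' I'' (z, y r)) x)
       - F \<beta> (mcomb I' ?\<delta>' (\<alpha> r)) (merge I' I'' (z, y r)) x) \<in> LP"
      by (intro Lp_diff Lp_scale FLp \<beta> \<delta> \<delta>' zt D_pts[OF z] r)
     then show ?thesis
      unfolding mw A'[symmetric] w_def[symmetric] A_def[symmetric] by (simp add: q_def[abs_def])
    qed
    have "nrm (%x. \<Sum>r\<in>R. c r * q r t x) <= (\<Sum>r\<in>R. nrm (%x. c r * q r t x))"
     by (intro Lp_norm_sum Lp_scale qL)
    then show ?case by (simp add: Lp_norm_scale)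
   qed
  qed simp
 qed
 moreover have "cont_rep I' (f (%_. 0) (%_ _. 0)) \<psi>"
  unfolding cont_rep_def
 proof (intro conjI ballI)
  fix z assume z: "z \<in> pts I'"
  have "AE x in L. \<forall>r\<in>R. \<Psi> (\<alpha> r) (merge I' I'' (z, y r)) x = F (%_. 0) (\<alpha> r) (merge I' I'' (z, y r)) x"
  proof (rule AE_finite_allI[OF R])
   fix r assume r: "r \<in> R"
   show "AE x in L. \<Psi> (\<alpha> r) (merge I' I'' (z, y r)) x = F (%_. 0) (\<alpha> r) (merge I' I'' (z, y r)) x"
    using \<Psi>[OF r] mp[OF z r] unfolding cont_rep_def by blast
  qed
  then show "AE x in L. \<psi> z x = f (%_. 0) (%_ _. 0) z x"
   by eventually_elim (simp add: \<psi>_def f_def mcomb_0[OF \<alpha> dj])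
 next
  have "AE x in L. \<forall>r\<in>R. continuous_on (pts ?I) (%w. \<Psi> (\<alpha> r) w x)"
  proof (rule AE_finite_allI[OF R])
   fix r assume r: "r \<in> R"
   show "AE x in L. continuous_on (pts ?I) (%w. \<Psi> (\<alpha> r) w x)" using \<Psi>[OF r] unfolding cont_rep_def by blast
  qed
  then show "AE x in L. continuous_on (pts I') (%z. \<psi> z x)"
  proof eventually_elim
   case (elim x)
   show ?case unfolding \<psi>_def
   proof (intro continuous_on_sum continuous_on_mult continuous_on_const)
    fix r assume r: "r \<in> R"
    show "continuous_on (pts I') (%z. \<Psi> (\<alpha> r) (merge I' I'' (z, y r)) x)"
     by (rule continuous_on_compose2[OF elim[rule_format, OF r] continuous_on_merge]) (use mp[OF _ r] in blast)
   qed
  qed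
 qed
 ultimately have "(%x. \<psi> (\<lambda>l\<in>I'. x) x) \<in> sobolev D m p & sobolev_norm D m p (%x. \<psi> (\<lambda>l\<in>I'. x) x) <= K * E"
  using K E unfolding diag_const_def by blast
 then show ?thesis by (simp only: \<psi>_def merge_const_restrict)
qed

end

section \<open>The trace as a function of the remaining variables\<close>

context Sobolev_domain
begin

lemma mixed_holder_one:
 assumes f: "mixed_holder I \<gamma> B f" and y: "y \<in> pts I" "l \<in> I" "s \<in> closure D"
 shows "nrm (%x. f (y(l := s)) x - f y x) <= B * norm (s - y l) powr \<gamma>"
proof -
 define h where "h = (%_::nat. s - y l)"
 have "nrm (mdiff {l} h f y) <= B * (\<Prod>j\<in>{l}. norm (h j) powr \<gamma>)"
  by (rule f[unfolded mixed_holder_def, rule_format, OF _ y(1)]) (use y in \<open>auto simp: h_def\<close>)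
 moreover have "mdiff {l} h f y = (%x. f (y(l := s)) x - f y x)"
  by (rule ext) (simp add: mdiff_insert h_def)
 ultimately show ?thesis by (simp add: h_def)
qed

lemma mixed_holder_two:
 assumes f: "mixed_holder I \<gamma> B f" and y: "y \<in> pts I" "l \<in> I" "s \<in> closure D" "l' \<in> I" "s' \<in> closure D" "l ~= l'"
 shows "nrm (%x. (f (y(l := s, l' := s')) x - f (y(l := s)) x) - (f (y(l' := s')) x - f y x))
  <= B * norm (s - y l) powr \<gamma> * norm (s' - y l') powr \<gamma>"
proof -
 define h where "h = (%_::nat. s - y l)(l' := s' - y l')"
 have hm: "y j + h j \<in> closure D" if "j \<in> {l, l'}" for j
  using that y by (cases "j = l'") (auto simp: h_def)
 have "nrm (mdiff {l, l'} h f y) <= B * (\<Prod>j\<in>{l, l'}. norm (h j) powr \<gamma>)"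
  by (rule f[unfolded mixed_holder_def, rule_format, OF _ y(1) hm]) (use y in auto)
 moreover have "mdiff {l, l'} h f y = (%x. (f (y(l := s, l' := s')) x - f (y(l := s)) x) - (f (y(l' := s')) x - f y x))"
  using y(6) by (intro ext) (simp add: mdiff_insert h_def)
 ultimately show ?thesis using y(6) by (simp add: h_def mult.assoc)
qed

lemma Lp_mvt_quotient:
 fixes E E' :: "real => real^'d => real"
 assumes t: "t ~= 0" and E: "!!\<tau>. \<bar>\<tau>\<bar> <= \<bar>t\<bar> ==> E \<tau> \<in> LP" and E': "!!\<tau>. \<bar>\<tau>\<bar> <= \<bar>t\<bar> ==> E' \<tau> \<in> LP"
  and k: "!!\<tau>. \<bar>\<tau>\<bar> <= \<bar>t\<bar> ==> nrm (%x. E' \<tau> x - E' 0 x) <= \<kappa>"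
  and d: "!!\<tau>. \<bar>\<tau>\<bar> <= \<bar>t\<bar> ==> ((%h. nrm (%x. (E (\<tau> + h) x - E \<tau> x) / h - E' \<tau> x)) \<longlongrightarrow> 0) (at 0)"
 shows "nrm (%x. (E t x - E 0 x) / t - E' 0 x) <= \<kappa>"
proof -
 have "nrm (%x. E t x - E 0 x - t * E' 0 x) <= \<kappa> * \<bar>t\<bar>"
  by (rule Lp_mvt_abs[where E'=E', OF E E' E' k d]) auto
 moreover have "(%x. (E t x - E 0 x) / t - E' 0 x) = (%x. (1 / t) * (E t x - E 0 x - t * E' 0 x))"
  using t by (auto simp: field_simps)
 ultimately have "nrm (%x. (E t x - E 0 x) / t - E' 0 x) <= \<bar>1 / t\<bar> * (\<kappa> * \<bar>t\<bar>)"
  by (simp only: Lp_norm_scale mult_left_mono abs_ge_zero)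
 then show ?thesis using t by simp
qed

end

text \<open>I' holds the variables set equal to x, I'' the remaining ones. Pointwise representatives
  \<Psi> are required for derivatives in the remaining variables; derivatives in the traced ones
  enter through the norms of F.\<close>

locale trace_setup = Sobolev_domain D p for D :: "(real^'d) set" and p :: real +
 fixes I' I'' :: "nat set" and m n :: nat and \<gamma> K B :: real
  and F :: "('d => nat) => (nat => 'd => nat) => (nat => real^'d) => real^'d => real"
  and \<Psi> :: "(nat => 'd => nat) => (nat => real^'d) => real^'d => real"
 assumes K: "diag_const I' m \<gamma> K" and fin: "finite I'" "finite I''" and dj: "I' \<inter> I'' = {}" and mn: "m <= n"
  and F: "sob_family (I' \<union> I'') m n F"
  and \<Psi>: "!!\<alpha>. \<alpha> \<in> mix_indices I'' n ==> cont_rep (I' \<union> I'') (F (%_. 0) \<alpha>) (\<Psi> \<alpha>)"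
  and B: "0 <= B" and \<gamma>: "0 < \<gamma>"
  and mh: "!!\<beta> \<alpha>. mi_order \<beta> <= m ==> \<alpha> \<in> mix_indices (I' \<union> I'') n ==> mixed_holder (I' \<union> I'') \<gamma> B (F \<beta> \<alpha>)"
begin

abbreviation "mg z y \<equiv> merge I' I'' (z, y)"

text \<open>The trace of the \<alpha>-th derivative, which turns out to be the \<alpha>-th
  derivative of the trace.\<close>

definition G where "G \<alpha> y x = \<Psi> \<alpha> (mg (%_. x) y) x"

lemma K0: "0 <= K" using K by (simp add: diag_const_def)

lemma F_Lp:
 assumes "mi_order \<beta> <= m" "\<alpha> \<in> mix_indices (I' \<union> I'') n" "y \<in> pts (I' \<union> I'')"
 shows "F \<beta> \<alpha> y \<in> LP"
proof -
 have "Lp_derivs (I' \<union> I'') n (F \<beta>)" using F assms(1) unfolding sob_family_def by blast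
 from Lp_continuousD[OF Lp_derivs_continuous[OF this assms(2)] assms(3)] show ?thesis .
qed

text \<open>The combination runs over the vertices of the mixed difference over A. Its difference in
  a traced variable l is a mixed difference over \<open>insert l A\<close>, and the product of the
  steps factors accordingly; here the mixed norms are used in full. The factor c later carries the
  normalising powers of |h_l|.\<close>

lemma G_mdiff:
 assumes \<alpha>: "\<alpha> \<in> mix_indices I'' n" and y: "y \<in> pts I''" and A: "A \<subseteq> I''" and h: "!!l. l \<in> A ==> y l + h l \<in> closure D"
 shows "(%x. c * mdiff A h (G \<alpha>) y x) \<in> sobolev D m p \<and>
  sobolev_norm D m p (%x. c * mdiff A h (G \<alpha>) y x) <= K * (\<bar>c\<bar> * (B * (\<Prod>l\<in>A. norm (h l) powr \<gamma>)))"
proof -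
 define yS where "yS S = (%l. if l \<in> S then y l + h l else y l)" for S
 have fA: "finite A" using finite_subset[OF A fin(2)] .
 have mgS: "mg z (yS S) = (%l. if l \<in> S then mg z y l + h l else mg z y l)" if "S \<in> Pow A" for z S
  using that A dj by (auto simp: merge_def yS_def fun_eq_iff)
 have comb: "(\<Sum>S\<in>Pow A. c * (-1) ^ card (A - S) * f (mg z (yS S)) x) = c * mdiff A h f (mg z y) x" for f z and x :: "real^'d"
  unfolding mdiff_def sum_distrib_left mult.assoc by (intro sum.cong refl) (simp only: mgS)
 have sumG: "(\<Sum>S\<in>Pow A. c * (-1) ^ card (A - S) * \<Psi> \<alpha> (mg (%_. x) (yS S)) x) = c * mdiff A h (G \<alpha>) y x" for x
  unfolding mdiff_def sum_distrib_left mult.assoc G_def yS_def ..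
 have hm: "mg z y l + h l \<in> closure D" if "l \<in> A" for l z using h[OF that] merge_right[of l I'' I' z y] A dj that by auto
 have "(%x. \<Sum>S\<in>Pow A. c * (-1) ^ card (A - S) * \<Psi> \<alpha> (mg (%_. x) (yS S)) x) \<in> sobolev D m p \<and>
  sobolev_norm D m p (%x. \<Sum>S\<in>Pow A. c * (-1) ^ card (A - S) * \<Psi> \<alpha> (mg (%_. x) (yS S)) x) <= K * (\<bar>c\<bar> * (B * (\<Prod>l\<in>A. norm (h l) powr \<gamma>)))"
 proof (rule trace_combination[where R="Pow A" and \<alpha>="%_. \<alpha>" and y=yS and c="%S. c * (-1) ^ card (A - S)" and \<Psi>=\<Psi>, OF K fin dj mn F])
  show "yS S \<in> pts I''" if "S \<in> Pow A" for S unfolding yS_def using that by (intro mdiff_point_mem[of y I'' _ A] y h A) auto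
  show "0 <= \<bar>c\<bar> * (B * (\<Prod>l\<in>A. norm (h l) powr \<gamma>))" using B by (simp add: prod_nonneg)
 next
  fix \<beta> :: "'d => nat" and \<delta> :: "nat => 'd => nat" and z assume \<beta>: "mi_order \<beta> <= m" and \<delta>: "\<delta> \<in> mix_indices I' m" and z: "z \<in> pts I'"
  note H = mh[OF \<beta> mcomb_mix_indices[OF \<delta> \<alpha> mn]]
  show "nrm (%x. \<Sum>S\<in>Pow A. c * (-1) ^ card (A - S) * F \<beta> (mcomb I' \<delta> \<alpha>) (mg z (yS S)) x) <= \<bar>c\<bar> * (B * (\<Prod>l\<in>A. norm (h l) powr \<gamma>))"
   unfolding comb Lp_norm_scale
   using H[unfolded mixed_holder_def, rule_format, of A "mg z y" h] A merge_PiE[OF z y] hm by (intro mult_left_mono) auto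
  fix l s assume l: "l \<in> I'" and s: "s \<in> closure D"
  define h' where "h' = h(l := s - z l)"
  have lA: "l \<notin> A" using l A dj by auto
  have "c * mdiff A h (F \<beta> (mcomb I' \<delta> \<alpha>)) (mg (z(l := s)) y) x - c * mdiff A h (F \<beta> (mcomb I' \<delta> \<alpha>)) (mg z y) x
    = c * mdiff (insert l A) h' (F \<beta> (mcomb I' \<delta> \<alpha>)) (mg z y) x" for x
  proof -
   have 1: "mdiff A h' f w x = mdiff A h f w x" for f w by (rule mdiff_cong) (use lA in \<open>auto simp: h'_def\<close>)
   show ?thesis unfolding mdiff_insert[OF fA lA] 1 merge_upd_left[OF l]
    by (simp add: h'_def merge_left[OF l] right_diff_distrib)
  qed
  moreover have "nrm (%x. c * mdiff (insert l A) h' (F \<beta> (mcomb I' \<delta> \<alpha>)) (mg z y) x) <= \<bar>c\<bar> * (B * (\<Prod>j\<in>insert l A. norm (h' j) powr \<gamma>))"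
   unfolding Lp_norm_scale
  proof (intro mult_left_mono H[unfolded mixed_holder_def, rule_format] merge_PiE[OF z y])
   show "mg z y j + h' j \<in> closure D" if "j \<in> insert l A" for j
    using that hm[of j z] s lA merge_left[OF l, of I'' z y] by (auto simp: h'_def)
  qed (use A l in auto)
  moreover have "(\<Prod>j\<in>insert l A. norm (h' j) powr \<gamma>) = norm (s - z l) powr \<gamma> * (\<Prod>j\<in>A. norm (h j) powr \<gamma>)"
   using fA lA by (auto simp: h'_def intro!: prod.cong)
  ultimately show "nrm (%x. (\<Sum>S\<in>Pow A. c * (-1) ^ card (A - S) * F \<beta> (mcomb I' \<delta> \<alpha>) (mg (z(l := s)) (yS S)) x)
    - (\<Sum>S\<in>Pow A. c * (-1) ^ card (A - S) * F \<beta> (mcomb I' \<delta> \<alpha>) (mg z (yS S)) x)) <= \<bar>c\<bar> * (B * (\<Prod>l\<in>A. norm (h l) powr \<gamma>)) * norm (s - z l) powr \<gamma>"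
   unfolding comb by (simp add: mult_ac)
 qed (use fA \<alpha> \<Psi> in auto)
 then show ?thesis unfolding sumG .
qed

lemma G_sobolev:
 assumes \<alpha>: "\<alpha> \<in> mix_indices I'' n" and y: "y \<in> pts I''"
 shows "G \<alpha> y \<in> sobolev D m p" "sobolev_norm D m p (G \<alpha> y) <= K * B"
proof -
 have "(%x. 1 * mdiff {} (%_. 0) (G \<alpha>) y x) = G \<alpha> y" by (rule ext) simp
 then show "G \<alpha> y \<in> sobolev D m p" "sobolev_norm D m p (G \<alpha> y) <= K * B"
  using G_mdiff[OF \<alpha> y, of "{}" "%_. 0" 1] by simp_all
qed

text \<open>A combination of two terms. The points y1 and y2 are joined by changing one remaining
  variable at a time; for the difference in a traced variable each change is a mixed difference of
  order two.\<close>

lemma G_diff: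
 assumes \<alpha>: "\<alpha> \<in> mix_indices I'' n" and y: "y1 \<in> pts I''" "y2 \<in> pts I''"
 shows "sobolev_norm D m p (%x. G \<alpha> y1 x - G \<alpha> y2 x) <= K * (\<Sum>l\<in>I''. B * norm (y1 l - y2 l) powr \<gamma>)"
proof -
 define c where "c r = (if r = (0::nat) then 1 else - 1 :: real)" for r
 define yr where "yr r = (if r = (0::nat) then y1 else y2)" for r
 have comb: "(\<Sum>r\<in>{0,1}. c r * g (yr r) x) = g y1 x - g y2 x" for g :: "(nat => real^'d) => real^'d => real" and x
  by (simp add: c_def yr_def)
 have "(%x. \<Sum>r\<in>{0,1}. c r * \<Psi> \<alpha> (mg (%_. x) (yr r)) x) \<in> sobolev D m p \<and>
  sobolev_norm D m p (%x. \<Sum>r\<in>{0,1}. c r * \<Psi> \<alpha> (mg (%_. x) (yr r)) x) <= K * (\<Sum>l\<in>I''. B * norm (y1 l - y2 l) powr \<gamma>)"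
 proof (rule trace_combination[where R="{0,1}" and \<alpha>="%_. \<alpha>" and y=yr and c=c and \<Psi>=\<Psi>, OF K fin dj mn F])
  show "yr r \<in> pts I''" for r using y by (simp add: yr_def)
  show "0 <= (\<Sum>l\<in>I''. B * norm (y1 l - y2 l) powr \<gamma>)" using B by (simp add: sum_nonneg)
 next
  fix \<beta> :: "'d => nat" and \<delta> :: "nat => 'd => nat" and z assume \<beta>: "mi_order \<beta> <= m" and \<delta>: "\<delta> \<in> mix_indices I' m" and z: "z \<in> pts I'"
  note mc = mcomb_mix_indices[OF \<delta> \<alpha> mn]
  note H = mh[OF \<beta> mc]
  let ?f = "F \<beta> (mcomb I' \<delta> \<alpha>)"
  have Lpf: "?f (mg z y) \<in> LP" if "y \<in> pts I''" "z \<in> pts I'" for y z by (rule F_Lp[OF \<beta> mc merge_PiE[OF that(2,1)]])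
  show "nrm (%x. \<Sum>r\<in>{0,1}. c r * ?f (mg z (yr r)) x) <= (\<Sum>l\<in>I''. B * norm (y1 l - y2 l) powr \<gamma>)"
   unfolding comb[of "%y. ?f (mg z y)"]
  proof (rule holder_telescope[OF fin(2) Lpf[OF _ z] _ y])
   fix w l s assume w: "w \<in> pts I''" and l: "l \<in> I''" and s: "s \<in> closure D"
   show "nrm (%x. ?f (mg z (w(l := s))) x - ?f (mg z w) x) <= B * norm (s - w l) powr \<gamma>"
    using mixed_holder_one[OF H merge_PiE[OF z w] _ s, of l] l by (simp add: merge_upd_right[OF l dj] merge_right[OF l dj])
  qed
  fix l s assume l: "l \<in> I'" and s: "s \<in> closure D"
  let ?z = "z(l := s)"
  note zs = shift_mem_PiE[OF z l s]
  have "nrm (%x. (?f (mg ?z y1) x - ?f (mg z y1) x) - (?f (mg ?z y2) x - ?f (mg z y2) x))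
    <= (\<Sum>l'\<in>I''. (B * norm (s - z l) powr \<gamma>) * norm (y1 l' - y2 l') powr \<gamma>)"
  proof (rule holder_telescope[where f="%y x. ?f (mg ?z y) x - ?f (mg z y) x", OF fin(2) Lp_diff[OF Lpf[OF _ zs] Lpf[OF _ z]] _ y])
   fix w l' s' assume w: "w \<in> pts I''" and l': "l' \<in> I''" and s': "s' \<in> closure D"
   have ll: "l' ~= l" using l l' dj by auto
   have "nrm (%x. (?f ((mg z w)(l' := s', l := s)) x - ?f ((mg z w)(l' := s')) x) - (?f ((mg z w)(l := s)) x - ?f (mg z w) x))
     <= B * norm (s' - mg z w l') powr \<gamma> * norm (s - mg z w l) powr \<gamma>"
    by (rule mixed_holder_two[OF H merge_PiE[OF z w] _ s' _ s ll]) (use l l' in auto)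
   moreover have "mg ?z (w(l' := s')) = (mg z w)(l' := s', l := s)" "mg z (w(l' := s')) = (mg z w)(l' := s')" "mg ?z w = (mg z w)(l := s)"
    unfolding merge_upd_left[OF l] merge_upd_right[OF l' dj] by simp_all
   ultimately show "nrm (%x. (?f (mg ?z (w(l' := s'))) x - ?f (mg z (w(l' := s'))) x) - (?f (mg ?z w) x - ?f (mg z w) x))
     <= B * norm (s - z l) powr \<gamma> * norm (s' - w l') powr \<gamma>"
    unfolding merge_left[OF l] merge_right[OF l' dj] by (simp only: mult_ac)
  qed
  moreover have "(\<Sum>l'\<in>I''. (B * norm (s - z l) powr \<gamma>) * norm (y1 l' - y2 l') powr \<gamma>) = (\<Sum>l\<in>I''. B * norm (y1 l - y2 l) powr \<gamma>) * norm (s - z l) powr \<gamma>"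
   unfolding sum_distrib_right by (simp only: mult_ac)
  moreover have "(%x. (\<Sum>r\<in>{0,1}. c r * ?f (mg ?z (yr r)) x) - (\<Sum>r\<in>{0,1}. c r * ?f (mg z (yr r)) x))
    = (%x. (?f (mg ?z y1) x - ?f (mg z y1) x) - (?f (mg ?z y2) x - ?f (mg z y2) x))"
   by (simp add: c_def yr_def fun_eq_iff)
  ultimately show "nrm (%x. (\<Sum>r\<in>{0,1}. c r * ?f (mg ?z (yr r)) x) - (\<Sum>r\<in>{0,1}. c r * ?f (mg z (yr r)) x))
    <= (\<Sum>l\<in>I''. B * norm (y1 l - y2 l) powr \<gamma>) * norm (s - z l) powr \<gamma>" by (simp only:)
 qed (use \<alpha> \<Psi> in auto)
 then show ?thesis by (simp add: c_def yr_def G_def)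
qed

text \<open>A combination of three terms. By the mean value inequality the quotient deviates from
  the derivative by the oscillation of the latter over the step, which is of order |t|^\<gamma>. The
  same argument applies to differences in a traced variable, where the oscillation is a mixed
  difference of order two.\<close>

lemma G_quotient:
 assumes l: "l \<in> I''" and \<alpha>': "(mi_inc \<alpha> l i) \<in> mix_indices I'' n" and y: "y \<in> pts I''"
  and t: "t ~= 0" and seg: "!!\<tau>. \<bar>\<tau>\<bar> <= \<bar>t\<bar> ==> y l + \<tau> *\<^sub>R axis i 1 \<in> D"
 shows "sobolev_norm D m p (%x. (G \<alpha> (y(l := y l + t *\<^sub>R axis i 1)) x - G \<alpha> y x) / t - G (mi_inc \<alpha> l i) y x)
  <= K * (B * \<bar>t\<bar> powr \<gamma>)"
proof -
 let ?e = "axis i 1 :: real^'d" and ?\<alpha>' = "mi_inc \<alpha> l i"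
 note \<alpha> = mix_indices_mono_upd[OF \<alpha>' l]
 have lI: "l \<notin> I'" "l \<in> I' \<union> I''" using l dj by auto
 define ys where "ys \<tau> = y(l := y l + \<tau> *\<^sub>R ?e)" for \<tau>
 have ys0: "ys 0 = y" by (simp add: ys_def)
 have ysp: "ys \<tau> \<in> pts I''" if "\<bar>\<tau>\<bar> <= \<bar>t\<bar>" for \<tau> unfolding ys_def by (rule shift_mem_PiE[OF y l Dcl[OF seg[OF that]]])
 \<comment> \<open>Terms 0 and 1 form the difference quotient; term 2 is the candidate for the
   derivative and alone carries the raised multi-index.\<close>
 define c where "c r = (if r = (0::nat) then 1 / t else if r = 1 then - 1 / t else - 1 :: real)" for r
 define yr where "yr r = (if r = (0::nat) then ys t else y)" for r
 define ar where "ar r = (if r = 2 then ?\<alpha>' else \<alpha>)" for r :: nat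
 have comb: "(\<Sum>r\<in>{0,1,2}. c r * g (ar r) (yr r) x) = (g \<alpha> (ys t) x - g \<alpha> y x) / t - g ?\<alpha>' y x"
  for g :: "(nat => 'd => nat) => (nat => real^'d) => real^'d => real" and x
  by (simp add: c_def yr_def ar_def diff_divide_distrib)
 have "(%x. \<Sum>r\<in>{0,1,2}. c r * \<Psi> (ar r) (mg (%_. x) (yr r)) x) \<in> sobolev D m p \<and>
  sobolev_norm D m p (%x. \<Sum>r\<in>{0,1,2}. c r * \<Psi> (ar r) (mg (%_. x) (yr r)) x) <= K * (B * \<bar>t\<bar> powr \<gamma>)"
 proof (rule trace_combination[where R="{0,1,2}" and \<alpha>=ar and y=yr and c=c and \<Psi>=\<Psi>, OF K fin dj mn F])
  show "yr r \<in> pts I''" for r using y ysp[of t] by (simp add: yr_def)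
  show "0 <= B * \<bar>t\<bar> powr \<gamma>" using B by simp
  show ar: "ar r \<in> mix_indices I'' n" for r using \<alpha> \<alpha>' by (simp add: ar_def)
  show "cont_rep (I' \<union> I'') (F (%_. 0) (ar r)) (\<Psi> (ar r))" for r by (rule \<Psi>[OF ar])
 next
  fix \<beta> :: "'d => nat" and \<delta> :: "nat => 'd => nat" and z assume \<beta>: "mi_order \<beta> <= m" and \<delta>: "\<delta> \<in> mix_indices I' m" and z: "z \<in> pts I'"
  let ?a = "mcomb I' \<delta> \<alpha>" and ?a' = "mcomb I' \<delta> ?\<alpha>'"
  have a': "?a' = ?a(l := (?a l)(i := Suc (?a l i)))" unfolding mcomb_upd'[OF lI(1)] mcomb_other[OF lI(1)] ..
  note mc = mcomb_mix_indices[OF \<delta> \<alpha> mn] and mc' = mcomb_mix_indices[OF \<delta> \<alpha>' mn]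
  note H = mh[OF \<beta> mc']
  have FL: "Lp_derivs (I' \<union> I'') n (F \<beta>)" using F \<beta> unfolding sob_family_def by blast
  let ?f = "F \<beta> ?a" and ?f' = "F \<beta> ?a'"
  have Lpf: "?f (mg z (ys \<tau>)) \<in> LP" "?f' (mg z (ys \<tau>)) \<in> LP" if "\<bar>\<tau>\<bar> <= \<bar>t\<bar>" "z \<in> pts I'" for \<tau> z
   by (rule F_Lp[OF \<beta> mc merge_PiE[OF that(2) ysp[OF that(1)]]]) (rule F_Lp[OF \<beta> mc' merge_PiE[OF that(2) ysp[OF that(1)]]])
  have mgs: "mg z (ys \<tau>) = (mg z y)(l := y l + \<tau> *\<^sub>R ?e)" for z \<tau> unfolding ys_def by (rule merge_upd_right[OF l dj])
  have mgl: "mg z y l = y l" for z by (rule merge_right[OF l dj])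
  have der: "((%h. nrm (%x. (?f (mg z (ys (\<tau> + h))) x - ?f (mg z (ys \<tau>)) x) / h - ?f' (mg z (ys \<tau>)) x)) \<longlongrightarrow> 0) (at 0)"
   if "\<bar>\<tau>\<bar> <= \<bar>t\<bar>" "z \<in> pts I'" for \<tau> z
  proof -
   have "mg z (ys \<tau>) l \<in> D" unfolding mgs using seg[OF that(1)] by simp
   from Lp_derivs_boundary[where y="mg z (ys \<tau>)", OF _ FL lI(2) mc'[unfolded a'] merge_PiE[OF that(2) ysp[OF that(1)]] this]
   show ?thesis using fin by (simp add: a' mgs scaleR_left_distrib add.assoc)
  qed
  have ft: "\<bar>0\<bar> <= \<bar>t\<bar>" by simp
  have "nrm (%x. (?f (mg z (ys t)) x - ?f (mg z (ys 0)) x) / t - ?f' (mg z (ys 0)) x) <= B * \<bar>t\<bar> powr \<gamma>"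
  proof (rule Lp_mvt_quotient[where E="%\<tau>. ?f (mg z (ys \<tau>))" and E'="%\<tau>. ?f' (mg z (ys \<tau>))", OF t Lpf(1)[OF _ z] Lpf(2)[OF _ z] _ der[OF _ z]])
   fix \<tau> assume \<tau>: "\<bar>\<tau>\<bar> <= \<bar>t\<bar>"
   have "nrm (%x. ?f' (mg z (ys \<tau>)) x - ?f' (mg z (ys 0)) x) <= B * norm ((y l + \<tau> *\<^sub>R ?e) - mg z y l) powr \<gamma>"
    unfolding mgs ys0 using mixed_holder_one[OF H merge_PiE[OF z y] lI(2) Dcl[OF seg[OF \<tau>]]] by (simp add: mgl)
   also have "\<dots> <= B * \<bar>t\<bar> powr \<gamma>" using \<tau> B \<gamma> by (intro mult_left_mono powr_mono2) (auto simp: mgl)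
   finally show "nrm (%x. ?f' (mg z (ys \<tau>)) x - ?f' (mg z (ys 0)) x) <= B * \<bar>t\<bar> powr \<gamma>" .
  qed
  then show "nrm (%x. \<Sum>r\<in>{0,1,2}. c r * F \<beta> (mcomb I' \<delta> (ar r)) (mg z (yr r)) x) <= B * \<bar>t\<bar> powr \<gamma>"
   unfolding comb[of "%a w. F \<beta> (mcomb I' \<delta> a) (mg z w)"] ys0 .
  fix l' s assume l': "l' \<in> I'" and s: "s \<in> closure D"
  let ?z = "z(l' := s)"
  note zs = shift_mem_PiE[OF z l' s]
  have ll: "l ~= l'" using lI l' by auto
  have mgz: "mg ?z (ys \<tau>) = (mg z (ys \<tau>))(l' := s)" for \<tau> by (rule merge_upd_left[OF l'])
  have "nrm (%x. ((?f (mg ?z (ys t)) x - ?f (mg z (ys t)) x) - (?f (mg ?z (ys 0)) x - ?f (mg z (ys 0)) x)) / t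
    - (?f' (mg ?z (ys 0)) x - ?f' (mg z (ys 0)) x)) <= B * \<bar>t\<bar> powr \<gamma> * norm (s - z l') powr \<gamma>"
  proof (rule Lp_mvt_quotient[where E="%\<tau> x. ?f (mg ?z (ys \<tau>)) x - ?f (mg z (ys \<tau>)) x" and E'="%\<tau> x. ?f' (mg ?z (ys \<tau>)) x - ?f' (mg z (ys \<tau>)) x",
    OF t Lp_diff[OF Lpf(1)[OF _ zs] Lpf(1)[OF _ z]] Lp_diff[OF Lpf(2)[OF _ zs] Lpf(2)[OF _ z]]])
   fix \<tau> assume \<tau>: "\<bar>\<tau>\<bar> <= \<bar>t\<bar>"
   have "nrm (%x. (?f' ((mg z y)(l := y l + \<tau> *\<^sub>R ?e, l' := s)) x - ?f' ((mg z y)(l := y l + \<tau> *\<^sub>R ?e)) x)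
      - (?f' ((mg z y)(l' := s)) x - ?f' (mg z y) x))
     <= B * norm ((y l + \<tau> *\<^sub>R ?e) - mg z y l) powr \<gamma> * norm (s - mg z y l') powr \<gamma>"
    by (rule mixed_holder_two[OF H merge_PiE[OF z y] lI(2) Dcl[OF seg[OF \<tau>]] _ s ll]) (use l' in simp)
   also have "\<dots> <= B * \<bar>t\<bar> powr \<gamma> * norm (s - z l') powr \<gamma>"
    unfolding merge_left[OF l'] using \<tau> B \<gamma> by (intro mult_left_mono mult_right_mono powr_mono2) (auto simp: mgl)
   finally show "nrm (%x. (?f' (mg ?z (ys \<tau>)) x - ?f' (mg z (ys \<tau>)) x) - (?f' (mg ?z (ys 0)) x - ?f' (mg z (ys 0)) x))
     <= B * \<bar>t\<bar> powr \<gamma> * norm (s - z l') powr \<gamma>"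
    unfolding mgz unfolding ys0 mgs .
   let ?q = "%z h x. (?f (mg z (ys (\<tau> + h))) x - ?f (mg z (ys \<tau>)) x) / h - ?f' (mg z (ys \<tau>)) x"
   have yl: "y l + \<tau> *\<^sub>R ?e \<in> D" by (rule seg[OF \<tau>])
   show "((%h. nrm (%x. ((?f (mg ?z (ys (\<tau> + h))) x - ?f (mg z (ys (\<tau> + h))) x) - (?f (mg ?z (ys \<tau>)) x - ?f (mg z (ys \<tau>)) x)) / h
     - (?f' (mg ?z (ys \<tau>)) x - ?f' (mg z (ys \<tau>)) x))) \<longlongrightarrow> 0) (at 0)"
   proof (rule tendsto_sandwich[OF _ _ tendsto_const])
    show "((%h. nrm (?q ?z h) + nrm (?q z h)) \<longlongrightarrow> 0) (at 0)"
     using tendsto_add[OF der[OF \<tau> zs] der[OF \<tau> z]] by simp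
    show "\<forall>\<^sub>F h in at 0. nrm (%x. ((?f (mg ?z (ys (\<tau> + h))) x - ?f (mg z (ys (\<tau> + h))) x) - (?f (mg ?z (ys \<tau>)) x - ?f (mg z (ys \<tau>)) x)) / h
     - (?f' (mg ?z (ys \<tau>)) x - ?f' (mg z (ys \<tau>)) x)) <= nrm (?q ?z h) + nrm (?q z h)"
     using eventually_shift_mem[OF yl, of ?e]
    proof eventually_elim
     case (elim h)
     have yh: "ys (\<tau> + h) \<in> pts I''" unfolding ys_def
      by (rule shift_mem_PiE[OF y l Dcl]) (use elim in \<open>simp add: scaleR_left_distrib add.assoc\<close>)
     have qL: "?q z h \<in> LP" if z: "z \<in> pts I'" for z
     proof -
      have "(%x. (1 / h) * (?f (mg z (ys (\<tau> + h))) x - ?f (mg z (ys \<tau>)) x) - ?f' (mg z (ys \<tau>)) x) \<in> LP"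
       by (intro Lp_diff Lp_scale F_Lp[OF \<beta> mc merge_PiE[OF z yh]] Lpf \<tau> z)
      then show ?thesis by simp
     qed
     have "(%x. ((?f (mg ?z (ys (\<tau> + h))) x - ?f (mg z (ys (\<tau> + h))) x) - (?f (mg ?z (ys \<tau>)) x - ?f (mg z (ys \<tau>)) x)) / h
      - (?f' (mg ?z (ys \<tau>)) x - ?f' (mg z (ys \<tau>)) x)) = (%x. ?q ?z h x - ?q z h x)"
      by (simp add: fun_eq_iff diff_divide_distrib)
     then show ?case using Lp_norm_triangle_diff[OF qL[OF zs] qL[OF z]] by (simp only:)
    qed
   qed simp
  qed
  moreover have "(%x. (\<Sum>r\<in>{0,1,2}. c r * F \<beta> (mcomb I' \<delta> (ar r)) (mg ?z (yr r)) x) - (\<Sum>r\<in>{0,1,2}. c r * F \<beta> (mcomb I' \<delta> (ar r)) (mg z (yr r)) x))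
   = (%x. ((?f (mg ?z (ys t)) x - ?f (mg z (ys t)) x) - (?f (mg ?z (ys 0)) x - ?f (mg z (ys 0)) x)) / t
    - (?f' (mg ?z (ys 0)) x - ?f' (mg z (ys 0)) x))"
   unfolding comb[of "%a w. F \<beta> (mcomb I' \<delta> a) (mg z w)"] comb[of "%a w. F \<beta> (mcomb I' \<delta> a) (mg ?z w)"] ys0
   by (simp add: fun_eq_iff diff_divide_distrib)
  ultimately show "nrm (%x. (\<Sum>r\<in>{0,1,2}. c r * F \<beta> (mcomb I' \<delta> (ar r)) (mg ?z (yr r)) x)
    - (\<Sum>r\<in>{0,1,2}. c r * F \<beta> (mcomb I' \<delta> (ar r)) (mg z (yr r)) x)) <= B * \<bar>t\<bar> powr \<gamma> * norm (s - z l') powr \<gamma>"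
   by (simp only:)
 qed simp
 moreover have "(\<Sum>r\<in>{0,1,2}. c r * \<Psi> (ar r) (mg (%_. x) (yr r)) x) = (G \<alpha> (ys t) x - G \<alpha> y x) / t - G ?\<alpha>' y x" for x
  using comb[of G x] by (simp only: G_def)
 ultimately show ?thesis by (simp only: ys_def)
qed

end

context trace_setup
begin

lemma G_mix_derivs: "mix_derivs D I'' n (sobolev D m p) (sobolev_norm D m p) (G (%_ _. 0)) G"
 unfolding mix_derivs_def
proof (intro conjI ballI allI impI)
 fix \<alpha> :: "nat => 'd => nat" and y assume \<alpha>: "\<alpha> \<in> mix_indices I'' n" and y: "y \<in> pts I''"
 show "G \<alpha> y \<in> sobolev D m p" by (rule G_sobolev(1)[OF \<alpha> y])
 show "((%z. sobolev_norm D m p (%x. G \<alpha> z x - G \<alpha> y x)) \<longlongrightarrow> 0) (at y within pts I'')"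
 proof (rule tendsto_sandwich[OF _ _ tendsto_const])
  show "\<forall>\<^sub>F z in at y within pts I''. sobolev_norm D m p (%x. G \<alpha> z x - G \<alpha> y x) <= K * (\<Sum>l\<in>I''. B * norm (z l - y l) powr \<gamma>)"
   unfolding eventually_at_topological by (rule exI[of _ UNIV]) (auto intro!: G_diff \<alpha> y)
  have "((%z. z) \<longlongrightarrow> y) (at y within pts I'')" by (rule tendsto_ident_at)
  then have c: "((%z. z l) \<longlongrightarrow> y l) (at y within pts I'')" for l unfolding tendsto_fun_iff by simp
  have "((%z. norm (z l - y l)) \<longlongrightarrow> norm (y l - y l)) (at y within pts I'')" for l
   by (intro tendsto_norm tendsto_diff c tendsto_const)
  then have "((%z. norm (z l - y l) powr \<gamma>) \<longlongrightarrow> 0 powr \<gamma>) (at y within pts I'')" for l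
   using \<gamma> by (intro tendsto_powr' tendsto_const) auto
  then have "((%z. K * (\<Sum>l\<in>I''. B * norm (z l - y l) powr \<gamma>)) \<longlongrightarrow> K * (\<Sum>l\<in>I''. B * 0 powr \<gamma>)) (at y within pts I'')"
   by (intro tendsto_mult_left tendsto_sum)
  then show "((%z. K * (\<Sum>l\<in>I''. B * norm (z l - y l) powr \<gamma>)) \<longlongrightarrow> 0) (at y within pts I'')" by simp
 qed (simp add: sobolev_norm_nonneg)
next
 fix \<alpha> :: "nat => 'd => nat" and l i y
 assume l: "l \<in> I''" and \<alpha>': "(mi_inc \<alpha> l i) \<in> mix_indices I'' n" and y: "y \<in> I'' \<rightarrow>\<^sub>E D"
 have "y l \<in> D" using y l by auto
 then obtain r where r: "r > 0" "ball (y l) r \<subseteq> D" using open_D openE by blast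
 show "((%t. sobolev_norm D m p (%x. (G \<alpha> (y(l := y l + t *\<^sub>R axis i 1)) x - G \<alpha> y x) / t
   - G (mi_inc \<alpha> l i) y x)) \<longlongrightarrow> 0) (at 0)"
 proof (rule tendsto_sandwich[OF _ _ tendsto_const])
  have "\<forall>\<^sub>F t in at (0::real). \<bar>t\<bar> < r & t ~= 0"
   unfolding eventually_at by (rule exI[of _ r]) (use r(1) in auto)
  then show "\<forall>\<^sub>F t in at 0. sobolev_norm D m p (%x. (G \<alpha> (y(l := y l + t *\<^sub>R axis i 1)) x - G \<alpha> y x) / t
   - G (mi_inc \<alpha> l i) y x) <= K * (B * \<bar>t\<bar> powr \<gamma>)"
  proof eventually_elim
   case (elim t)
   show ?case
    by (rule G_quotient[OF l \<alpha>' D_pts[OF y]]) (use elim r(2) in \<open>auto simp: subset_iff dist_norm\<close>)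
  qed
  have "((%t. \<bar>t\<bar>) \<longlongrightarrow> \<bar>0::real\<bar>) (at 0)" by (intro tendsto_rabs tendsto_ident_at)
  then have "((%t. \<bar>t\<bar> powr \<gamma>) \<longlongrightarrow> 0 powr \<gamma>) (at (0::real))" using \<gamma> by (intro tendsto_powr' tendsto_const) auto
  then have "((%t. K * (B * \<bar>t\<bar> powr \<gamma>)) \<longlongrightarrow> K * (B * 0 powr \<gamma>)) (at 0)" by (intro tendsto_mult_left)
  then show "((%t. K * (B * \<bar>t\<bar> powr \<gamma>)) \<longlongrightarrow> 0) (at 0)" by simp
 qed (simp add: sobolev_norm_nonneg)
qed simp

text \<open>The norm is defined through a selected family of derivatives, which agrees with G a.e.
  at every point by \<open>Lp_derivs_unique\<close>, applied to weak derivatives of order 0. The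
  normalising negative powers of |h_l| cancel the product in \<open>G_mdiff\<close>.\<close>

lemma G_holder_mix_norm:
 "holder_mix_norm D I'' n \<gamma> (sobolev D m p) (sobolev_norm D m p) (G (%_ _. 0)) <= ennreal (K * B)"
proof -
 define g where "g = (SOME g. mix_derivs D I'' n (sobolev D m p) (sobolev_norm D m p) (G (%_ _. 0)) g)"
 have g: "mix_derivs D I'' n (sobolev D m p) (sobolev_norm D m p) (G (%_ _. 0)) g"
  unfolding g_def using G_mix_derivs by (rule someI[where P="mix_derivs D I'' n (sobolev D m p) (sobolev_norm D m p) (G (%_ _. 0))"])
 have z: "mi_order (%_ :: 'd. 0) <= m" by (simp add: mi_order_def)
 have ae: "AE x in L. g \<alpha> y x = G \<alpha> y x" if \<alpha>: "\<alpha> \<in> mix_indices I'' n" and y: "y \<in> pts I''" for \<alpha> y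
 proof -
  have W: "AE x in L. weak_deriv D p (%_. 0) (h \<alpha> y) x = h \<alpha> y x"
   if "mix_derivs D I'' n (sobolev D m p) (sobolev_norm D m p) (G (%_ _. 0)) h" for h
   by (rule weak_deriv_0[OF sobolev_Lp[OF mix_derivs_memD(1)[OF that \<alpha> y]]])
  have "AE x in L. weak_deriv D p (%_. 0) (g \<alpha> y) x = weak_deriv D p (%_. 0) (G \<alpha> y) x"
  proof (rule Lp_derivs_unique[OF fin(2) mix_derivs_imp_Lp_derivs[OF g fin(2) z] mix_derivs_imp_Lp_derivs[OF G_mix_derivs fin(2) z] _ \<alpha> y])
   fix y assume "y \<in> pts I''"
   then have "g (%_ _. 0) y = G (%_ _. 0) y" using g by (simp add: mix_derivs_def)
   then show "AE x in L. weak_deriv D p (%_. 0) (g (%_ _. 0) y) x = weak_deriv D p (%_. 0) (G (%_ _. 0) y) x" by simp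
  qed
  with W[OF g] W[OF G_mix_derivs] show ?thesis by eventually_elim simp
 qed
 have n0: "sobolev_norm D m p (g \<alpha> y) <= K * B" if \<alpha>: "\<alpha> \<in> mix_indices I'' n" and y: "y \<in> pts I''" for \<alpha> y
  using G_sobolev[OF \<alpha> y] sobolev_cong_AE(3)[OF sobolev_Lp[OF G_sobolev(1)[OF \<alpha> y]] ae[OF \<alpha> y]] by simp
 have n1: "sobolev_norm D m p (mix_diff_quot \<gamma> I'' h (g \<alpha>) y) <= K * B"
  if y: "y \<in> pts I''" and h: "\<forall>l\<in>I''. y l + h l \<in> closure D" and \<alpha>: "\<alpha> \<in> mix_indices I'' n" for \<alpha> y h
 proof -
  let ?A = "active I'' h"
  have A: "?A \<subseteq> I''" "!!l. l \<in> ?A ==> h l ~= 0" by (auto simp: active_def)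
  have fA: "finite ?A" using finite_subset[OF A(1) fin(2)] .
  define c where "c = (\<Prod>l\<in>?A. norm (h l) powr (- \<gamma>))"
  have hA: "y l + h l \<in> closure D" if "l \<in> ?A" for l using h A that by auto
  note Gm = G_mdiff[OF \<alpha> y A(1) hA, of c]
  have "AE x in L. \<forall>S\<in>Pow ?A. g \<alpha> (%l. if l \<in> S then y l + h l else y l) x = G \<alpha> (%l. if l \<in> S then y l + h l else y l) x"
  proof (rule AE_finite_allI)
   fix S assume "S \<in> Pow ?A"
   then show "AE x in L. g \<alpha> (%l. if l \<in> S then y l + h l else y l) x = G \<alpha> (%l. if l \<in> S then y l + h l else y l) x"
    by (intro ae[OF \<alpha>] mdiff_point_mem[of y I'' _ ?A] y hA A(1)) auto
  qed (use fA in simp)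
  then have "AE x in L. mix_diff_quot \<gamma> I'' h (g \<alpha>) y x = c * mdiff ?A h (G \<alpha>) y x"
  proof eventually_elim
   case (elim x)
   have "mdiff ?A h (g \<alpha>) y x = mdiff ?A h (G \<alpha>) y x"
    unfolding mdiff_def by (intro sum.cong refl) (use elim in simp)
   then show ?case by (simp add: mix_diff_quot_eq_mdiff[OF fin(2)] c_def)
  qed
  from sobolev_cong_AE(3)[OF sobolev_Lp this, of m] Gm
  have "sobolev_norm D m p (mix_diff_quot \<gamma> I'' h (g \<alpha>) y) <= K * (\<bar>c\<bar> * (B * (\<Prod>l\<in>?A. norm (h l) powr \<gamma>)))" by auto
  also have "\<bar>c\<bar> * (B * (\<Prod>l\<in>?A. norm (h l) powr \<gamma>)) = B * (\<Prod>l\<in>?A. norm (h l) powr (- \<gamma>) * norm (h l) powr \<gamma>)"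
   by (simp add: c_def abs_prod prod.distrib)
  also have "(\<Prod>l\<in>?A. norm (h l) powr (- \<gamma>) * norm (h l) powr \<gamma>) = 1"
   using A(2) by (intro prod.neutral) (simp add: powr_add[symmetric])
  finally show ?thesis by simp
 qed
 show ?thesis
  unfolding holder_mix_norm_def C_mix_norm_def holder_mix_seminorm_def mix_partial_def g_def[symmetric]
  using n0 n1 by (auto intro!: SUP_least ennreal_leI)
qed

end

section \<open>From the mixed Hoelder norm to bounds of mixed differences\<close>

context Sobolev_domain
begin

lemma finite_mix_indices:
 assumes "finite I"
 shows "finite (mix_indices I n :: (nat => 'd => nat) set)"
proof -
 let ?P = "(%f l. if l \<in> I then f l else (%_. 0)) ` (I \<rightarrow>\<^sub>E {a :: 'd => nat. mi_order a <= n})"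
 have "\<alpha> \<in> ?P" if a: "\<alpha> \<in> mix_indices I n" for \<alpha> :: "nat => 'd => nat"
  by (rule image_eqI[where x="restrict \<alpha> I"]) (use a in \<open>auto simp: mix_indices_def fun_eq_iff\<close>)
 moreover have "finite ?P" by (intro finite_imageI finite_PiE assms finite_mi_order_le)
 ultimately show ?thesis by (meson finite_subset subsetI)
qed

lemma mix_derivs_bounded:
 assumes g: "mix_derivs D I n (sobolev D m p) (sobolev_norm D m p) \<phi> g" and I: "finite I"
 shows "\<exists>M. \<forall>\<alpha>\<in>mix_indices I n. \<forall>y\<in>pts I. sobolev_norm D m p (g \<alpha> y) <= M"
proof -
 define Q where "Q = {\<beta> :: 'd => nat. mi_order \<beta> <= m} \<times> (mix_indices I n :: (nat => 'd => nat) set)"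
 have Q: "finite Q" unfolding Q_def by (intro finite_cartesian_product finite_mi_order_le finite_mix_indices I)
 have "\<forall>q\<in>Q. \<exists>M. \<forall>y\<in>pts I. nrm (weak_deriv D p (fst q) (g (snd q) y)) <= M"
 proof
  fix q assume "q \<in> Q"
  then have q: "mi_order (fst q) <= m" "snd q \<in> mix_indices I n" by (auto simp: Q_def)
  show "\<exists>M. \<forall>y\<in>pts I. nrm (weak_deriv D p (fst q) (g (snd q) y)) <= M"
   by (rule Lp_continuous_bounded[OF I Lp_derivs_continuous[OF mix_derivs_imp_Lp_derivs[OF g I q(1)] q(2)]])
 qed
 from bchoice[OF this] obtain M where M: "\<forall>q\<in>Q. \<forall>y\<in>pts I. nrm (weak_deriv D p (fst q) (g (snd q) y)) <= M q" ..
 define b where "b = (\<Sum>q\<in>Q. max 0 (M q))"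
 have b0: "0 <= b" by (auto simp: b_def intro: sum_nonneg)
 show ?thesis
 proof (intro exI ballI)
  fix \<alpha> :: "nat => 'd => nat" and y assume \<alpha>: "\<alpha> \<in> mix_indices I n" and y: "y \<in> pts I"
  show "sobolev_norm D m p (g \<alpha> y) <= real (card {\<alpha> :: 'd => nat. mi_order \<alpha> <= m}) * b"
  proof (rule sobolev_norm_le[OF _ b0])
   fix \<beta> :: "'d => nat" assume "mi_order \<beta> <= m"
   then have q: "(\<beta>, \<alpha>) \<in> Q" using \<alpha> by (simp add: Q_def)
   have "nrm (weak_deriv D p \<beta> (g \<alpha> y)) <= M (\<beta>, \<alpha>)" using M[rule_format, OF q y] by simp
   also have "\<dots> <= max 0 (M (\<beta>, \<alpha>))" by simp
   also have "\<dots> <= b" unfolding b_def by (rule member_le_sum[OF q _ Q]) simp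
   finally show "nrm (weak_deriv D p \<beta> (g \<alpha> y)) <= b" .
  qed
 qed
qed

lemma mix_derivs_some:
 assumes "\<phi> \<in> C_mix D I n V N"
 shows "mix_derivs D I n V N \<phi> (%\<alpha>. mix_partial D I n V N \<alpha> \<phi>)"
proof -
 obtain g where "mix_derivs D I n V N \<phi> g" using assms by (auto simp: C_mix_def)
 then show ?thesis unfolding mix_partial_def by (rule someI[where P="mix_derivs D I n V N \<phi>"])
qed

text \<open>Membership asks for a finite seminorm; the other part of the norm is finite by
  compactness. It permits calculating with a real number b in place of the extended norm.\<close>

lemma holder_mix_norm_finite:
 assumes \<phi>: "\<phi> \<in> holder_mix D I n \<gamma> (sobolev D m p) (sobolev_norm D m p)" and I: "finite I"
 shows "holder_mix_norm D I n \<gamma> (sobolev D m p) (sobolev_norm D m p) \<phi> < \<infinity>"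
proof -
 have c: "\<phi> \<in> C_mix D I n (sobolev D m p) (sobolev_norm D m p)" using \<phi> by (simp add: holder_mix_def)
 obtain M where M: "\<forall>\<alpha>\<in>mix_indices I n. \<forall>y\<in>pts I. sobolev_norm D m p (mix_partial D I n (sobolev D m p) (sobolev_norm D m p) \<alpha> \<phi> y) <= M"
  using mix_derivs_bounded[OF mix_derivs_some[OF c] I] by blast
 have "C_mix_norm D I n (sobolev D m p) (sobolev_norm D m p) \<phi> <= ennreal M"
  unfolding C_mix_norm_def by (intro SUP_least ennreal_leI) (use M in blast)
 also have "\<dots> < \<infinity>" by simp
 finally show ?thesis using \<phi> by (simp add: holder_mix_norm_def holder_mix_def)
qed

lemma mix_partial_bound:
 assumes b: "0 <= b" "holder_mix_norm D I n \<gamma> V N \<phi> <= ennreal b" and \<alpha>: "\<alpha> \<in> mix_indices I n" and y: "y \<in> pts I"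
 shows "N (mix_partial D I n V N \<alpha> \<phi> y) <= b"
proof -
 have "ennreal (N (mix_partial D I n V N \<alpha> \<phi> y)) <= C_mix_norm D I n V N \<phi>"
  unfolding C_mix_norm_def by (rule SUP_upper2[OF \<alpha>], rule SUP_upper2[OF y]) simp
 also have "\<dots> <= ennreal b" using b(2) by (simp add: holder_mix_norm_def)
 finally show ?thesis using b(1) by simp
qed

lemma mix_diff_quot_bound:
 assumes b: "0 <= b" "holder_mix_norm D I n \<gamma> V N \<phi> <= ennreal b" and I: "finite I" and \<alpha>: "\<alpha> \<in> mix_indices I n" and y: "y \<in> pts I"
  and h: "\<forall>l\<in>I. y l + h l \<in> closure D" "active I h ~= {}" "\<forall>l\<in>active I h. mi_order (\<alpha> l) = n"
 shows "N (mix_diff_quot \<gamma> I h (mix_partial D I n V N \<alpha> \<phi>) y) <= b"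
proof -
 have s: "active I h \<subseteq> I" by (auto simp: active_def)
 have c: "card (active I h) \<in> {1..card I}"
  using card_mono[OF I s] h(2) finite_subset[OF s I] by (simp add: Suc_le_eq card_gt_0_iff)
 have yh: "(y, h) \<in> {(y, h'). y \<in> pts I & (\<forall>l\<in>I. y l + h' l \<in> closure D) & card (active I h') = card (active I h)}"
  using y h by simp
 have a: "\<alpha> \<in> {\<alpha> \<in> mix_indices I n. \<forall>l\<in>active I h. mi_order (\<alpha> l) = n}" using \<alpha> h by simp
 have "ennreal (N (mix_diff_quot \<gamma> I h (mix_partial D I n V N \<alpha> \<phi>) y)) <= holder_mix_seminorm D I n \<gamma> V N \<phi>"
  unfolding holder_mix_seminorm_def
  by (rule SUP_upper2[OF c], rule SUP_upper2[OF yh], unfold prod.case, rule SUP_upper2[OF a]) simp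
 also have "\<dots> <= ennreal b" using b(2) by (simp add: holder_mix_norm_def)
 finally show ?thesis using b(1) by simp
qed

text \<open>For variables of top order the seminorm bounds the mixed differences, and
  \<open>Lp_derivs_mixed_holder\<close> extends this to all orders. A weak derivative of order at
  most m commutes a.e. with the finite sum in a mixed difference and is dominated by the Sobolev
  norm.\<close>

lemma holder_mix_imp_mixed_holder:
 assumes dom: "bounded_C1_domain D" and \<gamma>: "0 < \<gamma>" "\<gamma> <= 1" and I: "finite I"
 shows "\<exists>K\<ge>0. \<forall>\<phi> b \<beta> \<alpha>. \<phi> \<in> C_mix D I n (sobolev D m p) (sobolev_norm D m p) --> 0 <= b -->
  holder_mix_norm D I n \<gamma> (sobolev D m p) (sobolev_norm D m p) \<phi> <= ennreal b --> mi_order \<beta> <= m --> \<alpha> \<in> mix_indices I n -->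
  mixed_holder I \<gamma> (K * b) (%y. weak_deriv D p \<beta> (mix_partial D I n (sobolev D m p) (sobolev_norm D m p) \<alpha> \<phi> y))"
proof (rule Lp_derivs_mixed_holder[OF dom \<gamma> I, where n=n])
 fix K :: real assume K0: "0 <= K" and K: "!!B g \<alpha>. 0 <= B ==> Lp_derivs I n g ==>
  (!!\<alpha> y. \<alpha> \<in> mix_indices I n ==> y \<in> pts I ==> nrm (g \<alpha> y) <= B) ==>
  (!!\<alpha> A y h. \<alpha> \<in> mix_indices I n ==> A \<subseteq> I ==> A ~= {} ==> (!!l. l \<in> A ==> mi_order (\<alpha> l) = n) ==> y \<in> pts I ==>
   (!!l. l \<in> A ==> y l + h l \<in> closure D) ==> (!!l. l \<in> A ==> h l ~= 0) ==>
   nrm (mdiff A h (g \<alpha>) y) <= B * (\<Prod>l\<in>A. norm (h l) powr \<gamma>)) ==>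
  \<alpha> \<in> mix_indices I n ==> mixed_holder I \<gamma> (K * B) (g \<alpha>)"
 let ?V = "sobolev D m p" and ?N = "sobolev_norm D m p"
 show ?thesis
 proof (intro exI[of _ K] conjI K0 allI impI)
  fix \<phi> b and \<beta> :: "'d => nat" and \<alpha>0 :: "nat => 'd => nat"
  assume \<phi>: "\<phi> \<in> C_mix D I n ?V ?N" and b: "0 <= b" "holder_mix_norm D I n \<gamma> ?V ?N \<phi> <= ennreal b"
   and \<beta>: "mi_order \<beta> <= m" and \<alpha>0: "\<alpha>0 \<in> mix_indices I n"
  define g where "g \<alpha> = mix_partial D I n ?V ?N \<alpha> \<phi>" for \<alpha>
  let ?W = "weak_deriv D p \<beta>"
  have g: "mix_derivs D I n ?V ?N \<phi> g" using mix_derivs_some[OF \<phi>] unfolding g_def[abs_def] .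
  show "mixed_holder I \<gamma> (K * b) (%y. ?W (mix_partial D I n ?V ?N \<alpha>0 \<phi> y))"
   unfolding g_def[symmetric]
  proof (rule K[where g="%\<alpha> y. ?W (g \<alpha> y)", OF b(1) mix_derivs_imp_Lp_derivs[OF g I \<beta>] _ _ \<alpha>0])
   fix \<alpha> :: "nat => 'd => nat" and y assume \<alpha>: "\<alpha> \<in> mix_indices I n" and y: "y \<in> pts I"
   show "nrm (?W (g \<alpha> y)) <= b"
    using Lp_norm_weak_deriv_le[OF \<beta>, of "g \<alpha> y"] mix_partial_bound[OF b \<alpha> y] unfolding g_def by linarith
  next
   fix \<alpha> :: "nat => 'd => nat" and A y h assume \<alpha>: "\<alpha> \<in> mix_indices I n" and A: "A \<subseteq> I" "A ~= {}" and top: "!!l. l \<in> A ==> mi_order (\<alpha> l) = n"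
    and y: "y \<in> pts I" and h: "!!l. l \<in> A ==> y l + h l \<in> closure D" "!!l. l \<in> A ==> h l ~= 0"
   \<comment> \<open>Extended by 0 off A, so that the active indices are exactly A and the steps off
     A keep y in the closure.\<close>
   define h' where "h' l = (if l \<in> A then h l else 0)" for l
   have act: "active I h' = A" using A h(2) by (auto simp: active_def h'_def)
   have fA: "finite A" using finite_subset[OF A(1) I] .
   have hc: "\<forall>l\<in>I. y l + h' l \<in> closure D" using y h(1) by (auto simp: h'_def)
   define c where "c = (\<Prod>l\<in>A. norm (h l) powr (- \<gamma>))"
   let ?w = "%S l. if l \<in> S then y l + h l else y l"
   have gS: "g \<alpha> (?w S) \<in> ?V" if "S \<in> Pow A" for S
    by (rule mix_derivs_memD(1)[OF g \<alpha> mdiff_point_mem[OF y h(1) A(1)]]) (use that in auto)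
   have "mix_diff_quot \<gamma> I h' (g \<alpha>) y x = (\<Sum>S\<in>Pow A. (c * (-1) ^ card (A - S)) * g \<alpha> (?w S) x)" for x
   proof -
    have "mdiff A h' (g \<alpha>) y x = mdiff A h (g \<alpha>) y x" by (rule mdiff_cong) (simp add: h'_def)
    moreover have "(\<Prod>l\<in>A. norm (h' l) powr (- \<gamma>)) = c" unfolding c_def by (rule prod.cong) (simp_all add: h'_def)
    ultimately show ?thesis unfolding mix_diff_quot_eq_mdiff[OF I] act
     by (simp add: mdiff_def sum_distrib_left mult.assoc)
   qed
   then have q: "mix_diff_quot \<gamma> I h' (g \<alpha>) y = (%x. \<Sum>S\<in>Pow A. (c * (-1) ^ card (A - S)) * g \<alpha> (?w S) x)" by (rule ext)
   let ?u = "%x. \<Sum>S\<in>Pow A. (c * (-1) ^ card (A - S)) * g \<alpha> (?w S) x"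
   have u: "?u \<in> ?V" by (rule sobolev_linear_combination(1)[OF gS])
   have "AE x in L. ?W ?u x = (\<Sum>S\<in>Pow A. (c * (-1) ^ card (A - S)) * ?W (g \<alpha> (?w S)) x)"
    by (rule sobolev_linear_combination(2)[OF gS \<beta>])
   then have ae: "AE x in L. c * mdiff A h (%y. ?W (g \<alpha> y)) y x = ?W ?u x"
    by eventually_elim (simp add: mdiff_def sum_distrib_left mult.assoc)
   note WL = weak_deriv_props(1)[OF u \<beta>]
   have mL: "(%x. c * mdiff A h (%y. ?W (g \<alpha> y)) y x) \<in> LP" by (rule Lp_cong_AE[OF WL ae])
   have "\<bar>c\<bar> * nrm (mdiff A h (%y. ?W (g \<alpha> y)) y) = nrm (?W ?u)"
    using Lp_norm_cong_AE[OF ae Lp_measurable[OF mL] Lp_measurable[OF WL]] by (simp add: Lp_norm_scale)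
   also have "\<dots> <= ?N ?u" by (rule Lp_norm_weak_deriv_le[OF \<beta>])
   also have "\<dots> <= b"
    using mix_diff_quot_bound[OF b I \<alpha> y hc] A(2) top unfolding act g_def[symmetric] q by simp
   finally have le: "\<bar>c\<bar> * nrm (mdiff A h (%y. ?W (g \<alpha> y)) y) <= b" .
   let ?P = "\<Prod>l\<in>A. norm (h l) powr \<gamma>"
   have "?P * c = (\<Prod>l\<in>A. norm (h l) powr \<gamma> * norm (h l) powr (- \<gamma>))" by (simp add: c_def prod.distrib)
   also have "\<dots> = 1" using h(2) by (intro prod.neutral) (simp add: powr_add[symmetric])
   finally have Pc: "?P * c = 1" .
   have c0: "0 <= c" "0 <= ?P" by (simp_all add: c_def prod_nonneg)
   have "nrm (mdiff A h (%y. ?W (g \<alpha> y)) y) = (?P * c) * nrm (mdiff A h (%y. ?W (g \<alpha> y)) y)" by (simp only: Pc mult_1)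
   also have "\<dots> = ?P * (\<bar>c\<bar> * nrm (mdiff A h (%y. ?W (g \<alpha> y)) y))" using c0 by (simp add: mult.assoc)
   also have "\<dots> <= ?P * b" by (rule mult_left_mono[OF le c0(2)])
   finally show "nrm (mdiff A h (%y. ?W (g \<alpha> y)) y) <= b * ?P" by (simp add: mult.commute)
  qed
 qed
qed

lemma mix_derivs_section:
 assumes g: "mix_derivs D (I' \<union> I'') n V N \<phi> g" and y: "y \<in> I'' \<rightarrow>\<^sub>E D"
 shows "mix_derivs D I' n V N (%z. \<phi> (merge I' I'' (z, y))) (%\<alpha> z. g \<alpha> (merge I' I'' (z, y)))"
 unfolding mix_derivs_def
proof (intro conjI ballI allI impI)
 let ?m = "%z. merge I' I'' (z, y)"
 have ix: "\<alpha> \<in> mix_indices (I' \<union> I'') n" if "\<alpha> \<in> mix_indices I' n" for \<alpha> :: "nat => 'd => nat"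
  using that by (auto simp: mix_indices_def mi_order_def)
 have mp: "?m z \<in> pts (I' \<union> I'')" if "z \<in> pts I'" for z by (rule merge_PiE[OF that D_pts[OF y]])
 show "g (%_ _. 0) (?m z) = \<phi> (?m z)" if "z \<in> pts I'" for z
  using g mp[OF that] unfolding mix_derivs_def by blast
 fix \<alpha> :: "nat => 'd => nat" and z
 show "g \<alpha> (?m z) \<in> V" if "\<alpha> \<in> mix_indices I' n" "z \<in> pts I'"
  by (rule mix_derivs_memD(1)[OF g ix[OF that(1)] mp[OF that(2)]])
 show "((%w. N (%x. g \<alpha> (?m w) x - g \<alpha> (?m z) x)) \<longlongrightarrow> 0) (at z within pts I')" if \<alpha>: "\<alpha> \<in> mix_indices I' n" and z: "z \<in> pts I'"
 proof (rule filterlim_compose[OF mix_derivs_memD(2)[OF g ix[OF \<alpha>] mp[OF z]]])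
  show "filterlim ?m (at (?m z) within pts (I' \<union> I'')) (at z within pts I')"
   unfolding filterlim_at
  proof
   show "(?m \<longlongrightarrow> ?m z) (at z within pts I')"
    using continuous_on_merge[of "pts I'" I' I'' y] z by (simp add: continuous_on_def)
   \<comment> \<open>Injectivity keeps punctured neighbourhoods punctured, as the limit at the image
     point excludes that point itself.\<close>
   have "?m w ~= ?m z" if w: "w \<in> pts I'" "w ~= z" for w
   proof
    assume e: "?m w = ?m z"
    have "w l = z l" for l
    proof (cases "l \<in> I'")
     case True
     have "?m w l = ?m z l" using e by simp
     then show ?thesis using True by (simp add: merge_left)
    next
     case False
     then show ?thesis using w(1) z by (simp add: PiE_iff extensional_def)
    qed
    then show False using w(2) by auto
   qed
   then show "\<forall>\<^sub>F w in at z within pts I'. ?m w \<in> pts (I' \<union> I'') & ?m w ~= ?m z"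
    unfolding eventually_at_topological using mp by (intro exI[of _ UNIV]) auto
  qed
 qed
 fix l i
 assume l: "l \<in> I'" and \<alpha>': "(mi_inc \<alpha> l i) \<in> mix_indices I' n" and z: "z \<in> I' \<rightarrow>\<^sub>E D"
 show "((%t. N (%x. (g \<alpha> (?m (z(l := z l + t *\<^sub>R axis i 1))) x - g \<alpha> (?m z) x) / t
   - g (mi_inc \<alpha> l i) (?m z) x)) \<longlongrightarrow> 0) (at 0)"
  using mix_derivs_derivD[OF g _ ix[OF \<alpha>'] merge_PiE[OF z y]] l by (simp only: merge_upd_left[OF l] merge_left[OF l] UnI1)
qed

lemma sobolev_norm_0: "sobolev_norm D m p (%_. 0) = 0"
proof -
 have "sobolev_norm D m p (%_. 0) <= real (card {\<alpha> :: 'd => nat. mi_order \<alpha> <= m}) * 0"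
 proof (rule sobolev_norm_le)
  fix \<alpha> :: "'d => nat"
  have "has_weak_deriv D \<alpha> (%_. 0) (%_. 0)" by (simp add: has_weak_deriv_def)
  then have ae: "AE x in L. weak_deriv D p \<alpha> (%_. 0) x = 0" by (rule weak_deriv_AE_eq[OF Lp_zero])
  have "nrm (weak_deriv D p \<alpha> (%_. 0)) = nrm (%_. 0)"
   by (rule Lp_norm_cong_AE[OF ae]) (intro Lp_measurable Lp_cong_AE[OF Lp_zero ae] Lp_zero)+
  then show "nrm (weak_deriv D p \<alpha> (%_. 0)) <= 0" by simp
 qed simp
 then show ?thesis using sobolev_norm_nonneg[of m "%_. 0"] by simp
qed

text \<open>The chosen weak derivative of order 0 equals the function only a.e., and a
  representative is insensitive to this.\<close>

lemma cont_rep_weak_deriv_0: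
 assumes "!!y. y \<in> pts I ==> \<phi> y \<in> LP"
 shows "cont_rep I (%y. weak_deriv D p (%_. 0) (\<phi> y)) \<psi> \<longleftrightarrow> cont_rep I \<phi> \<psi>"
proof -
 have "(AE x in L. \<psi> y x = weak_deriv D p (%_. 0) (\<phi> y) x) \<longleftrightarrow> (AE x in L. \<psi> y x = \<phi> y x)" if y: "y \<in> pts I" for y
 proof
  assume "AE x in L. \<psi> y x = weak_deriv D p (%_. 0) (\<phi> y) x"
  then show "AE x in L. \<psi> y x = \<phi> y x" using weak_deriv_0[OF assms[OF y]] by eventually_elim simp
 next
  assume "AE x in L. \<psi> y x = \<phi> y x"
  then show "AE x in L. \<psi> y x = weak_deriv D p (%_. 0) (\<phi> y) x" using weak_deriv_0[OF assms[OF y]] by eventually_elim simp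
 qed
 then show ?thesis by (simp add: cont_rep_def)
qed

end

section \<open>Traces of mixed Hoelder families\<close>

context Sobolev_domain
begin

lemma holder_mix_cont_rep:
 assumes dom: "bounded_C1_domain D" and \<gamma>: "0 < \<gamma>" "\<gamma> <= 1" "2 * real CARD('d) / \<gamma> < p" and I: "finite I"
  and \<phi>: "\<phi> \<in> holder_mix D I n \<gamma> (sobolev D m p) (sobolev_norm D m p)"
 shows "\<exists>\<psi>. cont_rep I \<phi> \<psi>"
proof -
 let ?V = "sobolev D m p" and ?N = "sobolev_norm D m p"
 have c: "\<phi> \<in> C_mix D I n ?V ?N" using \<phi> by (simp add: holder_mix_def)
 define g where "g \<alpha> = mix_partial D I n ?V ?N \<alpha> \<phi>" for \<alpha>
 have g: "mix_derivs D I n ?V ?N \<phi> g" using mix_derivs_some[OF c] unfolding g_def[abs_def] .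
 have g0: "g (%_ _. 0) y = \<phi> y" if "y \<in> pts I" for y using g that by (simp add: mix_derivs_def)
 have z: "mi_order (%_ :: 'd. 0) <= m" "(%_ _. 0) \<in> mix_indices I n" by (simp_all add: mi_order_def mix_indices_def)
 define b where "b = enn2real (holder_mix_norm D I n \<gamma> ?V ?N \<phi>)"
 have b: "0 <= b" "holder_mix_norm D I n \<gamma> ?V ?N \<phi> <= ennreal b"
  using holder_mix_norm_finite[OF \<phi> I] by (simp_all add: b_def)
 from holder_mix_imp_mixed_holder[OF dom \<gamma>(1,2) I, where n=n and m=m]
 obtain K where K: "0 <= K" "mixed_holder I \<gamma> (K * b) (%y. weak_deriv D p (%_. 0) (g (%_ _. 0) y))"
  unfolding g_def using c b z by blast
 have Kb: "0 <= K * b" using K(1) b(1) by simp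
 have "\<exists>\<psi>. cont_rep I (%y. weak_deriv D p (%_. 0) (g (%_ _. 0) y)) \<psi>"
  using cont_rep_exists[OF \<gamma>(1,3) I] Kb K(2) Lp_derivs_continuous[OF mix_derivs_imp_Lp_derivs[OF g I z(1)] z(2)] by blast
 moreover have "cont_rep I (%y. weak_deriv D p (%_. 0) (g (%_ _. 0) y)) \<psi> \<longleftrightarrow> cont_rep I (g (%_ _. 0)) \<psi>" for \<psi>
  by (rule cont_rep_weak_deriv_0[OF sobolev_Lp[OF mix_derivs_memD(1)[OF g z(2)]]])
 moreover have "cont_rep I (g (%_ _. 0)) \<psi> \<longleftrightarrow> cont_rep I \<phi> \<psi>" for \<psi> by (simp add: cont_rep_def g0)
 ultimately show ?thesis by simp
qed

text \<open>One constant serves every \<phi> with norm at most b and every continuous representative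
  \<psi> of it; the constant is the product of the one for diagonals and the one for mixed
  differences.\<close>

lemma diag_trace_bound:
 assumes dom: "bounded_C1_domain D" and \<gamma>: "0 < \<gamma>" "\<gamma> <= 1" "2 * real CARD('d) / \<gamma> < p"
  and fin: "finite I'" "finite I''" and dj: "I' \<inter> I'' = {}" and mn: "m <= n"
 shows "\<exists>C\<ge>0. \<forall>\<phi> \<psi> b. \<phi> \<in> C_mix D (I' \<union> I'') n (sobolev D m p) (sobolev_norm D m p) --> 0 <= b -->
  holder_mix_norm D (I' \<union> I'') n \<gamma> (sobolev D m p) (sobolev_norm D m p) \<phi> <= ennreal b --> cont_rep (I' \<union> I'') \<phi> \<psi> -->
  (%y x. \<psi> (merge I' I'' ((%_. x), y)) x) \<in> C_mix D I'' n (sobolev D m p) (sobolev_norm D m p) \<and>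
  holder_mix_norm D I'' n \<gamma> (sobolev D m p) (sobolev_norm D m p) (%y x. \<psi> (merge I' I'' ((%_. x), y)) x) <= ennreal (C * b)"
proof -
 let ?V = "sobolev D m p" and ?N = "sobolev_norm D m p" and ?I = "I' \<union> I''"
 have I: "finite ?I" using fin by simp
 obtain Kd where Kd: "diag_const I' m \<gamma> Kd" using diag_const_exists[OF \<gamma>(1,3) fin(1)] ..
 from holder_mix_imp_mixed_holder[OF dom \<gamma>(1,2) I, where n=n and m=m]
 obtain K where K0: "0 <= K" and K: "\<forall>\<phi> b \<beta> \<alpha>. \<phi> \<in> C_mix D ?I n ?V ?N --> 0 <= b -->
  holder_mix_norm D ?I n \<gamma> ?V ?N \<phi> <= ennreal b --> mi_order \<beta> <= m --> \<alpha> \<in> mix_indices ?I n -->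
  mixed_holder ?I \<gamma> (K * b) (%y. weak_deriv D p \<beta> (mix_partial D ?I n ?V ?N \<alpha> \<phi> y))"
  by (elim exE conjE)
 have Kd0: "0 <= Kd" using Kd by (simp add: diag_const_def)
 show ?thesis
 proof (intro exI[of _ "Kd * K"] conjI allI impI)
  show "0 <= Kd * K" using Kd0 K0 by simp
 next
  fix \<phi> \<psi> and b :: real
  assume \<phi>: "\<phi> \<in> C_mix D ?I n ?V ?N" and b: "0 <= b" "holder_mix_norm D ?I n \<gamma> ?V ?N \<phi> <= ennreal b" and \<psi>: "cont_rep ?I \<phi> \<psi>"
  define g where "g \<alpha> = mix_partial D ?I n ?V ?N \<alpha> \<phi>" for \<alpha>
  have g: "mix_derivs D ?I n ?V ?N \<phi> g" using mix_derivs_some[OF \<phi>] unfolding g_def[abs_def] .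
  have g0: "g (%_ _. 0) y = \<phi> y" if "y \<in> pts ?I" for y using g that by (simp add: mix_derivs_def)
  have z: "mi_order (%_ :: 'd. 0) <= m" by (simp add: mi_order_def)
  have ix: "\<alpha> \<in> mix_indices ?I n" if "\<alpha> \<in> mix_indices I'' n" for \<alpha> :: "nat => 'd => nat"
   using that by (auto simp: mix_indices_def mi_order_def)
  define F where "F \<beta> \<alpha> y = weak_deriv D p \<beta> (g \<alpha> y)" for \<beta> \<alpha> y
  have mh: "mixed_holder ?I \<gamma> (K * b) (F \<beta> \<alpha>)" if "mi_order \<beta> <= m" "\<alpha> \<in> mix_indices ?I n" for \<beta> \<alpha>
   using K \<phi> b that unfolding F_def[abs_def] g_def by blast
  have Kb: "0 <= K * b" using K0 b(1) by simp
  have Fc: "Lp_continuous ?I (F (%_. 0) \<alpha>)" if "\<alpha> \<in> mix_indices ?I n" for \<alpha>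
   using Lp_derivs_continuous[OF mix_derivs_imp_Lp_derivs[OF g I z] that] unfolding F_def[abs_def] .
  have "\<exists>\<psi>. cont_rep ?I (F (%_. 0) \<alpha>) \<psi>" if "\<alpha> \<in> mix_indices I'' n" for \<alpha>
   using cont_rep_exists[OF \<gamma>(1,3) I] Kb mh[OF z ix[OF that]] Fc[OF ix[OF that]] by blast
  then have "\<forall>\<alpha>\<in>mix_indices I'' n. \<exists>\<psi>. cont_rep ?I (F (%_. 0) \<alpha>) \<psi>" by blast
  from bchoice[OF this] obtain \<Psi>0 where \<Psi>0: "\<forall>\<alpha>\<in>mix_indices I'' n. cont_rep ?I (F (%_. 0) \<alpha>) (\<Psi>0 \<alpha>)" ..
  \<comment> \<open>At order zero the representative is the given one, because the claim is about
    \<psi>; for higher derivatives any representative will do.\<close>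
  define \<Psi> where "\<Psi> \<alpha> = (if \<alpha> = (%_ _. 0) then \<psi> else \<Psi>0 \<alpha>)" for \<alpha>
  have "(%_ _. 0) \<in> (mix_indices ?I n :: (nat => 'd => nat) set)" by (simp add: mi_order_def mix_indices_def)
  note gz = sobolev_Lp[OF mix_derivs_memD(1)[OF g this]]
  have "cont_rep ?I (g (%_ _. 0)) \<psi>" using \<psi> by (simp add: cont_rep_def g0)
  then have \<psi>': "cont_rep ?I (F (%_. 0) (%_ _. 0)) \<psi>"
   using cont_rep_weak_deriv_0[of ?I "g (%_ _. 0)" \<psi>, OF gz] unfolding F_def[abs_def] by simp
  have \<Psi>: "cont_rep ?I (F (%_. 0) \<alpha>) (\<Psi> \<alpha>)" if "\<alpha> \<in> mix_indices I'' n" for \<alpha>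
   using \<Psi>0 that \<psi>' by (cases "\<alpha> = (%_ _. 0)") (simp_all add: \<Psi>_def)
  have FF: "sob_family ?I m n F" using mix_derivs_sob_family[OF g I] unfolding F_def[abs_def] .
  interpret T: trace_setup D p I' I'' m n \<gamma> Kd "K * b" F \<Psi>
   by unfold_locales (fact Kd fin dj mn FF \<Psi> Kb \<gamma>(1) mh)+
  have e: "T.G (%_ _. 0) = (%y x. \<psi> (merge I' I'' ((%_. x), y)) x)"
   by (intro ext) (simp add: T.G_def \<Psi>_def)
  show "(%y x. \<psi> (merge I' I'' ((%_. x), y)) x) \<in> C_mix D I'' n ?V ?N"
   using T.G_mix_derivs unfolding e C_mix_def by blast
  show "holder_mix_norm D I'' n \<gamma> ?V ?N (%y x. \<psi> (merge I' I'' ((%_. x), y)) x) <= ennreal (Kd * K * b)"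
   using T.G_holder_mix_norm unfolding e by (simp add: mult.assoc)
 qed
qed

text \<open>With y frozen no variables remain, and the trace bound over the index set {} is the
  estimate for the single function, since the space without variables is the Sobolev space itself.
  If the norm of the section is infinite, 0 < C' makes the right-hand side infinite.\<close>

lemma diag_trace_section_bound:
 assumes C: "0 <= C" "\<forall>\<phi> \<psi> b. \<phi> \<in> C_mix D (I' \<union> {}) n (sobolev D m p) (sobolev_norm D m p) --> 0 <= b -->
  holder_mix_norm D (I' \<union> {}) n \<gamma> (sobolev D m p) (sobolev_norm D m p) \<phi> <= ennreal b --> cont_rep (I' \<union> {}) \<phi> \<psi> -->
  (%y x. \<psi> (merge I' {} ((%_. x), y)) x) \<in> C_mix D {} n (sobolev D m p) (sobolev_norm D m p) \<and>
  holder_mix_norm D {} n \<gamma> (sobolev D m p) (sobolev_norm D m p) (%y x. \<psi> (merge I' {} ((%_. x), y)) x) <= ennreal (C * b)"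
  and C': "C <= C'" "0 < C'"
  and \<phi>: "\<phi> \<in> C_mix D (I' \<union> I'') n (sobolev D m p) (sobolev_norm D m p)"
  and \<psi>: "cont_rep (I' \<union> I'') \<phi> \<psi>" and y: "y \<in> I'' \<rightarrow>\<^sub>E D"
 shows "ennreal (sobolev_norm D m p (%x. \<psi> (merge I' I'' ((%_. x), y)) x)) <= ennreal C' *
  holder_mix_norm D I' n \<gamma> (sobolev D m p) (sobolev_norm D m p) (%z. \<phi> (merge I' I'' (z, y)))"
proof -
 let ?V = "sobolev D m p" and ?N = "sobolev_norm D m p"
 let ?\<phi> = "%z. \<phi> (merge I' I'' (z, y))" and ?\<psi> = "%z. \<psi> (merge I' I'' (z, y))"
 let ?H = "holder_mix_norm D I' n \<gamma> ?V ?N ?\<phi>"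
 show ?thesis
 proof (cases "?H = \<infinity>")
  case True
  then show ?thesis using C'(2) by (simp add: ennreal_mult_top)
 next
  case False
  define b where "b = enn2real ?H"
  have b: "0 <= b" "?H = ennreal b" using False by (simp_all add: b_def less_top)
  have mp: "merge I' I'' (z, y) \<in> pts (I' \<union> I'')" if "z \<in> pts I'" for z by (rule merge_PiE[OF that D_pts[OF y]])
  obtain g where g: "mix_derivs D (I' \<union> I'') n ?V ?N \<phi> g" using \<phi> by (auto simp: C_mix_def)
  have c: "?\<phi> \<in> C_mix D I' n ?V ?N" using mix_derivs_section[OF g y] by (auto simp: C_mix_def)
  have r: "cont_rep I' ?\<phi> ?\<psi>"
   unfolding cont_rep_def
  proof (intro conjI ballI)
   show "AE x in L. \<psi> (merge I' I'' (z, y)) x = \<phi> (merge I' I'' (z, y)) x" if "z \<in> pts I'" for z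
    using \<psi> mp[OF that] unfolding cont_rep_def by blast
   have "AE x in L. continuous_on (pts (I' \<union> I'')) (%y. \<psi> y x)" using \<psi> unfolding cont_rep_def by blast
   then show "AE x in L. continuous_on (pts I') (%z. \<psi> (merge I' I'' (z, y)) x)"
   proof eventually_elim
    case (elim x)
    show ?case by (rule continuous_on_compose2[OF elim continuous_on_merge]) (use mp in blast)
   qed
  qed
  let ?T = "%w x. ?\<psi> (merge I' {} ((%_. x), w)) x"
  have T: "?T \<in> C_mix D {} n ?V ?N" "holder_mix_norm D {} n \<gamma> ?V ?N ?T <= ennreal (C * b)"
   using C(2)[rule_format, of ?\<phi> b ?\<psi>] c b r by auto
  have "?T (%_. undefined) \<in> ?V" using T(1) by (auto simp: C_mix_def mix_derivs_def mix_indices_empty)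
  from holder_mix_norm_empty[where \<phi>="?T" and V="?V" and N="?N", OF this sobolev_norm_0]
  have "ennreal (?N (?T (%_. undefined))) <= ennreal (C * b)" using T(2) by simp
  also have "ennreal (C * b) <= ennreal C' * ?H"
   unfolding b(2) using b(1) C' by (simp add: ennreal_mult[symmetric] mult_right_mono)
  finally have "ennreal (?N (?T (%_. undefined))) <= ennreal C' * ?H" .
  moreover have "?T (%_. undefined) = (%x. \<psi> (merge I' I'' ((%_. x), y)) x)"
  proof
   fix x
   have "merge I' I'' (merge I' {} ((%_. x), %_. undefined), y) = merge I' I'' ((%_. x), y)" by (auto simp: merge_def fun_eq_iff)
   then show "?T (%_. undefined) x = \<psi> (merge I' I'' ((%_. x), y)) x" by simp
  qed
  ultimately show ?thesis by simp
 qed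
qed

end

theorem proposition11:
  fixes D :: "(real^'d) set" and k n m :: nat and \<gamma> p :: real
  assumes "CARD('d) \<in> {2, 3}"
    and "bounded_C1_domain D"
    and "k \<ge> 1" and "n \<ge> m"
    and "0 < \<gamma>" and "\<gamma> \<le> 1"
    and "2 * real CARD('d) / \<gamma> < p"
  shows "\<exists>C>0. \<forall>\<phi>\<in>holder_mix D {1..k} n \<gamma> (sobolev D m p) (sobolev_norm D m p).
    (\<exists>\<psi>. continuous_representative D k \<phi> \<psi>) \<and>
    (\<forall>\<psi>. continuous_representative D k \<phi> \<psi> \<longrightarrow>
      (\<forall>j\<in>{2..k+1}.
        (\<forall>y\<in>{j..k} \<rightarrow>\<^sub>E D.
          diag_trace k j \<psi> y \<in> sobolev D m p \<and>
          ennreal (sobolev_norm D m p (diag_trace k j \<psi> y))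
            \<le> ennreal (C ^ (j - 1)) *
              holder_mix_norm D {1..<j} n \<gamma> (sobolev D m p) (sobolev_norm D m p)
                (\<lambda>z. \<phi> (merge {1..<j} {j..k} (z, y)))) \<and>
        diag_trace k j \<psi> \<in> holder_mix D {j..k} n \<gamma> (sobolev D m p) (sobolev_norm D m p) \<and>
        holder_mix_norm D {j..k} n \<gamma> (sobolev D m p) (sobolev_norm D m p) (diag_trace k j \<psi>)
          \<le> ennreal (C ^ (j - 1)) *
            holder_mix_norm D {1..k} n \<gamma> (sobolev D m p) (sobolev_norm D m p) \<phi>))"
proof -
 note dom = assms(2) and mn = assms(4) and \<gamma> = assms(5,6,7)
 have D: "open D" "bounded D" using dom by (simp_all add: bounded_C1_domain_def)
 have "1 <= real CARD('d)" by (simp add: Suc_le_eq)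
 \<comment> \<open>From \<gamma> <= 1 one obtains 1 <= d <= 2 d / \<gamma> < p, so that p is an
   admissible exponent for Minkowski's inequality.\<close>
 also have "\<dots> <= 2 * real CARD('d) / \<gamma>" using \<gamma>(1,2) by (simp add: pos_le_divide_eq mult.commute mult_left_le)
 finally have p1: "1 <= p" using \<gamma>(3) by simp
 interpret Sobolev_domain D p
  by unfold_locales (use D p1 in \<open>auto intro!: bounded_set_imp_lmeasurable\<close>)
 let ?V = "sobolev D m p" and ?N = "sobolev_norm D m p"
 define P where "P I' I'' C \<longleftrightarrow> (\<forall>\<phi> \<psi> b. \<phi> \<in> C_mix D (I' \<union> I'') n ?V ?N --> 0 <= b -->
  holder_mix_norm D (I' \<union> I'') n \<gamma> ?V ?N \<phi> <= ennreal b --> cont_rep (I' \<union> I'') \<phi> \<psi> -->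
  (%y x. \<psi> (merge I' I'' ((%_. x), y)) x) \<in> C_mix D I'' n ?V ?N \<and>
  holder_mix_norm D I'' n \<gamma> ?V ?N (%y x. \<psi> (merge I' I'' ((%_. x), y)) x) <= ennreal (C * b))" for I' I'' C
 have P: "\<exists>C\<ge>0. P I' I'' C" if "finite I'" "finite I''" "I' \<inter> I'' = {}" for I' I''
  unfolding P_def by (rule diag_trace_bound[OF dom \<gamma> that mn])
 \<comment> \<open>One constant for the trace as a function of the remaining variables, another for
   sections in which these are frozen. For j = k + 1 the set of remaining variables is
   empty.\<close>
 have "\<forall>j. \<exists>C\<ge>0. P {1..<j} {j..k} C" "\<forall>j. \<exists>C\<ge>0. P {1..<j} {} C" by (intro allI P; auto)+
 from choice[OF this(1)] choice[OF this(2)]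
 obtain C1 C2 where C1: "!!j. 0 <= C1 j" "!!j. P {1..<j} {j..k} (C1 j)" and C2: "!!j. 0 <= C2 j" "!!j. P {1..<j} {} (C2 j)"
  by (elim exE) auto
 \<comment> \<open>Dominates the constants of the finitely many j and is at least 1; then C <=
   C^(j-1), because j >= 2 makes the exponent positive.\<close>
 define C where "C = 1 + (\<Sum>j\<in>{2..k+1}. C1 j + C2 j)"
 have C: "1 <= C" unfolding C_def using C1(1) C2(1) by (simp add: sum_nonneg)
 have Cj: "C1 j <= C ^ (j - 1)" "C2 j <= C ^ (j - 1)" if j: "j \<in> {2..k+1}" for j
 proof -
  have "C1 j + C2 j <= (\<Sum>j\<in>{2..k+1}. C1 j + C2 j)"
   by (rule member_le_sum[OF j]) (use C1(1) C2(1) in auto)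
  moreover have "C <= C ^ (j - 1)" using C j by (intro self_le_power) auto
  ultimately show "C1 j <= C ^ (j - 1)" "C2 j <= C ^ (j - 1)" using C1(1)[of j] C2(1)[of j] unfolding C_def by linarith+
 qed
 have cr: "continuous_representative D k \<phi> \<psi> \<longleftrightarrow> cont_rep {1..k} \<phi> \<psi>" for \<phi> \<psi>
  by (simp add: continuous_representative_def cont_rep_def)
 show ?thesis
 proof (intro exI[of _ C] conjI ballI allI impI)
  show "0 < C" using C by simp
 next
  fix \<phi> assume "\<phi> \<in> holder_mix D {1..k} n \<gamma> ?V ?N"
  then show "\<exists>\<psi>. continuous_representative D k \<phi> \<psi>"
   unfolding cr by (intro holder_mix_cont_rep[OF dom \<gamma>]) auto
 next
  fix \<phi> \<psi> j assume \<phi>: "\<phi> \<in> holder_mix D {1..k} n \<gamma> ?V ?N" and "continuous_representative D k \<phi> \<psi>" and j: "j \<in> {2..k+1}"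
  then have r: "cont_rep {1..k} \<phi> \<psi>" by (simp add: cr)
  have un: "{1..k} = {1..<j} \<union> {j..k}" using j by auto
  have c: "\<phi> \<in> C_mix D {1..k} n ?V ?N" using \<phi> by (simp add: holder_mix_def)
  have dt: "(%y x. \<psi> (merge {1..<j} {j..k} ((%_. x), y)) x) = diag_trace k j \<psi>" by (simp add: diag_trace_def fun_eq_iff)
  let ?H = "holder_mix_norm D {1..k} n \<gamma> ?V ?N \<phi>"
  define b where "b = enn2real ?H"
  have b: "0 <= b" "?H = ennreal b" using holder_mix_norm_finite[OF \<phi>] by (simp_all add: b_def)
  have Cp: "0 < C ^ (j - 1)" using C by simp
  have T: "diag_trace k j \<psi> \<in> C_mix D {j..k} n ?V ?N" "holder_mix_norm D {j..k} n \<gamma> ?V ?N (diag_trace k j \<psi>) <= ennreal (C1 j * b)"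
   using C1(2)[of j, unfolded P_def, rule_format, of \<phi> b \<psi>] c b r unfolding un[symmetric] dt by auto
  have "ennreal (C1 j * b) <= ennreal (C ^ (j - 1)) * ?H"
   unfolding b(2) using b(1) Cj(1)[OF j] Cp by (simp add: ennreal_mult[symmetric] mult_right_mono del: ennreal_power)
  with T(2) show "holder_mix_norm D {j..k} n \<gamma> ?V ?N (diag_trace k j \<psi>) <= ennreal (C ^ (j - 1)) * ?H" by (rule order_trans)
  have "holder_mix_norm D {j..k} n \<gamma> ?V ?N (diag_trace k j \<psi>) < \<infinity>" using T(2) by (rule le_less_trans) simp
  then show "diag_trace k j \<psi> \<in> holder_mix D {j..k} n \<gamma> ?V ?N"
   using T(1) by (simp add: holder_mix_def holder_mix_norm_def)
  fix y assume y: "y \<in> {j..k} \<rightarrow>\<^sub>E D"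
  obtain g where g: "mix_derivs D {j..k} n ?V ?N (diag_trace k j \<psi>) g" using T(1) by (auto simp: C_mix_def)
  have z: "(%_ _. 0) \<in> (mix_indices {j..k} n :: (nat => 'd => nat) set)" by (simp add: mi_order_def mix_indices_def)
  have "g (%_ _. 0) y = diag_trace k j \<psi> y" using g D_pts[OF y] by (simp add: mix_derivs_def)
  then show "diag_trace k j \<psi> y \<in> ?V" using mix_derivs_memD(1)[OF g z D_pts[OF y]] by simp
  have "ennreal (?N (%x. \<psi> (merge {1..<j} {j..k} ((%_. x), y)) x)) <= ennreal (C ^ (j - 1)) *
    holder_mix_norm D {1..<j} n \<gamma> ?V ?N (%z. \<phi> (merge {1..<j} {j..k} (z, y)))"
   by (rule diag_trace_section_bound[OF C2(1) C2(2)[unfolded P_def] Cj(2)[OF j] Cp c[unfolded un] r[unfolded un] y])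
  then show "ennreal (?N (diag_trace k j \<psi> y)) <= ennreal (C ^ (j - 1)) *
    holder_mix_norm D {1..<j} n \<gamma> ?V ?N (%z. \<phi> (merge {1..<j} {j..k} (z, y)))"
   by (simp add: diag_trace_def)
 qed
qed

end
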